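(* Let $$\widetilde{p}_A(g_0,g_1,g_2,\dots):=g_0+\sum_\Gamma\frac{g_0^{\mathrm{tr}(\Gamma)}}{|\mathrm{Aut}(\Gamma)|}\prod_v g_{l(v)}^{|\mathrm{out}(v)|-1},$$ where $\Gamma$ runs over the minimal representatives of levelled oriented forests (with no strong vertices) on at least two leaves and $v$ over the non-leaf vertices of $\Gamma$; let $$\widetilde{Q}_B(g_0,g_1,g_2,\dots):=\sum_\Gamma\frac{1}{|\mathrm{Aut}(\Gamma)|}\left(\frac{g_0}{2}\right)^{\mathrm{tr}(\Gamma)-1}\prod_{v\in\Gamma_s}\left(\frac{g_{l(v)}}{2}\right)^{|\mathrm{wout}(v)|}\prod_{v\in\Gamma_w}g_{l(v)}^{|\mathrm{out}(v)|-1},$$ where $\Gamma$ runs over the minimal representatives of levelled oriented strong forests on $n\ge1$ leaves; and let $$Q_B(g_0,g_1,g_2,\dots):=\widetilde{p}_A\left(\tfrac{g_0}{2},g_1,g_2,\dots\right)+\widetilde{Q}_B(g_0,g_1,g_2,\dots).$$ Remove from $Q_B$ all bad monomials, and then in the remaining monomials replace $g_0$ with $t$ and, for all $i,r\ge1$, replace the power $g_i^r$ (where $r$ is the full exponent of $g_i$ in the monomial) with $\frac{q^r-q}{q-1}\,t^r$. The resulting series is $$\phi_B(q,t)=\frac{t}{2}+\sum_{n\ge2}P_{\mathcal{C}_{B_n}}(q)\,\frac{t^n}{2^n\,n!}\in\mathbb{Q}[q][[t]],$$ where $P_{\mathcal{C}_{B_n}}(q)=\sum_i\mathrm{rk}\big(H^{2i}(Y_{\mathcal{C}_{B_n}},\mathbb{Z})\big)q^i$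 is the Poincaré polynomial of the maximal De Concini–Procesi model $Y_{\mathcal{C}_{B_n}}$ of the root arrangement of type $B_n$.
   Context: **Models.** Let $V$ be a finite dimensional complex vector space and $\mathcal{G}$ a finite set of nonzero subspaces of $V^*$. For $A\in\mathcal{G}$ let $A^\perp\subset V$ be its annihilator, and let $\mathcal{A}_{\mathcal{G}}=V\setminus\bigcup_{A\in\mathcal{G}}A^\perp$. The De Concini–Procesi model $Y_{\mathcal{G}}$ is the closure of the image of the embedding $\mathcal{A}_{\mathcal{G}}\to V\times\prod_{A\in\mathcal{G}}\mathbb{P}(V/A^\perp)$ given by the inclusion on the first component and by the maps $V\setminus A^\perp\to\mathbb{P}(V/A^\perp)$ on the other components. The odd-degree integer cohomology of the models considered here is $0$. **Type $B_n$.** Let $V=\mathbb{C}^n$ with coordinate functions $x_1,\dots,x_n\in V^*$. $\mathcal{C}_{B_n}$ is the set of all subspaces of $V^*$ that are sums of (nonempty) collections of the lines $\langle x_i\rangle$ and $\langle x_i\pm x_j\rangle$ ($i\ne j$) spanned by the roots of a root system of type $B_n$. **Forests.** A levelled oriented forest is a finite disjoint union of finite rooted trees (non-planar, leaves unlabelled), with edges directed away from the roots; the degenerate tree consisting of a single leaf is allowed as a component. Leaves are the vertices without outgoing edges. A non-leaf vertex $v$ has level $l(v)=1+$ (distance from $v$ to the root of its tree). $\mathrm{out}(v)$ is the set of outgoing edges of $v$; $\mathrm{tr}(\Gamma)$ is the number of trees of $\Gamma$ (including degenerate ones). In type $B$ the vertices are moreover divided into strong and weak ones: leaves are weak, each level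 contains at most one strong vertex, and the parent of a strong vertex is strong (so the strong vertices, if any, form a directed chain starting at a root). A tree is strong if it has at least one strong vertex and weak otherwise; a forest is strong if it contains a strong tree (which is then unique). $\Gamma_s$ is the set of strong vertices of $\Gamma$, $\Gamma_w$ is the set of weak non-leaf vertices, and for a strong vertex $v$, $\mathrm{wout}(v)$ is the set of outgoing edges from $v$ to weak vertices (leaves included). $\mathrm{Aut}(\Gamma)$ is the group of automorphisms of $\Gamma$ as a rooted oriented forest, sending strong vertices to strong vertices and weak vertices to weak vertices. A trivial tail is a weak subtree (no strong vertices) with a single leaf stemming from a non-leaf vertex $v$, its root, with $|\mathrm{out}(v)|=1$. Two forests are equivalent if they differ only by trivial tails (i.e. by replacing such subtrees with a single leaf, or conversely); the minimal representative of an equivalence class is the forest in it with no trivial tails (equivalently, every weak non-leaf vertex has at least two leaves among its descendants; a strong vertex may have just one). All sums are over isomorphism classes. **Bad monomials.** A monomial is bad if there exist $1\le i<j$ such that $g_j$ appears in the monomial but $g_i$ does not. *)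

theory Defs
  imports
    "HOL-Homology.Homology"
    "HOL-Combinatorics.Permutations"
    "HOL-Computational_Algebra.Computational_Algebra"
    "HOL-Library.Poly_Mapping"
    "HOL-Library.Function_Algebras"
begin

section \<open>Integral singular cohomology\<close>

text \<open>Cochains are the homomorphisms from the library's group of singular chains to the integers,
  made extensional so that equality is equality on singular chains.\<close>

definition cochain_group :: "nat \<Rightarrow> 'a topology \<Rightarrow> ('a chain \<Rightarrow> int) monoid" where
  "cochain_group p X =
     \<lparr>carrier = hom (chain_group p X) integer_group \<inter> extensional (carrier (chain_group p X)),
      monoid.mult = (\<lambda>\<phi> \<psi>. \<lambda>c\<in>carrier (chain_group p X). \<phi> c + \<psi> c),
      one = (\<lambda>c\<in>carrier (chain_group p X). 0)\<rparr>"

definition coboundary :: "nat \<Rightarrow> 'a topology \<Rightarrow> ('a chain \<Rightarrow> int) \<Rightarrow> 'a chain \<Rightarrow> int" where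
  "coboundary p X \<phi> = (\<lambda>c\<in>carrier (chain_group (Suc p) X). \<phi> (chain_boundary (Suc p) c))"

definition cocycle_group :: "nat \<Rightarrow> 'a topology \<Rightarrow> ('a chain \<Rightarrow> int) monoid" where
  "cocycle_group p X =
     subgroup_generated (cochain_group p X)
       {\<phi> \<in> carrier (cochain_group p X). coboundary p X \<phi> = \<one>\<^bsub>cochain_group (Suc p) X\<^esub>}"

definition coboundary_set :: "nat \<Rightarrow> 'a topology \<Rightarrow> ('a chain \<Rightarrow> int) set" where
  "coboundary_set p X =
     (case p of 0 \<Rightarrow> {\<one>\<^bsub>cochain_group 0 X\<^esub>}
      | Suc k \<Rightarrow> coboundary k X ` carrier (cochain_group k X))"

definition cohomology_group :: "nat \<Rightarrow> 'a topology \<Rightarrow> ('a chain \<Rightarrow> int) set monoid" where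
  "cohomology_group p X = cocycle_group p X Mod coboundary_set p X"

lemma comm_group_cochain_group: "comm_group (cochain_group p X)"
proof (rule comm_groupI)
  fix \<phi> assume \<phi>: "\<phi> \<in> carrier (cochain_group p X)"
  let ?\<psi> = "\<lambda>c\<in>carrier (chain_group p X). - \<phi> c"
  have "?\<psi> \<in> carrier (cochain_group p X)"
    using \<phi> by (auto simp: cochain_group_def hom_def singular_chain_add)
  moreover have "?\<psi> \<otimes>\<^bsub>cochain_group p X\<^esub> \<phi> = \<one>\<^bsub>cochain_group p X\<^esub>"
    by (auto simp: cochain_group_def)
  ultimately show "\<exists>\<psi>\<in>carrier (cochain_group p X). \<psi> \<otimes>\<^bsub>cochain_group p X\<^esub> \<phi> = \<one>\<^bsub>cochain_group p X\<^esub>"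
    by blast
qed (auto simp: cochain_group_def hom_def singular_chain_add extensional_def fun_eq_iff restrict_def)

definition Z_independent :: "('a, 'b) monoid_scheme \<Rightarrow> 'a set \<Rightarrow> bool" where
  "Z_independent G S \<longleftrightarrow>
     finite S \<and> S \<subseteq> carrier G \<and>
     (\<forall>a :: 'a \<Rightarrow> int. finprod G (\<lambda>x. x [^]\<^bsub>G\<^esub> a x) S = \<one>\<^bsub>G\<^esub> \<longrightarrow> (\<forall>x\<in>S. a x = 0))"

text \<open>Meaningful for abelian groups of finite rank (in particular finitely generated ones).\<close>

definition abelian_rank :: "('a, 'b) monoid_scheme \<Rightarrow> nat" where
  "abelian_rank G = Sup {card S | S. Z_independent G S}"

text \<open>Only the even cohomology is recorded, with the variable in degree 2.\<close>

definition even_poincare_poly :: "'a topology \<Rightarrow> rat poly" where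
  "even_poincare_poly X =
     (\<Sum>i | abelian_rank (cohomology_group (2 * i) X) \<noteq> 0.
        monom (of_nat (abelian_rank (cohomology_group (2 * i) X))) i)"


section \<open>De Concini--Procesi models\<close>

definition cscale :: "complex \<Rightarrow> ('a \<Rightarrow> complex) \<Rightarrow> 'a \<Rightarrow> complex" where
  "cscale c f = (\<lambda>x. c * f x)"

interpretation cfun: vector_space cscale
  by unfold_locales (auto simp: cscale_def fun_eq_iff algebra_simps)

definition quotient_topology :: "'a topology \<Rightarrow> ('a \<Rightarrow> 'b) \<Rightarrow> 'b topology" where
  "quotient_topology X f =
     topology (\<lambda>U. U \<subseteq> f ` topspace X \<and> openin X {x \<in> topspace X. f x \<in> U})"

lemma openin_quotient_topology:
  "openin (quotient_topology X f) U \<longleftrightarrow>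
     U \<subseteq> f ` topspace X \<and> openin X {x \<in> topspace X. f x \<in> U}"
proof -
  have "istopology (\<lambda>U. U \<subseteq> f ` topspace X \<and> openin X {x \<in> topspace X. f x \<in> U})"
    unfolding istopology_def
  proof (rule conjI; intro allI impI)
    fix S T assume S: "S \<subseteq> f ` topspace X \<and> openin X {x \<in> topspace X. f x \<in> S}"
      and T: "T \<subseteq> f ` topspace X \<and> openin X {x \<in> topspace X. f x \<in> T}"
    have "{x \<in> topspace X. f x \<in> S \<inter> T} =
        {x \<in> topspace X. f x \<in> S} \<inter> {x \<in> topspace X. f x \<in> T}" by auto
    then show "S \<inter> T \<subseteq> f ` topspace X \<and> openin X {x \<in> topspace X. f x \<in> S \<inter> T}"
      using S T by (auto intro: openin_Int)
  next
    fix K assume K: "\<forall>S\<in>K. S \<subseteq> f ` topspace X \<and> openin X {x \<in> topspace X. f x \<in> S}"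
    have "{x \<in> topspace X. f x \<in> \<Union>K} = (\<Union>S\<in>K. {x \<in> topspace X. f x \<in> S})" by auto
    moreover have "openin X (\<Union>S\<in>K. {x \<in> topspace X. f x \<in> S})"
      using K by (intro openin_Union) auto
    ultimately show "\<Union>K \<subseteq> f ` topspace X \<and> openin X {x \<in> topspace X. f x \<in> \<Union>K}"
      using K by auto
  qed
  then show ?thesis by (simp add: quotient_topology_def topology_inverse')
qed

lemma quotient_map_quotient_topology: "quotient_map X (quotient_topology X f) f"
proof -
  have "{x \<in> topspace X. f x \<in> f ` topspace X} = topspace X" by auto
  then have "openin (quotient_topology X f) (f ` topspace X)"
    by (simp add: openin_quotient_topology)
  then have "topspace (quotient_topology X f) = f ` topspace X"
    by (metis openin_quotient_topology openin_subset openin_topspace subset_antisym)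
  then show ?thesis by (auto simp: quotient_map_def openin_quotient_topology)
qed

text \<open>In the following \<open>V\<close> is a finite-dimensional space of complex-valued functions on the
  naturals, with the subspace topology of the product topology (its usual topology), and linear
  forms on \<open>V\<close> are given as complex-valued functions on \<open>nat \<Rightarrow> complex\<close>.\<close>

definition annihilator ::
  "(nat \<Rightarrow> complex) set \<Rightarrow> ((nat \<Rightarrow> complex) \<Rightarrow> complex) set \<Rightarrow> (nat \<Rightarrow> complex) set" where
  "annihilator V A = {v \<in> V. \<forall>f\<in>A. f v = 0}"

text \<open>A line in \<open>V/W\<close> is represented by its preimage in \<open>V\<close>: the line through the class of \<open>v\<close>
  is \<open>span ({v} \<union> W) / W\<close>.  The quotient maps from \<open>V\<close> to \<open>V/W\<close> and from the nonzero vectors of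
  \<open>V/W\<close> to \<open>P(V/W)\<close> are open, so \<open>P(V/W)\<close> carries the quotient topology of \<open>V - W\<close>.\<close>

definition line_mod :: "(nat \<Rightarrow> complex) set \<Rightarrow> (nat \<Rightarrow> complex) \<Rightarrow> (nat \<Rightarrow> complex) set" where
  "line_mod W v = cfun.span (insert v W)"

definition proj_quotient ::
  "(nat \<Rightarrow> complex) set \<Rightarrow> (nat \<Rightarrow> complex) set \<Rightarrow> (nat \<Rightarrow> complex) set topology" where
  "proj_quotient V W = quotient_topology (top_of_set (V - W)) (line_mod W)"

definition arrangement_complement ::
  "(nat \<Rightarrow> complex) set \<Rightarrow> ((nat \<Rightarrow> complex) \<Rightarrow> complex) set set \<Rightarrow> (nat \<Rightarrow> complex) set" where
  "arrangement_complement V G = V - (\<Union>A\<in>G. annihilator V A)"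

definition model_ambient ::
  "(nat \<Rightarrow> complex) set \<Rightarrow> ((nat \<Rightarrow> complex) \<Rightarrow> complex) set set \<Rightarrow>
   ((nat \<Rightarrow> complex) \<times> (((nat \<Rightarrow> complex) \<Rightarrow> complex) set \<Rightarrow> (nat \<Rightarrow> complex) set)) topology" where
  "model_ambient V G =
     prod_topology (top_of_set V)
       (product_topology (\<lambda>A. proj_quotient V (annihilator V A)) G)"

definition model_embedding ::
  "(nat \<Rightarrow> complex) set \<Rightarrow> ((nat \<Rightarrow> complex) \<Rightarrow> complex) set set \<Rightarrow> (nat \<Rightarrow> complex) \<Rightarrow>
   (nat \<Rightarrow> complex) \<times> (((nat \<Rightarrow> complex) \<Rightarrow> complex) set \<Rightarrow> (nat \<Rightarrow> complex) set)" where
  "model_embedding V G v = (v, \<lambda>A\<in>G. line_mod (annihilator V A) v)"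

definition DCP_model ::
  "(nat \<Rightarrow> complex) set \<Rightarrow> ((nat \<Rightarrow> complex) \<Rightarrow> complex) set set \<Rightarrow>
   ((nat \<Rightarrow> complex) \<times> (((nat \<Rightarrow> complex) \<Rightarrow> complex) set \<Rightarrow> (nat \<Rightarrow> complex) set)) topology" where
  "DCP_model V G =
     subtopology (model_ambient V G)
       (model_ambient V G closure_of (model_embedding V G ` arrangement_complement V G))"

definition Cn :: "nat \<Rightarrow> (nat \<Rightarrow> complex) set" where
  "Cn n = {v. \<forall>i. i \<notin> {1..n} \<longrightarrow> v i = 0}"

definition coord :: "nat \<Rightarrow> (nat \<Rightarrow> complex) \<Rightarrow> complex" where
  "coord i = (\<lambda>v. v i)"

definition root_lines_B :: "nat \<Rightarrow> ((nat \<Rightarrow> complex) \<Rightarrow> complex) set set" where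
  "root_lines_B n =
     {cfun.span {coord i} | i. i \<in> {1..n}} \<union>
     {cfun.span {coord i + coord j} | i j. i \<in> {1..n} \<and> j \<in> {1..n} \<and> i \<noteq> j} \<union>
     {cfun.span {coord i - coord j} | i j. i \<in> {1..n} \<and> j \<in> {1..n} \<and> i \<noteq> j}"

text \<open>The sum of a collection of subspaces is the span of its union.\<close>

definition building_B :: "nat \<Rightarrow> ((nat \<Rightarrow> complex) \<Rightarrow> complex) set set" where
  "building_B n = {cfun.span (\<Union>L) | L. L \<subseteq> root_lines_B n \<and> L \<noteq> {}}"

definition poincare_B :: "nat \<Rightarrow> rat poly" where
  "poincare_B n = even_poincare_poly (DCP_model (Cn n) (building_B n))"


section \<open>Levelled oriented forests\<close>

text \<open>Every finite forest is isomorphic to one with vertices in \<open>nat\<close>.\<close>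

record forest =
  verts :: "nat set"
  edges :: "(nat \<times> nat) set"
  strong :: "nat set"

definition roots :: "forest \<Rightarrow> nat set" where
  "roots \<Gamma> = {v \<in> verts \<Gamma>. v \<notin> Range (edges \<Gamma>)}"

definition leaves :: "forest \<Rightarrow> nat set" where
  "leaves \<Gamma> = {v \<in> verts \<Gamma>. v \<notin> Domain (edges \<Gamma>)}"

definition level :: "forest \<Rightarrow> nat \<Rightarrow> nat" where
  "level \<Gamma> v = 1 + (THE d. \<exists>r\<in>roots \<Gamma>. (r, v) \<in> edges \<Gamma> ^^ d)"

definition out :: "forest \<Rightarrow> nat \<Rightarrow> (nat \<times> nat) set" where
  "out \<Gamma> v = {e \<in> edges \<Gamma>. fst e = v}"

definition wout :: "forest \<Rightarrow> nat \<Rightarrow> (nat \<times> nat) set" where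
  "wout \<Gamma> v = {e \<in> out \<Gamma> v. snd e \<notin> strong \<Gamma>}"

definition tr :: "forest \<Rightarrow> nat" where
  "tr \<Gamma> = card (roots \<Gamma>)"

definition weak_inner :: "forest \<Rightarrow> nat set" where
  "weak_inner \<Gamma> = verts \<Gamma> - leaves \<Gamma> - strong \<Gamma>"

definition levelled_forest :: "forest \<Rightarrow> bool" where
  "levelled_forest \<Gamma> \<longleftrightarrow>
     finite (verts \<Gamma>) \<and> edges \<Gamma> \<subseteq> verts \<Gamma> \<times> verts \<Gamma> \<and>
     acyclic (edges \<Gamma>) \<and> single_valued ((edges \<Gamma>)\<inverse>) \<and>
     strong \<Gamma> \<subseteq> verts \<Gamma> - leaves \<Gamma> \<and>
     (\<forall>u\<in>strong \<Gamma>. \<forall>v\<in>strong \<Gamma>. level \<Gamma> u = level \<Gamma> v \<longrightarrow> u = v) \<and>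
     (\<forall>(u, v)\<in>edges \<Gamma>. v \<in> strong \<Gamma> \<longrightarrow> u \<in> strong \<Gamma>)"

definition descendants :: "forest \<Rightarrow> nat \<Rightarrow> nat set" where
  "descendants \<Gamma> v = (edges \<Gamma>)\<^sup>* `` {v}"

definition trivial_tail_root :: "forest \<Rightarrow> nat \<Rightarrow> bool" where
  "trivial_tail_root \<Gamma> v \<longleftrightarrow>
     v \<in> verts \<Gamma> - leaves \<Gamma> \<and> card (out \<Gamma> v) = 1 \<and>
     descendants \<Gamma> v \<inter> strong \<Gamma> = {} \<and> card (descendants \<Gamma> v \<inter> leaves \<Gamma>) = 1"

definition minimal :: "forest \<Rightarrow> bool" where
  "minimal \<Gamma> \<longleftrightarrow> (\<forall>v. \<not> trivial_tail_root \<Gamma> v)"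

definition forest_iso :: "(forest \<times> forest) set" where
  "forest_iso = {(\<Gamma>, \<Delta>). \<exists>f. bij_betw f (verts \<Gamma>) (verts \<Delta>) \<and>
     map_prod f f ` edges \<Gamma> = edges \<Delta> \<and> f ` strong \<Gamma> = strong \<Delta>}"

definition Aut :: "forest \<Rightarrow> (nat \<Rightarrow> nat) set" where
  "Aut \<Gamma> = {f. f permutes verts \<Gamma> \<and> map_prod f f ` edges \<Gamma> = edges \<Gamma> \<and> f ` strong \<Gamma> = strong \<Gamma>}"

definition forests_A :: "forest set" where
  "forests_A = {\<Gamma>. levelled_forest \<Gamma> \<and> minimal \<Gamma> \<and> strong \<Gamma> = {} \<and> card (leaves \<Gamma>) \<ge> 2}"

definition strong_forests_B :: "forest set" where
  "strong_forests_B = {\<Gamma>. levelled_forest \<Gamma> \<and> minimal \<Gamma> \<and> strong \<Gamma> \<noteq> {} \<and> card (leaves \<Gamma>) \<ge> 1}"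


section \<open>Power series in infinitely many variables\<close>

text \<open>Exponent vectors have finite support; polynomials are finitely supported and power series are
  arbitrary coefficient functions on exponent vectors.\<close>

type_synonym exponents = "nat \<Rightarrow>\<^sub>0 nat"
type_synonym polynomial = "exponents \<Rightarrow>\<^sub>0 rat"
type_synonym series = "exponents \<Rightarrow> rat"

definition cst :: "rat \<Rightarrow> polynomial" where
  "cst c = Poly_Mapping.single 0 c"

definition g :: "nat \<Rightarrow> polynomial" where
  "g i = Poly_Mapping.single (Poly_Mapping.single i 1) 1"

definition term_A :: "forest \<Rightarrow> polynomial" where
  "term_A \<Gamma> = cst (1 / of_nat (card (Aut \<Gamma>))) * g 0 ^ tr \<Gamma> *
     (\<Prod>v\<in>verts \<Gamma> - leaves \<Gamma>. g (level \<Gamma> v) ^ (card (out \<Gamma> v) - 1))"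

definition term_B :: "forest \<Rightarrow> polynomial" where
  "term_B \<Gamma> = cst (1 / of_nat (card (Aut \<Gamma>))) * (cst (1/2) * g 0) ^ (tr \<Gamma> - 1) *
     (\<Prod>v\<in>strong \<Gamma>. (cst (1/2) * g (level \<Gamma> v)) ^ card (wout \<Gamma> v)) *
     (\<Prod>v\<in>weak_inner \<Gamma>. g (level \<Gamma> v) ^ (card (out \<Gamma> v) - 1))"

text \<open>Infinite formal sum over isomorphism classes: infinitely many classes may share the same
  number of leaves, but on the families of minimal forests above each monomial occurs in only
  finitely many summands.\<close>

definition sum_iso_classes :: "forest set \<Rightarrow> (forest \<Rightarrow> polynomial) \<Rightarrow> series" where
  "sum_iso_classes F T = (\<lambda>m.
     \<Sum>c | c \<in> F // forest_iso \<and> Poly_Mapping.lookup (T (SOME \<Gamma>. \<Gamma> \<in> c)) m \<noteq> 0.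
       Poly_Mapping.lookup (T (SOME \<Gamma>. \<Gamma> \<in> c)) m)"

definition p_A :: series where
  "p_A = (\<lambda>m. Poly_Mapping.lookup (g 0) m + sum_iso_classes forests_A term_A m)"

definition Q_tilde_B :: series where
  "Q_tilde_B = sum_iso_classes strong_forests_B term_B"

definition halve_g0 :: "series \<Rightarrow> series" where
  "halve_g0 F = (\<lambda>m. F m * (1/2) ^ Poly_Mapping.lookup m 0)"

definition Q_B :: series where
  "Q_B = (\<lambda>m. halve_g0 p_A m + Q_tilde_B m)"

definition bad :: "exponents \<Rightarrow> bool" where
  "bad m \<longleftrightarrow> (\<exists>i j. 1 \<le> i \<and> i < j \<and> j \<in> Poly_Mapping.keys m \<and> i \<notin> Poly_Mapping.keys m)"

text \<open>The variable of \<open>rat poly\<close> is \<open>q\<close>, and \<open>fps_X\<close> is \<open>t\<close>; the polynomial division in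
  \<open>q_factor\<close> is exact.\<close>

definition q_factor :: "nat \<Rightarrow> rat poly" where
  "q_factor r = (monom 1 r - monom 1 1) div [:-1, 1:]"

definition subst_monomial :: "exponents \<Rightarrow> rat poly fps" where
  "subst_monomial m = fps_X ^ Poly_Mapping.lookup m 0 *
     (\<Prod>i\<in>Poly_Mapping.keys m - {0}. fps_const (q_factor (Poly_Mapping.lookup m i)) * fps_X ^ Poly_Mapping.lookup m i)"

text \<open>A monomial of total degree \<open>d\<close> contributes to the coefficient of \<open>t\<^sup>d\<close> only, and there are
  finitely many monomials of a given degree that are not bad.\<close>

definition remove_bad_and_subst :: "series \<Rightarrow> rat poly fps" where
  "remove_bad_and_subst F = Abs_fps (\<lambda>n.
     \<Sum>m | \<not> bad m \<and> fps_nth (subst_monomial m) n \<noteq> 0.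
       smult (F m) (fps_nth (subst_monomial m) n))"

definition phi_B :: "rat poly fps" where
  "phi_B = fps_const [:1/2:] * fps_X +
     Abs_fps (\<lambda>n. if n \<ge> 2 then smult (1 / (2 ^ n * fact n)) (poincare_B n) else 0)"

end

theory Submission
 imports Defs "HOL-Analysis.Abstract_Topological_Spaces"
begin

text \<open>The model is built from \<open>V\<close> by adding the members of the arrangement one at a time in an order
compatible with inclusion.  Each step is a blow-up whose exceptional part is a bundle of projective
spaces; excision together with a Thom isomorphism shows that the integral homology stays free and
concentrated in even degrees, and that its ranks grow as for a projective bundle.  This gives
\<open>P W = 1 + (\<Sum>U. P U * (q + \<dots> + q ^ (dim W - dim U - 1)))\<close> over the flats \<open>U\<close> properly below \<open>W\<close>, hence
a sum over chains of flats, while the universal coefficient theorem for free homology passes to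
cohomology.  A chain of flats of type \<open>B\<close> is a descending sequence of equivalence relations on \<open>{0..n}\<close>,
the class of \<open>0\<close> carrying the vanishing coordinates, together with signs modulo a global sign on each
of the other classes.  The classes along the sequence are the vertices of a forest with labelled
leaves, those of the class of \<open>0\<close> being strong; counting labellings yields the weights
\<open>1/|Aut|\<close>, and counting signs yields the powers of \<open>1/2\<close>.\<close>

text \<open>The closure in the definition is awkward to blow up, so an explicit set takes its place:
  a point of \<open>compatible W S\<close> is a vector of \<open>W\<close> with nested lines through
  it, one modulo each flat in \<open>S\<close>. This makes sense for every flat \<open>W\<close> and
  every down-closed \<open>S\<close>, so the centre of a blow-up is again such a model, for a
  smaller flat. Over the centre the new line is a free choice, so the exceptional part is a product
  and only products with linear pairs have to be computed. What is carried along is not the homology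
  of the new space but surjectivity of the map down and the rank of its kernel; vanishing in odd
  degrees is what lets both pass from a neighbourhood of the centre to the whole space. In the
  series the exponent of \<open>g_i\<close> is the jump of dimension from one flat to the next, that
  of \<open>g_0\<close> the dimension of the smallest flat, and \<open>q_factor r\<close> is the
  Poincare polynomial of P^(r-1) minus 1, the contribution of such a jump. Bad monomials are removed
  because a chain has no zero jumps before it reaches the whole space.\<close>

abbreviation "cmap \<equiv> continuous_map"
abbreviation "prod_top \<equiv> prod_topology"
abbreviation "subtop \<equiv> subtopology"
abbreviation "homol \<equiv> homology_group"
abbreviation "rel_homol \<equiv> relative_homology_group"
abbreviation "lookup \<equiv> Poly_Mapping.lookup"

section \<open>Free abelian groups of finite rank\<close>

text \<open>\<open>group G\<close> is demanded separately because \<open>iso\<close> only sees the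
  carrier and the multiplication; an isomorphism by itself would leave the unit of \<open>G\<close>
  unconstrained.\<close>

definition free_rank :: "('a, 'b) monoid_scheme => nat => bool" where
 "free_rank G r \<longleftrightarrow> group G & (EX h. h : iso G (free_Abelian_group {..<r}))"

lemma free_rank_iso:
 assumes "free_rank G r" "h : iso G H" "group H"
 shows "free_rank H r"
proof -
 from assms obtain k where "k : iso G (free_Abelian_group {..<r})" "group G" by(auto simp: free_rank_def)
 then have "k \<circ> inv_into (carrier G) h : iso H (free_Abelian_group {..<r})"
  using assms group.iso_set_sym iso_set_trans by blast
 with assms show ?thesis by(auto simp: free_rank_def)
qed

lemma free_rank_is_iso: "free_rank G r ==> G \<cong> H ==> group H ==> free_rank H r"
 using free_rank_iso unfolding is_iso_def by blast

lemma free_rank_0: "free_rank G 0 \<longleftrightarrow> trivial_group G"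
proof -
 have "trivial_group (free_Abelian_group {..<0::nat})"
  unfolding trivial_group_def by(intro conjI group_free_Abelian_group) (auto simp: free_Abelian_group_def)
 moreover have "trivial_group G ==> EX h. h : iso G (free_Abelian_group {..<0::nat})"
  by(intro exI[of _ "%_. 0"]) (auto simp: trivial_group_def iso_def hom_def bij_betw_def group.is_monoid)
 ultimately show ?thesis
  unfolding free_rank_def using isomorphic_group_triviality group_free_Abelian_group by(metis is_isoI trivial_group_def)
qed

lemma free_rank_integer_group: "free_rank integer_group 1"
proof -
 have "integer_group \<cong> free_Abelian_group {..<1::nat}"
  using isomorphic_group_integer_free_Abelian_group_singleton[of "0::nat"] by(simp add: lessThan_Suc)
 then show ?thesis by(auto simp: free_rank_def is_iso_def)
qed

lemma free_hom_eq:
 assumes H: "group H" "h : hom (free_Abelian_group S) H" "k : hom (free_Abelian_group S) H"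
  and eq: "!!a. a : S ==> h (frag_of a) = k (frag_of a)" and x: "Poly_Mapping.keys x <= S"
 shows "h x = k x"
 using x
proof (rule free_Abelian_group_induct)
 interpret h: group_hom "free_Abelian_group S" H h using H by(simp add: group_hom_def group_hom_axioms_def)
 interpret k: group_hom "free_Abelian_group S" H k using H by(simp add: group_hom_def group_hom_axioms_def)
 show "h 0 = k 0" using h.hom_one k.hom_one by simp
 fix x y assume xy: "Poly_Mapping.keys x <= S" "Poly_Mapping.keys y <= S" "h x = k x" "h y = k y"
 then show "h (x - y) = k (x - y)"
  using h.hom_mult[of x "-y"] k.hom_mult[of x "-y"] h.hom_inv[of y] k.hom_inv[of y] by simp
qed (rule eq)

text \<open>A short exact sequence with free quotient splits: lifts of the generators of
  \<open>C\<close> together with the image of a basis of \<open>A\<close> form a basis of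
  \<open>B\<close>.\<close>

lemma free_rank_ext:
 assumes A: "free_rank A a" and C: "free_rank C c" and B: "comm_group B"
  and f: "f : hom A B" "inj_on f (carrier A)"
  and gh: "h : hom B C" "h ` carrier B = carrier C"
  and ker: "!!x. x : carrier B ==> h x = \<one>\<^bsub>C\<^esub> \<longleftrightarrow> x : f ` carrier A"
 shows "free_rank B (a + c)"
proof -
 interpret B: comm_group B by fact
 let ?a = "free_Abelian_group {..<a}" and ?c = "free_Abelian_group {..<c}" and ?F = "free_Abelian_group {..<a + c}"
 obtain \<alpha>' where \<alpha>': "\<alpha>' : iso A ?a" "group A" using A by(auto simp: free_rank_def)
 define \<alpha> where "\<alpha> = inv_into (carrier A) \<alpha>'"
 have \<alpha>: "\<alpha> : iso ?a A" unfolding \<alpha>_def using \<alpha>' group.iso_set_sym by blast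
 obtain \<gamma> where \<gamma>: "\<gamma> : iso C ?c" "group C" using C by(auto simp: free_rank_def)
 have "EX b:carrier B. \<gamma> (h b) = frag_of i" if "i < c" for i
 proof -
  have "frag_of i : \<gamma> ` carrier C" using \<gamma> that by(auto simp: iso_def bij_betw_def)
  then show ?thesis using gh by(metis imageE)
 qed
 then obtain b where b: "!!i. i < c ==> b i : carrier B & \<gamma> (h (b i)) = frag_of i" by metis
 have \<alpha>h: "\<alpha> : hom ?a A" and \<gamma>h: "\<gamma> \<circ> h : hom B ?c" and f\<alpha>: "f \<circ> \<alpha> : hom ?a B"
  using \<alpha> \<gamma> f gh hom_compose unfolding iso_def by blast+
 have "(%i. if i < a then f (\<alpha> (frag_of i)) else b (i - a)) ` {..<a + c} <= carrier B"
  using b hom_in_carrier[OF f\<alpha>] by auto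
 then obtain \<Phi> where \<Phi>: "\<Phi> : hom ?F B" "!!i. i < a + c ==> \<Phi> (frag_of i) = (if i < a then f (\<alpha> (frag_of i)) else b (i - a))"
  by(rule B.free_Abelian_group_universal) auto
 interpret \<Phi>: group_hom ?F B \<Phi> using \<Phi> B.is_group by(simp add: group_hom_def group_hom_axioms_def)
 have \<Phi>1: "\<Phi> x = f (\<alpha> x)" if "Poly_Mapping.keys x <= {..<a}" for x
 proof -
  have "carrier ?a <= carrier ?F" by(auto simp: subset_iff trans_less_add1)
  then have "\<Phi> : hom ?a B" using \<Phi>(1) unfolding hom_def by(auto simp del: carrier_free_Abelian_group_iff)
  then show ?thesis using free_hom_eq[OF B.is_group _ f\<alpha> _ that] \<Phi>(2) by auto
 qed
 \<comment> \<open>\<open>t\<close> projects onto the last \<open>c\<close> generators;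
   \<open>frag_extend t\<close> is then \<open>h\<close> after \<open>\<Phi>\<close> in
   coordinates.\<close>
 define t where "t = (%i. if i < a then 0 else frag_of (i - a))"
 have th: "frag_extend t : hom ?F ?c"
 proof -
  have "Poly_Mapping.keys (t i) <= {..<c}" if "i < a + c" for i using that by(auto simp: t_def)
  then have "Poly_Mapping.keys (frag_extend t x) <= {..<c}" if "Poly_Mapping.keys x <= {..<a + c}" for x
   using keys_frag_extend[of t x] that by(meson UN_least lessThan_iff order_trans subsetD)
  then show ?thesis by(auto simp: hom_def frag_extend_add)
 qed
 have \<Phi>2: "\<gamma> (h (\<Phi> x)) = frag_extend t x" if "Poly_Mapping.keys x <= {..<a + c}" for x
 proof -
  have "\<gamma> (h (f u)) = 0" if "u : carrier A" for u
   using ker[of "f u"] hom_in_carrier[OF f(1) that] that hom_one[OF _ \<gamma>(2), of \<gamma> ?c] \<gamma>(1) by(auto simp: iso_def)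
  then have "(\<gamma> \<circ> h \<circ> \<Phi>) (frag_of i) = frag_extend t (frag_of i)" if "i : {..<a + c}" for i
   using that b hom_in_carrier[OF \<alpha>h] by(auto simp: \<Phi>(2) t_def)
  then show ?thesis using free_hom_eq[OF _ hom_compose[OF \<Phi>(1) \<gamma>h] th _ that] by simp
 qed
 have lk: "lookup (frag_extend t x) j = lookup x (j + a)" for x j
 proof (rule free_Abelian_group_induct[of x UNIV])
  show "lookup (frag_extend t (frag_of i)) j = lookup (frag_of i) (j + a)" for i
   by(auto simp: t_def lookup_single when_def)
 qed (simp_all add: frag_extend_diff lookup_minus)
 have "inj_on \<Phi> (carrier ?F)"
  unfolding \<Phi>.inj_on_one_iff
 proof (intro allI impI)
  fix x assume x: "x : carrier ?F" "\<Phi> x = \<one>\<^bsub>B\<^esub>"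
  then have "frag_extend t x = 0" using \<Phi>2[of x] hom_one[OF \<gamma>h] by simp
  then have z: "lookup x (j + a) = 0" for j using lk[of x j] by simp
  have xa: "Poly_Mapping.keys x <= {..<a}"
  proof
   fix i assume "i : Poly_Mapping.keys x"
   then show "i : {..<a}" using z[of "i - a"] by(cases "i < a") (auto simp: in_keys_iff)
  qed
  then have "f (\<alpha> x) = f \<one>\<^bsub>A\<^esub>" using x(2) \<Phi>1 hom_one[OF f(1) \<alpha>'(2)] by simp
  then have "\<alpha> x = \<alpha> 0"
   using inj_onD[OF f(2)] hom_in_carrier[OF \<alpha>h] xa hom_one[OF \<alpha>h] \<alpha>'(2) by(simp add: group.is_monoid)
  then show "x = \<one>\<^bsub>?F\<^esub>" using \<alpha> xa by(auto simp: iso_def bij_betw_def inj_on_def)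
 qed
 moreover have "z : \<Phi> ` carrier ?F" if z: "z : carrier B" for z
 proof -
  define x2 where "x2 = frag_extend (frag_of \<circ> (%i. i + a)) (\<gamma> (h z))"
  have "Poly_Mapping.keys (\<gamma> (h z)) <= {..<c}" using hom_in_carrier[OF \<gamma>h z] by simp
  then have x2: "x2 : carrier ?F" unfolding x2_def using keys_frag_extend[of "frag_of \<circ> (%i. i + a)" "\<gamma> (h z)"] by force
  have "t \<circ> (%i. i + a) = frag_of" by(auto simp: t_def)
  then have e: "\<gamma> (h (\<Phi> x2)) = \<gamma> (h z)"
   using \<Phi>2[of x2] x2 frag_expansion[of "\<gamma> (h z)"] by(simp add: x2_def frag_extend_compose)
  \<comment> \<open>\<open>x2\<close> is chosen so that \<open>\<Phi> x2\<close> and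
    \<open>z\<close> have the same image in \<open>C\<close>; their quotient \<open>w\<close> is
    killed by \<open>h\<close> and therefore hit by \<open>f\<close>.\<close>
  define w where "w = z \<otimes>\<^bsub>B\<^esub> inv\<^bsub>B\<^esub> \<Phi> x2"
  have w: "w : carrier B" "w \<otimes>\<^bsub>B\<^esub> \<Phi> x2 = z" unfolding w_def using z x2 by(auto simp: B.m_assoc)
  have "h w \<otimes>\<^bsub>C\<^esub> h z = h z"
  proof -
   have "h (\<Phi> x2) = h z" using inj_onD[where A = "carrier C", OF _ e] \<gamma>(1) gh(2) \<Phi>.hom_closed[OF x2] z by(auto simp: iso_def bij_betw_def)
   then show ?thesis using hom_mult[OF gh(1) w(1), of "\<Phi> x2"] w(2) x2 by simp
  qed
  then have "h w = \<one>\<^bsub>C\<^esub>" using \<gamma>(2) hom_in_carrier[OF gh(1)] w z by(metis group.r_cancel_one)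
  then obtain u where u: "u : carrier A" "w = f u" using ker w by auto
  have "\<alpha>' u : carrier ?a" "\<alpha> (\<alpha>' u) = u" using \<alpha>' u hom_in_carrier[of \<alpha>' A ?a u] unfolding \<alpha>_def by(auto simp: iso_def bij_betw_def)
  moreover from this have "\<alpha>' u : carrier ?F" by(auto simp: subset_iff trans_less_add1)
  ultimately have "\<Phi> (\<alpha>' u + x2) = z"
   using \<Phi>.hom_mult[of "\<alpha>' u" x2] x2 \<Phi>1[of "\<alpha>' u"] u w by auto
  then show ?thesis using \<open>\<alpha>' u : carrier ?F\<close> x2 keys_add[of "\<alpha>' u" x2] by(intro image_eqI[of _ _ "\<alpha>' u + x2"]) auto
 qed
 ultimately have "\<Phi> : iso ?F B" using \<Phi>.hom_closed by(auto simp: iso_def bij_betw_def \<Phi>(1))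
 then show ?thesis using group.iso_set_sym[OF group_free_Abelian_group] B.is_group by(auto simp: free_rank_def)
qed

text \<open>Gaussian elimination without division: one coordinate is cleared at a time, at the cost
  of one vector, so dependence over the integers survives to the end.\<close>

lemma integer_relation:
 fixes v :: "'a => nat => int"
 assumes "finite S" "card S > r" "!!x i. x : S ==> i >= r ==> v x i = 0"
 shows "EX a. (EX x:S. a x ~= 0) & (ALL i. (\<Sum>x\<in>S. a x * v x i) = 0)"
 using assms
proof (induction r arbitrary: S v)
 case 0
 then show ?case by(intro exI[of _ "%_. 1"]) (auto simp: card_gt_0_iff)
next
 case (Suc r)
 show ?case
 proof (cases "ALL x:S. v x r = 0")
  case True
  then have "v x i = 0" if "x : S" "i >= r" for x i using that Suc.prems(3)[of x i] by(cases "i = r") auto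
  then show ?thesis using Suc.IH[of S v] Suc.prems by simp
 next
  case False
  then obtain y where y: "y : S" "v y r ~= 0" by blast
  \<comment> \<open>Cross-multiplying with the pivot vector \<open>y\<close> clears coordinate
    \<open>r\<close> and keeps all entries integral.\<close>
  define v' where "v' = (%x i. v y r * v x i - v x r * v y i)"
  have "EX a. (EX x:S - {y}. a x ~= 0) & (ALL i. (\<Sum>x\<in>S - {y}. a x * v' x i) = 0)"
  proof (rule Suc.IH)
   show "v' x i = 0" if "x : S - {y}" "i >= r" for x i
    using that Suc.prems(3)[of x i] Suc.prems(3)[of y i] y by(cases "i = r") (auto simp: v'_def)
  qed (use Suc.prems y in auto)
  then obtain a where a: "EX x:S - {y}. a x ~= 0" "!!i. (\<Sum>x\<in>S - {y}. a x * v' x i) = 0" by blast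
  \<comment> \<open>A relation between the reduced vectors is translated back: the other
    coefficients are scaled by the pivot, and \<open>y\<close> collects what the elimination
    subtracted.\<close>
  define a' where "a' = (%x. if x = y then - (\<Sum>x\<in>S - {y}. a x * v x r) else a x * v y r)"
  have "(\<Sum>x\<in>S. a' x * v x i) = (\<Sum>x\<in>S - {y}. a x * v' x i)" for i
   using Suc.prems(1) y
   by(simp add: sum.remove[of S y] a'_def v'_def sum_distrib_left sum_distrib_right algebra_simps flip: sum_subtractf)
  then show ?thesis using a y by(intro exI[of _ a']) (auto simp: a'_def)
 qed
qed

text \<open>A supremum in \<open>nat\<close> is informative only for a bounded set:
  \<open>integer_relation\<close> bounds the independent sets, and a basis attains the
  bound.\<close>

lemma abelian_rank_free:
 assumes G: "comm_group G" and fr: "free_rank G r"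
 shows "abelian_rank G = r"
proof -
 interpret G: comm_group G by fact
 let ?F = "free_Abelian_group {..<r}"
 obtain \<phi> where \<phi>: "\<phi> : iso G ?F" using fr by(auto simp: free_rank_def)
 then have \<phi>i: "inj_on \<phi> (carrier G)" and \<phi>s: "\<phi> ` carrier G = carrier ?F" by(auto simp: iso_def bij_betw_def)
 interpret \<phi>: group_hom G ?F \<phi> using \<phi> G.is_group by(simp add: group_hom_def group_hom_axioms_def iso_def)
 have fp: "\<phi> (finprod G (%x. x [^]\<^bsub>G\<^esub> a x) S) = (\<Sum>x\<in>S. frag_cmul (a x) (\<phi> x))"
  if "finite S" "S <= carrier G" for S and a :: "'a => int"
  using that
 proof (induction S rule: finite_induct)
  case (insert x S)
  then have "(%x. x [^]\<^bsub>G\<^esub> a x) : S \<rightarrow> carrier G" "x : carrier G" by auto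
  then show ?case using insert \<phi>.hom_closed[of x] by(simp add: \<phi>.hom_int_pow)
 qed (use \<phi>.hom_one in simp)
 have eq: "finprod G (%x. x [^]\<^bsub>G\<^esub> a x) S = \<one>\<^bsub>G\<^esub> \<longleftrightarrow> (ALL i. (\<Sum>x\<in>S. a x * lookup (\<phi> x) i) = 0)"
  if S: "finite S" "S <= carrier G" for S and a :: "'a => int"
 proof -
  have "finprod G (%x. x [^]\<^bsub>G\<^esub> a x) S : carrier G" using S by(intro G.finprod_closed) auto
  then have "finprod G (%x. x [^]\<^bsub>G\<^esub> a x) S = \<one>\<^bsub>G\<^esub> \<longleftrightarrow> (\<Sum>x\<in>S. frag_cmul (a x) (\<phi> x)) = 0"
   unfolding fp[OF S, symmetric] using inj_onD[OF \<phi>i _ _ G.one_closed] \<phi>.hom_one by auto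
  then show ?thesis by(simp add: poly_mapping_eq_iff fun_eq_iff lookup_sum)
 qed
 have le: "card S <= r" if "Z_independent G S" for S
 proof (rule ccontr)
  assume "~ card S <= r"
  have S: "finite S" "S <= carrier G" using that by(auto simp: Z_independent_def)
  have "lookup (\<phi> x) i = 0" if "x : S" "i >= r" for x i
   using \<phi>.hom_closed[of x] S(2) that by(auto simp: in_keys_iff subset_iff)
  then obtain a where "EX x:S. a x ~= 0" "ALL i. (\<Sum>x\<in>S. a x * lookup (\<phi> x) i) = 0"
   using integer_relation[of S r "%x. lookup (\<phi> x)"] S(1) \<open>~ card S <= r\<close> by auto
  then show False using that eq[OF S, of a] by(auto simp: Z_independent_def)
 qed
 define b where "b = (%i. inv_into (carrier G) \<phi> (frag_of i))"
 have b: "b i : carrier G" "\<phi> (b i) = frag_of i" if "i < r" for i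
 proof -
  have "frag_of i : \<phi> ` carrier G" unfolding \<phi>s using that by simp
  then show "b i : carrier G" "\<phi> (b i) = frag_of i" unfolding b_def by(rule inv_into_into, rule f_inv_into_f)
 qed
 have binj: "inj_on b {..<r}" using b by(metis frag_of_eq inj_onI lessThan_iff)
 have ex: "Z_independent G (b ` {..<r})"
  unfolding Z_independent_def
 proof (intro conjI allI impI)
  fix a :: "'a => int"
  assume "finprod G (%x. x [^]\<^bsub>G\<^esub> a x) (b ` {..<r}) = \<one>\<^bsub>G\<^esub>"
  then have "(\<Sum>x\<in>b ` {..<r}. a x * lookup (\<phi> x) i) = 0" for i using eq[of "b ` {..<r}" a] b by auto
  moreover have "(\<Sum>x\<in>b ` {..<r}. a x * lookup (\<phi> x) i) = (\<Sum>j<r. if i = j then a (b j) else 0)" for i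
   unfolding sum.reindex[OF binj] using b by(intro sum.cong) (auto simp: lookup_single when_def)
  ultimately have "(if i < r then a (b i) else 0) = 0" for i by simp
  then show "ALL x:b ` {..<r}. a x = 0" by(metis imageE lessThan_iff)
 qed (use b in auto)
 have "Sup {card S | S. Z_independent G S} = r"
 proof (rule cSup_eq_maximum)
  show "r : {card S | S. Z_independent G S}"
   using ex card_image[OF binj] by(intro CollectI exI[of _ "b ` {..<r}"]) auto
 qed (use le in auto)
 then show ?thesis by(simp add: abelian_rank_def)
qed

section \<open>Cohomology of spaces with free homology\<close>

abbreviation "chain \<equiv> singular_chain"
abbreviation "cycle p X \<equiv> singular_relcycle p X {}"
abbreviation "bdry p X \<equiv> singular_relboundary p X {}"

lemma cycle_frag_extend: "(!!j. cycle p X (z j)) ==> cycle p X (frag_extend z y)"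
 unfolding frag_extend_def by(intro singular_relcycle_sum singular_relcycle_cmul)

text \<open>Passes from homology classes to chains: \<open>c\<close> reads off the coordinates of a
  cycle, and \<open>z j\<close> is a cycle representing the j-th generator, set to 0 beyond the rank
  so that no range condition on \<open>j\<close> has to be carried along.\<close>

lemma homology_coordinates:
 assumes "free_rank (homol (int p) X) r"
 obtains c z where
  "!!x y. cycle p X x ==> cycle p X y ==> c (x + y) = c x + c y"
  "!!x. cycle p X x ==> c x = 0 \<longleftrightarrow> bdry p X x"
  "!!j. cycle p X (z j)" "!!j. j < r ==> c (z j) = frag_of j" "!!j. j >= r ==> z j = 0"
  "!!x. cycle p X x ==> bdry p X (x - frag_extend z (c x))"
proof -
 let ?H = "homol (int p) X" and ?F = "free_Abelian_group {..<r}"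
 let ?q = "homologous_rel_set p X {}"
 obtain \<phi> where "\<phi> : iso ?H ?F" using assms by(auto simp: free_rank_def)
 then have \<phi>: "\<phi> : hom ?H ?F" and \<phi>i: "inj_on \<phi> (carrier ?H)" and \<phi>s: "\<phi> ` carrier ?H = carrier ?F"
  by(auto simp: iso_def bij_betw_def)
 have qc: "?q x : carrier ?H" if "cycle p X x" for x
  using that by(auto simp: carrier_relative_homology_group)
 have qadd: "?q (x + y) = ?q x \<otimes>\<^bsub>?H\<^esub> ?q y" if "cycle p X x" "cycle p X y" for x y
 proof -
  have "(#>\<^bsub>relcycle_group p X {}\<^esub>) (singular_relboundary_set p X {}) : hom (relcycle_group p X {}) ?H"
   by(simp add: nontrivial_relative_homology_group normal.r_coset_hom_Mod normal_subgroup_singular_relboundary_relcycle)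
  from hom_mult[OF this, of x y] that show ?thesis
   by(simp add: right_coset_singular_relboundary)
 qed
 define c where "c = (%x. \<phi> (?q x))"
 have 1: "c (x + y) = c x + c y" if "cycle p X x" "cycle p X y" for x y
  unfolding c_def qadd[OF that] using hom_mult[OF \<phi> qc[OF that(1)] qc[OF that(2)]] by simp
 have 2: "Poly_Mapping.keys (c x) <= {..<r}" if "cycle p X x" for x
  using hom_in_carrier[OF \<phi> qc[OF that]] by(simp add: c_def)
 have 3: "c x = 0 \<longleftrightarrow> bdry p X x" if x: "cycle p X x" for x
 proof -
  have "\<one>\<^bsub>?H\<^esub> : carrier ?H" by(simp add: group.is_monoid monoid.one_closed del: one_relative_homology_group)
  then have "c x = \<phi> \<one>\<^bsub>?H\<^esub> \<longleftrightarrow> ?q x = \<one>\<^bsub>?H\<^esub>"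
   unfolding c_def using inj_on_eq_iff[OF \<phi>i qc[OF x]] by blast
  then show ?thesis using hom_one[OF \<phi>] by(simp add: homologous_rel_set_eq_relboundary del: one_relative_homology_group) (simp add: homologous_rel_set_eq_relboundary)
 qed
 have "EX z. cycle p X z & (if j < r then c z = frag_of j else z = 0)" for j
 proof (cases "j < r")
  case True
  then have "frag_of j : \<phi> ` carrier ?H" unfolding \<phi>s by simp
  with True show ?thesis unfolding c_def carrier_relative_homology_group by auto
 qed (auto intro: exI[of _ 0])
 then obtain z where z: "!!j. cycle p X (z j)" "!!j. if j < r then c (z j) = frag_of j else z j = 0" by metis
 have "bdry p X (x - frag_extend z (c x))" if x: "cycle p X x" for x
 proof -
  have c0: "c 0 = 0" using 1[of 0 0] by simp
  have cd: "c (x - y) = c x - c y" if "cycle p X x" "cycle p X y" for x y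
   using 1[OF singular_relcycle_diff[OF that] that(2)] by(simp add: algebra_simps)
  have "c (frag_extend z (c x)) = c x"
   using 2[OF x]
   by(rule free_Abelian_group_induct)
    (use z c0 in \<open>auto simp: frag_extend_diff cd cycle_frag_extend\<close>)
  then show ?thesis using x z by(simp add: cd cycle_frag_extend singular_relcycle_diff flip: 3)
 qed
 with z show thesis using that[OF 1 3] by(metis leD)
qed

text \<open>Cycles split off the chains: this uses that chain groups are free and, inductively, that the
 boundaries of one degree less are a direct summand.\<close>

lemma cycle_splitting_step:
 assumes fr: "free_rank (homol (int p) X) r"
  and add: "!!x y. \<rho> (x + y) = \<rho> x + \<rho> y"
  and cyc: "!!x. chain p X x ==> cycle p X (\<rho> x)"
  and idem: "!!x. cycle p X x ==> \<rho> x = x"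
 shows "EX s. (ALL x y. s (x + y) = s x + s y) & (ALL x. chain p X x --> chain (Suc p) X (s x)) &
  (ALL x. bdry p X x --> chain_boundary (Suc p) (s x) = x)"
proof -
 obtain c z where c: "!!x y. cycle p X x ==> cycle p X y ==> c (x + y) = c x + c y"
  "!!x. cycle p X x ==> c x = 0 \<longleftrightarrow> bdry p X x"
  and z: "!!j. cycle p X (z j)" "!!j. j < r ==> c (z j) = frag_of j" "!!j. j >= r ==> z j = 0"
  and hom: "!!x. cycle p X x ==> bdry p X (x - frag_extend z (c x))"
  using homology_coordinates[OF fr] by blast
 \<comment> \<open>\<open>b\<close> projects chains onto boundaries: \<open>\<rho>\<close> makes a
   cycle, and subtracting the chosen representative of its class leaves a boundary.\<close>
 define b where "b = (%x. \<rho> x - frag_extend z (c (\<rho> x)))"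
 have "EX d. chain (Suc p) X d & chain_boundary (Suc p) d = b (frag_of sg)" if "singular_simplex p X sg" for sg
  using hom[OF cyc, of "frag_of sg"] that by(simp add: b_def singular_boundary singular_chain_of)
 \<comment> \<open>Chain groups are free on the simplices, so preimages under the boundary map are
   chosen simplex by simplex and extended linearly.\<close>
 then obtain d where d: "!!sg. singular_simplex p X sg ==> chain (Suc p) X (d sg) & chain_boundary (Suc p) (d sg) = b (frag_of sg)"
  by metis
 have bd: "chain_boundary (Suc p) (frag_extend d x) = b x" if "chain p X x" for x
 proof (rule free_Abelian_group_induct[where P = "%x. _ (frag_extend d x) = b x"])
  show "Poly_Mapping.keys x <= singular_simplex_set p X" using that by(simp add: singular_chain_def)
  have "\<rho> 0 = 0" using add[of 0 0] by simp
  moreover have "c 0 = 0" using c(1)[of 0 0] by simp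
  ultimately show "chain_boundary (Suc p) (frag_extend d 0) = b 0" by(simp add: b_def)
  fix x y assume xy: "Poly_Mapping.keys x <= singular_simplex_set p X" "Poly_Mapping.keys y <= singular_simplex_set p X"
   "chain_boundary (Suc p) (frag_extend d x) = b x" "chain_boundary (Suc p) (frag_extend d y) = b y"
  have "\<rho> (x - y) + \<rho> y = \<rho> x" using add[of "x - y" y] by simp
  moreover have "c (\<rho> (x - y) + \<rho> y) = c (\<rho> (x - y)) + c (\<rho> y)"
   using c(1)[OF cyc cyc] xy by(metis singular_chain_def singular_chain_diff)
  ultimately have "\<rho> (x - y) = \<rho> x - \<rho> y" "c (\<rho> (x - y)) = c (\<rho> x) - c (\<rho> y)" by(metis eq_diff_eq)+
  with xy show "chain_boundary (Suc p) (frag_extend d (x - y)) = b (x - y)"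
   by(simp add: b_def frag_extend_diff chain_boundary_diff)
 qed (use d in auto)
 show ?thesis
 proof (intro exI[of _ "frag_extend d"] conjI allI impI)
  show "chain (Suc p) X (frag_extend d x)" if "chain p X x" for x
   using that d by(intro singular_chain_extend) (auto simp: singular_chain_def)
  fix x assume x: "bdry p X x"
  then have "cycle p X x" by(rule singular_relboundary_imp_relcycle)
  then show "chain_boundary (Suc p) (frag_extend d x) = x"
   using bd[OF singular_boundary_imp_chain[OF x]] x c(2)[of x] by(simp add: b_def idem)
 qed (rule frag_extend_add)
qed

lemma cycle_splitting:
 assumes fr: "!!p. free_rank (homol (int p) X) (r p)"
 obtains \<rho> s where "!!x y. \<rho> (x + y) = \<rho> x + \<rho> y" "!!x. chain p X x ==> cycle p X (\<rho> x)" "!!x. cycle p X x ==> \<rho> x = x"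
  "!!x y. s (x + y) = s x + s y" "!!x. chain p X x ==> chain (Suc p) X (s x)" "!!x. bdry p X x ==> chain_boundary (Suc p) (s x) = x"
proof -
 have "EX \<rho>. (ALL x y. \<rho> (x + y) = \<rho> x + \<rho> y) & (ALL x. chain p X x --> cycle p X (\<rho> x)) & (ALL x. cycle p X x --> \<rho> x = x)"
 proof (induction p)
  case 0
  show ?case by(rule exI[of _ id]) (auto simp: singular_cycle chain_boundary_def)
 next
  case (Suc p)
  then obtain s where s: "!!x y. s (x + y) = s x + s y" "!!x. chain p X x ==> chain (Suc p) X (s x)"
   "!!x. bdry p X x ==> chain_boundary (Suc p) (s x) = x"
   using cycle_splitting_step[OF fr[of p]] by metis
  have "s 0 = 0" using s(1)[of 0 0] by simp
  moreover have "bdry p X (chain_boundary (Suc p) x)" "chain p X (chain_boundary (Suc p) x)" if "chain (Suc p) X x" for x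
   using that by(auto simp: singular_boundary singular_chain_boundary_alt)
  \<comment> \<open>\<open>s\<close> of the boundary of \<open>y\<close> is the part of
    \<open>y\<close> complementary to the cycles; removing it is the projection in the next
    degree.\<close>
  ultimately show ?case using s
   by(intro exI[of _ "%y. y - s (chain_boundary (Suc p) y)"])
    (auto simp: singular_cycle chain_boundary_diff chain_boundary_add singular_chain_diff)
 qed
 then obtain \<rho> where \<rho>: "!!x y. \<rho> (x + y) = \<rho> x + \<rho> y" "!!x. chain p X x ==> cycle p X (\<rho> x)" "!!x. cycle p X x ==> \<rho> x = x"
  by blast
 from cycle_splitting_step[OF fr this] show thesis using that[OF \<rho>] by blast
qed

text \<open>Evaluation on the cycles \<open>z j\<close> identifies cohomology with the dual of
  homology. It is onto because functionals on cycles extend to chains by \<open>\<rho>\<close>. Its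
  kernel consists of coboundaries because a cocycle vanishing on cycles factors through the boundary
  map, whose image has the section \<open>s\<close>; this is how freeness one degree lower removes
  the Ext term.\<close>

lemma cohomology_rank:
 assumes fr: "!!p. free_rank (homol (int p) X) (r p)"
 shows "abelian_rank (cohomology_group p X) = r p"
proof -
 let ?C = "%p. cochain_group p X" and ?F = "free_Abelian_group {..<r p}"
 let ?K = "{\<phi> : carrier (?C p). coboundary p X \<phi> = \<one>\<^bsub>?C (Suc p)\<^esub>}"
 let ?Z = "cocycle_group p X"
 interpret C: comm_group "?C q" for q by(rule comm_group_cochain_group)
 have Cc: "\<phi> : carrier (?C q) \<longleftrightarrow> \<phi> : extensional {x. chain q X x} &
   (ALL x y. chain q X x --> chain q X y --> \<phi> (x + y) = \<phi> x + \<phi> y)" for \<phi> q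
  by(auto simp: cochain_group_def hom_def)
 have Cm: "(\<phi> \<otimes>\<^bsub>?C q\<^esub> \<psi>) = (\<lambda>c\<in>{x. chain q X x}. \<phi> c + \<psi> c)" "\<one>\<^bsub>?C q\<^esub> = (\<lambda>c\<in>{x. chain q X x}. 0)" for \<phi> \<psi> q
  by(simp_all add: cochain_group_def)
 have C0: "\<phi> 0 = 0" if "\<phi> : carrier (?C q)" for \<phi> q
  using that unfolding Cc by(metis add.right_neutral add_left_cancel singular_chain_0)
 have Cd: "\<phi> (x - y) = \<phi> x - \<phi> y" if "\<phi> : carrier (?C q)" "chain q X x" "chain q X y" for \<phi> x y q
  using that unfolding Cc by(metis add_diff_cancel_right' diff_add_cancel singular_chain_diff)
 have bch: "chain q X (chain_boundary (Suc q) x)" if "chain (Suc q) X x" for x q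
  using that by(rule singular_chain_boundary_alt)
 have dh: "coboundary q X : hom (?C q) (?C (Suc q))" for q
  by(rule homI) (auto simp: Cc Cm coboundary_def chain_boundary_add singular_chain_add bch fun_eq_iff)
 interpret \<delta>: group_hom "?C p" "?C (Suc p)" "coboundary p X" by unfold_locales (rule dh)
 have K: "?K = kernel (?C p) (?C (Suc p)) (coboundary p X)" by(auto simp: kernel_def)
 have Kz: "\<phi> (chain_boundary (Suc p) x) = 0" if "\<phi> : ?K" "chain (Suc p) X x" for \<phi> x
  using that by(auto simp: Cm coboundary_def fun_eq_iff restrict_def split: if_splits)
 have Zc: "carrier ?Z = ?K" unfolding cocycle_group_def
  using subgroup.carrier_subgroup_generated_subgroup[OF \<delta>.subgroup_kernel] K by simp
 have Zm: "(\<otimes>\<^bsub>?Z\<^esub>) = (\<otimes>\<^bsub>?C p\<^esub>)" "\<one>\<^bsub>?Z\<^esub> = \<one>\<^bsub>?C p\<^esub>" by(auto simp: cocycle_group_def subgroup_generated_def)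
 have Zcomm: "comm_group ?Z" unfolding cocycle_group_def by(rule C.abelian_subgroup_generated) (rule C.comm_group_axioms)
 obtain c z where c: "!!x y. cycle p X x ==> cycle p X y ==> c (x + y) = c x + c y"
  "!!x. cycle p X x ==> c x = 0 \<longleftrightarrow> bdry p X x"
  and z: "!!j. cycle p X (z j)" "!!j. j < r p ==> c (z j) = frag_of j" "!!j. j >= r p ==> z j = 0"
  and hom: "!!x. cycle p X x ==> bdry p X (x - frag_extend z (c x))"
  using homology_coordinates[OF fr] by blast
 obtain \<rho> where \<rho>: "!!x y. \<rho> (x + y) = \<rho> x + \<rho> y" "!!x. chain p X x ==> cycle p X (\<rho> x)" "!!x. cycle p X x ==> \<rho> x = x"
  using cycle_splitting[OF fr] by metis
 have zch: "chain p X (z j)" for j using z(1) by(simp add: singular_cycle)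
 define ev where "ev = (%\<phi>. \<Sum>j<r p. frag_cmul (\<phi> (z j)) (frag_of j))"
 have evl: "lookup (ev \<phi>) j = (if j < r p then \<phi> (z j) else 0)" for \<phi> j
  by(simp add: ev_def lookup_sum lookup_single when_def mult_delta_right)
 have evF: "Poly_Mapping.keys (ev \<phi>) <= {..<r p}" for \<phi> by(auto simp: in_keys_iff evl split: if_splits)
 have ev_hom: "ev : hom ?Z ?F"
  by(rule homI) (auto simp: evF Zm Cm poly_mapping_eq_iff fun_eq_iff lookup_add evl zch)
 have "n : ev ` carrier ?Z" if n: "Poly_Mapping.keys n <= {..<r p}" for n
 proof -
  \<comment> \<open>The functional \<open>n\<close> on homology, pulled back to all chains by way of
    \<open>\<rho>\<close>.\<close>
  define \<phi> where "\<phi> = (\<lambda>x\<in>{x. chain p X x}. \<Sum>j<r p. lookup n j * lookup (c (\<rho> x)) j)"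
  have "\<phi> : carrier (?C p)"
   unfolding Cc by(auto simp: \<phi>_def singular_chain_add \<rho>(1) c(1)[OF \<rho>(2) \<rho>(2)] lookup_add distrib_left sum.distrib)
  moreover have "\<phi> (chain_boundary (Suc p) x) = 0" if x: "chain (Suc p) X x" for x
  proof -
   have "bdry p X (chain_boundary (Suc p) x)" using x by(auto simp: singular_boundary)
   then have "c (\<rho> (chain_boundary (Suc p) x)) = 0"
    using c(2) \<rho>(3) singular_relboundary_imp_relcycle by metis
   then show ?thesis using bch[OF x] by(simp add: \<phi>_def)
  qed
  ultimately have "\<phi> : carrier ?Z" unfolding Zc by(auto simp: Cm coboundary_def)
  moreover have "ev \<phi> = n"
  proof (rule poly_mapping_eqI)
   fix j
   have "lookup n j = 0" if "~ j < r p" using n that by(auto simp: in_keys_iff subset_iff)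
   then show "lookup (ev \<phi>) j = lookup n j"
    using z zch by(auto simp: evl \<phi>_def \<rho>(3) lookup_single when_def mult_delta_right)
  qed
  ultimately show ?thesis by blast
 qed
 then have surj: "ev ` carrier ?Z = carrier ?F" using evF by auto
 \<comment> \<open>A cycle differs from a combination of the \<open>z j\<close> by a boundary; a
   cocycle kills the boundary and \<open>ev \<phi> = 0\<close> kills the rest.\<close>
 have zero_on_cycles: "\<phi> x = 0" if \<phi>: "\<phi> : ?K" "ev \<phi> = 0" and x: "cycle p X x" for \<phi> x
 proof -
  have \<phi>c: "\<phi> : carrier (?C p)" using \<phi> by blast
  have zc: "chain p X (frag_extend z y)" for y using cycle_frag_extend[of p X z, OF z(1)] by(simp add: singular_cycle)
  have w: "\<phi> (frag_extend z y) = 0" for y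
  proof (rule free_Abelian_group_induct[of y UNIV])
   show "\<phi> (frag_extend z (frag_of j)) = 0" for j using evl[of \<phi> j] \<phi>(2) z(3)[of j] C0[OF \<phi>c] by(cases "j < r p") auto
  qed (simp_all add: frag_extend_diff Cd[OF \<phi>c] C0[OF \<phi>c] zc)
  obtain d where "chain (Suc p) X d" "chain_boundary (Suc p) d = x - frag_extend z (c x)"
   using hom[OF x] by(auto simp: singular_boundary)
  then have "\<phi> (x - frag_extend z (c x)) = 0" using Kz[OF \<phi>(1)] by metis
  then show ?thesis using Cd[OF \<phi>c _ zc] x w by(simp add: singular_cycle)
 qed
 have ker: "kernel ?Z ?F ev = coboundary_set p X"
 proof (cases p)
  case 0
  have "\<phi> = \<one>\<^bsub>?C p\<^esub>" if "\<phi> : ?K" "ev \<phi> = 0" for \<phi>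
  proof (rule extensionalityI[of _ "{x. chain p X x}"])
   show "\<phi> x = \<one>\<^bsub>?C p\<^esub> x" if "x : {x. chain p X x}" for x
    using that zero_on_cycles[OF \<open>\<phi> : ?K\<close> \<open>ev \<phi> = 0\<close>] 0 by(simp add: singular_cycle chain_boundary_def Cm)
   show "\<phi> : extensional {x. chain p X x}" using that(1) Cc by blast
  qed (simp add: Cm)
  moreover have "ev \<one>\<^bsub>?C p\<^esub> = 0" using zch by(simp add: ev_def Cm)
  ultimately have "kernel ?Z ?F ev = {\<one>\<^bsub>?C p\<^esub>}" unfolding kernel_def Zc by auto
  then show ?thesis by(simp add: coboundary_set_def 0)
 next
  case (Suc k)
  obtain s where s: "!!x y. s (x + y) = s x + s y" "!!x. chain k X x ==> chain (Suc k) X (s x)"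
   "!!x. bdry k X x ==> chain_boundary (Suc k) (s x) = x"
   using cycle_splitting[OF fr] by metis
  have "\<phi> : coboundary k X ` carrier (?C k)" if \<phi>: "\<phi> : ?K" "ev \<phi> = 0" for \<phi>
  proof
   have \<phi>c: "\<phi> : carrier (?C (Suc k))" using \<phi> Suc by blast
   \<comment> \<open>Every chain differs from \<open>s\<close> of its boundary by a cycle, on which
     \<open>\<phi>\<close> vanishes, so the coboundary of this \<open>\<psi>\<close> is
     \<open>\<phi>\<close>.\<close>
   define \<psi> where "\<psi> = (\<lambda>x\<in>{x. chain k X x}. \<phi> (s x))"
   show "\<psi> : carrier (?C k)" using \<phi>c s(2) unfolding Cc \<psi>_def by(auto simp: s(1) singular_chain_add)
   show "\<phi> = coboundary k X \<psi>"
   proof (rule extensionalityI[of _ "{x. chain (Suc k) X x}"])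
    show "\<phi> : extensional {x. chain (Suc k) X x}" using \<phi>c Cc by blast
    fix x assume "x : {x. chain (Suc k) X x}"
    then have x: "chain (Suc k) X x" by simp
    let ?y = "s (chain_boundary (Suc k) x)"
    have y: "chain (Suc k) X ?y" using s(2) bch[OF x] .
    have "chain_boundary (Suc k) ?y = chain_boundary (Suc k) x" using x by(intro s) (auto simp: singular_boundary)
    then have "\<phi> (x - ?y) = 0"
     using zero_on_cycles[OF \<phi>, of "x - ?y"] x y Suc by(simp add: singular_cycle singular_chain_diff chain_boundary_diff)
    then show "\<phi> x = coboundary k X \<psi> x" using Cd[OF \<phi>c x y] x bch[OF x] by(simp add: coboundary_def \<psi>_def)
   qed (simp add: coboundary_def)
  qed
  moreover have "coboundary k X \<psi> : ?K & ev (coboundary k X \<psi>) = 0" if \<psi>: "\<psi> : carrier (?C k)" for \<psi>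
  proof
   have "coboundary (Suc k) X (coboundary k X \<psi>) = \<one>\<^bsub>?C (Suc (Suc k))\<^esub>"
    using chain_boundary_boundary_alt[of "Suc k" X] bch
    by(auto simp: coboundary_def Cm C0[OF \<psi>])
   then show "coboundary k X \<psi> : ?K" using hom_in_carrier[OF dh \<psi>] by(simp add: Suc)
   show "ev (coboundary k X \<psi>) = 0"
    using z(1) C0[OF \<psi>] by(auto simp: ev_def coboundary_def Suc singular_cycle)
  qed
  ultimately show ?thesis unfolding kernel_def Zc by(auto simp: coboundary_set_def Suc)
 qed
 interpret gh: group_hom ?Z ?F ev
  using ev_hom Zcomm by(intro group_hom.intro group_hom_axioms.intro) (auto simp: comm_group_def)
 have "(%A. the_elem (ev ` A)) : iso (cohomology_group p X) ?F"
  unfolding cohomology_group_def ker[symmetric] by(rule gh.FactGroup_iso_set[OF surj])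
 moreover have "comm_group (cohomology_group p X)"
  unfolding cohomology_group_def ker[symmetric]
  by(rule comm_group.abelian_FactGroup[OF Zcomm]) (rule gh.subgroup_kernel)
 ultimately show ?thesis
  by(intro abelian_rank_free) (auto simp: free_rank_def comm_group_def)
qed

section \<open>Spaces with free homology in even degrees\<close>

text \<open>\<open>b\<close> is indexed by half the degree, while homology groups are indexed by
  \<open>int\<close> and vanish in negative degrees.\<close>

definition evrank :: "(nat => nat) => int => nat" where
 "evrank b p = (if p >= 0 & even p then b (nat (p div 2)) else 0)"

definition even_free :: "'a topology => (nat => nat) => bool" where
 "even_free X b \<longleftrightarrow> (ALL p. free_rank (homol p X) (evrank b p))"

text \<open>A relative form of \<open>even_free\<close>. The kernel over \<open>X\<close> is what
  can be carried from a neighbourhood of a centre to the whole space; the homology of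
  \<open>X'\<close> itself changes in between.\<close>

definition even_kernel :: "'a topology => 'b topology => ('a => 'b) => (nat => nat) => bool" where
 "even_kernel X' X f k \<longleftrightarrow> cmap X' X f &
   (ALL p. hom_induced p X' {} X {} f ` carrier (homol p X') = carrier (homol p X) &
     free_rank (subgroup_generated (homol p X')
       (kernel (homol p X') (homol p X) (hom_induced p X' {} X {} f))) (evrank k p))"

lemma evrank_odd [simp]: "odd p ==> evrank b p = 0"
 by(simp add: evrank_def)

lemma evrank_add: "evrank (%i. b i + c i) p = evrank b p + evrank c p"
 by(simp add: evrank_def)

lemma homology_exact_1:
 assumes "x : carrier (homol p X)"
 shows "hom_induced p X {} X S id x = \<one>\<^bsub>rel_homol p X S\<^esub> \<longleftrightarrow>
  x : hom_induced p (subtop X S) {} X {} id ` carrier (homol p (subtop X S))"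
 using assms homology_exactness_axiom_3[of p X S] by(auto simp: kernel_def)

lemma homology_exact_2:
 assumes "x : carrier (rel_homol p X S)"
 shows "hom_boundary p X S x = \<one>\<^bsub>homol (p - 1) (subtop X S)\<^esub> \<longleftrightarrow>
  x : hom_induced p X {} X S id ` carrier (homol p X)"
 using assms homology_exactness_axiom_1[of p X S] by(auto simp: kernel_def)

lemma homology_exact_3:
 assumes "x : carrier (homol p (subtop X S))"
 shows "hom_induced p (subtop X S) {} X {} id x = \<one>\<^bsub>homol p X\<^esub> \<longleftrightarrow>
  x : hom_boundary (p + 1) X S ` carrier (rel_homol (p + 1) X S)"
proof -
 have "kernel (homol p (subtop X S)) (homol p X) (hom_induced p (subtop X S) {} X {} id)
   = hom_boundary (p + 1) X S ` carrier (rel_homol (p + 1) X S)"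
  using homology_exactness_axiom_2[of "p + 1" X S] by auto
 then show ?thesis using assms by(auto simp: kernel_def)
qed

lemma group_hom_induced: "group_hom (rel_homol p X S) (rel_homol p Y T) (hom_induced p X S Y T f)"
 by(intro group_hom.intro group_hom_axioms.intro) (auto simp: hom_induced_hom)

lemma group_hom_boundary: "group_hom (rel_homol p X S) (homol (p - 1) (subtop X S)) (hom_boundary p X S)"
 by(intro group_hom.intro group_hom_axioms.intro) (auto simp: hom_boundary_hom)

lemma even_free_extend:
 assumes X: "even_free X b" and k: "even_kernel X' X f k"
 shows "even_free X' (%i. k i + b i)"
 unfolding even_free_def evrank_add
proof
 fix p
 let ?H = "homol p X'" and ?h = "hom_induced p X' {} X {} f"
 let ?K = "kernel ?H (homol p X) ?h"
 interpret group_hom ?H "homol p X" ?h by(rule group_hom_induced)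
 have c: "carrier (subgroup_generated ?H ?K) = ?K"
  using subgroup.carrier_subgroup_generated_subgroup[OF subgroup_kernel] .
 show "free_rank ?H (evrank k p + evrank b p)"
 proof (rule free_rank_ext[where A = "subgroup_generated ?H ?K" and C = "homol p X" and f = "%x. x" and h = ?h])
  show "(%x. x) : hom (subgroup_generated ?H ?K) ?H"
   unfolding hom_def c by(auto simp: kernel_def subgroup_generated_def)
  show "?h x = \<one>\<^bsub>homol p X\<^esub> \<longleftrightarrow> x : (%x. x) ` carrier (subgroup_generated ?H ?K)"
   if "x : carrier ?H" for x
   unfolding c using that by(simp add: kernel_def del: one_relative_homology_group)
 qed (use X k in \<open>auto simp: even_free_def even_kernel_def abelian_homology_group hom_induced_hom\<close>)
qed

text \<open>The long exact sequences of the two pairs agree on the relative terms, so the kernel of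
  \<open>X'\<close> over \<open>X\<close> should be that of \<open>U'\<close> over \<open>U\<close>.
  The connecting maps are the only obstruction; odd vanishing of \<open>homol p X\<close> and of the
  kernels over \<open>U\<close> disposes of them, each in one parity.\<close>

lemma even_kernel_ladder:
 assumes f: "cmap X' X f" "f : U' \<rightarrow> U"
  and rel: "!!p. hom_induced p X' U' X U f : iso (rel_homol p X' U') (rel_homol p X U)"
  and k: "even_kernel (subtop X' U') (subtop X U) f k"
  and odd: "!!p. odd p ==> trivial_group (homol p X)"
 shows "even_kernel X' X f k"
proof -
 let ?HX = "%p. homol p X" and ?HX' = "%p. homol p X'"
 let ?HU = "%p. homol p (subtop X U)" and ?HU' = "%p. homol p (subtop X' U')"
 let ?R = "%p. rel_homol p X U" and ?R' = "%p. rel_homol p X' U'"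
 let ?i = "%p. hom_induced p (subtop X U) {} X {} id" and ?i' = "%p. hom_induced p (subtop X' U') {} X' {} id"
 let ?j = "%p. hom_induced p X {} X U id" and ?j' = "%p. hom_induced p X' {} X' U' id"
 let ?d = "%p. hom_boundary p X U" and ?d' = "%p. hom_boundary p X' U'"
 let ?fX = "%p. hom_induced p X' {} X {} f" and ?fU = "%p. hom_induced p (subtop X' U') {} (subtop X U) {} f"
 let ?fR = "%p. hom_induced p X' U' X U f"
 have fU: "cmap (subtop X' U') (subtop X U) f"
  using k by(simp add: even_kernel_def)
 have nat1: "?fX p (?i' p u) = ?i p (?fU p u)" for p u
  using hom_induced_compose_empty[OF _ f(1), of "subtop X' U'" id p]
     hom_induced_compose_empty[OF fU, of X id p] by(simp add: fun_eq_iff)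
 have nat2: "?fR p (?j' p x) = ?j p (?fX p x)" for p x
  using hom_induced_compose[of X' X' id "{}" U' X f U p] hom_induced_compose[of X' X f "{}" "{}" X id U p] f
  by(simp add: fun_eq_iff)
 have nat3: "?fU (p - 1) (?d' p r) = ?d p (?fR p r)" for p r
  using fun_cong[OF naturality_hom_induced[OF f, of p], of r] by simp
 have nat3': "?fU p (?d' (p + 1) r) = ?d (p + 1) (?fR (p + 1) r)" for p r
  using nat3[of "p + 1"] by simp
 have surjU: "?fU p ` carrier (?HU' p) = carrier (?HU p)" for p using k by(simp add: even_kernel_def)
 have kerU: "free_rank (subgroup_generated (?HU' p) (kernel (?HU' p) (?HU p) (?fU p))) (evrank k p)" for p
  using k by(simp add: even_kernel_def)
 have kerU_odd: "u = \<one>\<^bsub>?HU' p\<^esub>" if "odd p" "u : carrier (?HU' p)" "?fU p u = \<one>\<^bsub>?HU p\<^esub>" for p u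
 proof -
  interpret group_hom "?HU' p" "?HU p" "?fU p" by(rule group_hom_induced)
  have "trivial_group (subgroup_generated (?HU' p) (kernel (?HU' p) (?HU p) (?fU p)))"
   using kerU[of p] that(1) by(simp add: free_rank_0)
  then have "kernel (?HU' p) (?HU p) (?fU p) = {\<one>\<^bsub>?HU' p\<^esub>}"
   using subgroup.carrier_subgroup_generated_subgroup[OF subgroup_kernel] by(auto simp: trivial_group_def)
  then show ?thesis using that(2,3) by(auto simp: kernel_def)
 qed
 have fRi: "inj_on (?fR p) (carrier (?R' p))" and fRs: "?fR p ` carrier (?R' p) = carrier (?R p)" for p
  using rel[of p] by(auto simp: iso_def bij_betw_def)
 have fR1: "r = \<one>\<^bsub>?R' p\<^esub>" if "r : carrier (?R' p)" "?fR p r = \<one>\<^bsub>?R p\<^esub>" for p r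
 proof -
  interpret group_hom "?R' p" "?R p" "?fR p" by(rule group_hom_induced)
  show ?thesis using inj_onD[OF fRi _ that(1) G.one_closed] that(2) by simp
 qed
 have Xodd: "x = \<one>\<^bsub>?HX p\<^esub>" if "odd p" "x : carrier (?HX p)" for p x
  using odd[OF that(1)] that(2) by(auto simp: trivial_group_def)
 have surj: "x : ?fX p ` carrier (?HX' p)" if x: "x : carrier (?HX p)" for p x
 proof (cases "odd p")
  case True
  interpret group_hom "?HX' p" "?HX p" "?fX p" by(rule group_hom_induced)
  show ?thesis using Xodd[OF True x] hom_one by(metis G.one_closed imageI)
 next
  case False
  interpret fX: group_hom "?HX' p" "?HX p" "?fX p" by(rule group_hom_induced)
  interpret j: group_hom "?HX p" "?R p" "?j p" by(rule group_hom_induced)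
  have "?j p x : carrier (?R p)" using x by simp
  then obtain r where r: "r : carrier (?R' p)" "?fR p r = ?j p x" using fRs[of p] by(metis imageE)
  have "?d p (?j p x) = \<one>\<^bsub>?HU (p - 1)\<^esub>"
   using homology_exact_2[of "?j p x" p X U] x by(auto simp: hom_induced_carrier)
  then have "?fU (p - 1) (?d' p r) = \<one>\<^bsub>?HU (p - 1)\<^esub>" using nat3[of p r] r by simp
  \<comment> \<open>\<open>p - 1\<close> is odd, so a class of \<open>U'\<close> that dies in
    \<open>U\<close> is already trivial; hence \<open>r\<close> comes from
    \<open>X'\<close>.\<close>
  then have "?d' p r = \<one>\<^bsub>?HU' (p - 1)\<^esub>" using kerU_odd[of "p - 1"] False by(simp add: hom_boundary_carrier)
  then obtain x' where x': "x' : carrier (?HX' p)" "r = ?j' p x'"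
   using homology_exact_2[OF r(1)] by auto
  \<comment> \<open>The lift \<open>x'\<close> may miss \<open>x\<close> by a class coming from
    \<open>U\<close>, and such classes lift because \<open>U'\<close> maps onto \<open>U\<close> in
    homology.\<close>
  let ?y = "x \<otimes>\<^bsub>?HX p\<^esub> inv\<^bsub>?HX p\<^esub> (?fX p x')"
  have y: "?y : carrier (?HX p)" using x x' by simp
  have "?j p (?fX p x') = ?j p x" using nat2[of p x'] r x' by simp
  then have "?j p ?y = \<one>\<^bsub>?R p\<^esub>" using x x' by simp
  then obtain u where u: "u : carrier (?HU p)" "?y = ?i p u" using homology_exact_1[OF y] by auto
  then obtain u' where u': "u' : carrier (?HU' p)" "u = ?fU p u'" using surjU[of p] by(metis imageE)
  have "x = ?y \<otimes>\<^bsub>?HX p\<^esub> ?fX p x'" using x x' by(simp add: fX.H.m_assoc)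
  also have "... = ?fX p (?i' p u') \<otimes>\<^bsub>?HX p\<^esub> ?fX p x'" using u u' nat1 by metis
  also have "... = ?fX p (?i' p u' \<otimes>\<^bsub>?HX' p\<^esub> x')" using x' by(simp add: hom_induced_carrier)
  finally show ?thesis using x' by(metis fX.G.m_closed hom_induced_carrier imageI)
 qed
 have ker: "free_rank (subgroup_generated (?HX' p) (kernel (?HX' p) (?HX p) (?fX p))) (evrank k p)" for p
 proof (rule free_rank_iso[OF kerU])
  interpret fX: group_hom "?HX' p" "?HX p" "?fX p" by(rule group_hom_induced)
  interpret fU: group_hom "?HU' p" "?HU p" "?fU p" by(rule group_hom_induced)
  interpret i': group_hom "?HU' p" "?HX' p" "?i' p" by(rule group_hom_induced)
  interpret i: group_hom "?HU p" "?HX p" "?i p" by(rule group_hom_induced)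
  interpret d': group_hom "?R' (p + 1)" "?HU' p" "?d' (p + 1)" using group_hom_boundary[of "p + 1" X' U'] by simp
  let ?KX = "kernel (?HX' p) (?HX p) (?fX p)" and ?KU = "kernel (?HU' p) (?HU p) (?fU p)"
  have cX: "carrier (subgroup_generated (?HX' p) ?KX) = ?KX"
   using subgroup.carrier_subgroup_generated_subgroup[OF fX.subgroup_kernel] .
  have cU: "carrier (subgroup_generated (?HU' p) ?KU) = ?KU"
   using subgroup.carrier_subgroup_generated_subgroup[OF fU.subgroup_kernel] .
  have into: "?i' p ` ?KU <= ?KX" using nat1 by(auto simp: kernel_def)
  have h: "?i' p : hom (subgroup_generated (?HU' p) ?KU) (subgroup_generated (?HX' p) ?KX)"
   unfolding hom_def cX cU using into by(auto simp: subgroup_generated_def kernel_def)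
  have triv: "u = \<one>\<^bsub>?HU' p\<^esub>" if u: "u : ?KU" "?i' p u = \<one>\<^bsub>?HX' p\<^esub>" for u
  proof (cases "odd p")
   case True
   then show ?thesis using kerU_odd u by(auto simp: kernel_def)
  next
   case False
   have uc: "u : carrier (?HU' p)" "?fU p u = \<one>\<^bsub>?HU p\<^esub>" using u by(auto simp: kernel_def)
   obtain r where r: "r : carrier (?R' (p + 1))" "u = ?d' (p + 1) r"
    using homology_exact_3[OF uc(1)] u(2) by auto
   have "?d (p + 1) (?fR (p + 1) r) = \<one>\<^bsub>?HU p\<^esub>" using nat3'[of p r] r uc by simp
   then obtain x where x: "x : carrier (?HX (p + 1))" "?fR (p + 1) r = ?j (p + 1) x"
    using homology_exact_2[of "?fR (p + 1) r" "p + 1" X U] by(auto simp: hom_induced_carrier)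
   interpret j: group_hom "?HX (p + 1)" "?R (p + 1)" "?j (p + 1)" by(rule group_hom_induced)
   \<comment> \<open>\<open>p + 1\<close> is odd, so \<open>x\<close> lies in a trivial group and
     the relative class \<open>r\<close> vanishes with it.\<close>
   have "x = \<one>\<^bsub>?HX (p + 1)\<^esub>" using Xodd[of "p + 1"] False x by simp
   then have "?fR (p + 1) r = \<one>\<^bsub>?R (p + 1)\<^esub>" using x by simp
   then have "r = \<one>\<^bsub>?R' (p + 1)\<^esub>" using fR1 r by blast
   then show ?thesis using r by simp
  qed
  have inj: "inj_on (?i' p) ?KU"
  proof (rule inj_onI)
   fix u v assume uv: "u : ?KU" "v : ?KU" "?i' p u = ?i' p v"
   then have c: "u : carrier (?HU' p)" "v : carrier (?HU' p)" by(auto simp: kernel_def)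
   have "u \<otimes>\<^bsub>?HU' p\<^esub> inv\<^bsub>?HU' p\<^esub> v : ?KU" using uv by(auto simp: kernel_def)
   moreover have "?i' p (u \<otimes>\<^bsub>?HU' p\<^esub> inv\<^bsub>?HU' p\<^esub> v) = \<one>\<^bsub>?HX' p\<^esub>" using uv c by simp
   ultimately have "u \<otimes>\<^bsub>?HU' p\<^esub> inv\<^bsub>?HU' p\<^esub> v = \<one>\<^bsub>?HU' p\<^esub>" by(rule triv)
   then show "u = v" using c by(metis fU.G.inv_equality fU.G.inv_inv fU.G.inv_closed)
  qed
  have sur: "?KX <= ?i' p ` ?KU"
  proof
   fix x assume "x : ?KX"
   then have x: "x : carrier (?HX' p)" "?fX p x = \<one>\<^bsub>?HX p\<^esub>" by(auto simp: kernel_def)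
   interpret j: group_hom "?HX p" "?R p" "?j p" by(rule group_hom_induced)
   have "?fR p (?j' p x) = \<one>\<^bsub>?R p\<^esub>" using nat2[of p x] x by simp
   then have "?j' p x = \<one>\<^bsub>?R' p\<^esub>" using fR1 hom_induced_carrier by blast
   then obtain u where u: "u : carrier (?HU' p)" "x = ?i' p u" using homology_exact_1[OF x(1)] by auto
   have "?i p (?fU p u) = \<one>\<^bsub>?HX p\<^esub>" using nat1[of p u] u x by simp
   then obtain r where r: "r : carrier (?R (p + 1))" "?fU p u = ?d (p + 1) r"
    using homology_exact_3[of "?fU p u" p X U] by(auto simp: hom_induced_carrier)
   then obtain r' where r': "r' : carrier (?R' (p + 1))" "r = ?fR (p + 1) r'" using fRs[of "p + 1"] by(metis imageE)
   \<comment> \<open>Removing the boundary of \<open>r'\<close> leaves the image in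
     \<open>X'\<close> unchanged and makes the class vanish in \<open>U\<close>.\<close>
   let ?v = "u \<otimes>\<^bsub>?HU' p\<^esub> inv\<^bsub>?HU' p\<^esub> (?d' (p + 1) r')"
   have dc: "?d' (p + 1) r' : carrier (?HU' p)" using r' by simp
   have "?fU p (?d' (p + 1) r') = ?fU p u" using nat3'[of p r'] r r' by simp
   then have "?v : ?KU" using u dc by(auto simp: kernel_def)
   moreover have "?i' p (?d' (p + 1) r') = \<one>\<^bsub>?HX' p\<^esub>"
    using homology_exact_3[OF dc] r' by auto
   then have "?i' p ?v = x" using u dc by simp
   ultimately show "x : ?i' p ` ?KU" by blast
  qed
  show "?i' p : iso (subgroup_generated (?HU' p) ?KU) (subgroup_generated (?HX' p) ?KX)"
   unfolding iso_def bij_betw_def cX cU using h inj subset_antisym[OF into sur] by blast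
  show "group (subgroup_generated (?HX' p) ?KX)" by(simp add: fX.G.group_subgroup_generated)
 qed
 have "?fX p ` carrier (?HX' p) = carrier (?HX p)" for p
  using surj by(auto simp: hom_induced_carrier)
 with ker f(1) show ?thesis by(simp add: even_kernel_def)
qed

lemma subgroup_generated_kernel_carrier:
 "carrier (subgroup_generated (rel_homol p X S) (kernel (rel_homol p X S) (rel_homol p Y T) (hom_induced p X S Y T f)))
  = kernel (rel_homol p X S) (rel_homol p Y T) (hom_induced p X S Y T f)"
 by(rule subgroup.carrier_subgroup_generated_subgroup[OF group_hom.subgroup_kernel[OF group_hom_induced]])

lemma even_free_iso:
 assumes "even_free X b" "!!p. homol p X \<cong> homol p Y"
 shows "even_free Y b"
 using assms unfolding even_free_def by(meson free_rank_is_iso group_relative_homology_group)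

lemma even_kernel_precompose:
 assumes k: "even_kernel X' X f k" and g: "cmap Y X' h"
  and iso: "!!p. hom_induced p Y {} X' {} h : iso (homol p Y) (homol p X')"
  and f': "!!y. y : topspace Y ==> f' y = f (h y)"
 shows "even_kernel Y X f' k"
proof -
 have cf: "cmap X' X f" using k by(simp add: even_kernel_def)
 have "cmap Y X (f \<circ> h)" using g cf by(rule continuous_map_compose)
 then have cf': "cmap Y X f'" by(rule continuous_map_eq) (simp add: f')
 have comp: "hom_induced p Y {} X {} f' y = hom_induced p X' {} X {} f (hom_induced p Y {} X' {} h y)" for p y
 proof -
  have "hom_induced p Y {} X {} f' = hom_induced p Y {} X {} (f \<circ> h)"
   by(rule hom_induced_eq) (simp add: f')
  then show ?thesis using hom_induced_compose_empty[OF g cf, of p] by simp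
 qed
 have "hom_induced p Y {} X {} f' ` carrier (homol p Y) = carrier (homol p X)
  & free_rank (subgroup_generated (homol p Y) (kernel (homol p Y) (homol p X) (hom_induced p Y {} X {} f'))) (evrank k p)" for p
 proof
  let ?g = "hom_induced p Y {} X' {} h"
  have gs: "?g ` carrier (homol p Y) = carrier (homol p X')" and gi: "inj_on ?g (carrier (homol p Y))"
   using iso[of p] by(auto simp: iso_def bij_betw_def)
  have fs: "hom_induced p X' {} X {} f ` carrier (homol p X') = carrier (homol p X)"
   using k by(simp add: even_kernel_def)
  show "hom_induced p Y {} X {} f' ` carrier (homol p Y) = carrier (homol p X)"
   unfolding comp fs[symmetric] gs[symmetric] by(simp add: image_image)
  let ?KY = "kernel (homol p Y) (homol p X) (hom_induced p Y {} X {} f')"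
  let ?KX = "kernel (homol p X') (homol p X) (hom_induced p X' {} X {} f)"
  have im: "?g ` ?KY = ?KX"
  proof -
   have "x : ?g ` ?KY" if "x : ?KX" for x
   proof -
    have "x : carrier (homol p X')" using that by(simp add: kernel_def)
    then obtain y where "y : carrier (homol p Y)" "x = ?g y" using gs by(metis imageE)
    then show ?thesis using that by(auto simp: kernel_def comp)
   qed
   moreover have "?g y : ?KX" if "y : ?KY" for y
    using that by(simp add: kernel_def comp hom_induced_carrier del: one_relative_homology_group)
   ultimately show ?thesis by blast
  qed
  have "?g : iso (subgroup_generated (homol p Y) ?KY) (subgroup_generated (homol p X') ?KX)"
  proof -
   have "?g : hom (subgroup_generated (homol p Y) ?KY) (subgroup_generated (homol p X') ?KX)"
    unfolding hom_def subgroup_generated_kernel_carrier using im hom_mult[OF hom_induced_hom, of _ p Y "{}" _ X' "{}" h]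
    by(auto simp: subgroup_generated_def kernel_def)
   moreover have "inj_on ?g ?KY" using gi by(rule inj_on_subset) (auto simp: kernel_def)
   ultimately show ?thesis unfolding iso_def bij_betw_def subgroup_generated_kernel_carrier using im by blast
  qed
  moreover have "free_rank (subgroup_generated (homol p X') ?KX) (evrank k p)"
   using k by(simp add: even_kernel_def)
  ultimately show "free_rank (subgroup_generated (homol p Y) ?KY) (evrank k p)"
   using free_rank_iso[OF _ group.iso_set_sym[OF group.group_subgroup_generated[OF group_relative_homology_group]]
     group.group_subgroup_generated[OF group_relative_homology_group]] by blast
 qed
 with cf' show ?thesis by(simp add: even_kernel_def)
qed

lemma even_kernel_postcompose:
 assumes k: "even_kernel X' X f k" and g: "cmap X Y h"
  and iso: "!!p. hom_induced p X {} Y {} h : iso (homol p X) (homol p Y)"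
  and f': "!!x. x : topspace X' ==> f' x = h (f x)"
 shows "even_kernel X' Y f' k"
proof -
 have cf: "cmap X' X f" using k by(simp add: even_kernel_def)
 have "cmap X' Y (h \<circ> f)" using cf g by(rule continuous_map_compose)
 then have cf': "cmap X' Y f'" by(rule continuous_map_eq) (simp add: f')
 have comp: "hom_induced p X' {} Y {} f' y = hom_induced p X {} Y {} h (hom_induced p X' {} X {} f y)" for p y
 proof -
  have "hom_induced p X' {} Y {} f' = hom_induced p X' {} Y {} (h \<circ> f)"
   by(rule hom_induced_eq) (simp add: f')
  then show ?thesis using hom_induced_compose_empty[OF cf g, of p] by simp
 qed
 have "hom_induced p X' {} Y {} f' ` carrier (homol p X') = carrier (homol p Y)
  & free_rank (subgroup_generated (homol p X') (kernel (homol p X') (homol p Y) (hom_induced p X' {} Y {} f'))) (evrank k p)" for p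
 proof
  let ?g = "hom_induced p X {} Y {} h"
  interpret g: group_hom "homol p X" "homol p Y" ?g by(rule group_hom_induced)
  have gs: "?g ` carrier (homol p X) = carrier (homol p Y)" and gi: "inj_on ?g (carrier (homol p X))"
   using iso[of p] by(auto simp: iso_def bij_betw_def)
  have fs: "hom_induced p X' {} X {} f ` carrier (homol p X') = carrier (homol p X)"
   using k by(simp add: even_kernel_def)
  show "hom_induced p X' {} Y {} f' ` carrier (homol p X') = carrier (homol p Y)"
   unfolding comp gs[symmetric] fs[symmetric] by(simp add: image_image)
  have "?g x = \<one>\<^bsub>homol p Y\<^esub> \<longleftrightarrow> x = \<one>\<^bsub>homol p X\<^esub>" if "x : carrier (homol p X)" for x
   using inj_onD[OF gi _ that g.G.one_closed] g.hom_one by metis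
  then have "kernel (homol p X') (homol p Y) (hom_induced p X' {} Y {} f') = kernel (homol p X') (homol p X) (hom_induced p X' {} X {} f)"
   unfolding kernel_def comp by(simp add: hom_induced_carrier del: one_relative_homology_group)
  then show "free_rank (subgroup_generated (homol p X') (kernel (homol p X') (homol p Y) (hom_induced p X' {} Y {} f'))) (evrank k p)"
   using k by(simp add: even_kernel_def)
 qed
 with cf' show ?thesis by(simp add: even_kernel_def)
qed

lemma even_kernel_homeomorphic:
 assumes "homeomorphic_map X Y f"
 shows "even_kernel X Y f (%_. 0)"
proof -
 have "hom_induced p X {} Y {} f ` carrier (homol p X) = carrier (homol p Y)
  & free_rank (subgroup_generated (homol p X) (kernel (homol p X) (homol p Y) (hom_induced p X {} Y {} f))) 0" for p
 proof -
  let ?f = "hom_induced p X {} Y {} f"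
  interpret f: group_hom "homol p X" "homol p Y" ?f by(rule group_hom_induced)
  have "?f : iso (homol p X) (homol p Y)" using assms by(rule homeomorphic_map_homology_iso)
  then have s: "?f ` carrier (homol p X) = carrier (homol p Y)" and i: "inj_on ?f (carrier (homol p X))"
   by(auto simp: iso_def bij_betw_def)
  have "kernel (homol p X) (homol p Y) ?f = {\<one>\<^bsub>homol p X\<^esub>}"
   using i f.inj_iff_trivial_ker by blast
  then have "trivial_group (subgroup_generated (homol p X) (kernel (homol p X) (homol p Y) ?f))"
   unfolding trivial_group_def subgroup_generated_kernel_carrier
   by(simp add: f.G.group_subgroup_generated del: one_relative_homology_group)
  then show ?thesis using s by(simp add: free_rank_0)
 qed
 then show ?thesis using assms homeomorphic_imp_continuous_map by(auto simp: even_kernel_def evrank_def)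
qed

text \<open>With the homology of \<open>subtop X S\<close> and the relative groups both even, every
  connecting map vanishes and the long exact sequence breaks into short ones, which restrict to the
  kernels over \<open>Z\<close>.\<close>

lemma even_kernel_adjoin:
 assumes f: "cmap X Z f" and k: "even_kernel (subtop X S) Z f k"
  and b: "even_free Z b" and m: "!!p. free_rank (rel_homol p X S) (evrank m p)"
 shows "even_kernel X Z f (%i. k i + m i)"
proof -
 let ?X = "%p. homol p X" and ?S = "%p. homol p (subtop X S)"
 let ?R = "%p. rel_homol p X S" and ?Z = "%p. homol p Z"
 let ?i = "%p. hom_induced p (subtop X S) {} X {} id" and ?j = "%p. hom_induced p X {} X S id"
 let ?d = "%p. hom_boundary p X S"
 let ?fX = "%p. hom_induced p X {} Z {} f" and ?fS = "%p. hom_induced p (subtop X S) {} Z {} f"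
 have nat: "?fX p (?i p u) = ?fS p u" for p u
  using hom_induced_compose_empty[OF _ f(1), of "subtop X S" id p] by(simp add: fun_eq_iff)
 have Sfree: "even_free (subtop X S) (%i. k i + b i)" by(rule even_free_extend[OF b k])
 have Sodd: "trivial_group (?S p)" if "odd p" for p
  using Sfree that by(simp add: even_free_def flip: free_rank_0) (metis evrank_odd)
 have Rodd: "trivial_group (?R p)" if "odd p" for p
  using m[of p] that by(simp flip: free_rank_0)
 have surjS: "?fS p ` carrier (?S p) = carrier (?Z p)" for p using k by(simp add: even_kernel_def)
 have surj: "?fX p ` carrier (?X p) = carrier (?Z p)" for p
 proof
  show "carrier (?Z p) <= ?fX p ` carrier (?X p)"
   unfolding surjS[symmetric] by(auto simp flip: nat simp: hom_induced_carrier)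
 qed (auto simp: hom_induced_carrier)
 have ker: "free_rank (subgroup_generated (?X p) (kernel (?X p) (?Z p) (?fX p))) (evrank (%i. k i + m i) p)" for p
  unfolding evrank_add
 proof -
  interpret fX: group_hom "?X p" "?Z p" "?fX p" by(rule group_hom_induced)
  interpret fS: group_hom "?S p" "?Z p" "?fS p" by(rule group_hom_induced)
  interpret i: group_hom "?S p" "?X p" "?i p" by(rule group_hom_induced)
  interpret j: group_hom "?X p" "?R p" "?j p" by(rule group_hom_induced)
  let ?KX = "kernel (?X p) (?Z p) (?fX p)" and ?KS = "kernel (?S p) (?Z p) (?fS p)"
  note cX = subgroup_generated_kernel_carrier[of p X "{}" Z "{}" f]
   and cS = subgroup_generated_kernel_carrier[of p "subtop X S" "{}" Z "{}" f]
  have inj: "u = \<one>\<^bsub>?S p\<^esub>" if u: "u : carrier (?S p)" "?i p u = \<one>\<^bsub>?X p\<^esub>" for u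
  proof (cases "odd p")
   case True
   then show ?thesis using Sodd[OF True] u by(auto simp: trivial_group_def)
  next
   case False
   then have "trivial_group (?R (p + 1))" by(intro Rodd) simp
   then have R: "carrier (?R (p + 1)) = {\<one>\<^bsub>?R (p + 1)\<^esub>}" by(simp add: trivial_group_def)
   obtain r where r: "r : carrier (?R (p + 1))" "u = ?d (p + 1) r"
    using homology_exact_3[OF u(1)] u(2) by auto
   interpret d: group_hom "?R (p + 1)" "?S p" "?d (p + 1)" using group_hom_boundary[of "p + 1" X S] by simp
   show ?thesis using d.hom_one r R by(metis singletonD)
  qed
  have jsurj: "r : ?j p ` carrier (?X p)" if r: "r : carrier (?R p)" for r
  proof (cases "odd p")
   case True
   then have "r = \<one>\<^bsub>?R p\<^esub>" using Rodd r by(auto simp: trivial_group_def)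
   then show ?thesis using j.hom_one fX.G.one_closed by(metis imageI)
  next
   case False
   then have "trivial_group (?S (p - 1))" by(intro Sodd) simp
   moreover have "?d p r : carrier (?S (p - 1))" by(rule hom_boundary_carrier)
   ultimately have "?d p r = \<one>\<^bsub>?S (p - 1)\<^esub>" by(metis singletonD trivial_group_def)
   then show ?thesis using homology_exact_2[OF r] by blast
  qed
  show "free_rank (subgroup_generated (?X p) ?KX) (evrank k p + evrank m p)"
  proof (rule free_rank_ext[where A = "subgroup_generated (?S p) ?KS" and C = "?R p" and f = "?i p" and h = "?j p"])
   show "free_rank (subgroup_generated (?S p) ?KS) (evrank k p)" using k by(simp add: even_kernel_def)
   show "comm_group (subgroup_generated (?X p) ?KX)"
    by(rule fX.G.abelian_subgroup_generated) (rule abelian_homology_group)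
   show "?i p : hom (subgroup_generated (?S p) ?KS) (subgroup_generated (?X p) ?KX)"
    unfolding hom_def cX cS using nat by(auto simp: subgroup_generated_def kernel_def)
   show "inj_on (?i p) (carrier (subgroup_generated (?S p) ?KS))"
   proof (rule inj_on_subset)
    show "inj_on (?i p) (carrier (?S p))" unfolding i.inj_iff_trivial_ker using inj by(auto simp: kernel_def simp del: one_relative_homology_group)
   qed (unfold cS, auto simp: kernel_def)
   show "?j p : hom (subgroup_generated (?X p) ?KX) (?R p)"
    unfolding hom_def cX by(auto simp: subgroup_generated_def kernel_def)
   show "?j p ` carrier (subgroup_generated (?X p) ?KX) = carrier (?R p)"
   proof
    show "carrier (?R p) <= ?j p ` carrier (subgroup_generated (?X p) ?KX)"
    proof
     fix r assume "r : carrier (?R p)"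
     then obtain x where x: "x : carrier (?X p)" "r = ?j p x" using jsurj by blast
     have "?fX p x : carrier (?Z p)" using x by simp
     then obtain s where s: "s : carrier (?S p)" "?fX p x = ?fS p s" using surjS[of p] by(metis imageE)
     \<comment> \<open>Correcting by a class of \<open>S\<close> with the same image in
       \<open>Z\<close> moves \<open>x\<close> into the kernel without changing its relative
       class.\<close>
     let ?y = "x \<otimes>\<^bsub>?X p\<^esub> inv\<^bsub>?X p\<^esub> (?i p s)"
     have "?y : ?KX" using x s nat by(simp add: kernel_def del: one_relative_homology_group)
     moreover have "?j p (?i p s) = \<one>\<^bsub>?R p\<^esub>"
      using homology_exact_1[of "?i p s" p X S] s by(auto simp: hom_induced_carrier simp del: one_relative_homology_group)
     then have "?j p ?y = r" using x s by(simp del: one_relative_homology_group)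
     ultimately show "r : ?j p ` carrier (subgroup_generated (?X p) ?KX)" unfolding cX by blast
    qed
   qed (auto simp: hom_induced_carrier)
   show "?j p x = \<one>\<^bsub>?R p\<^esub> \<longleftrightarrow> x : ?i p ` carrier (subgroup_generated (?S p) ?KS)"
    if "x : carrier (subgroup_generated (?X p) ?KX)" for x
   proof -
    have x: "x : carrier (?X p)" "?fX p x = \<one>\<^bsub>?Z p\<^esub>" using that unfolding cX by(auto simp: kernel_def)
    have "?j p x = \<one>\<^bsub>?R p\<^esub> \<longleftrightarrow> x : ?i p ` carrier (?S p)" by(rule homology_exact_1[OF x(1)])
    also have "... \<longleftrightarrow> x : ?i p ` ?KS" using x(2) nat by(auto simp: kernel_def simp del: one_relative_homology_group)
    finally show ?thesis unfolding cS .
   qed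
  qed (use m in auto)
 qed
 from surj ker f show ?thesis by(simp add: even_kernel_def)
qed

section \<open>Continuity and homotopies for coordinate functions\<close>

lemma continuous_map_fun_iff:
 fixes f :: "'a => 'i => 'b::topological_space"
 shows "cmap X euclidean f \<longleftrightarrow> (ALL i. cmap X euclidean (%x. f x i))"
 using continuous_map_componentwise_UNIV[of X "%_. euclidean" f] by(simp add: euclidean_product_topology)

lemma continuous_map_funI [continuous_intros]:
 fixes f :: "'a => 'i => 'b::topological_space"
 shows "(!!i. cmap X euclidean (%x. f x i)) ==> cmap X euclidean f"
 by(simp add: continuous_map_fun_iff)

lemma continuous_map_fun_apply:
 fixes f :: "'a => 'i => 'b::topological_space"
 shows "cmap X euclidean f ==> cmap X euclidean (%x. f x i)"
 by(simp add: continuous_map_fun_iff)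

lemma continuous_map_mult [continuous_intros]:
 fixes f h :: "'a => 'b::real_normed_algebra"
 shows "cmap X euclidean f ==> cmap X euclidean h ==> cmap X euclidean (%x. f x * h x)"
 by(simp add: continuous_map_atin tendsto_mult)

lemma continuous_map_divide:
 fixes f h :: "'a => 'b::real_normed_field"
 shows "cmap X euclidean f ==> cmap X euclidean h ==> (!!x. x : topspace X ==> h x ~= 0) ==> cmap X euclidean (%x. f x / h x)"
 by(simp add: continuous_map_atin tendsto_divide)

lemma continuous_map_of_real:
 fixes f :: "'a => real"
 shows "cmap X euclidean f ==> cmap X euclidean (%x. of_real (f x) :: 'b::real_normed_algebra_1)"
 by(simp add: continuous_map_atin tendsto_of_real)

lemma homotopic_withI:
 assumes "cmap (prod_top (top_of_set {0..1::real}) X) Y (%z. h (fst z) (snd z))"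
  "!!x. h 0 x = f x" "!!x. h 1 x = f' x" "!!t. t : {0..1} ==> P (h t)"
 shows "homotopic_with P X Y f f'"
 unfolding homotopic_with_def using assms by(intro exI[of _ "%z. h (fst z) (snd z)"]) auto

section \<open>Products with the pair of a Euclidean space and its punctured space\<close>

text \<open>Every R^n sits in the same type, as sequences vanishing from \<open>n\<close> on, which
  allows induction on the dimension.\<close>

definition rspace :: "nat => (nat => real) set" where
 "rspace n = {x. ALL i>=n. x i = 0}"

lemma rspace_0: "rspace 0 = {0}"
 by(auto simp: rspace_def)

lemma continuous_map_prod_rspace:
 assumes "cmap W Z (%w. fst (f w))" "!!i. cmap W euclidean (%w. snd (f w) i)"
  "!!w. w : topspace W ==> snd (f w) : A"
 shows "cmap W (prod_top Z (top_of_set A)) f"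
 unfolding continuous_map_pairwise continuous_map_in_subtopology
 using assms by(auto simp: o_def intro: continuous_map_funI)

text \<open>Suspension: the triple of the whole space, the punctured space \<open>S\<close> and the
  slit space \<open>T\<close> shifts the degree by one, and excision turns the pair of
  \<open>S\<close> and \<open>T\<close> into the pair for one dimension less.\<close>

lemma thom_step:
 "rel_homol p (prod_top Z (top_of_set (rspace (Suc n)))) (topspace Z \<times> (rspace (Suc n) - {0})) \<cong>
  rel_homol (p - 1) (prod_top Z (top_of_set (rspace n))) (topspace Z \<times> (rspace n - {0}))"
proof -
 let ?X = "prod_top Z (top_of_set (rspace (Suc n)))"
 define S where "S = topspace Z \<times> (rspace (Suc n) - {0})"
 \<comment> \<open>\<open>T\<close> omits the closed half-axis on which the earlier coordinates
   vanish and the last one is at most 0. \<open>N\<close> is the part of \<open>S\<close> to be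
   excised; it lies in \<open>T\<close> because the origin is missing.\<close>
 define T where "T = topspace Z \<times> {x : rspace (Suc n). (EX i<n. x i ~= 0) \<or> x n > 0}"
 define N where "N = topspace Z \<times> {x : rspace (Suc n) - {0}. x n >= 0}"
 have subX: "subtop ?X (topspace Z \<times> A) = prod_top Z (top_of_set A)" if "A <= rspace (Suc n)" for A
  using that by(simp add: subtopology_Times subtopology_subtopology Int_absorb1)
 have TS: "T <= S" by(auto simp: S_def T_def)
 have coord: "cmap (prod_top (top_of_set {0..1::real}) (prod_top Z (top_of_set A))) euclidean (%z. snd (snd z) i)"
  for i and A :: "(nat => real) set"
 proof -
  have "cmap (prod_top (top_of_set {0..1::real}) (prod_top Z (top_of_set A))) (top_of_set A) (snd \<circ> snd)"
   by(rule continuous_map_compose[OF continuous_map_snd continuous_map_snd])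
  then show ?thesis by(auto simp: continuous_map_in_subtopology continuous_map_fun_iff o_def)
 qed
 have time: "cmap (prod_top (top_of_set {0..1::real}) (prod_top Z (top_of_set A))) euclidean fst" for A :: "(nat => real) set"
  using continuous_map_fst[of "top_of_set {0..1::real}"] by(auto simp: continuous_map_in_subtopology)
 have zcoord: "cmap (prod_top (top_of_set {0..1::real}) (prod_top Z (top_of_set A))) Z (%z. fst (snd z))" for A :: "(nat => real) set"
  using continuous_map_compose[OF continuous_map_snd continuous_map_fst] by(simp add: o_def)
 have coord': "cmap (prod_top Z (top_of_set A)) euclidean (%z. snd z i)" for A :: "(nat => real) set" and i
  using continuous_map_snd[of Z "top_of_set A"] by(auto simp: continuous_map_in_subtopology continuous_map_fun_iff o_def)
 \<comment> \<open>Pushing the last coordinate to 1 along a segment deforms the whole space and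
   \<open>T\<close> to the same hyperplane, so the pair has no relative homology.\<close>
 have "trivial_group (rel_homol q ?X T)" for q
 proof (rule trivial_relative_homology_group_gen[where f = "%z. (fst z, (snd z)(n := 1))"])
  show "cmap ?X (subtop ?X T) (%z. (fst z, (snd z)(n := 1)))"
   unfolding T_def subX[OF Collect_subset]
   by(rule continuous_map_prod_rspace) (use coord' in \<open>auto simp: continuous_map_fst rspace_def\<close>)
  have *: "homotopic_with (%h. True) (prod_top Z (top_of_set A)) (prod_top Z (top_of_set A)) (%z. (fst z, (snd z)(n := 1))) id"
   if A: "!!x t. x : A ==> t : {0..1} ==> x(n := (1 - t) + t * x n) : A" for A :: "(nat => real) set"
  proof (rule homotopic_withI[where h = "%t z. (fst z, (snd z)(n := (1 - t) + t * snd z n))"])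
   have "cmap (prod_top (top_of_set {0..1}) (prod_top Z (top_of_set A))) euclidean
     (%z. ((snd (snd z))(n := 1 - fst z + fst z * snd (snd z) n)) i)" for i
    using coord time by(cases "i = n") (auto intro!: continuous_intros)
   then show "cmap (prod_top (top_of_set {0..1}) (prod_top Z (top_of_set A))) (prod_top Z (top_of_set A))
    (%z. (fst (snd z), (snd (snd z))(n := 1 - fst z + fst z * snd (snd z) n)))"
    using zcoord A by(intro continuous_map_prod_rspace) (auto simp: mult.commute)
  qed auto
  show "homotopic_with (%h. True) (subtop ?X T) (subtop ?X T) (%z. (fst z, (snd z)(n := 1))) id"
   unfolding T_def subX[OF Collect_subset]
  proof (rule *, goal_cases)
   case (1 x t)
   have "(1 - t) + t * x n > 0" if "x n > 0"
    using that 1(2) by(cases "t = 1") (auto intro: add_pos_nonneg)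
   with 1 show ?case by(fastforce simp: rspace_def)
  qed
  show "homotopic_with (%k. True) ?X ?X (%z. (fst z, (snd z)(n := 1))) id"
   by(rule *) (auto simp: rspace_def)
 qed
 then have "rel_homol p ?X S \<cong> rel_homol (p - 1) (subtop ?X S) T"
 proof -
  have "hom_relboundary p ?X S T : iso (rel_homol p ?X S) (rel_homol (p - 1) (subtop ?X S) T)"
  proof (rule very_short_exact_sequence)
   show "exact_seq ([rel_homol (p - 1) ?X T, rel_homol (p - 1) (subtop ?X S) T, rel_homol p ?X S, rel_homol p ?X T],
    [hom_induced (p - 1) (subtop ?X S) T ?X T id, hom_relboundary p ?X S T, hom_induced p ?X T ?X S id])"
    using homology_exactness_triple_1[OF TS, of p ?X] homology_exactness_triple_2[OF TS, of p ?X] by simp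
  qed fact+
  then show ?thesis by(rule is_isoI)
 qed
 also have "rel_homol (p - 1) (subtop ?X (S - N)) (T - N) \<cong> rel_homol (p - 1) (subtop ?X S) T"
 proof -
  let ?Y = "subtop ?X S"
  have Y: "?Y = prod_top Z (top_of_set (rspace (Suc n) - {0}))" unfolding S_def by(rule subX) auto
  have clN: "closedin ?Y N"
  proof -
   have "N = {z : topspace ?Y. 0 <= snd z n}" unfolding Y by(auto simp: N_def)
   moreover have "closedin ?Y {z : topspace ?Y. snd z n : {0..}}"
    unfolding Y by(rule closedin_continuous_map_preimage[OF coord']) auto
   ultimately show ?thesis by simp
  qed
  have opT: "openin ?Y T"
  proof -
   have o: "openin ?Y {z : topspace ?Y. snd z i : U}" if "open U" for i U
    unfolding Y by(rule openin_continuous_map_preimage[OF coord']) (use that in auto)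
   have "T = (\<Union>i\<in>{..<n}. {z : topspace ?Y. snd z i : - {0}}) Un {z : topspace ?Y. snd z n : {0<..}}"
    unfolding Y by(auto simp: T_def fun_eq_iff)
   also have "openin ?Y ..."
   proof (rule openin_Un)
    show "openin ?Y {z : topspace ?Y. snd z n : {0<..}}" by(rule o) simp
    show "openin ?Y (\<Union>i\<in>{..<n}. {z : topspace ?Y. snd z i : - {0}})"
    proof (rule openin_Union, elim imageE, simp only:)
     show "openin ?Y {z : topspace ?Y. snd z i : - {0}}" for i by(rule o) (simp add: open_Compl)
    qed
   qed
   finally show ?thesis .
  qed
  have NT: "N <= T"
  proof
   fix z assume "z : N"
   then obtain a x where z: "z = (a, x)" "a : topspace Z" "x : rspace (Suc n)" "x ~= 0" "x n >= 0" by(auto simp: N_def)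
   have "(EX i<n. x i ~= 0) \<or> x n > 0"
   proof (rule ccontr)
    assume "~ ?thesis"
    then have "x i = 0" for i using z by(cases i n rule: linorder_cases) (auto simp: rspace_def)
    then show False using z by auto
   qed
   with z show "z : T" by(auto simp: T_def)
  qed
  have "hom_induced (p - 1) (subtop ?Y (S - N)) (T - N) (subtop ?Y S) T id
   : iso (rel_homol (p - 1) (subtop ?Y (S - N)) (T - N)) (rel_homol (p - 1) (subtop ?Y S) T)"
   by(rule homology_excision_axiom) (use clN opT NT TS in \<open>simp_all add: closure_of_closedin interior_of_openin\<close>)
  then show ?thesis by(simp add: subtopology_subtopology Int_absorb1 is_isoI)
 qed
 then have "rel_homol (p - 1) (subtop ?X S) T \<cong> rel_homol (p - 1) (subtop ?X (S - N)) (T - N)"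
  by(simp add: group.iso_sym)
 also have "... \<cong> rel_homol (p - 1) (prod_top Z (top_of_set (rspace n))) (topspace Z \<times> (rspace n - {0}))"
 proof -
  define H where "H = {x : rspace (Suc n). x n < 0}"
  have SN: "subtop ?X (S - N) = prod_top Z (top_of_set H)"
  proof -
   have "S - N = topspace Z \<times> H" by(auto simp: S_def N_def H_def)
   then show ?thesis using subX[of H] by(auto simp: H_def)
  qed
  have TN: "T - N = topspace Z \<times> {x : H. EX i<n. x i ~= 0}"
   by(auto simp: T_def N_def H_def)
  have r0: "x : rspace n ==> x n = 0" for x by(simp add: rspace_def)
  have idn: "x(n := 0) = x" if "x : rspace n" for x using r0[OF that] by auto
  show ?thesis
   unfolding SN TN
  \<comment> \<open>What is left is an open half-space relative to the complement of the negative
    axis; forgetting the last coordinate and restoring it as -1 are inverse up to homotopy.\<close>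
  proof (rule homotopy_equivalent_space_imp_isomorphic_relative_homology_groups
    [where f = "%z. (fst z, (snd z)(n := 0))" and g = "%z. (fst z, (snd z)(n := -1))"])
   show "cmap (prod_top Z (top_of_set H)) (prod_top Z (top_of_set (rspace n))) (%z. (fst z, (snd z)(n := 0)))"
    by(rule continuous_map_prod_rspace) (use coord' in \<open>auto simp: continuous_map_fst rspace_def H_def\<close>)
   show "cmap (prod_top Z (top_of_set (rspace n))) (prod_top Z (top_of_set H)) (%z. (fst z, (snd z)(n := -1)))"
    by(rule continuous_map_prod_rspace) (use coord' in \<open>auto simp: continuous_map_fst rspace_def H_def\<close>)
   show "(%z. (fst z, (snd z)(n := 0))) : topspace Z \<times> {x : H. EX i<n. x i ~= 0} \<rightarrow> topspace Z \<times> (rspace n - {0})"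
    by(auto simp: H_def rspace_def fun_eq_iff) (metis less_irrefl)
   show "(%z. (fst z, (snd z)(n := -1))) : topspace Z \<times> (rspace n - {0}) \<rightarrow> topspace Z \<times> {x : H. EX i<n. x i ~= 0}"
   proof (rule funcsetI)
    fix z assume "z : topspace Z \<times> (rspace n - {0})"
    then obtain a x where z: "z = (a, x)" "a : topspace Z" and x: "x : rspace n" "x ~= 0" by auto
    obtain i where i: "x i ~= 0" using x(2) by(auto simp: fun_eq_iff)
    with x have "i < n" by(auto simp: rspace_def not_le[symmetric])
    with x z i show "(fst z, (snd z)(n := -1)) : topspace Z \<times> {x : H. EX i<n. x i ~= 0}"
     by(auto simp: H_def rspace_def intro!: exI[of _ i])
   qed
   let ?P = "topspace Z \<times> {x : H. EX i<n. x i ~= 0}"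
   show "homotopic_with (%h. h : ?P \<rightarrow> ?P) (prod_top Z (top_of_set H)) (prod_top Z (top_of_set H))
    ((%z. (fst z, (snd z)(n := -1))) \<circ> (%z. (fst z, (snd z)(n := 0)))) id"
   proof (rule homotopic_withI[where h = "%t z. (fst z, (snd z)(n := (t - 1) + t * snd z n))"])
    have HH: "x(n := (t - 1) + t * x n) : H" if "x : H" "0 <= t" "t <= 1" for x t
    proof -
     have "t - 1 + t * x n < 0"
     proof (cases "t = 0")
      case False
      then have "t * x n < 0" using that by(simp add: H_def mult_pos_neg)
      then show ?thesis using that by linarith
     qed simp
     then show ?thesis using that by(auto simp: H_def rspace_def)
    qed
    have "cmap (prod_top (top_of_set {0..1}) (prod_top Z (top_of_set H))) euclidean
      (%z. ((snd (snd z))(n := fst z - 1 + fst z * snd (snd z) n)) i)" for i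
     using coord time by(cases "i = n") (auto intro!: continuous_intros)
    then show "cmap (prod_top (top_of_set {0..1}) (prod_top Z (top_of_set H))) (prod_top Z (top_of_set H))
     (%z. (fst (snd z), (snd (snd z))(n := fst z - 1 + fst z * snd (snd z) n)))"
     using zcoord HH by(intro continuous_map_prod_rspace) auto
    show "(%z. (fst z, (snd z)(n := t - 1 + t * snd z n))) : ?P \<rightarrow> ?P" if "t : {0..1}" for t
     using HH that by(fastforce)
   qed (auto simp: fun_eq_iff)
   show "homotopic_with (%h. h : topspace Z \<times> (rspace n - {0}) \<rightarrow> topspace Z \<times> (rspace n - {0}))
     (prod_top Z (top_of_set (rspace n))) (prod_top Z (top_of_set (rspace n)))
     ((%z. (fst z, (snd z)(n := 0))) \<circ> (%z. (fst z, (snd z)(n := - 1)))) id"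
    by(rule homotopic_with_equal)
      (auto simp: o_def idn continuous_map_prod_rspace continuous_map_fst coord' intro!: continuous_map_prod_rspace)
  qed
 qed
 finally show ?thesis unfolding S_def .
qed

lemma thom_iso:
 "rel_homol p (prod_top Z (top_of_set (rspace n))) (topspace Z \<times> (rspace n - {0})) \<cong>
  homol (p - int n) Z"
proof (induction n arbitrary: p)
 case 0
 have "prod_top Z (top_of_set {0::nat => real}) homeomorphic_space Z"
  using homeomorphic_space_prod_topology_sing1[of "0 :: nat => real" euclidean Z] homeomorphic_space_sym by auto
 moreover have "topspace Z \<times> ({0::nat => real} - {0}) = {}" by simp
 ultimately show ?case
  by(simp only: rspace_0 of_nat_0 diff_0_right homeomorphic_space_imp_isomorphic_homology_groups)
next
 case (Suc n)
 have "rel_homol p (prod_top Z (top_of_set (rspace (Suc n)))) (topspace Z \<times> (rspace (Suc n) - {0})) \<cong>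
  rel_homol (p - 1) (prod_top Z (top_of_set (rspace n))) (topspace Z \<times> (rspace n - {0}))"
  by(rule thom_step)
 also have "... \<cong> homol (p - 1 - int n) Z" by(rule Suc.IH)
 also have "p - 1 - int n = p - int (Suc n)" by simp
 finally show ?case .
qed

lemma thom_free_rank:
 assumes "even_free Z b"
 shows "free_rank (rel_homol p (prod_top Z (top_of_set (rspace (2 * d)))) (topspace Z \<times> (rspace (2 * d) - {0})))
  (evrank (%i. if i >= d then b (i - d) else 0) p)"
proof -
 have "free_rank (homol (p - int (2 * d)) Z) (evrank b (p - int (2 * d)))"
  using assms by(simp add: even_free_def)
 moreover have "evrank b (p - int (2 * d)) = evrank (%i. if i >= d then b (i - d) else 0) p"
 proof (cases "even p")
  case True
  then obtain k where k: "p = 2 * k" by(elim evenE)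
  then show ?thesis by(auto simp: evrank_def nat_diff_distrib)
 qed (simp add: evrank_def)
 ultimately show ?thesis
  by(intro free_rank_is_iso[OF _ group.iso_sym[OF _ thom_iso]]) auto
qed

lemma homotopic_with_trueI:
 assumes "cmap (prod_top (top_of_set {0..1::real}) X) Y (%z. h (fst z) (snd z))"
  "!!x. x : topspace X ==> h 0 x = f x" "!!x. x : topspace X ==> h 1 x = f' x"
 shows "homotopic_with (%_. True) X Y f f'"
 using assms by(subst homotopic_with) (auto intro!: exI[of _ "%z. h (fst z) (snd z)"])

section \<open>Open quotient maps\<close>

lemma open_map_prod_id:
 assumes "open_map X Y f"
 shows "open_map (prod_top Z X) (prod_top Z Y) (%z. (fst z, f (snd z)))"
 unfolding open_map_def
proof (intro allI impI)
 fix W assume W: "openin (prod_top Z X) W"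
 show "openin (prod_top Z Y) ((%z. (fst z, f (snd z))) ` W)"
  unfolding openin_prod_topology_alt
 proof (intro allI impI)
  fix z y assume "(z, y) : (%z. (fst z, f (snd z))) ` W"
  then obtain x where x: "(z, x) : W" "y = f x" by auto
  then obtain A B where AB: "openin Z A" "openin X B" "z : A" "x : B" "A \<times> B <= W"
   using W unfolding openin_prod_topology_alt by metis
  then have "openin Y (f ` B)" using assms by(auto simp: open_map_def)
  moreover have "A \<times> f ` B <= (%z. (fst z, f (snd z))) ` W"
  proof
   fix w assume "w : A \<times> f ` B"
   then obtain a b where "a : A" "b : B" "w = (a, f b)" by auto
   then show "w : (%z. (fst z, f (snd z))) ` W" using AB by(intro image_eqI[of _ _ "(a, b)"]) auto
  qed
  ultimately show "EX U V. openin Z U & openin Y V & z : U & y : V & U \<times> V <= (%z. (fst z, f (snd z))) ` W"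
   using AB x by blast
 qed
qed

text \<open>Maps on spaces of lines are defined on representing vectors and then descended, also
  after multiplying with an interval or with other factors. Quotient maps are in general not stable
  under such products; open surjections are, hence the stronger notion.\<close>

definition open_quotient :: "'a topology => 'b topology => ('a => 'b) => bool" where
 "open_quotient X Y f \<longleftrightarrow> cmap X Y f & open_map X Y f & f ` topspace X = topspace Y"

lemma open_quotient_prod:
 assumes "open_quotient X Y f"
 shows "open_quotient (prod_top Z X) (prod_top Z Y) (%z. (fst z, f (snd z)))"
proof -
 have "(%z. (fst z, f (snd z))) ` (topspace Z \<times> topspace X) = topspace Z \<times> f ` topspace X" by force
 moreover have "cmap (prod_top Z X) Y (%z. f (snd z))"
  using continuous_map_compose[OF continuous_map_snd, of X Y f Z] assms by(simp add: open_quotient_def o_def)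
 ultimately show ?thesis
  using assms by(auto simp: open_quotient_def open_map_prod_id continuous_map_pairwise o_def continuous_map_fst)
qed

lemma open_quotient_lift:
 assumes "open_quotient X Y f" "cmap X W (%x. h (f x))"
 shows "cmap Y W h"
 using assms continuous_compose_quotient_map[of X Y f W h] continuous_open_imp_quotient_map[of X Y f]
 by(simp add: open_quotient_def o_def)

lemma open_quotient_restrict:
 assumes q: "open_quotient X Y f" and A: "A <= topspace X" "{x : topspace X. f x : f ` A} = A"
 shows "open_quotient (subtop X A) (subtop Y (f ` A)) f"
 using q A open_map_restriction[of X Y f "f ` A" A]
 by(auto simp: open_quotient_def continuous_map_in_subtopology continuous_map_from_subtopology)

section \<open>Lines modulo a subspace\<close>

lemma cscale_apply [simp]: "cscale c f x = c * f x"
 by(simp add: cscale_def)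

lemma in_line_mod:
 assumes "cfun.subspace U"
 shows "x : line_mod U v \<longleftrightarrow> (EX c. x - cscale c v : U)"
 using assms by(simp add: line_mod_def cfun.span_insert cfun.span_eq_iff[THEN iffD2])

lemma subspace_line_mod: "cfun.subspace (line_mod U v)"
 by(simp add: line_mod_def cfun.subspace_span)

lemma line_mod_contains: "U <= line_mod U v" "v : line_mod U v"
 by(auto simp: line_mod_def intro: cfun.span_base)

lemma line_mod_subset_iff:
 assumes "cfun.subspace W"
 shows "line_mod U v <= W \<longleftrightarrow> v : W & U <= W"
proof
 assume "v : W & U <= W"
 then show "line_mod U v <= W" unfolding line_mod_def using assms by(intro cfun.span_minimal) auto
next
 assume "line_mod U v <= W"
 then show "v : W & U <= W" using line_mod_contains(1)[of U v] line_mod_contains(2)[of v U] by blast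
qed

lemma line_mod_eq:
 assumes U: "cfun.subspace U" and v: "w - cscale c v : U" "c ~= 0"
 shows "line_mod U w = line_mod U v"
proof
 have "w : line_mod U v" using v in_line_mod[OF U] by blast
 then show "line_mod U w <= line_mod U v" by(simp add: line_mod_subset_iff subspace_line_mod line_mod_contains)
 have "cscale (- (1 / c)) (w - cscale c v) : U" by(rule cfun.subspace_scale[OF U v(1)])
 moreover have "cscale (- (1 / c)) (w - cscale c v) = v - cscale (1 / c) w"
  using v by(auto simp: fun_eq_iff field_simps)
 ultimately have "v : line_mod U w" using in_line_mod[OF U] by metis
 then show "line_mod U v <= line_mod U w" by(simp add: line_mod_subset_iff subspace_line_mod line_mod_contains)
qed

lemma line_mod_eq_iff:
 assumes U: "cfun.subspace U" and v: "w ~: U"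
 shows "line_mod U w = line_mod U v \<longleftrightarrow> (EX c. c ~= 0 & w - cscale c v : U)"
proof
 assume "line_mod U w = line_mod U v"
 then have "w : line_mod U v" using line_mod_contains by blast
 then obtain c where c: "w - cscale c v : U" using in_line_mod[OF U] by blast
 moreover have "c ~= 0"
 proof
  assume "c = 0"
  then have "w - cscale c v = w" by(simp add: fun_eq_iff)
  then show False using c v by metis
 qed
 ultimately show "EX c. c ~= 0 & w - cscale c v : U" by blast
qed (use line_mod_eq[OF U] in blast)

lemma continuous_on_cscale_add: "continuous_on A (%v::nat => complex. cscale c v + w)"
 by(intro continuous_on_coordinatewise_then_product)
   (auto intro!: continuous_intros continuous_on_product_then_coordinatewise[OF continuous_on_id])

lemma topspace_proj_quotient [simp]: "topspace (proj_quotient V U) = line_mod U ` (V - U)"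
 using quotient_map_quotient_topology[of "top_of_set (V - U)" "line_mod U"]
 by(auto simp: proj_quotient_def quotient_map_def)

lemma open_quotient_line_mod:
 assumes V: "cfun.subspace V" and U: "cfun.subspace U" "U <= V"
 shows "open_quotient (top_of_set (V - U)) (proj_quotient V U) (line_mod U)"
proof -
 have qm: "quotient_map (top_of_set (V - U)) (proj_quotient V U) (line_mod U)"
  unfolding proj_quotient_def by(rule quotient_map_quotient_topology)
 have "open_map (top_of_set (V - U)) (proj_quotient V U) (line_mod U)"
  unfolding open_map_def
 proof (intro allI impI)
  fix O' assume "openin (top_of_set (V - U)) O'"
  then obtain T where T: "open T" "O' = (V - U) Int T" by(auto simp: openin_open)
  \<comment> \<open>The saturation of an open set is the union of its preimages under the continuous
    maps sending \<open>v\<close> to \<open>c v + u\<close>, with \<open>c\<close> nonzero and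
    \<open>u\<close> in \<open>U\<close>.\<close>
  have "{x : V - U. line_mod U x : line_mod U ` O'} =
   (\<Union>c\<in>{c. c ~= 0}. \<Union>u\<in>U. (V - U) Int (%v. cscale c v + u) -` T)" (is "?L = ?R")
  proof
   show "?L <= ?R"
   proof
    fix x assume x: "x : ?L"
    then obtain v where v: "v : O'" "line_mod U x = line_mod U v" by auto
    then have vV: "v : V - U" "v : T" using T by auto
    obtain c where c: "c ~= 0" "v - cscale c x : U" using line_mod_eq_iff[OF U(1)] v(2) vV by(metis DiffD2)
    have "cscale c x + (v - cscale c x) = v" by simp
    then show "x : ?R" using c x vV by(intro UN_I[of c] UN_I[of "v - cscale c x"]) auto
   qed
   show "?R <= ?L"
   proof
    fix x assume "x : ?R"
    then obtain c u where cu: "c ~= 0" "u : U" "x : V - U" "cscale c x + u : T" by auto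
    let ?v = "cscale c x + u"
    have "?v - cscale c x : U" using cu by simp
    then have eq: "line_mod U ?v = line_mod U x" using line_mod_eq[OF U(1)] cu by blast
    have "?v : V" using cu U V by(meson DiffD1 cfun.subspace_add cfun.subspace_scale subsetD)
    moreover have "?v ~: U"
    proof
     assume "?v : U"
     then have "line_mod U ?v <= U" by(simp add: line_mod_subset_iff U)
     then show False using eq line_mod_contains(2)[of x U] cu by auto
    qed
    ultimately show "x : ?L" using cu T eq by(auto intro!: image_eqI[of _ _ ?v])
   qed
  qed
  also have "openin (top_of_set (V - U)) ?R"
  proof -
   have o: "openin (top_of_set (V - U)) ((V - U) Int (%v. cscale c v + u) -` T)" for c u
    using T by(intro openin_open_Int open_vimage continuous_on_cscale_add)
   show ?thesis
    by(rule openin_Union, elim imageE, simp only:, rule openin_Union, elim imageE, simp only:) (rule o)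
  qed
  finally have "openin (top_of_set (V - U)) {x : V - U. line_mod U x : line_mod U ` O'}" .
  then show "openin (proj_quotient V U) (line_mod U ` O')"
   unfolding proj_quotient_def openin_quotient_topology using T by(auto simp: image_mono)
 qed
 then show ?thesis using qm by(auto simp: open_quotient_def quotient_imp_continuous_map)
qed

lemma time_coord: "cmap (prod_top (top_of_set {0..1::real}) Y) euclidean fst"
 using continuous_map_fst[of "top_of_set {0..1::real}"] by(auto simp: continuous_map_in_subtopology)

text \<open>Linear coordinates for \<open>V\<close> modulo \<open>U\<close>: the \<open>e i\<close>
  span a complement of \<open>U\<close>, and the \<open>\<phi> i\<close> are dual to them and vanish
  on \<open>U\<close>. Linearity and continuity are asked for on \<open>V\<close> only, since the
  ambient type is infinite-dimensional.\<close>

locale proj_coords =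
 fixes V U :: "(nat => complex) set" and c :: nat and e :: "nat => nat => complex"
  and \<phi> :: "nat => (nat => complex) => complex"
 assumes V: "cfun.subspace V" and U: "cfun.subspace U" and UV: "U <= V"
  and e_in: "!!i. i < c ==> e i : V"
  and \<phi>_add: "!!i v w. v : V ==> w : V ==> \<phi> i (v + w) = \<phi> i v + \<phi> i w"
  and \<phi>_scale: "!!i k v. v : V ==> \<phi> i (cscale k v) = k * \<phi> i v"
  and \<phi>_cont: "!!i. continuous_on V (\<phi> i)"
  and \<phi>_U: "!!i u. u : U ==> \<phi> i u = 0"
  and \<phi>_e: "!!i j. i < c ==> j < c ==> \<phi> i (e j) = (if i = j then 1 else 0)"
  and dec: "!!v. v : V ==> v - (\<Sum>i<c. cscale (\<phi> i v) (e i)) : U"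
begin

definition L :: "(nat => complex) set => (nat => complex) set topology" where
 "L A = subtop (proj_quotient V U) (line_mod U ` A)"

text \<open>The flag from \<open>W 0 = U\<close> to \<open>W c = V\<close>; the lines of
  \<open>W j\<close> modulo \<open>U\<close> form the projective space P^(j-1).\<close>

definition W :: "nat => (nat => complex) set" where
 "W j = {v : V. ALL i. j <= i & i < c --> \<phi> i v = 0}"

definition sat :: "(nat => complex) set => bool" where
 "sat A \<longleftrightarrow> A <= V - U & {x : V - U. line_mod U x : line_mod U ` A} = A"

text \<open>An arbitrary representative. Formulas built on it are shown to be independent of the
  choice, and their continuity is tested after composing with \<open>line_mod U\<close>.\<close>

definition rep :: "(nat => complex) set => nat => complex" where
 "rep l = (SOME v. v : V - U & l = line_mod U v)"

lemma diff_in: "v : V ==> w : V ==> v - w : V"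
 by(rule cfun.subspace_diff[OF V])

lemma scale_in: "v : V ==> cscale k v : V"
 by(rule cfun.subspace_scale[OF V])

lemma \<phi>_diff: "v : V ==> w : V ==> \<phi> i (v - w) = \<phi> i v - \<phi> i w"
 using \<phi>_add[of "v - w" w i] by(simp add: diff_in)

lemma \<phi>_0: "\<phi> i 0 = 0"
 using \<phi>_U cfun.subspace_0[OF U] by blast

lemma sum_in: "m <= c ==> (\<Sum>i<m. cscale (k i) (e i)) : V"
 using V e_in by(intro cfun.subspace_sum) (auto intro: scale_in)

lemma \<phi>_sum:
 assumes "m <= c" "i < c"
 shows "\<phi> i (\<Sum>j<m. cscale (k j) (e j)) = (if i < m then k i else 0)"
 using assms(1)
proof (induction m)
 case (Suc m)
 have "\<phi> i ((\<Sum>j<m. cscale (k j) (e j)) + cscale (k m) (e m)) = \<phi> i (\<Sum>j<m. cscale (k j) (e j)) + \<phi> i (cscale (k m) (e m))"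
  using Suc.prems by(intro \<phi>_add sum_in scale_in e_in) auto
 also have "\<phi> i (cscale (k m) (e m)) = k m * (if i = m then 1 else 0)"
  using Suc.prems assms(2) e_in[of m] by(subst \<phi>_scale) (auto simp: \<phi>_e)
 also have "\<phi> i (\<Sum>j<m. cscale (k j) (e j)) = (if i < m then k i else 0)"
  using Suc by(meson Suc_leD)
 also have "(if i < m then k i else 0) + k m * (if i = m then 1 else 0) = (if i < Suc m then k i else 0)"
  by(auto simp: less_Suc_eq)
 finally show ?case unfolding sum.lessThan_Suc .
qed (simp add: \<phi>_0)

lemma in_U_iff: "v : V ==> v : U \<longleftrightarrow> (ALL i<c. \<phi> i v = 0)"
proof
 assume v: "v : V" "ALL i<c. \<phi> i v = 0"
 then have "(\<Sum>i<c. cscale (\<phi> i v) (e i)) = 0" by(intro sum.neutral) (auto simp: fun_eq_iff)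
 then show "v : U" using dec[OF v(1)] by simp
qed (use \<phi>_U in auto)

lemma same_line:
 assumes "x : V - U" "y : V - U" "line_mod U x = line_mod U y"
 obtains k where "k ~= 0" "!!i. \<phi> i x = k * \<phi> i y" "x - cscale k y : U"
proof -
 obtain k where k: "k ~= 0" "x - cscale k y : U" using line_mod_eq_iff[OF U] assms by(metis DiffD2)
 have "\<phi> i x = k * \<phi> i y" for i
  using \<phi>_U[OF k(2), of i] assms by(simp add: \<phi>_diff \<phi>_scale scale_in)
 then show thesis using that k by blast
qed

lemma sat_pattern:
 assumes "!!x y k. x : V ==> y : V ==> k ~= 0 ==> (!!i. \<phi> i x = k * \<phi> i y) ==> P y ==> P x"
 shows "sat {v : V - U. P v}"
 unfolding sat_def
proof (intro conjI subset_antisym)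
 show "{x : V - U. line_mod U x : line_mod U ` {v : V - U. P v}} <= {v : V - U. P v}"
 proof
  fix x assume "x : {x : V - U. line_mod U x : line_mod U ` {v : V - U. P v}}"
  then obtain v where v: "x : V - U" "v : V - U" "P v" "line_mod U x = line_mod U v" by auto
  obtain k where "k ~= 0" "!!i. \<phi> i x = k * \<phi> i v" using same_line[OF v(1,2,4)] by metis
  then show "x : {v : V - U. P v}" using assms[of x v k] v by auto
 qed
qed auto

lemma open_quotient_L: "sat A ==> open_quotient (top_of_set A) (L A) (line_mod U)"
 using open_quotient_restrict[OF open_quotient_line_mod[OF V U UV], of A]
 by(auto simp: sat_def L_def subtopology_subtopology Int_absorb1)

lemma rep: "v : V - U ==> rep (line_mod U v) : V - U & line_mod U (rep (line_mod U v)) = line_mod U v"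
 unfolding rep_def by(rule someI2[of _ v]) auto

lemma rep_sat:
 assumes A: "sat A" and v: "v : A"
 shows "rep (line_mod U v) : A"
proof -
 have "rep (line_mod U v) : {x : V - U. line_mod U x : line_mod U ` A}"
  using rep[of v] A v by(auto simp: sat_def)
 also have "... = A" using A unfolding sat_def by(rule conjunct2)
 finally show ?thesis .
qed

lemma rep_props:
 assumes "v : V - U"
 obtains k where "k ~= 0" "!!i. \<phi> i (rep (line_mod U v)) = k * \<phi> i v" "rep (line_mod U v) - cscale k v : U"
 using same_line[of "rep (line_mod U v)" v] rep[OF assms] assms by metis

lemma topspace_L: "sat A ==> topspace (L A) = line_mod U ` A"
 using open_quotient_L by(auto simp: open_quotient_def)

lemma continuous_map_line:
 assumes A: "sat A" and f: "!!i. cmap X euclidean (%x. f x i)" "!!x. x : topspace X ==> f x : A"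
 shows "cmap X (L A) (%x. line_mod U (f x))"
proof -
 have "cmap X (top_of_set A) f"
  using f by(auto simp: continuous_map_in_subtopology continuous_map_fun_iff)
 then show ?thesis using open_quotient_L[OF A] continuous_map_compose[of X "top_of_set A" f "L A" "line_mod U"]
  by(simp add: open_quotient_def o_def)
qed

lemma continuous_map_\<phi>:
 assumes "!!i. cmap X euclidean (%x. f x i)" "!!x. x : topspace X ==> f x : V"
 shows "cmap X euclidean (%x. \<phi> i (f x))"
proof -
 have "cmap X (top_of_set V) f"
  using assms by(auto simp: continuous_map_in_subtopology continuous_map_fun_iff)
 moreover have "cmap (top_of_set V) euclidean (\<phi> i)" using \<phi>_cont by simp
 ultimately show ?thesis using continuous_map_compose[of X "top_of_set V" f euclidean "\<phi> i"] by(simp add: o_def)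
qed

text \<open>Linear projection away from \<open>e j\<close>, carried out gradually as
  \<open>t\<close> runs from 0 to 1.\<close>

definition slide :: "nat => real => (nat => complex) => nat => complex" where
 "slide j t v = v - cscale (of_real t * \<phi> j v) (e j)"

lemma slide_in: "j < c ==> v : V ==> slide j t v : V"
 by(simp add: slide_def diff_in scale_in e_in)

lemma \<phi>_slide: "j < c ==> i < c ==> v : V ==> \<phi> i (slide j t v) = (if i = j then (1 - of_real t) * \<phi> j v else \<phi> i v)"
 by(simp add: slide_def \<phi>_diff scale_in e_in \<phi>_scale \<phi>_e algebra_simps)

lemma slide_line:
 assumes "j < c" "v : V - U"
 shows "line_mod U (slide j t (rep (line_mod U v))) = line_mod U (slide j t v)"
proof -
 obtain k where k: "k ~= 0" "!!i. \<phi> i (rep (line_mod U v)) = k * \<phi> i v" "rep (line_mod U v) - cscale k v : U"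
  using rep_props[OF assms(2)] by metis
 have "slide j t (rep (line_mod U v)) - cscale k (slide j t v) = rep (line_mod U v) - cscale k v"
  unfolding slide_def k(2) by(simp add: fun_eq_iff algebra_simps)
 then show ?thesis using line_mod_eq[OF U _ k(1)] k(3) by metis
qed

lemma continuous_slide:
 assumes "!!i. cmap X euclidean (%x. f x i)" "!!x. x : topspace X ==> f x : V" "cmap X euclidean t"
 shows "cmap X euclidean (%x. slide j (t x) (f x) i)"
 unfolding slide_def
 by(simp, intro continuous_map_diff continuous_map_mult continuous_map_of_real continuous_map_\<phi> assms) auto

text \<open>On lines this is P^j without the point spanned by \<open>e j\<close>;
  \<open>cell j\<close> below is the affine chart around that point.\<close>

definition S_set :: "nat => (nat => complex) set" where
 "S_set j = {v : V - U. v : W (Suc j) & (EX i<j. \<phi> i v ~= 0)}"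

definition cell :: "nat => (nat => complex) set" where
 "cell j = {v : V - U. v : W (Suc j) & \<phi> j v ~= 0}"

lemma sat_W: "sat (W j - U)"
proof -
 have "W j - U = {v : V - U. v : W j}" by(auto simp: W_def)
 then show ?thesis using sat_pattern[of "%v. v : W j"] by(auto simp: W_def)
qed

lemma sat_S: "sat (S_set j)"
 unfolding S_set_def by(rule sat_pattern) (auto simp: W_def)

lemma sat_cell: "sat (cell j)"
 unfolding cell_def by(rule sat_pattern) (auto simp: W_def)

lemma W_S: "j < c ==> W j - U <= S_set j"
proof
 fix v assume j: "j < c" and v: "v : W j - U"
 then obtain i where i: "i < c" "\<phi> i v ~= 0" using in_U_iff by(auto simp: W_def)
 then have "i < j" using v by(auto simp: W_def not_le[symmetric])
 with v i show "v : S_set j" by(auto simp: S_set_def W_def)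
qed

lemma coords:
 shows "cmap (prod_top Z (top_of_set A)) euclidean (%z. (snd z :: nat => complex) i)"
  "cmap (prod_top I (prod_top Z (top_of_set A))) euclidean (%z. (snd (snd z) :: nat => complex) i)"
  "cmap (prod_top I (prod_top Z (top_of_set A))) Z (%z. fst (snd z))"
 using continuous_map_snd[of Z "top_of_set A"] continuous_map_compose[OF continuous_map_snd[of I "prod_top Z (top_of_set A)"] continuous_map_snd]
  continuous_map_compose[OF continuous_map_snd[of I "prod_top Z (top_of_set A)"] continuous_map_fst]
 by(auto simp: continuous_map_in_subtopology continuous_map_fun_iff o_def)

text \<open>Projection from the point spanned by \<open>e j\<close> retracts the punctured P^j onto
  the hyperplane P^(j-1); the factor \<open>Z\<close> is carried along unchanged.\<close>

lemma punctured_retract: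
 assumes j: "j < c"
 shows "hom_induced p (prod_top Z (L (S_set j))) {} (prod_top Z (L (W j - U))) {} (%z. (fst z, line_mod U (slide j 1 (rep (snd z)))))
  : iso (homol p (prod_top Z (L (S_set j)))) (homol p (prod_top Z (L (W j - U))))"
  and "cmap (prod_top Z (L (S_set j))) (prod_top Z (L (W j - U))) (%z. (fst z, line_mod U (slide j 1 (rep (snd z)))))"
proof -
 have Ssub: "S_set j <= V - U" by(auto simp: S_set_def)
 have sl: "slide j t v : S_set j" if vS: "v : S_set j" for t v
 proof -
  have v: "v : V" "v : W (Suc j)" using vS by(auto simp: S_set_def)
  obtain i where i: "i < j" "\<phi> i v ~= 0" using vS by(auto simp: S_set_def)
  have "\<phi> i (slide j t v) ~= 0" using i j v by(simp add: \<phi>_slide)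
  moreover have "slide j t v : V" by(rule slide_in[OF j v(1)])
  moreover have "slide j t v ~: U" using calculation \<phi>_U by blast
  moreover have "slide j t v : W (Suc j)" using v j calculation(2) by(auto simp: W_def \<phi>_slide)
  ultimately show ?thesis using i by(auto simp: S_set_def)
 qed
 have sl1: "slide j 1 v : W j - U" if "v : S_set j" for v
 proof -
  have "slide j 1 v : S_set j" by(rule sl[OF that])
  moreover have "\<phi> j (slide j 1 v) = 0" using that j by(simp add: \<phi>_slide S_set_def)
  ultimately have *: "\<phi> i (slide j 1 v) = 0" if "j <= i" "i < c" for i
   using that by(cases "i = j") (auto simp: S_set_def W_def)
  show ?thesis using \<open>slide j 1 v : S_set j\<close> * by(auto simp: S_set_def W_def)
 qed
 let ?r = "%z. (fst z, line_mod U (slide j 1 (rep (snd z))))"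
 let ?XS = "prod_top Z (L (S_set j))" and ?XW = "prod_top Z (L (W j - U))"
 show cont: "cmap ?XS ?XW ?r"
 proof (rule open_quotient_lift[OF open_quotient_prod[OF open_quotient_L[OF sat_S]]])
  have "cmap (prod_top Z (top_of_set (S_set j))) ?XW (%z. (fst z, line_mod U (slide j 1 (snd z))))"
   using sl1 Ssub by(intro continuous_map_pairedI continuous_map_fst continuous_map_line sat_W continuous_slide)
     (auto intro: coords)
  then show "cmap (prod_top Z (top_of_set (S_set j))) ?XW (%z. ?r (fst z, line_mod U (snd z)))"
   by(rule continuous_map_eq) (use Ssub slide_line[OF j] in auto)
 qed
 have repS: "line_mod U (rep l) = l" if "l : topspace (L A)" "sat A" for l A
  using that rep by(auto simp: topspace_L sat_def)
 have incl: "cmap ?XW ?XS id"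
 proof -
  have "line_mod U ` (W j - U) <= line_mod U ` S_set j" using W_S[OF j] by blast
  then have "L (W j - U) = subtop (L (S_set j)) (line_mod U ` (W j - U))"
   by(simp add: L_def subtopology_subtopology Int_absorb1)
  then have "?XW = subtop ?XS (topspace Z \<times> line_mod U ` (W j - U))" by(simp add: prod_topology_subtopology)
  then show ?thesis by(simp add: continuous_map_from_subtopology)
 qed
 show "hom_induced p ?XS {} ?XW {} ?r : iso (homol p ?XS) (homol p ?XW)"
 proof (rule homotopy_equivalence_homology_group_isomorphism[OF cont incl])
  show "homotopic_with (%h. True) ?XS ?XS (id \<circ> ?r) id"
  proof (subst homotopic_with_sym, rule homotopic_with_trueI[where h = "%t z. (fst z, line_mod U (slide j t (rep (snd z))))"])
   show "cmap (prod_top (top_of_set {0..1}) ?XS) ?XS (%z. (fst (snd z), line_mod U (slide j (fst z) (rep (snd (snd z))))))"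
   proof (rule open_quotient_lift[OF open_quotient_prod[OF open_quotient_prod[OF open_quotient_L[OF sat_S]]]])
    have "cmap (prod_top (top_of_set {0..1}) (prod_top Z (top_of_set (S_set j)))) ?XS
      (%z. (fst (snd z), line_mod U (slide j (fst z) (snd (snd z)))))"
     using sl Ssub by(intro continuous_map_pairedI continuous_map_line sat_S continuous_slide coords time_coord) auto
    then show "cmap (prod_top (top_of_set {0..1}) (prod_top Z (top_of_set (S_set j)))) ?XS
      (%z. (%z. (fst (snd z), line_mod U (slide j (fst z) (rep (snd (snd z))))))
       (fst z, (fst (snd z), line_mod U (snd (snd z)))))"
     by(rule continuous_map_eq) (use Ssub slide_line[OF j] in auto)
   qed
   show "(fst z, line_mod U (slide j 0 (rep (snd z)))) = id z" if "z : topspace ?XS" for z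
   proof -
    have "slide j 0 v = v" for v by(simp add: slide_def fun_eq_iff)
    then show ?thesis using repS[OF _ sat_S, of "snd z" j] that by(auto simp: prod_eq_iff)
   qed
  qed auto
  show "homotopic_with (%h. True) ?XW ?XW (?r \<circ> id) id"
  proof (rule homotopic_with_equal)
   show "cmap ?XW ?XW (?r \<circ> id)" using incl cont by(rule continuous_map_compose)
   show "(?r \<circ> id) z = id z" if z: "z : topspace ?XW" for z
   proof -
    obtain v where v: "snd z = line_mod U v" "v : W j - U" using z by(auto simp: topspace_L[OF sat_W])
    have "rep (snd z) : W j - U" using rep_sat[OF sat_W v(2)] v(1) by simp
    then have "\<phi> j (rep (snd z)) = 0" using j by(auto simp: W_def)
    then have "slide j 1 (rep (snd z)) = rep (snd z)" by(simp add: slide_def fun_eq_iff)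
    then show ?thesis using repS[OF _ sat_W, of "snd z" j] z by(auto simp: prod_eq_iff)
   qed
  qed auto
 qed
qed

text \<open>Affine coordinates of a line in the cell, with real parts at even and imaginary parts at
  odd positions; \<open>unchart\<close> normalises the j-th coordinate to 1.\<close>

definition chart :: "nat => (nat => complex) => nat => real" where
 "chart j v = (%n. if n < 2 * j then (if even n then Re else Im) (\<phi> (n div 2) v / \<phi> j v) else 0)"

definition unchart :: "nat => (nat => real) => nat => complex" where
 "unchart j x = e j + (\<Sum>i<j. cscale (Complex (x (2 * i)) (x (2 * i + 1))) (e i))"

lemma chart_line: "v : V - U ==> chart j (rep (line_mod U v)) = chart j v"
 by(rule rep_props, assumption) (simp add: chart_def fun_eq_iff)

lemma \<phi>_unchart:
 assumes "j < c" "i < c"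
 shows "\<phi> i (unchart j x) = (if i < j then Complex (x (2 * i)) (x (2 * i + 1)) else if i = j then 1 else 0)"
proof -
 have "\<phi> i (unchart j x) = \<phi> i (e j) + \<phi> i (\<Sum>i<j. cscale (Complex (x (2 * i)) (x (2 * i + 1))) (e i))"
  unfolding unchart_def using assms by(intro \<phi>_add sum_in e_in) auto
 also have "\<phi> i (\<Sum>i<j. cscale (Complex (x (2 * i)) (x (2 * i + 1))) (e i)) = (if i < j then Complex (x (2 * i)) (x (2 * i + 1)) else 0)"
  using assms by(intro \<phi>_sum) auto
 finally show ?thesis using assms by(auto simp: \<phi>_e)
qed

lemma unchart_cell:
 assumes j: "j < c"
 shows "unchart j x : cell j"
proof -
 have V: "unchart j x : V" unfolding unchart_def using j by(intro cfun.subspace_add[OF V] sum_in e_in) auto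
 moreover have "\<phi> j (unchart j x) = 1" using \<phi>_unchart[OF j j] by simp
 moreover have "unchart j x ~: U" using calculation(2) \<phi>_U by fastforce
 ultimately show ?thesis using j by(auto simp: cell_def W_def \<phi>_unchart)
qed

lemma chart_unchart:
 assumes j: "j < c" and x: "x : rspace (2 * j)"
 shows "chart j (unchart j x) = x"
proof
 fix n
 have 1: "\<phi> j (unchart j x) = 1" using \<phi>_unchart[OF j j] by simp
 show "chart j (unchart j x) n = x n"
 proof (cases "n < 2 * j")
  case True
  then have n: "n div 2 < j" by auto
  then have *: "\<phi> (n div 2) (unchart j x) = Complex (x (2 * (n div 2))) (x (2 * (n div 2) + 1))"
   using \<phi>_unchart[OF j, of "n div 2" x] j by simp
  show ?thesis
  proof (cases "even n")
   case True
   then have "2 * (n div 2) = n" by simp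
   then show ?thesis using * 1 \<open>n < 2 * j\<close> True by(simp add: chart_def)
  next
   case False
   then have "2 * (n div 2) + 1 = n" by(metis odd_two_times_div_two_succ)
   then show ?thesis using * 1 \<open>n < 2 * j\<close> False by(simp add: chart_def)
  qed
 next
  case False
  then show ?thesis using x by(simp add: chart_def rspace_def)
 qed
qed

lemma unchart_chart:
 assumes j: "j < c" and v: "v : cell j"
 shows "line_mod U (unchart j (chart j v)) = line_mod U v"
proof -
 let ?u = "unchart j (chart j v)" and ?k = "1 / \<phi> j v"
 have vV: "v : V" "\<phi> j v ~= 0" "v : W (Suc j)" using v by(auto simp: cell_def)
 have uV: "?u : V" using unchart_cell[OF j] by(auto simp: cell_def)
 have "\<phi> i (?u - cscale ?k v) = 0" if i: "i < c" for i
 proof -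
  have "\<phi> i ?u = ?k * \<phi> i v"
  proof (cases "i < j")
   case True
   then have "\<phi> i ?u = Complex (chart j v (2 * i)) (chart j v (2 * i + 1))" using \<phi>_unchart[OF j i] by simp
   also have "... = \<phi> i v / \<phi> j v" using True by(auto simp: chart_def)
   finally show ?thesis by simp
  next
   case False
   then show ?thesis using \<phi>_unchart[OF j i, of "chart j v"] vV i by(auto simp: W_def)
  qed
  then show ?thesis using uV vV by(simp add: \<phi>_diff \<phi>_scale scale_in)
 qed
 moreover have "?u - cscale ?k v : V" by(rule diff_in[OF uV scale_in[OF vV(1)]])
 ultimately have "?u - cscale ?k v : U" using in_U_iff by blast
 then show ?thesis using vV line_mod_eq[OF U, of ?u ?k v] by auto
qed

lemma chart_homeomorphic:
 assumes j: "j < c"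
 shows "homeomorphic_maps (prod_top Z (L (cell j))) (prod_top Z (top_of_set (rspace (2 * j))))
  (%z. (fst z, chart j (rep (snd z)))) (%z. (fst z, line_mod U (unchart j (snd z))))"
proof -
 have cV: "cell j <= V - U" by(auto simp: cell_def)
 have cr: "chart j v : rspace (2 * j)" for v by(auto simp: chart_def rspace_def)
 have "cmap (prod_top Z (L (cell j))) (prod_top Z (top_of_set (rspace (2 * j)))) (%z. (fst z, chart j (rep (snd z))))"
 proof (rule open_quotient_lift[OF open_quotient_prod[OF open_quotient_L[OF sat_cell]]])
  have "cmap (prod_top Z (top_of_set (cell j))) (prod_top Z (top_of_set (rspace (2 * j)))) (%z. (fst z, chart j (snd z)))"
  proof (rule continuous_map_prod_rspace)
   have \<phi>c: "cmap (prod_top Z (top_of_set (cell j))) euclidean (%z. \<phi> i (snd z) / \<phi> j (snd z))" for i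
    using cV by(intro continuous_map_divide continuous_map_\<phi> coords) (auto simp: cell_def)
   have "cmap (prod_top Z (top_of_set (cell j))) euclidean (%z. Re (\<phi> i (snd z) / \<phi> j (snd z)))"
    "cmap (prod_top Z (top_of_set (cell j))) euclidean (%z. Im (\<phi> i (snd z) / \<phi> j (snd z)))" for i
    using \<phi>c[of i] by(simp_all add: continuous_map_atin tendsto_Re tendsto_Im)
   then show "cmap (prod_top Z (top_of_set (cell j))) euclidean (%z. snd (fst z, chart j (snd z)) n)" for n
    by(cases "n < 2 * j"; cases "even n") (simp_all add: chart_def)
  qed (auto simp: continuous_map_fst cr)
  then show "cmap (prod_top Z (top_of_set (cell j))) (prod_top Z (top_of_set (rspace (2 * j))))
    (%z. (%z. (fst z, chart j (rep (snd z)))) (fst z, line_mod U (snd z)))"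
   by(rule continuous_map_eq) (use cV chart_line in auto)
 qed
 moreover have "cmap (prod_top Z (top_of_set (rspace (2 * j)))) (prod_top Z (L (cell j))) (%z. (fst z, line_mod U (unchart j (snd z))))"
 proof (intro continuous_map_pairedI continuous_map_fst continuous_map_line sat_cell unchart_cell[OF j])
  fix n
  have rc: "cmap (prod_top Z (top_of_set (rspace (2 * j)))) euclidean (%z. snd z i)" for i
   using continuous_map_snd[of Z "top_of_set (rspace (2 * j))"] by(auto simp: continuous_map_in_subtopology continuous_map_fun_iff o_def)
  have "cmap (prod_top Z (top_of_set (rspace (2 * j)))) euclidean (%z. Complex (snd z (2 * i)) (snd z (2 * i + 1)))" for i
   using rc by(simp add: continuous_map_atin tendsto_Complex)
  then have "cmap (prod_top Z (top_of_set (rspace (2 * j)))) euclidean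
    (%z. e j n + (\<Sum>i<j. Complex (snd z (2 * i)) (snd z (2 * i + 1)) * e i n))"
   by(intro continuous_map_add continuous_map_sum continuous_map_mult) auto
  moreover have "unchart j x n = e j n + (\<Sum>i<j. Complex (x (2 * i)) (x (2 * i + 1)) * e i n)" for x
  proof -
   have "(\<Sum>i<m. cscale (k i) (e i)) n = (\<Sum>i<m. k i * e i n)" for m k by(induction m) auto
   then show ?thesis by(simp add: unchart_def)
  qed
  ultimately show "cmap (prod_top Z (top_of_set (rspace (2 * j)))) euclidean (%z. unchart j (snd z) n)" by simp
 qed
 moreover have "line_mod U (unchart j (chart j (rep l))) = l" if l: "l : topspace (L (cell j))" for l
 proof -
  obtain v where v: "l = line_mod U v" "v : cell j" using l by(auto simp: topspace_L[OF sat_cell])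
  then show ?thesis using unchart_chart[OF j v(2)] chart_line[of v j] cV by auto
 qed
 moreover have "chart j (rep (line_mod U (unchart j x))) = x" if "x : rspace (2 * j)" for x
  using chart_line[of "unchart j x" j] unchart_cell[OF j, of x] cV chart_unchart[OF j that] by auto
 ultimately show ?thesis by(auto simp: homeomorphic_maps_def)
qed

text \<open>Excising the hyperplane P^(j-1) from the pair of P^j and its puncture leaves the affine
  cell C^j relative to its own puncture, to which the Thom isomorphism applies.\<close>

lemma relative_cell:
 assumes j: "j < c" and b: "even_free Z b"
 shows "free_rank (rel_homol p (prod_top Z (L (W (Suc j) - U))) (topspace Z \<times> line_mod U ` S_set j))
  (evrank (%i. if i >= j then b (i - j) else 0) p)"
proof -
 let ?X = "prod_top Z (L (W (Suc j) - U))"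
 let ?S = "topspace Z \<times> line_mod U ` S_set j" and ?N = "topspace Z \<times> line_mod U ` (W j - U)"
 have sub: "A <= V - U" if "sat A" for A using that by(simp add: sat_def)
 have q: "open_quotient (prod_top Z (top_of_set (W (Suc j) - U))) ?X (%z. (fst z, line_mod U (snd z)))"
  by(intro open_quotient_prod open_quotient_L sat_W)
 have WV: "W (Suc j) - U <= V - U" by(auto simp: W_def)
 have line_mem: "line_mod U v : line_mod U ` A \<longleftrightarrow> v : A" if "sat A" "v : V - U" for v A
  using that by(auto simp: sat_def)
 have cphi: "cmap (prod_top Z (top_of_set (W (Suc j) - U))) euclidean (%z. \<phi> i (snd z))" for i
  using WV by(intro continuous_map_\<phi> coords) auto
 have openq: "openin ?X (topspace Z \<times> line_mod U ` A)"
  if A: "sat A" "A <= W (Suc j) - U" and o: "openin (prod_top Z (top_of_set (W (Suc j) - U))) (topspace Z \<times> A)" for A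
 proof -
  have "openin ?X ((%z. (fst z, line_mod U (snd z))) ` (topspace Z \<times> A))"
   using q o by(auto simp: open_quotient_def open_map_def)
  also have "(%z. (fst z, line_mod U (snd z))) ` (topspace Z \<times> A) = topspace Z \<times> line_mod U ` A" by force
  finally show ?thesis .
 qed
 have opS: "openin ?X ?S"
 proof (rule openq[OF sat_S])
  show "S_set j <= W (Suc j) - U" by(auto simp: S_set_def)
  have "topspace Z \<times> S_set j = (\<Union>i\<in>{..<j}. {z : topspace (prod_top Z (top_of_set (W (Suc j) - U))). \<phi> i (snd z) : - {0}})"
   by(auto simp: S_set_def W_def)
  also have "openin (prod_top Z (top_of_set (W (Suc j) - U))) ..."
  proof (rule openin_Union, elim imageE, simp only:)
   show "openin (prod_top Z (top_of_set (W (Suc j) - U))) {z : topspace (prod_top Z (top_of_set (W (Suc j) - U))). \<phi> i (snd z) : - {0}}" for i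
    by(rule openin_continuous_map_preimage[OF cphi]) (simp add: open_Compl)
  qed
  finally show "openin (prod_top Z (top_of_set (W (Suc j) - U))) (topspace Z \<times> S_set j)" .
 qed
 have opC: "openin ?X (topspace Z \<times> line_mod U ` cell j)"
 proof (rule openq[OF sat_cell])
  show "cell j <= W (Suc j) - U" by(auto simp: cell_def)
  have "topspace Z \<times> cell j = {z : topspace (prod_top Z (top_of_set (W (Suc j) - U))). \<phi> j (snd z) : - {0}}"
   by(auto simp: cell_def W_def)
  also have "openin (prod_top Z (top_of_set (W (Suc j) - U))) ..."
   by(rule openin_continuous_map_preimage[OF cphi]) (simp add: open_Compl)
  finally show "openin (prod_top Z (top_of_set (W (Suc j) - U))) (topspace Z \<times> cell j)" .
 qed
 have WX: "topspace ?X = topspace Z \<times> line_mod U ` (W (Suc j) - U)" by(simp add: topspace_L[OF sat_W])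
 have compl: "topspace ?X - ?N = topspace Z \<times> line_mod U ` cell j"
 proof -
  have "line_mod U v ~: line_mod U ` (W j - U) \<longleftrightarrow> line_mod U v : line_mod U ` cell j" if "v : W (Suc j) - U" for v
  proof -
   have v: "v : V - U" using that by(auto simp: W_def)
   have "v ~: W j \<longleftrightarrow> \<phi> j v ~= 0" using that j by(auto simp: W_def) (metis le_antisym not_less_eq_eq)
   then show ?thesis using line_mem[OF sat_W v, of j] line_mem[OF sat_cell v, of j] that v by(auto simp: cell_def)
  qed
  moreover have "cell j <= W (Suc j) - U" by(auto simp: cell_def)
  ultimately show ?thesis unfolding WX by(auto simp: image_iff) (blast | metis subsetD)+
 qed
 have NX: "?N <= topspace ?X" unfolding WX by(auto simp: W_def)
 have clN: "closedin ?X ?N"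
  using opC NX compl by(simp add: closedin_def)
 have NS: "?N <= ?S" using W_S[OF j] by auto
 have iso1: "rel_homol p (subtop ?X (topspace ?X - ?N)) (?S - ?N) \<cong> rel_homol p ?X ?S"
 proof -
  have "hom_induced p (subtop ?X (topspace ?X - ?N)) (?S - ?N) (subtop ?X (topspace ?X)) ?S id
   : iso (rel_homol p (subtop ?X (topspace ?X - ?N)) (?S - ?N)) (rel_homol p (subtop ?X (topspace ?X)) ?S)"
   by(rule homology_excision_axiom) (use clN opS NS openin_subset[OF opS] in \<open>simp_all add: closure_of_closedin interior_of_openin\<close>)
  then show ?thesis unfolding subtopology_topspace by(rule is_isoI)
 qed
 have cellX: "subtop ?X (topspace ?X - ?N) = prod_top Z (L (cell j))"
 proof -
  have "line_mod U ` cell j <= line_mod U ` (W (Suc j) - U)" by(auto simp: cell_def)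
  then have "L (cell j) = subtop (L (W (Suc j) - U)) (line_mod U ` cell j)"
   by(simp add: L_def subtopology_subtopology Int_absorb1)
  then show ?thesis unfolding compl by(simp add: prod_topology_subtopology)
 qed
 let ?f = "%z. (fst z, chart j (rep (snd z)))" and ?h = "%z. (fst z, line_mod U (unchart j (snd z)))"
 have SN: "?S - ?N = topspace Z \<times> line_mod U ` {v : cell j. EX i<j. \<phi> i v ~= 0}"
 proof -
  have "line_mod U v : line_mod U ` S_set j & line_mod U v ~: line_mod U ` (W j - U) \<longleftrightarrow> v : {v : cell j. EX i<j. \<phi> i v ~= 0}"
   if "v : V - U" for v
   unfolding line_mem[OF sat_S that] line_mem[OF sat_W that]
   using j by(auto simp: S_set_def cell_def W_def) (metis le_antisym not_less_eq_eq)+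
  then show ?thesis using sub[OF sat_S, of j] sub[OF sat_cell, of j]
   by(auto simp: image_iff) (blast | metis (no_types, lifting) DiffE image_eqI mem_Collect_eq subsetD)+
 qed
 have "rel_homol p (prod_top Z (L (cell j))) (?S - ?N) \<cong>
   rel_homol p (prod_top Z (top_of_set (rspace (2 * j)))) (topspace Z \<times> (rspace (2 * j) - {0}))"
 proof -
  have z: "chart j v = 0 \<longleftrightarrow> (ALL i<j. \<phi> i v = 0)" if v: "v : cell j" for v
  proof
   assume 0: "chart j v = 0"
   show "ALL i<j. \<phi> i v = 0"
   proof (intro allI impI)
    fix i assume "i < j"
    then have "Re (\<phi> i v / \<phi> j v) = 0" "Im (\<phi> i v / \<phi> j v) = 0"
     using fun_cong[OF 0, of "2 * i"] fun_cong[OF 0, of "2 * i + 1"] by(simp_all add: chart_def)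
    then have "\<phi> i v / \<phi> j v = 0" by(simp only: complex_eq_iff zero_complex.sel)
    then show "\<phi> i v = 0" using v by(simp add: cell_def)
   qed
  next
   assume 0: "ALL i<j. \<phi> i v = 0"
   have "n div 2 < j" if "n < 2 * j" for n using that by auto
   then show "chart j v = 0" using 0 by(auto simp: chart_def fun_eq_iff)
  qed
  have f1: "?f : ?S - ?N \<rightarrow> topspace Z \<times> (rspace (2 * j) - {0})"
  proof -
   have "chart j v : rspace (2 * j)" for v by(auto simp: chart_def rspace_def)
   then show ?thesis unfolding SN using z chart_line sub[OF sat_cell, of j] by fastforce
  qed
  have f2: "?h : topspace Z \<times> (rspace (2 * j) - {0}) \<rightarrow> ?S - ?N"
  proof -
   have "EX i<j. \<phi> i (unchart j x) ~= 0" if "x : rspace (2 * j) - {0}" for x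
   proof -
    have "chart j (unchart j x) ~= 0" using chart_unchart[OF j, of x] that by(metis DiffE singletonI)
    then show ?thesis unfolding z[OF unchart_cell[OF j]] by blast
   qed
   then show ?thesis unfolding SN using unchart_cell[OF j] by auto
  qed
  show ?thesis
   using homeomorphic_maps_relative_homology_group_isomorphisms[OF chart_homeomorphic[OF j] f1 f2, of p]
    group_isomorphisms_imp_iso is_isoI by blast
 qed
 then have "rel_homol p ?X ?S \<cong> rel_homol p (prod_top Z (top_of_set (rspace (2 * j)))) (topspace Z \<times> (rspace (2 * j) - {0}))"
  using iso1 unfolding cellX by(meson group.iso_sym group_relative_homology_group iso_trans)
 then show ?thesis
  using thom_free_rank[OF b, of p j] by(meson free_rank_is_iso group.iso_sym group_relative_homology_group)
qed

text \<open>P^(c-1) is built from a point by adding one cell of each complex dimension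
  \<open>d\<close> from 1 to \<open>c - 1\<close>, and each cell contributes the Betti numbers of
  \<open>Z\<close> moved up by \<open>d\<close>. The point itself reproduces \<open>Z\<close> and
  adds nothing to the kernel, which is why \<open>d = 0\<close> is absent.\<close>

theorem projective_bundle_even:
 assumes b: "even_free Z b" and c: "c > 0"
 shows "even_kernel (prod_top Z (proj_quotient V U)) Z fst (%i. \<Sum>d\<in>{1..<c}. if d <= i then b (i - d) else 0)"
proof -
 have "even_kernel (prod_top Z (L (W m - U))) Z fst (%i. \<Sum>d\<in>{1..<m}. if d <= i then b (i - d) else 0)"
  if "1 <= m" "m <= c" for m
  using that
 proof (induction m rule: dec_induct)
  case base
  have e0: "e 0 : W 1 - U" using c e_in[of 0] \<phi>_U[of "e 0" 0] \<phi>_e[of _ 0] by(auto simp: W_def)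
  have "line_mod U v = line_mod U (e 0)" if v: "v : W 1 - U" for v
  proof (rule line_mod_eq[OF U])
   have vV: "v : V" using v by(simp add: W_def)
   have "v - cscale (\<phi> 0 v) (e 0) : V" using vV e_in[OF c] by(intro diff_in scale_in)
   moreover have "\<phi> i (v - cscale (\<phi> 0 v) (e 0)) = 0" if "i < c" for i
    using that v vV e_in[OF c] c by(auto simp: \<phi>_diff scale_in \<phi>_scale \<phi>_e W_def Suc_le_eq)
   ultimately show "v - cscale (\<phi> 0 v) (e 0) : U" using in_U_iff by blast
   show "\<phi> 0 v ~= 0"
   proof
    assume "\<phi> 0 v = 0"
    then have "ALL i<c. \<phi> i v = 0" using v by(auto simp: W_def Suc_le_eq) (metis gr0I)
    then show False using in_U_iff[OF vV] v by blast
   qed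
  qed
  then have "line_mod U ` (W 1 - U) = {line_mod U (e 0)}" using e0 by blast
  then have 1: "L (W 1 - U) = subtop (proj_quotient V U) {line_mod U (e 0)}" by(simp add: L_def)
  have e0V: "e 0 : V - U" using e0 by(auto simp: W_def)
  have "homeomorphic_map (prod_top Z (L (W 1 - U))) Z fst"
  proof (rule homeomorphic_maps_imp_map)
   show "homeomorphic_maps (prod_top Z (L (W 1 - U))) Z fst (%z. (z, line_mod U (e 0)))"
    unfolding 1 homeomorphic_maps_def using e0V
    by(auto simp: continuous_map_fst continuous_map_paired continuous_map_in_subtopology)
  qed
  then show ?case using even_kernel_homeomorphic by auto
 next
  case (step m)
  let ?X = "prod_top Z (L (W (Suc m) - U))"
  let ?S = "topspace Z \<times> line_mod U ` S_set m"
  have m: "m < c" using step by simp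
  have SX: "subtop ?X ?S = prod_top Z (L (S_set m))"
  proof -
   have "line_mod U ` S_set m <= line_mod U ` (W (Suc m) - U)" by(auto simp: S_set_def)
   then have "L (S_set m) = subtop (L (W (Suc m) - U)) (line_mod U ` S_set m)"
    by(simp add: L_def subtopology_subtopology Int_absorb1)
   then show ?thesis by(simp add: prod_topology_subtopology)
  qed
  have "even_kernel (subtop ?X ?S) Z fst (%i. \<Sum>d\<in>{1..<m}. if d <= i then b (i - d) else 0)"
   unfolding SX
   by(rule even_kernel_precompose[OF _ punctured_retract(2)[OF m] punctured_retract(1)[OF m]]) (use step m in auto)
  then have "even_kernel ?X Z fst (%i. (\<Sum>d\<in>{1..<m}. if d <= i then b (i - d) else 0) + (if i >= m then b (i - m) else 0))"
   by(rule even_kernel_adjoin[OF continuous_map_fst _ b relative_cell[OF m b]])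
  then show ?case using step by(simp add: sum.atLeastLessThan_Suc atLeastLessThanSuc add.commute)
 qed
 from this[of c] have "even_kernel (prod_top Z (L (W c - U))) Z fst (%i. \<Sum>d\<in>{1..<c}. if d <= i then b (i - d) else 0)"
  using c by simp
 moreover have "L (W c - U) = proj_quotient V U"
 proof -
  have "W c = V" by(auto simp: W_def)
  then show ?thesis unfolding L_def by(metis topspace_proj_quotient subtopology_topspace)
 qed
 ultimately show ?thesis by simp
qed

end

section \<open>Homology of a blow-up\<close>

lemma even_kernel_homotopic:
 assumes "even_kernel X' X f k" "homotopic_with (%_. True) X' X f f'"
 shows "even_kernel X' X f' k"
 using assms homology_homotopy_empty[OF assms(2)] homotopic_with_imp_continuous_maps[OF assms(2)]
 by(simp add: even_kernel_def)

text \<open>Time 0 is the retraction and time 1 the identity, the convention under which scaling by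
  \<open>t\<close> is such a homotopy.\<close>

lemma deformation_retract_iso:
 assumes h: "cmap (prod_top (top_of_set {0..1::real}) X) X (%z. h (fst z) (snd z))"
  and Z: "!!x. x : topspace X ==> h 0 x : Z" "!!x. x : topspace X ==> h 1 x = x"
   "!!z. z : topspace X Int Z ==> h 0 z = z"
 shows "cmap X (subtop X Z) (h 0)"
  and "hom_induced p X {} (subtop X Z) {} (h 0) : iso (homol p X) (homol p (subtop X Z))"
  and "hom_induced p (subtop X Z) {} X {} id : iso (homol p (subtop X Z)) (homol p X)"
  and "homotopic_with (%_. True) X X (h 0) id"
proof -
 have h0: "cmap X X (h 0)"
  using continuous_map_compose[OF _ h, of X "%x. (0, x)"] by(simp add: continuous_map_paired o_def)
 then show c: "cmap X (subtop X Z) (h 0)"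
  using Z(1) by(auto simp: continuous_map_in_subtopology)
 have i: "cmap (subtop X Z) X id" by(simp add: continuous_map_from_subtopology)
 show hom: "homotopic_with (%_. True) X X (h 0) id"
  by(rule homotopic_with_trueI[where h = h]) (use h Z(2) in auto)
 then have 1: "homotopic_with (%_. True) X X (id \<circ> h 0) id" by simp
 have 2: "homotopic_with (%_. True) (subtop X Z) (subtop X Z) (h 0 \<circ> id) id"
  by(rule homotopic_with_equal) (use Z(3) continuous_map_compose[OF i c] in auto)
 show "hom_induced p X {} (subtop X Z) {} (h 0) : iso (homol p X) (homol p (subtop X Z))"
  by(rule homotopy_equivalence_homology_group_isomorphism[OF c i 1 2])
 show "hom_induced p (subtop X Z) {} X {} id : iso (homol p (subtop X Z)) (homol p X)"
  by(rule homotopy_equivalence_homology_group_isomorphism[OF i c 2 1])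
qed

text \<open>Both relative groups can be computed off the centre: excising \<open>E\<close> and
  \<open>Z\<close> leaves pairs that the homeomorphism \<open>f\<close> identifies.\<close>

lemma excision_square:
 fixes X' :: "'a topology" and X :: "'b topology"
 assumes f: "cmap X' X f" and Z: "closedin X Z" and N: "openin X N" "Z <= N"
  and E: "E = {x : topspace X'. f x : Z}" and N': "N' = {x : topspace X'. f x : N}"
  and homeo: "homeomorphic_map (subtop X' (topspace X' - E)) (subtop X (topspace X - Z)) f"
 shows "hom_induced p X' N' X N f : iso (rel_homol p X' N') (rel_homol p X N)"
proof -
 have E': "closedin X' E" unfolding E using f Z by(rule closedin_continuous_map_preimage)
 have N'o: "openin X' N'" unfolding N' using f N(1) by(rule openin_continuous_map_preimage)
 have EN: "E <= N'" using N E N' by auto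
 have NX: "N <= topspace X" using openin_subset N(1) by blast
 have N'X: "N' <= topspace X'" using openin_subset N'o by blast
 have i: "hom_induced p (subtop X (topspace X - Z)) (N - Z) X N id
   : iso (rel_homol p (subtop X (topspace X - Z)) (N - Z)) (rel_homol p X N)"
  using homology_excision_axiom[of X Z N "topspace X" p] Z N NX by(simp add: closure_of_closedin interior_of_openin)
 have i': "hom_induced p (subtop X' (topspace X' - E)) (N' - E) X' N' id
   : iso (rel_homol p (subtop X' (topspace X' - E)) (N' - E)) (rel_homol p X' N')"
  using homology_excision_axiom[of X' E N' "topspace X'" p] E' N'o EN N'X by(simp add: closure_of_closedin interior_of_openin)
 have im: "f ` (N' - E) = N - Z"
 proof
  show "f ` (N' - E) <= N - Z" using N' E by auto
  show "N - Z <= f ` (N' - E)"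
  proof
   fix y assume y: "y : N - Z"
   have "f ` (topspace X' - E) = topspace X - Z"
    using homeomorphic_imp_surjective_map[OF homeo] by(simp add: Int_absorb1)
   then obtain x where "x : topspace X' - E" "y = f x" using y NX by blast
   then show "y : f ` (N' - E)" using y by(auto simp: N' E)
  qed
 qed
 have k: "hom_induced p (subtop X' (topspace X' - E)) (N' - E) (subtop X (topspace X - Z)) (N - Z) f
   : iso (rel_homol p (subtop X' (topspace X' - E)) (N' - E)) (rel_homol p (subtop X (topspace X - Z)) (N - Z))"
  by(rule homeomorphic_map_relative_homology_iso[OF homeo _ im]) (use N'X in auto)
 let ?i = "hom_induced p (subtop X (topspace X - Z)) (N - Z) X N id"
 let ?i' = "hom_induced p (subtop X' (topspace X' - E)) (N' - E) X' N' id"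
 let ?k = "hom_induced p (subtop X' (topspace X' - E)) (N' - E) (subtop X (topspace X - Z)) (N - Z) f"
 let ?f = "hom_induced p X' N' X N f"
 have ck: "cmap (subtop X' (topspace X' - E)) (subtop X (topspace X - Z)) f"
  using homeo homeomorphic_imp_continuous_map by blast
 have sq: "?f (?i' x) = ?i (?k x)" for x
 proof -
  have "?f \<circ> ?i' = hom_induced p (subtop X' (topspace X' - E)) (N' - E) X N (f \<circ> id)"
   by(rule hom_induced_compose[symmetric]) (use f N' in \<open>auto simp: continuous_map_from_subtopology\<close>)
  moreover have "?i \<circ> ?k = hom_induced p (subtop X' (topspace X' - E)) (N' - E) X N (id \<circ> f)"
   by(rule hom_induced_compose[symmetric]) (use ck N' E in \<open>auto simp: continuous_map_from_subtopology\<close>)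
  ultimately show ?thesis by(simp add: fun_eq_iff)
 qed
 have gi: "?i ` carrier (rel_homol p (subtop X (topspace X - Z)) (N - Z)) = carrier (rel_homol p X N)"
  "inj_on ?i (carrier (rel_homol p (subtop X (topspace X - Z)) (N - Z)))"
  "?i' ` carrier (rel_homol p (subtop X' (topspace X' - E)) (N' - E)) = carrier (rel_homol p X' N')"
  "?k ` carrier (rel_homol p (subtop X' (topspace X' - E)) (N' - E)) = carrier (rel_homol p (subtop X (topspace X - Z)) (N - Z))"
  "inj_on ?k (carrier (rel_homol p (subtop X' (topspace X' - E)) (N' - E)))"
  using i i' k by(auto simp: iso_def bij_betw_def)
 have "?f ` carrier (rel_homol p X' N') = carrier (rel_homol p X N)"
  unfolding gi(3)[symmetric] gi(1)[symmetric] gi(4)[symmetric] image_image sq ..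
 moreover have "inj_on ?f (carrier (rel_homol p X' N'))"
 proof (rule inj_onI)
  fix x y assume xy: "x : carrier (rel_homol p X' N')" "y : carrier (rel_homol p X' N')" "?f x = ?f y"
  then obtain a b where ab: "a : carrier (rel_homol p (subtop X' (topspace X' - E)) (N' - E))" "x = ?i' a"
   "b : carrier (rel_homol p (subtop X' (topspace X' - E)) (N' - E))" "y = ?i' b"
   unfolding gi(3)[symmetric] by blast
  then have "?i (?k a) = ?i (?k b)" using xy(3) sq by simp
  then have "?k a = ?k b" by(rule inj_onD[OF gi(2)]) (auto simp: hom_induced_carrier)
  then have "a = b" using gi(5) ab by(meson inj_onD)
  then show "x = y" using ab by simp
 qed
 ultimately show ?thesis by(auto simp: iso_def bij_betw_def hom_induced_hom)
qed

text \<open>Near the centre both spaces retract, onto \<open>E\<close> and \<open>Z\<close>, and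
  \<open>f\<close> respects the two retractions; so the kernel over \<open>N\<close> is the one over
  \<open>Z\<close>, and the ladder extends it to all of \<open>X\<close>.\<close>

theorem blow_up_even:
 fixes X' :: "'a topology" and X :: "'b topology"
 assumes X: "even_free X b"
  and f: "cmap X' X f" and Z: "closedin X Z" and N: "openin X N" "Z <= N"
  and E: "E = {x : topspace X'. f x : Z}" and N': "N' = {x : topspace X'. f x : N}"
  and homeo: "homeomorphic_map (subtop X' (topspace X' - E)) (subtop X (topspace X - Z)) f"
  and h: "cmap (prod_top (top_of_set {0..1::real}) (subtop X N)) (subtop X N) (%z. h (fst z) (snd z))"
   "!!x. x : N ==> h 0 x : Z" "!!x. x : N ==> h 1 x = x" "!!x. x : Z ==> h 0 x = x"
  and h': "cmap (prod_top (top_of_set {0..1::real}) (subtop X' N')) (subtop X' N') (%z. h' (fst z) (snd z))"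
   "!!x. x : N' ==> h' 1 x = x" "!!x. x : E ==> h' 0 x = x"
  and comm: "!!x. x : N' ==> f (h' 0 x) = h 0 (f x)"
  and k: "even_kernel (subtop X' E) (subtop X Z) f k"
 shows "even_free X' (%i. k i + b i)"
proof -
 have NX: "N <= topspace X" using openin_subset N(1) by blast
 have N'X: "N' <= topspace X'" using N' by auto
 have EN: "E <= N'" using N E N' by auto
 have subE: "subtop (subtop X' N') E = subtop X' E"
  using EN by(simp add: subtopology_subtopology Int_absorb1)
 have subZ: "subtop (subtop X N) Z = subtop X Z"
  using N by(simp add: subtopology_subtopology Int_absorb1)
 \<comment> \<open>Membership in \<open>E\<close> is a condition on the image under
   \<open>f\<close>, and \<open>comm\<close> shows that this image has been retracted into
   \<open>Z\<close>.\<close>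
 have h'0: "h' 0 x : E" if x: "x : N'" for x
 proof -
  have "(0, x) : topspace (prod_top (top_of_set {0..1::real}) (subtop X' N'))" using x N'X by auto
  then have "h' 0 x : topspace (subtop X' N')"
   using continuous_map_image_subset_topspace[OF h'(1)] by(force simp: image_subset_iff)
  then show ?thesis using comm[OF x] h(2)[of "f x"] x by(auto simp: E N')
 qed
 note r = deformation_retract_iso[of "subtop X N" h Z, unfolded subZ]
 have rX: "cmap (subtop X N) (subtop X Z) (h 0)"
  "!!p. hom_induced p (subtop X Z) {} (subtop X N) {} id : iso (homol p (subtop X Z)) (homol p (subtop X N))"
  "homotopic_with (%_. True) (subtop X N) (subtop X N) (h 0) id"
  using r h by auto
 note r' = deformation_retract_iso[of "subtop X' N'" h' E, unfolded subE]
 have rX': "cmap (subtop X' N') (subtop X' E) (h' 0)"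
  "!!p. hom_induced p (subtop X' N') {} (subtop X' E) {} (h' 0) : iso (homol p (subtop X' N')) (homol p (subtop X' E))"
  using r' h' h'0 by auto
 have fN: "cmap (subtop X' N') (subtop X N) f"
  using f N' by(auto simp: continuous_map_in_subtopology continuous_map_from_subtopology)
 \<comment> \<open>\<open>f\<close> is first replaced by \<open>h 0\<close> after \<open>f\<close>,
   which factors through the centre; the homotopy from \<open>h 0\<close> to the identity then
   restores \<open>f\<close>.\<close>
 have "even_kernel (subtop X' N') (subtop X Z) (%x. h 0 (f x)) k"
  by(rule even_kernel_precompose[OF k rX'(1) rX'(2)]) (use comm in auto)
 then have "even_kernel (subtop X' N') (subtop X N) (%x. h 0 (f x)) k"
 proof (rule even_kernel_postcompose)
  show "cmap (subtop X Z) (subtop X N) id"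
   using N by(auto simp: continuous_map_in_subtopology continuous_map_from_subtopology)
 qed (use rX in auto)
 moreover have "homotopic_with (%_. True) (subtop X' N') (subtop X N) (h 0 \<circ> f) (id \<circ> f)"
  by(rule homotopic_with_compose_continuous_map_right[OF rX(3) fN]) auto
 ultimately have kN: "even_kernel (subtop X' N') (subtop X N) f k"
  using even_kernel_homotopic by(fastforce simp: o_def)
 have "even_kernel X' X f k"
 proof (rule even_kernel_ladder[OF f _ _ kN])
  show "hom_induced p X' N' X N f : iso (rel_homol p X' N') (rel_homol p X N)" for p
   by(rule excision_square[OF f Z N E N' homeo])
  show "trivial_group (homol p X)" if "odd p" for p
   using X that by(simp add: even_free_def flip: free_rank_0) (metis evrank_odd)
 qed (use N' in auto)
 then show ?thesis by(rule even_free_extend[OF X])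
qed

text \<open>Openness is checked on boxes; a box of images is open because \<open>I\<close> is
  finite.\<close>

lemma open_map_product:
 assumes I: "finite I" and f: "!!i. i : I ==> open_map (X i) (Y i) (f i)"
 shows "open_map (product_topology X I) (product_topology Y I) (%x. \<lambda>i\<in>I. f i (x i))"
 unfolding open_map_def
proof (intro allI impI)
 fix T assume T: "openin (product_topology X I) T"
 show "openin (product_topology Y I) ((%x. \<lambda>i\<in>I. f i (x i)) ` T)"
  unfolding openin_subopen[of _ "(%x. \<lambda>i\<in>I. f i (x i)) ` T"]
 proof
  fix y assume "y : (%x. \<lambda>i\<in>I. f i (x i)) ` T"
  then obtain x where x: "x : T" "y = (\<lambda>i\<in>I. f i (x i))" by blast
  obtain B where B: "!!i. i : I ==> openin (X i) (B i)" "x : Pi\<^sub>E I B" "Pi\<^sub>E I B <= T"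
   using bspec[OF T[unfolded openin_product_topology_alt] x(1)] by(elim exE conjE) blast
  have "openin (product_topology Y I) (Pi\<^sub>E I (%i. f i ` B i))"
   using I f B by(auto simp: openin_PiE open_map_def)
  moreover have "y : Pi\<^sub>E I (%i. f i ` B i)" using x B by auto
  moreover have "Pi\<^sub>E I (%i. f i ` B i) <= (%x. \<lambda>i\<in>I. f i (x i)) ` T"
  proof
   fix z assume z: "z : Pi\<^sub>E I (%i. f i ` B i)"
   then have "ALL i:I. EX b. b : B i & z i = f i b" by(auto simp: PiE_iff)
   then obtain b where b: "ALL i:I. b i : B i & z i = f i (b i)" by(rule bchoice[THEN exE])
   then have "restrict b I : T" using B by(auto intro!: subsetD[OF B(3)])
   moreover have "z = (\<lambda>i\<in>I. f i (restrict b I i))"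
    using z b by(auto simp: fun_eq_iff PiE_iff extensional_def)
   ultimately show "z : (%x. \<lambda>i\<in>I. f i (x i)) ` T" by blast
  qed
  ultimately show "EX T'. openin (product_topology Y I) T' & y : T' & T' <= (%x. \<lambda>i\<in>I. f i (x i)) ` T" by blast
 qed
qed

lemma open_quotient_product:
 assumes I: "finite I" and f: "!!i. i : I ==> open_quotient (X i) (Y i) (f i)"
 shows "open_quotient (product_topology X I) (product_topology Y I) (%x. \<lambda>i\<in>I. f i (x i))"
 unfolding open_quotient_def
proof (intro conjI)
 show "open_map (product_topology X I) (product_topology Y I) (%x. \<lambda>i\<in>I. f i (x i))"
  using open_map_product[OF I] f by(auto simp: open_quotient_def)
 show "cmap (product_topology X I) (product_topology Y I) (%x. \<lambda>i\<in>I. f i (x i))"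
  unfolding continuous_map_componentwise
 proof (intro conjI ballI)
  fix i assume i: "i : I"
  then have "cmap (product_topology X I) (Y i) (f i \<circ> (%x. x i))"
   using f by(intro continuous_map_compose[of _ "X i"] continuous_map_product_projection) (auto simp: open_quotient_def)
  then show "cmap (product_topology X I) (Y i) (%x. (\<lambda>i\<in>I. f i (x i)) i)" using i by(simp add: o_def)
 qed auto
 show "(%x. \<lambda>i\<in>I. f i (x i)) ` topspace (product_topology X I) = topspace (product_topology Y I)"
 proof
  show "(%x. \<lambda>i\<in>I. f i (x i)) ` topspace (product_topology X I) <= topspace (product_topology Y I)"
  proof -
   have "f i a : topspace (Y i)" if "i : I" "a : topspace (X i)" for i a
    using f[OF that(1)] that(2) by(auto simp: open_quotient_def)
   then show ?thesis by(auto simp: PiE_iff)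
  qed
  show "topspace (product_topology Y I) <= (%x. \<lambda>i\<in>I. f i (x i)) ` topspace (product_topology X I)"
  proof
   fix z assume z: "z : topspace (product_topology Y I)"
   then have "ALL i:I. EX b. b : topspace (X i) & z i = f i b" using f by(fastforce simp: PiE_iff open_quotient_def)
   then obtain b where b: "ALL i:I. b i : topspace (X i) & z i = f i (b i)" by(rule bchoice[THEN exE])
   then have "restrict b I : topspace (product_topology X I)" by auto
   moreover have "z = (\<lambda>i\<in>I. f i (restrict b I i))"
    using z b by(auto simp: fun_eq_iff PiE_iff extensional_def)
   ultimately show "z : (%x. \<lambda>i\<in>I. f i (x i)) ` topspace (product_topology X I)" by blast
  qed
 qed
qed

lemma open_quotient_openin:
 assumes q: "open_quotient X Y f" and "T <= topspace Y" "openin X {x : topspace X. f x : T}"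
 shows "openin Y T"
proof -
 have "f ` {x : topspace X. f x : T} = T" using assms by(auto simp: open_quotient_def)
 moreover have "openin Y (f ` {x : topspace X. f x : T})"
  using assms unfolding open_quotient_def open_map_def by blast
 ultimately show ?thesis by simp
qed

lemma open_quotient_closedin:
 assumes q: "open_quotient X Y f" and "T <= topspace Y" "closedin X {x : topspace X. f x : T}"
 shows "closedin Y T"
proof -
 have "topspace X - {x : topspace X. f x : T} = {x : topspace X. f x : topspace Y - T}"
  using q by(auto simp: open_quotient_def)
 then have "openin Y (topspace Y - T)"
  using assms by(intro open_quotient_openin[OF q]) (auto simp: closedin_def)
 then show ?thesis using assms by(simp add: closedin_def)
qed

text \<open>Recognises one topology as another from a common parametrisation, for instance P(W/U) as
  a subspace of P(V/U).\<close>

lemma open_quotient_unique: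
 assumes "open_quotient X Y f" "open_quotient X Y' f"
 shows "Y = Y'"
proof -
 have "openin Y' T" if "open_quotient X Y f" "open_quotient X Y' f" "openin Y T" for Y Y' :: "'b topology" and T
 proof (rule open_quotient_openin[OF that(2)])
  show "T <= topspace Y'" using that openin_subset[OF that(3)] by(auto simp: open_quotient_def)
  show "openin X {x : topspace X. f x : T}"
   using that openin_continuous_map_preimage[of X Y f T] by(auto simp: open_quotient_def)
 qed
 then show ?thesis unfolding topology_eq using assms by blast
qed

lemma open_quotient_preimage:
 assumes "open_quotient X Y f" "T <= topspace Y"
 shows "open_quotient (subtop X {x : topspace X. f x : T}) (subtop Y T) f"
proof -
 have "f ` {x : topspace X. f x : T} = T" using assms by(auto simp: open_quotient_def)
 then show ?thesis using open_quotient_restrict[OF assms(1), of "{x : topspace X. f x : T}"] by auto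
qed

lemma line_mod_of_mem:
 assumes "cfun.subspace B" "u : line_mod B w" "u ~: B"
 shows "line_mod B u = line_mod B w"
proof -
 obtain k where k: "u - cscale k w : B" using assms in_line_mod by blast
 moreover have "k ~= 0"
 proof
  assume "k = 0"
  then have "u - cscale k w = u" by(simp add: fun_eq_iff)
  then show False using k assms by metis
 qed
 ultimately show ?thesis by(rule line_mod_eq[OF assms(1)])
qed

lemma line_mod_subset_line_mod:
 assumes "A <= B" "v : line_mod B w"
 shows "line_mod A v <= line_mod B w"
 using assms line_mod_contains(1)[of B w] by(simp add: line_mod_subset_iff subspace_line_mod)

lemma (in proj_coords) proj_quotient_sub:
 assumes "cfun.subspace V'" "V <= V'"
 shows "proj_quotient V U = subtop (proj_quotient V' U) (line_mod U ` (V - U))"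
proof (rule open_quotient_unique)
 show "open_quotient (top_of_set (V - U)) (proj_quotient V U) (line_mod U)"
  by(rule open_quotient_line_mod[OF V U UV])
 have q': "open_quotient (top_of_set (V' - U)) (proj_quotient V' U) (line_mod U)"
  by(rule open_quotient_line_mod[OF assms(1) U]) (use UV assms in auto)
 have "{x : V' - U. line_mod U x : line_mod U ` (V - U)} = V - U"
 proof -
  have "x : V" if "line_mod U x = line_mod U y" "y : V" for x y
   using that line_mod_subset_iff[OF V, of U y] UV line_mod_contains(2)[of x U] by auto
  then show ?thesis using assms by auto
 qed
 then show "open_quotient (top_of_set (V - U)) (subtop (proj_quotient V' U) (line_mod U ` (V - U))) (line_mod U)"
  using open_quotient_restrict[OF q', of "V - U"] assms
  by(simp add: subtopology_subtopology Int_absorb1 Diff_mono)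
qed

lemma (in proj_coords) closedin_preimage_U:
 assumes "!!i. cmap T euclidean (%x. w x i)" "!!x. x : topspace T ==> w x : V"
 shows "closedin T {x : topspace T. w x : U}"
proof -
 have "{x : topspace T. w x : U} = topspace T Int (\<Inter>i\<in>{..<c}. {x : topspace T. \<phi> i (w x) : {0}})"
  using assms(2) in_U_iff by auto
 moreover have "closedin T {x : topspace T. \<phi> i (w x) : {0}}" for i
  by(rule closedin_continuous_map_preimage[OF continuous_map_\<phi>[OF assms]]) auto
 ultimately show ?thesis by(cases "c = 0") (auto intro!: closedin_Int closedin_INT)
qed

text \<open>Writing a vector as \<open>a + b\<close> with \<open>a\<close> in \<open>U\<close> and
  \<open>b\<close> in the span of the \<open>e i\<close>, this is \<open>a + t b\<close>: the
  identity at time 1, projection onto \<open>U\<close> at time 0.\<close>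

definition (in proj_coords) contract :: "real => (nat => complex) => nat => complex" where
 "contract t u = u - cscale (of_real (1 - t)) (\<Sum>i<c. cscale (\<phi> i u) (e i))"

context proj_coords begin

lemma contract_apply: "contract t u x = u x - (1 - of_real t) * (\<Sum>i<c. \<phi> i u * e i x)"
proof -
 have "(\<Sum>i<m. cscale (\<phi> i u) (e i)) x = (\<Sum>i<m. \<phi> i u * e i x)" for m by(induction m) auto
 then show ?thesis by(simp add: contract_def)
qed

lemma contract_linear:
 assumes "x : V" "y : V"
 shows "contract t (x - cscale k y) = contract t x - cscale k (contract t y)"
 using assms by(auto simp: fun_eq_iff contract_apply \<phi>_diff \<phi>_scale scale_in algebra_simps sum_distrib_left simp flip: sum_subtractf)

lemma contract_U: "u : U ==> contract t u = u"
 by(auto simp: fun_eq_iff contract_apply \<phi>_U)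

lemma contract_1: "contract 1 u = u"
 by(auto simp: fun_eq_iff contract_apply)

lemma contract_0: "x : V ==> contract 0 x : U"
 using dec[of x] by(simp add: contract_def cscale_def)

text \<open>The contraction is an affine combination of \<open>x\<close> and its projection to
  \<open>U\<close>, so it cannot leave a subspace that contains \<open>U\<close> and
  \<open>x\<close>.\<close>

lemma contract_in:
 assumes K: "cfun.subspace K" "U <= K" and x: "x : K" "x : V"
 shows "contract t x : K"
proof -
 have "contract 0 x : K" using contract_0 K x by auto
 then have "cscale (of_real t) x + cscale (of_real (1 - t)) (contract 0 x) : K"
  using K x by(intro cfun.subspace_add cfun.subspace_scale) auto
 also have "cscale (of_real t) x + cscale (of_real (1 - t)) (contract 0 x) = contract t x"
  by(auto simp: fun_eq_iff contract_apply algebra_simps)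
 finally show ?thesis .
qed

lemma contract_contract:
 assumes x: "x : V"
 shows "contract s (contract t x) = contract (s * t) x"
proof -
 have "contract t x = contract 0 x - cscale (- of_real t) (x - contract 0 x)"
  by(auto simp: fun_eq_iff contract_apply algebra_simps)
 moreover have c0: "contract 0 x : V" using contract_0[OF x] UV by blast
 ultimately have "contract s (contract t x) = contract s (contract 0 x) - cscale (- of_real t) (contract s (x - contract 0 x))"
  using contract_linear[OF c0 diff_in[OF x c0]] by metis
 also have "x - contract 0 x = x - cscale 1 (contract 0 x)" by(simp add: fun_eq_iff)
 also have "contract s ... = contract s x - cscale 1 (contract s (contract 0 x))"
  using x c0 by(rule contract_linear)
 also have "contract s (contract 0 x) = contract 0 x" by(rule contract_U[OF contract_0[OF x]])
 also have "contract 0 x - cscale (- of_real t) (contract s x - cscale 1 (contract 0 x)) = contract (s * t) x"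
  by(auto simp: fun_eq_iff contract_apply algebra_simps)
 finally show ?thesis .
qed

lemma continuous_contract:
 assumes "!!i. cmap T euclidean (%x. w x i)" "!!x. x : topspace T ==> w x : V" "cmap T euclidean \<tau>"
 shows "cmap T euclidean (%x. contract (\<tau> x) (w x) i)"
 unfolding contract_apply
 by(intro continuous_map_diff continuous_map_mult continuous_map_sum continuous_map_of_real continuous_map_\<phi> assms) auto

end

section \<open>Models of subspace arrangements\<close>

type_synonym cvec = "nat => complex"
type_synonym mpoint = "cvec \<times> (cvec set => cvec set)"

text \<open>An explicit candidate for the closure, with conditions on lines in place of limits. The
  lines are spanned by vectors of \<open>W\<close>, so that models of smaller \<open>W\<close> live
  in the same ambient product over \<open>V\<close>.\<close>

definition compatible :: "cvec set => cvec set set => mpoint set" where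
 "compatible W S = {x. fst x : W & snd x : extensional S &
   (ALL B:S. EX u:W - B. snd x B = line_mod B u) & (ALL B:S. fst x : snd x B) &
   (ALL A:S. ALL B:S. A <= B --> snd x A <= snd x B)}"

definition model_top :: "cvec set => cvec set => cvec set set => mpoint topology" where
 "model_top V W S = subtop (prod_top (top_of_set V) (product_topology (proj_quotient V) S)) (compatible W S)"

text \<open>Points are lifted by choosing a vector on every line. Continuity on the models is tested
  on these lifts, where maps are given by coordinates.\<close>

definition lift_map :: "cvec set set => cvec \<times> (cvec set => cvec) => mpoint" where
 "lift_map S x = (fst x, \<lambda>B\<in>S. line_mod B (snd x B))"

definition lift_amb :: "cvec set => cvec set set => (cvec \<times> (cvec set => cvec)) topology" where
 "lift_amb V S = prod_top (top_of_set V) (product_topology (%B. top_of_set (V - B)) S)"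

definition lift_top :: "cvec set => mpoint set => cvec set set => (cvec \<times> (cvec set => cvec)) topology" where
 "lift_top V P S = subtop (lift_amb V S) {x : topspace (lift_amb V S). lift_map S x : P}"

definition vrep :: "cvec set => cvec set => cvec" where
 "vrep B l = (SOME u. u ~: B & l = line_mod B u)"

lemma vrep: "u ~: B ==> l = line_mod B u ==> vrep B l ~: B & l = line_mod B (vrep B l)"
 unfolding vrep_def by(rule someI[of "%u. u ~: B & l = line_mod B u"]) auto

lemma vrep_mem: "u ~: B ==> l = line_mod B u ==> vrep B l : l"
 using vrep line_mod_contains(2) by metis

text \<open>\<open>F\<close> plays the set of proper flats and \<open>d\<close> the dimension, which
  enters through the codimensions in \<open>coords\<close>.\<close>

locale arrangement =
 fixes V :: "cvec set" and F :: "cvec set set" and d :: "cvec set => nat"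
 assumes finF: "finite F"
  and subV: "cfun.subspace V" and subF: "!!B. B : F ==> cfun.subspace B"
  and proper: "!!B. B : F ==> B < V"
  and inter: "!!A B. A : F ==> B : F ==> A Int B : F"
  and coords: "!!U W. U : F ==> W : insert V F ==> U < W ==> EX e \<phi>. proj_coords W U (d W - d U) e \<phi>"
  and dmono: "!!U W. U : F ==> W : insert V F ==> U < W ==> d U < d W"
begin

lemma open_quotient_lift_amb:
 assumes S: "S <= F"
 shows "open_quotient (lift_amb V S) (prod_top (top_of_set V) (product_topology (proj_quotient V) S)) (lift_map S)"
proof -
 have "finite S" using S finF finite_subset by blast
 moreover have "open_quotient (top_of_set (V - B)) (proj_quotient V B) (line_mod B)" if "B : S" for B
  using that S subV subF proper by(intro open_quotient_line_mod) auto
 ultimately have "open_quotient (product_topology (%B. top_of_set (V - B)) S) (product_topology (proj_quotient V) S) (%x. \<lambda>B\<in>S. line_mod B (x B))"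
  by(rule open_quotient_product)
 from open_quotient_prod[OF this, of "top_of_set V"] show ?thesis
  by(simp add: lift_amb_def lift_map_def[abs_def])
qed

lemma compatible_topspace:
 assumes S: "S <= F" and W: "W <= V"
 shows "compatible W S <= topspace (prod_top (top_of_set V) (product_topology (proj_quotient V) S))"
 using W by(fastforce simp: compatible_def PiE_iff mem_Times_iff)

lemma topspace_model: "S <= F ==> W <= V ==> topspace (model_top V W S) = compatible W S"
 using compatible_topspace[of S W] unfolding model_top_def topspace_subtopology by(intro Int_absorb1)

lemma open_quotient_lift_top:
 assumes S: "S <= F" and W: "W <= V" and P: "P <= compatible W S"
 shows "open_quotient (lift_top V P S) (subtop (model_top V W S) P) (lift_map S)"
proof -
 have "subtop (model_top V W S) P = subtop (prod_top (top_of_set V) (product_topology (proj_quotient V) S)) P"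
  using P by(simp add: model_top_def subtopology_subtopology Int_absorb1)
 moreover have "P <= topspace (prod_top (top_of_set V) (product_topology (proj_quotient V) S))"
  using P compatible_topspace[OF S W] by blast
 ultimately show ?thesis unfolding lift_top_def
  using open_quotient_preimage[OF open_quotient_lift_amb[OF S]] by simp
qed

lemma topspace_lift_top: "topspace (lift_top V P S) = {x. fst x : V & snd x : extensional S & (ALL B:S. snd x B : V - B) & lift_map S x : P}"
proof (rule Set.set_eqI)
 fix x
 show "x : topspace (lift_top V P S) \<longleftrightarrow> x : {x. fst x : V & snd x : extensional S & (ALL B:S. snd x B : V - B) & lift_map S x : P}"
  unfolding lift_top_def topspace_subtopology lift_amb_def topspace_prod_topology topspace_product_topology
  by(simp add: mem_Times_iff PiE_iff) blast
qed

lemma lift_coords: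
 shows "cmap (lift_top V P S) euclidean (%x. fst x i)"
  and "B : S ==> cmap (lift_top V P S) euclidean (%x. snd x B i)"
proof -
 have 1: "cmap (lift_amb V S) (top_of_set V) fst" unfolding lift_amb_def by(rule continuous_map_fst)
 then show "cmap (lift_top V P S) euclidean (%x. fst x i)"
  unfolding lift_top_def by - (rule continuous_map_fun_apply, rule continuous_map_from_subtopology, auto simp: continuous_map_in_subtopology)
 assume B: "B : S"
 have "cmap (lift_amb V S) (top_of_set (V - B)) ((%f. f B) \<circ> snd)"
  unfolding lift_amb_def by(rule continuous_map_compose[OF continuous_map_snd continuous_map_product_projection[OF B]])
 then show "cmap (lift_top V P S) euclidean (%x. snd x B i)"
  unfolding lift_top_def by - (rule continuous_map_fun_apply, rule continuous_map_from_subtopology, auto simp: continuous_map_in_subtopology o_def)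
qed

lemma continuous_line:
 assumes B: "B : F" and w: "!!i. cmap T euclidean (%x. w x i)" "!!x. x : topspace T ==> w x : V - B"
 shows "cmap T (proj_quotient V B) (%x. line_mod B (w x))"
proof -
 have "cmap T (top_of_set (V - B)) w" using w by(auto simp: continuous_map_in_subtopology continuous_map_fun_iff)
 moreover have "cmap (top_of_set (V - B)) (proj_quotient V B) (line_mod B)"
  using open_quotient_line_mod[OF subV subF[OF B]] proper[OF B] by(auto simp: open_quotient_def)
 ultimately show ?thesis using continuous_map_compose by(fastforce simp: o_def)
qed

lemma continuous_into_model:
 assumes S: "S <= F" and W: "W <= V"
  and 1: "!!i. cmap T euclidean (%x. fst (f x) i)"
  and 2: "!!B. B : S ==> cmap T (proj_quotient V B) (%x. snd (f x) B)"
  and 3: "!!x. x : topspace T ==> f x : P" and P: "P <= compatible W S"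
 shows "cmap T (subtop (model_top V W S) P) f"
proof -
 have "f x : compatible W S" if "x : topspace T" for x using 3[OF that] P by blast
 then have 4: "fst (f x) : V & snd (f x) : extensional S" if "x : topspace T" for x using that W by(auto simp: compatible_def)
 have "cmap T (top_of_set V) (%x. fst (f x))"
  using 1 4 by(auto simp: continuous_map_in_subtopology continuous_map_fun_iff)
 moreover have "cmap T (product_topology (proj_quotient V) S) (%x. snd (f x))"
  unfolding continuous_map_componentwise using 2 4 by auto
 moreover have "subtop (model_top V W S) P = subtop (prod_top (top_of_set V) (product_topology (proj_quotient V) S)) P"
  using P by(simp add: model_top_def subtopology_subtopology Int_absorb1)
 ultimately show ?thesis using 3 by(auto simp: continuous_map_in_subtopology continuous_map_pairwise o_def)
qed

lemma model_coords:
 shows "cmap (subtop (model_top V W S) P) euclidean (%x. fst x i)"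
  and "B : S ==> cmap (subtop (model_top V W S) P) (proj_quotient V B) (%x. snd x B)"
proof -
 let ?A = "prod_top (top_of_set V) (product_topology (proj_quotient V) S)"
 have sub: "subtop (model_top V W S) P = subtop ?A (compatible W S Int P)"
  by(simp add: model_top_def subtopology_subtopology)
 have "cmap ?A (top_of_set V) fst" by(rule continuous_map_fst)
 then show "cmap (subtop (model_top V W S) P) euclidean (%x. fst x i)"
  unfolding sub by - (rule continuous_map_fun_apply, rule continuous_map_from_subtopology, auto simp: continuous_map_in_subtopology)
 assume B: "B : S"
 have "cmap ?A (proj_quotient V B) ((%f. f B) \<circ> snd)"
  by(rule continuous_map_compose[OF continuous_map_snd continuous_map_product_projection[OF B]])
 then show "cmap (subtop (model_top V W S) P) (proj_quotient V B) (%x. snd x B)"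
  unfolding sub by(intro continuous_map_from_subtopology) (simp add: o_def)
qed

end

text \<open>\<open>S\<close> is the down-closed set of flats already blown up, and \<open>U\<close>
  is minimal among the remaining ones. The coordinates are taken in \<open>V\<close>, so that one
  contraction serves all \<open>W\<close>; it preserves \<open>W\<close>, which contains
  \<open>U\<close>.\<close>

locale blowup_step = arrangement +
 fixes W :: "cvec set" and S :: "cvec set set" and U :: "cvec set" and c :: nat and e :: "nat => cvec" and \<phi> :: "nat => cvec => complex"
 assumes W: "W : insert V F" and S: "S <= F" and SW: "!!A. A : S ==> A < W"
  and down: "!!A B. A : S ==> B : F ==> B <= A ==> B : S"
  and U: "U : F" "U ~: S" "U < W" and below: "!!B. B : F ==> B < U ==> B : S"
  and pc: "proj_coords V U c e \<phi>"
begin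

interpretation pc: proj_coords V U c e \<phi> by(rule pc)

abbreviation "lam \<equiv> pc.contract"

text \<open>Near the centre the line at \<open>B\<close> is spanned by a representative of the line
  at the smaller flat \<open>B Int U\<close>, and it can be contracted as long as that
  representative never enters \<open>B\<close>. Quantifying over all representatives keeps the
  condition free of choices.\<close>

definition N :: "mpoint set" where
 "N = {x : compatible W S. ALL B:S. ALL t:{0..1}. ALL u. u ~: B Int U --> snd x (B Int U) = line_mod (B Int U) u --> lam t u ~: B}"

text \<open>The strict transform of \<open>U\<close>, which is the centre of the next
  blow-up.\<close>

definition Z :: "mpoint set" where
 "Z = {x : compatible W S. fst x : U & (ALL B:S. B < U --> snd x B <= U)}"

text \<open>The line at \<open>B\<close> is moved through a representative of the line at
  \<open>B Int U\<close>: two such representatives differ, up to a scalar, by a vector of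
  \<open>U\<close>, and the contraction fixes \<open>U\<close>.\<close>

definition flow :: "real => mpoint => mpoint" where
 "flow t x = (lam t (fst x), \<lambda>B\<in>S. line_mod B (lam t (vrep (B Int U) (snd x (B Int U)))))"

lemma WV: "W <= V" and subW: "cfun.subspace W" and subU: "cfun.subspace U" and UV: "U <= V"
 using W proper subV subF U by auto

text \<open>\<open>U\<close> cannot lie below a member of the down-closed set \<open>S\<close>;
  hence \<open>B Int U\<close> is strictly smaller than \<open>U\<close> and has been blown up
  already.\<close>

lemma meet:
 assumes "B : S"
 shows "B Int U : S" "B Int U : F" "B Int U < U" "cfun.subspace (B Int U)" "cfun.subspace B" "B : F"
proof -
 show B: "B : F" using assms S by blast
 then show BU: "B Int U : F" using inter U by blast
 have "~ U <= B" using down[OF assms U(1)] U(2) by blast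
 then show sub: "B Int U < U" by blast
 show "B Int U : S" using below[OF BU sub] .
 show "cfun.subspace (B Int U)" "cfun.subspace B" using subF B BU by auto
qed

lemma lam_mem_line:
 assumes "cfun.subspace B" "B <= U" "B <= C" "v : line_mod B u" "v : V" "u : V"
 shows "lam t v : line_mod C (lam t u)"
proof -
 obtain k where k: "v - cscale k u : B" using assms in_line_mod by blast
 then have "lam t (v - cscale k u) = v - cscale k u" using assms by(intro pc.contract_U) auto
 moreover have "lam t (v - cscale k u) = lam t v - cscale k (lam t u)" using assms by(intro pc.contract_linear) auto
 ultimately have "lam t v - cscale k (lam t u) : B" using k by simp
 then have "lam t v : line_mod B (lam t u)" using in_line_mod[OF assms(1)] by blast
 then show ?thesis using assms(3) by(auto simp: line_mod_def intro: subsetD[OF cfun.span_mono[of "insert (lam t u) B" "insert (lam t u) C"]])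
qed

lemma lam_indep:
 assumes B: "B : S" and u: "u : V - (B Int U)" "u' : V - (B Int U)" "line_mod (B Int U) u = line_mod (B Int U) u'"
 shows "line_mod B (lam t u) = line_mod B (lam t u')" "lam t u : B \<longleftrightarrow> lam t u' : B"
proof -
 note m = meet[OF B]
 have 1: "lam t u : line_mod B (lam t u')" if "u : V" "u' : V" "line_mod (B Int U) u = line_mod (B Int U) u'" for u u'
  using lam_mem_line[OF m(4), of B u u' t] that line_mod_contains(2)[of u "B Int U"] by auto
 show eq: "line_mod B (lam t u) = line_mod B (lam t u')"
  using 1[of u u'] 1[of u' u] u line_mod_subset_line_mod[of B B "lam t u" "lam t u'"]
   line_mod_subset_line_mod[of B B "lam t u'" "lam t u"] by blast
 have "x : B" if "line_mod B x = line_mod B y" "y : B" for x y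
  using that line_mod_subset_iff[OF m(5), of B y] line_mod_contains(2)[of x B] by auto
 from this[OF eq] this[OF eq[symmetric]] show "lam t u : B \<longleftrightarrow> lam t u' : B" by blast
qed

lemma compatible_rep:
 assumes x: "x : compatible W S" and B: "B : S"
 shows "vrep B (snd x B) : W - B" "snd x B = line_mod B (vrep B (snd x B))"
proof -
 obtain u where u: "u : W - B" "snd x B = line_mod B u" using x B by(auto simp: compatible_def)
 have v: "vrep B (snd x B) ~: B" "snd x B = line_mod B (vrep B (snd x B))" using vrep[of u B "snd x B"] u by auto
 show "snd x B = line_mod B (vrep B (snd x B))" by(rule v(2))
 have "line_mod B u <= W" using u SW[OF B] by(simp add: line_mod_subset_iff subW)
 then show "vrep B (snd x B) : W - B" using v u vrep_mem[of u B "snd x B"] by auto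
qed

abbreviation "vr x B \<equiv> vrep (B Int U) (snd x (B Int U))"

lemma vr:
 assumes x: "x : compatible W S" and B: "B : S"
 shows "vr x B : W" "vr x B ~: B Int U" "snd x (B Int U) = line_mod (B Int U) (vr x B)" "vr x B : V - (B Int U)"
 using compatible_rep[OF x meet(1)[OF B]] WV by auto

text \<open>The line at \<open>B Int U\<close> lies in the line at \<open>B\<close>, so a vector of
  the former that is outside \<open>B\<close> spans the latter modulo \<open>B\<close>.\<close>

lemma snd_eq:
 assumes x: "x : compatible W S" and B: "B : S" and nB: "vr x B ~: B"
 shows "snd x B = line_mod B (vr x B)"
proof -
 have "snd x (B Int U) <= snd x B" using x meet(1)[OF B] B by(auto simp: compatible_def)
 moreover have "vr x B : snd x (B Int U)" using vr(3)[OF x B] line_mod_contains(2) by metis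
 ultimately have "vr x B : line_mod B (vrep B (snd x B))" using compatible_rep(2)[OF x B] by blast
 then show ?thesis using line_mod_of_mem[OF meet(5)[OF B] _ nB] compatible_rep(2)[OF x B] by metis
qed

lemma in_N_iff:
 assumes x: "x : compatible W S"
 shows "x : N \<longleftrightarrow> (ALL B:S. ALL t:{0..1}. lam t (vr x B) ~: B)"
proof
 assume "x : N"
 then show "ALL B:S. ALL t:{0..1}. lam t (vr x B) ~: B" using vr[OF x] unfolding N_def by blast
next
 assume R: "ALL B:S. ALL t:{0..1}. lam t (vr x B) ~: B"
 show "x : N"
  unfolding N_def
 proof (intro CollectI conjI x ballI allI impI)
  fix B t u assume B: "B : S" and t: "t : {0..1::real}" and u: "u ~: B Int U" "snd x (B Int U) = line_mod (B Int U) u"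
  have "line_mod (B Int U) (vr x B) <= W"
   using vr(1)[OF x B] U(3) by(auto simp: line_mod_subset_iff[OF subW])
  then have "line_mod (B Int U) u <= W" using u(2) vr(3)[OF x B] by simp
  then have "u : V" using line_mod_contains(2)[of u "B Int U"] WV by blast
  then have uV: "u : V - B Int U" using u(1) by blast
  have "line_mod (B Int U) u = line_mod (B Int U) (vr x B)" using u(2) vr(3)[OF x B] by simp
  from lam_indep(2)[OF B uV vr(4)[OF x B] this, of t] show "lam t u ~: B" using R B t by blast
 qed
qed

lemma N_props:
 assumes x: "x : N" and B: "B : S" and t: "t : {0..1}"
 shows "lam t (vr x B) : W - B" "snd x B = line_mod B (vr x B)"
proof -
 have xc: "x : compatible W S" using x by(simp add: N_def)
 have "lam t (vr x B) : W" using pc.contract_in[OF subW _ vr(1)[OF xc B]] vr(4)[OF xc B] U by auto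
 then show "lam t (vr x B) : W - B" using x in_N_iff[OF xc] B t by blast
 have "vr x B ~: B" using x in_N_iff[OF xc] B pc.contract_1[of "vr x B"] by(metis atLeastAtMost_iff order_refl zero_le_one)
 then show "snd x B = line_mod B (vr x B)" by(rule snd_eq[OF xc B])
qed

lemma flow_compatible:
 assumes x: "x : N" and t: "t : {0..1}"
 shows "flow t x : compatible W S"
proof -
 have xc: "x : compatible W S" using x by(simp add: N_def)
 have fx: "fst x : W" using xc by(simp add: compatible_def)
 show ?thesis
  unfolding compatible_def
 proof (intro CollectI conjI ballI impI)
  show "fst (flow t x) : W" using pc.contract_in[OF subW _ fx] fx WV U by(auto simp: flow_def)
  show "snd (flow t x) : extensional S" by(simp add: flow_def)
  fix B assume B: "B : S"
  have vV: "vr x B : V" using vr[OF xc B] by auto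
  show "EX u:W - B. snd (flow t x) B = line_mod B u"
   using N_props(1)[OF x B t] B by(auto simp: flow_def)
  have "fst x : snd x (B Int U)" using xc meet(1)[OF B] by(simp add: compatible_def)
  then have "fst x : line_mod (B Int U) (vr x B)" using vr(3)[OF xc B] by simp
  then show "fst (flow t x) : snd (flow t x) B"
   using lam_mem_line[OF meet(4)[OF B], of B "fst x" "vr x B" t] fx WV vV B by(auto simp: flow_def)
  fix A assume A: "A : S" "B <= A"
  have uV: "vr x A : V" using vr[OF xc A(1)] by auto
  have "B Int U <= A Int U" using A(2) by blast
  then have "snd x (B Int U) <= snd x (A Int U)" using xc meet(1)[OF B] meet(1)[OF A(1)] by(simp add: compatible_def)
  then have "vr x B : line_mod (A Int U) (vr x A)"
   using vr(3)[OF xc B] vr(3)[OF xc A(1)] line_mod_contains(2)[of "vr x B" "B Int U"] by auto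
  then have "lam t (vr x B) : line_mod A (lam t (vr x A))"
   using lam_mem_line[OF meet(4)[OF A(1)], of A] uV vV by auto
  then show "snd (flow t x) B <= snd (flow t x) A"
   using line_mod_subset_line_mod[OF A(2)] A B by(auto simp: flow_def)
 qed
qed

lemma vr_flow:
 assumes x: "x : N" and t: "t : {0..1}" and B: "B : S"
 shows "line_mod (B Int U) (vr (flow t x) B) = line_mod (B Int U) (lam t (vr x B))" "lam t (vr x B) : V - (B Int U)"
proof -
 have "snd (flow t x) (B Int U) = line_mod (B Int U) (lam t (vr x B))"
  using meet[OF B] by(simp add: flow_def Int_assoc)
 then show "line_mod (B Int U) (vr (flow t x) B) = line_mod (B Int U) (lam t (vr x B))"
  using vr(3)[OF flow_compatible[OF x t] B] by simp
 show "lam t (vr x B) : V - (B Int U)" using N_props(1)[OF x B t] WV by auto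
qed

lemma flow_N:
 assumes x: "x : N" and t: "t : {0..1}"
 shows "flow t x : N"
 unfolding in_N_iff[OF flow_compatible[OF x t]]
proof (intro ballI)
 fix B s assume B: "B : S" and s: "s : {0..1::real}"
 have xc: "x : compatible W S" using x by(simp add: N_def)
 have "lam s (vr (flow t x) B) : B \<longleftrightarrow> lam s (lam t (vr x B)) : B"
  by(rule lam_indep(2)[OF B vr(4)[OF flow_compatible[OF x t] B] vr_flow(2)[OF x t B] vr_flow(1)[OF x t B]])
 \<comment> \<open>Contractions compose by multiplying their times, and \<open>s * t\<close> is
   again in the unit interval, where \<open>x\<close> is known to avoid \<open>B\<close>.\<close>
 also have "lam s (lam t (vr x B)) = lam (s * t) (vr x B)" using vr(4)[OF xc B] by(intro pc.contract_contract) auto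
 finally show "lam s (vr (flow t x) B) ~: B"
  using x B s t unfolding in_N_iff[OF xc] by(auto simp: mult_le_one)
qed

lemma flow_1:
 assumes x: "x : N"
 shows "flow 1 x = x"
proof -
 have "snd x : extensional S" using x by(auto simp: N_def compatible_def)
 moreover have "lam 1 (vr x B) = vr x B" for B by(rule pc.contract_1)
 moreover have "snd (flow 1 x) = snd x"
  by(rule extensionalityI[where A = S]) (use N_props(2)[OF x, of _ 1] calculation in \<open>auto simp: flow_def\<close>)
 ultimately show ?thesis by(simp add: flow_def prod_eq_iff pc.contract_1)
qed

lemma flow_0:
 assumes x: "x : N"
 shows "flow 0 x : Z"
proof -
 have xc: "x : compatible W S" using x by(simp add: N_def)
 have "fst x : V" using xc WV by(auto simp: compatible_def)
 then have "fst (flow 0 x) : U" by(simp add: flow_def pc.contract_0)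
 moreover have "snd (flow 0 x) B <= U" if B: "B : S" "B < U" for B
  using B vr(4)[OF xc B(1)] pc.contract_0[of "vr x B"] by(auto simp: flow_def line_mod_subset_iff[OF subU, THEN iffD2] subsetD)
 moreover have "flow 0 x : compatible W S" using flow_compatible[OF x] by simp
 ultimately show ?thesis by(simp add: Z_def)
qed

lemma Z_props:
 assumes z: "z : Z" and B: "B : S"
 shows "vr z B : U" "vr z B ~: B"
proof -
 have zc: "z : compatible W S" using z by(simp add: Z_def)
 have "snd z (B Int U) <= U" using z meet[OF B] by(auto simp: Z_def)
 then show 1: "vr z B : U" using vr(3)[OF zc B] line_mod_contains(2)[of "vr z B" "B Int U"] by auto
 show "vr z B ~: B" using 1 vr(2)[OF zc B] by auto
qed

lemma Z_N: "Z <= N"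
proof
 fix z assume z: "z : Z"
 then have zc: "z : compatible W S" by(simp add: Z_def)
 show "z : N" unfolding in_N_iff[OF zc] using Z_props[OF z] pc.contract_U by auto
qed

lemma flow_Z: "z : Z ==> flow t z = z"
proof -
 assume z: "z : Z"
 then have zN: "z : N" using Z_N by blast
 have "lam t (vr z B) = vr z B" if "B : S" for B using Z_props(1)[OF z that] by(rule pc.contract_U)
 moreover have "lam t (fst z) = fst z" using z by(intro pc.contract_U) (simp add: Z_def)
 moreover have "snd z : extensional S" using z by(auto simp: Z_def compatible_def)
 moreover have "snd (flow t z) = snd z"
  by(rule extensionalityI[where A = S]) (use N_props(2)[OF zN, of _ 1] calculation in \<open>auto simp: flow_def\<close>)
 ultimately show ?thesis by(simp add: flow_def prod_eq_iff)
qed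

end

lemma continuous_map_snd_comp:
 "cmap L Y f ==> cmap (prod_top I L) Y (%z. f (snd z))"
 using continuous_map_compose[OF continuous_map_snd, of L Y f I] by(simp add: o_def)

section \<open>The blown-up model, the lifted flow and its continuity\<close>

context blowup_step begin

interpretation pc: proj_coords V U c e \<phi> by(rule pc)

definition S' :: "cvec set set" where "S' = insert U S"

definition pr :: "mpoint => mpoint" where "pr x = (fst x, restrict (snd x) S)"

definition E :: "mpoint set" where "E = {x : compatible W S'. pr x : Z}"

definition N' :: "mpoint set" where "N' = {x : compatible W S'. pr x : N}"

text \<open>The line at \<open>U\<close> stays put: it contains \<open>U\<close>, and the
  contraction preserves every subspace containing \<open>U\<close>.\<close>

definition flow' :: "real => mpoint => mpoint" where
 "flow' t x = (fst (flow t (pr x)), \<lambda>B\<in>S'. if B = U then snd x U else snd (flow t (pr x)) B)"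

abbreviation "X \<equiv> model_top V W S"
abbreviation "X' \<equiv> model_top V W S'"

lemma S'F: "S' <= F" using S U by(auto simp: S'_def)

lemma NC: "N <= compatible W S" and ZC: "Z <= compatible W S" and EC: "E <= compatible W S'" and NC': "N' <= compatible W S'"
 by(auto simp: N_def Z_def E_def N'_def)

lemma tX: "topspace X = compatible W S" and tX': "topspace X' = compatible W S'"
 using topspace_model S S'F WV by auto

lemma subX: "subtop X (compatible W S) = X" and subX': "subtop X' (compatible W S') = X'"
 using tX tX' subtopology_topspace by metis+

lemma US: "B : S ==> ~ U <= B" "B : S ==> B ~= U"
 using meet(3) U by blast+

lemma pr_compatible: "x : compatible W S' ==> pr x : compatible W S"
 by(simp add: compatible_def pr_def S'_def)

lemma snd_pr: "B : S ==> snd (pr x) B = snd x B" and fst_pr: "fst (pr x) = fst x"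
 by(simp_all add: pr_def)

text \<open>No member of \<open>S\<close> contains \<open>U\<close>, so the only new nesting
  conditions are those for flats below \<open>U\<close>.\<close>

lemma compatible_insertI:
 assumes x: "pr x : compatible W S" "snd x : extensional S'" and u: "u : W - U" "snd x U = line_mod U u"
  and v: "fst x : snd x U" and A: "!!A. A : S ==> A < U ==> snd x A <= snd x U"
 shows "x : compatible W S'"
proof -
 have "fst x : W" "!!B. B : S ==> EX u:W - B. snd x B = line_mod B u" "!!B. B : S ==> fst x : snd x B"
  "!!A B. A : S ==> B : S ==> A <= B ==> snd x A <= snd x B"
  using x(1) by(auto simp: compatible_def pr_def)
 note x' = this
 show ?thesis
  unfolding compatible_def
 proof (intro CollectI conjI ballI impI)
  fix B assume B: "B : S'"
  show "EX u:W - B. snd x B = line_mod B u" using B u x'(2) by(auto simp: S'_def)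
  show "fst x : snd x B" using B v x'(3) by(auto simp: S'_def)
  fix A assume A: "A : S'" "B <= A"
  show "snd x B <= snd x A"
  proof (cases "B = U")
   case True
   then have "A = U" using A US(1)[of A] by(auto simp: S'_def)
   with True show ?thesis by simp
  next
   case False
   then have BS: "B : S" using B by(simp add: S'_def)
   then show ?thesis using A assms(6)[of B] x'(4)[of B A] False by(cases "A = U") (auto simp: S'_def)
  qed
 qed (use x'(1) assms(2) in auto)
qed

lemma pr_flow':
 assumes "x : N'" "t : {0..1}"
 shows "pr (flow' t x) = flow t (pr x)"
proof -
 have "snd (flow t (pr x)) : extensional S" by(simp add: flow_def)
 then have "snd (pr (flow' t x)) = snd (flow t (pr x))"
  by(intro extensionalityI[where A = S]) (auto simp: pr_def flow'_def S'_def US)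
 then show ?thesis by(simp add: prod_eq_iff fst_pr) (simp add: flow'_def)
qed

lemma line_in_V:
 assumes "x : compatible W S'"
 shows "cfun.subspace (snd x U)" "U <= snd x U" "snd x U <= V" "EX u:W - U. snd x U = line_mod U u" "fst x : snd x U"
  "!!A. A : S ==> A < U ==> snd x A <= snd x U"
proof -
 show u: "EX u:W - U. snd x U = line_mod U u" and "fst x : snd x U"
  and "!!A. A : S ==> A < U ==> snd x A <= snd x U" using assms by(auto simp: compatible_def S'_def)
 then obtain u where u: "u : W - U" "snd x U = line_mod U u" by blast
 then show "cfun.subspace (snd x U)" "U <= snd x U" by(simp_all add: subspace_line_mod line_mod_contains)
 show "snd x U <= V" unfolding u(2) line_mod_subset_iff[OF subV] using u(1) WV UV by blast
qed

lemma flow'_compatible: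
 assumes x: "x : N'" and t: "t : {0..1}"
 shows "flow' t x : N'"
proof -
 have xc: "x : compatible W S'" and xN: "pr x : N" using x by(auto simp: N'_def)
 note l = line_in_V[OF xc]
 have sU: "snd (flow' t x) U = snd x U" by(simp add: flow'_def S'_def)
 have lam_l: "lam t v : snd x U" if "v : snd x U" for v
  using pc.contract_in[OF l(1,2) that] that l(3) by blast
 have "flow' t x : compatible W S'"
 proof (rule bexE[OF l(4)], rule compatible_insertI)
  show "pr (flow' t x) : compatible W S"
   unfolding pr_flow'[OF x t] by(rule flow_compatible[OF xN t])
  show "snd (flow' t x) : extensional S'" by(simp add: flow'_def)
  show "fst (flow' t x) : snd (flow' t x) U"
   unfolding sU using lam_l[OF l(5)] by(simp add: flow'_def flow_def fst_pr)
  fix A assume A: "A : S" "A < U"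
  have prc: "pr x : compatible W S" using xN NC by blast
  have AU: "A Int U = A" using A by blast
  have "vr (pr x) A : snd (pr x) A" using vr(3)[OF prc A(1)] line_mod_contains(2)[of "vr (pr x) A" A] by(simp add: AU)
  then have "vr (pr x) A : snd x U" using l(6)[OF A] A(1) by(auto simp: snd_pr)
  then have "lam t (vr (pr x) A) : snd x U" by(rule lam_l)
  then have "line_mod A (lam t (vr (pr x) A)) <= snd x U"
   using A l(2) by(simp add: line_mod_subset_iff[OF l(1)])
  then show "snd (flow' t x) A <= snd (flow' t x) U"
   unfolding sU using A by(simp add: flow'_def flow_def S'_def US)
 qed (use sU in auto)
 moreover have "pr (flow' t x) : N" unfolding pr_flow'[OF x t] by(rule flow_N[OF xN t])
 ultimately show ?thesis by(simp add: N'_def)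
qed

lemma flow'_eqI:
 assumes x: "x : N'" "t : {0..1}" and eq: "flow t (pr x) = pr x"
 shows "flow' t x = x"
proof -
 have "snd x : extensional S'" using x by(simp add: N'_def compatible_def)
 then have "snd (flow' t x) = snd x"
  by(intro extensionalityI[where A = S']) (auto simp: flow'_def eq S'_def snd_pr US)
 then show ?thesis by(simp add: prod_eq_iff) (simp add: flow'_def eq fst_pr)
qed

lemma lift_vr:
 assumes y: "y : topspace (lift_top V P S'')" and P: "P <= compatible W S''" and S'': "S'' = S \<or> S'' = S'" and B: "B : S"
 shows "line_mod (B Int U) (vr (lift_map S'' y) B) = line_mod (B Int U) (snd y (B Int U))"
  "snd y (B Int U) : V - B Int U" "vr (lift_map S'' y) B : V - B Int U"
proof -
 have BU: "B Int U : S''" using meet(1)[OF B] S'' by(auto simp: S'_def)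
 then show 1: "snd y (B Int U) : V - B Int U" using y by(auto simp: topspace_lift_top)
 have l: "snd (lift_map S'' y) (B Int U) = line_mod (B Int U) (snd y (B Int U))" using BU by(simp add: lift_map_def)
 have v: "vr (lift_map S'' y) B ~: B Int U & snd (lift_map S'' y) (B Int U) = line_mod (B Int U) (vr (lift_map S'' y) B)"
  using vrep[OF _ l] 1 by blast
 then show 2: "line_mod (B Int U) (vr (lift_map S'' y) B) = line_mod (B Int U) (snd y (B Int U))" using l by simp
 have "line_mod (B Int U) (snd y (B Int U)) <= V" using 1 UV by(auto simp: line_mod_subset_iff[OF subV])
 then have "vr (lift_map S'' y) B : V" using 2 line_mod_contains(2)[of "vr (lift_map S'' y) B" "B Int U"] by auto
 then show "vr (lift_map S'' y) B : V - B Int U" using v by blast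
qed

lemma closedin_preimage:
 assumes "B : F" "!!i. cmap T euclidean (%x. w x i)" "!!x. x : topspace T ==> w x : V"
 shows "closedin T {x : topspace T. w x : B}"
proof -
 obtain e' \<phi>' where "proj_coords V B (d V - d B) e' \<phi>'" using coords[of B V] proper assms(1) by blast
 from proj_coords.closedin_preimage_U[OF this assms(2,3)] show ?thesis .
qed

abbreviation "Lt \<equiv> lift_top V (compatible W S) S"

lemma qX: "open_quotient Lt X (lift_map S)"
 using open_quotient_lift_top[OF S WV order_refl] by(simp add: subX)

text \<open>On lifts the complement is a finite union of projections of closed sets along the unit
  interval, and projecting along a compact factor is a closed map.\<close>

lemma openN: "openin X N"
proof (rule open_quotient_openin[OF qX])
 show "N <= topspace X" using NC tX by simp
 let ?IL = "prod_top (top_of_set {0..1::real}) Lt"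
 define K where "K = (%B. {z : topspace ?IL. lam (fst z) (snd (snd z) (B Int U)) : B})"
 have K: "closedin Lt (snd ` K B)" if B: "B : S" for B
 proof -
  have "closedin ?IL (K B)"
   unfolding K_def
  proof (rule closedin_preimage[OF meet(6)[OF B]])
   have w: "snd (snd z) (B Int U) : V" if "z : topspace ?IL" for z
    using that meet(1)[OF B] by(auto simp: topspace_lift_top)
   then show "lam (fst z) (snd (snd z) (B Int U)) : V" if "z : topspace ?IL" for z
    using pc.contract_in[OF subV UV] that by blast
   show "cmap ?IL euclidean (%z. lam (fst z) (snd (snd z) (B Int U)) i)" for i
    by(rule pc.continuous_contract[OF continuous_map_snd_comp[OF lift_coords(2)[OF meet(1)[OF B]]] w time_coord])
  qed
  moreover have "closed_map ?IL Lt snd" by(rule Abstract_Topological_Spaces.closed_map_snd) (simp add: compact_space_subtopology)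
  ultimately show ?thesis by(simp add: closed_map_def)
 qed
 have "{x : topspace Lt. lift_map S x : N} = topspace Lt - (\<Union>B\<in>S. snd ` K B)"
 proof -
  have "lift_map S y : N \<longleftrightarrow> (ALL B:S. y ~: snd ` K B)" if y: "y : topspace Lt" for y
  proof -
   have c: "lift_map S y : compatible W S" using y by(simp add: topspace_lift_top)
   have "lam t (vr (lift_map S y) B) : B \<longleftrightarrow> lam t (snd y (B Int U)) : B" if B: "B : S" for B t
    using lam_indep(2)[OF B] lift_vr[OF y order_refl _ B] by blast
   then have "lift_map S y : N \<longleftrightarrow> (ALL B:S. ALL t:{0..1}. lam t (snd y (B Int U)) ~: B)"
    unfolding in_N_iff[OF c] by blast
   also have "... \<longleftrightarrow> (ALL B:S. y ~: snd ` K B)"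
    using y by(force simp: K_def)
   finally show ?thesis .
  qed
  then show ?thesis by blast
 qed
 moreover have "finite S" using S finF finite_subset by blast
 then have "closedin Lt (\<Union>B\<in>S. snd ` K B)" using K by(intro closedin_Union) auto
 ultimately show "openin Lt {x : topspace Lt. lift_map S x : N}" by(simp add: openin_diff)
qed

lemma closedZ: "closedin X Z"
proof (rule open_quotient_closedin[OF qX])
 show "Z <= topspace X" using ZC tX by simp
 have 1: "closedin Lt {y : topspace Lt. fst y : U}"
  by(rule closedin_preimage[OF U(1) lift_coords(1)]) (simp add: topspace_lift_top)
 have 2: "closedin Lt {y : topspace Lt. snd y B : U}" if "B : S" for B
  by(rule closedin_preimage[OF U(1) lift_coords(2)[OF that]]) (use that in \<open>simp add: topspace_lift_top\<close>)
 have "{y : topspace Lt. lift_map S y : Z} = {y : topspace Lt. fst y : U} Int (topspace Lt Int (\<Inter>B\<in>{B : S. B < U}. {y : topspace Lt. snd y B : U}))"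
  by(auto simp: Z_def topspace_lift_top lift_map_def line_mod_subset_iff[OF subU])
 moreover have "closedin Lt (topspace Lt Int (\<Inter>B\<in>{B : S. B < U}. {y : topspace Lt. snd y B : U}))"
 proof (cases "{B : S. B < U} = {}")
  case True
  then show ?thesis unfolding True by simp
 next
  case False
  then show ?thesis using 2 by(intro closedin_Int closedin_INT) auto
 qed
 ultimately show "closedin Lt {y : topspace Lt. lift_map S y : Z}" using closedin_Int[OF 1] by presburger
qed

text \<open>On lifts the arbitrary representative \<open>vr\<close> can be exchanged for the
  continuously varying vector at \<open>B Int U\<close>, because the moved line does not depend on
  the representative.\<close>

lemma continuous_flow:
 "cmap (prod_top (top_of_set {0..1::real}) (subtop X N)) (subtop X N) (%z. flow (fst z) (snd z))"
proof (rule open_quotient_lift[OF open_quotient_prod[OF open_quotient_lift_top[OF S WV NC]]])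
 let ?L = "lift_top V N S"
 let ?IL = "prod_top (top_of_set {0..1::real}) ?L"
 have fl: "flow (fst z) (lift_map S (snd z)) : N" if "z : topspace ?IL" for z
  using that by(intro flow_N) (auto simp: topspace_lift_top)
 have "cmap ?IL (subtop X N) (%z. flow (fst z) (lift_map S (snd z)))"
 proof (rule continuous_into_model[OF S WV])
  show "cmap ?IL euclidean (%z. fst (flow (fst z) (lift_map S (snd z))) i)" for i
   unfolding flow_def lift_map_def fst_conv
   by(rule pc.continuous_contract[OF continuous_map_snd_comp[OF lift_coords(1)] _ time_coord]) (auto simp: topspace_lift_top)
  show "cmap ?IL (proj_quotient V B) (%z. snd (flow (fst z) (lift_map S (snd z))) B)" if B: "B : S" for B
  proof (rule continuous_map_eq)
   have v: "snd (snd z) (B Int U) : V" if "z : topspace ?IL" for z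
    using that meet(1)[OF B] by(auto simp: topspace_lift_top)
   have eq: "lam (fst z) (snd (snd z) (B Int U)) : V - B & line_mod B (lam (fst z) (snd (snd z) (B Int U))) = snd (flow (fst z) (lift_map S (snd z))) B"
    if z: "z : topspace ?IL" for z
   proof -
    have y: "snd z : topspace ?L" and t: "fst z : {0..1}" using z by auto
    have yN: "lift_map S (snd z) : N" using y by(simp add: topspace_lift_top)
    note lv = lift_vr[OF y NC _ B]
    have "lam (fst z) (vr (lift_map S (snd z)) B) ~: B" using yN in_N_iff[of "lift_map S (snd z)"] NC B t by blast
    then have "lam (fst z) (snd (snd z) (B Int U)) ~: B" using lam_indep(2)[OF B] lv by blast
    moreover have "lam (fst z) (snd (snd z) (B Int U)) : V" using pc.contract_in[OF subV UV] v[OF z] by blast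
    moreover have "line_mod B (lam (fst z) (vr (lift_map S (snd z)) B)) = line_mod B (lam (fst z) (snd (snd z) (B Int U)))"
     using lam_indep(1)[OF B] lv by blast
    ultimately show ?thesis using B by(simp add: flow_def)
   qed
   show "cmap ?IL (proj_quotient V B) (%z. line_mod B (lam (fst z) (snd (snd z) (B Int U))))"
    by(rule continuous_line[OF meet(6)[OF B] pc.continuous_contract[OF continuous_map_snd_comp[OF lift_coords(2)[OF meet(1)[OF B]]] v time_coord]])
      (assumption | erule eq[THEN conjunct1])+
   show "line_mod B (lam (fst z) (snd (snd z) (B Int U))) = snd (flow (fst z) (lift_map S (snd z))) B" if "z : topspace ?IL" for z
    using eq[OF that] by blast
  qed
 qed (use fl NC in auto)
 then show "cmap ?IL (subtop X N) (%x. flow (fst (fst x, lift_map S (snd x))) (snd (fst x, lift_map S (snd x))))" by simp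
qed

lemma continuous_flow':
 "cmap (prod_top (top_of_set {0..1::real}) (subtop X' N')) (subtop X' N') (%z. flow' (fst z) (snd z))"
proof (rule open_quotient_lift[OF open_quotient_prod[OF open_quotient_lift_top[OF S'F WV NC']]])
 let ?L = "lift_top V N' S'"
 let ?IL = "prod_top (top_of_set {0..1::real}) ?L"
 have fl: "flow' (fst z) (lift_map S' (snd z)) : N'" if "z : topspace ?IL" for z
  using that by(intro flow'_compatible) (auto simp: topspace_lift_top)
 have "cmap ?IL (subtop X' N') (%z. flow' (fst z) (lift_map S' (snd z)))"
 proof (rule continuous_into_model[OF S'F WV])
  show "cmap ?IL euclidean (%z. fst (flow' (fst z) (lift_map S' (snd z))) i)" for i
   unfolding flow'_def flow_def lift_map_def fst_conv fst_pr
   by(rule pc.continuous_contract[OF continuous_map_snd_comp[OF lift_coords(1)] _ time_coord]) (auto simp: topspace_lift_top)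
  show "cmap ?IL (proj_quotient V B) (%z. snd (flow' (fst z) (lift_map S' (snd z))) B)" if B': "B : S'" for B
  proof (cases "B = U")
   case True
   have "cmap ?IL (proj_quotient V U) (%z. line_mod U (snd (snd z) U))"
    by(rule continuous_line[OF U(1) continuous_map_snd_comp[OF lift_coords(2)]]) (auto simp: S'_def topspace_lift_top)
   then show ?thesis using True by(simp add: flow'_def S'_def lift_map_def)
  next
   case False
   then have B: "B : S" using B' by(simp add: S'_def)
   show ?thesis
   proof (rule continuous_map_eq)
    have BU: "B Int U : S'" using meet(1)[OF B] by(simp add: S'_def)
    have v: "snd (snd z) (B Int U) : V" if "z : topspace ?IL" for z
     using that BU by(auto simp: topspace_lift_top)
    have eq: "lam (fst z) (snd (snd z) (B Int U)) : V - B & line_mod B (lam (fst z) (snd (snd z) (B Int U))) = snd (flow' (fst z) (lift_map S' (snd z))) B"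
     if z: "z : topspace ?IL" for z
    proof -
     have y: "snd z : topspace ?L" and t: "fst z : {0..1}" using z by auto
     have yN: "pr (lift_map S' (snd z)) : N" using y by(simp add: topspace_lift_top N'_def)
     note lv = lift_vr[OF y NC' _ B]
     have vp: "vr (pr x) B = vr x B" for x using snd_pr[OF meet(1)[OF B]] by simp
     have "lam (fst z) (vr (pr (lift_map S' (snd z))) B) ~: B"
      using yN in_N_iff[of "pr (lift_map S' (snd z))"] NC B t by blast
     then have "lam (fst z) (vr (lift_map S' (snd z)) B) ~: B" unfolding vp .
     then have "lam (fst z) (snd (snd z) (B Int U)) ~: B" using lam_indep(2)[OF B] lv by blast
     moreover have "lam (fst z) (snd (snd z) (B Int U)) : V" using pc.contract_in[OF subV UV] v[OF z] by blast
     moreover have "line_mod B (lam (fst z) (vr (lift_map S' (snd z)) B)) = line_mod B (lam (fst z) (snd (snd z) (B Int U)))"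
      using lam_indep(1)[OF B] lv by blast
     ultimately show ?thesis using B US(2)[OF B] vp by(simp add: flow_def flow'_def S'_def)
    qed
    show "cmap ?IL (proj_quotient V B) (%z. line_mod B (lam (fst z) (snd (snd z) (B Int U))))"
     by(rule continuous_line[OF meet(6)[OF B] pc.continuous_contract[OF continuous_map_snd_comp[OF lift_coords(2)[OF BU]] v time_coord]])
       (assumption | erule eq[THEN conjunct1])+
    show "line_mod B (lam (fst z) (snd (snd z) (B Int U))) = snd (flow' (fst z) (lift_map S' (snd z))) B" if "z : topspace ?IL" for z
     using eq[OF that] by blast
   qed
  qed
 qed (use fl NC' in auto)
 then show "cmap ?IL (subtop X' N') (%x. flow' (fst (fst x, lift_map S' (snd x))) (snd (fst x, lift_map S' (snd x))))" by simp
qed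

lemma continuous_pr: "cmap X' X pr"
proof -
 have "cmap X' (subtop X (compatible W S)) pr"
 proof (rule continuous_into_model[OF S WV])
  show "cmap X' euclidean (%x. fst (pr x) i)" for i
   using model_coords(1)[of W S' "compatible W S'"] by(simp add: subX' fst_pr)
  show "cmap X' (proj_quotient V B) (%x. snd (pr x) B)" if "B : S" for B
   using model_coords(2)[of B S' W "compatible W S'", unfolded subX'] that by(simp add: snd_pr S'_def)
 qed (use tX' pr_compatible in auto)
 then show ?thesis by(simp add: subX)
qed

end

section \<open>The blow-up map away from the centre\<close>

context blowup_step begin

interpretation pc: proj_coords V U c e \<phi> by(rule pc)

text \<open>The vectors attached to a point of the model below \<open>U\<close>: the point itself (\<open>None\<close>) and a vector on
 each of its lines.  The point lies over \<open>Z\<close> iff all of them are in \<open>U\<close>; those that are not span one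
 line modulo \<open>U\<close>.\<close>

definition J :: "cvec set option set" where "J = insert None (Some ` {B : S. B < U})"

definition wv :: "cvec set option => mpoint => cvec" where
 "wv j x = (case j of None => fst x | Some B => vrep B (snd x B))"

text \<open>Inverse of \<open>pr\<close> off \<open>Z\<close>: the line at \<open>U\<close> has to
  be the one spanned by any attached vector outside \<open>U\<close>.\<close>

definition ext_pt :: "mpoint => mpoint" where
 "ext_pt x = (fst x, \<lambda>B\<in>S'. if B = U then line_mod U (wv (SOME j. j : J & wv j x ~: U) x) else snd x B)"

lemma Z_iff: "x : compatible W S ==> x : Z \<longleftrightarrow> (ALL j:J. wv j x : U)"
proof -
 assume x: "x : compatible W S"
 have "snd x B <= U \<longleftrightarrow> vrep B (snd x B) : U" if "B : S" "B < U" for B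
  using line_mod_subset_iff[OF subU, of B "vrep B (snd x B)"] compatible_rep(2)[OF x that(1)] that(2) by auto
 then show ?thesis using x by(auto simp: Z_def J_def wv_def)
qed

lemma wv_W: "x : compatible W S ==> j : J ==> wv j x : W"
 using compatible_rep(1) by(auto simp: J_def wv_def compatible_def)

text \<open>Lines at two flats \<open>A\<close> and \<open>B\<close> below \<open>U\<close> are
  compared through the flat \<open>A Int B\<close>, whose line lies in both; it belongs to
  \<open>S\<close> because flats are closed under intersection and \<open>S\<close> is
  down-closed.\<close>

lemma wv_line:
 assumes x: "x : compatible W S" and i: "i : J" and j: "j : J" and n: "wv i x ~: U"
 shows "wv j x : line_mod U (wv i x)"
proof -
 have mod: "EX k. k ~= 0 & y - cscale k z : U" if "y : snd x A" "A : S" "A < U" "z = vrep A (snd x A)" "y ~: A" for y z A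
 proof -
  have "y : line_mod A z" using that compatible_rep(2)[OF x that(2)] by metis
  then have "line_mod A y = line_mod A z" using line_mod_of_mem[OF meet(5)[OF that(2)]] that by blast
  then have "EX k. k ~= 0 & y - cscale k z : A" using line_mod_eq_iff[OF meet(5)[OF that(2)] that(5)] by blast
  then show ?thesis using that(3) by blast
 qed
 have inv: "z - cscale (1 / k) y : U" if "k ~= 0" "y - cscale k z : U" for y z k
 proof -
  have "cscale (- (1 / k)) (y - cscale k z) : U" by(rule cfun.subspace_scale[OF subU that(2)])
  also have "cscale (- (1 / k)) (y - cscale k z) = z - cscale (1 / k) y" using that by(auto simp: fun_eq_iff field_simps)
  finally show ?thesis .
 qed
 have fstx: "fst x : snd x A" if "A : S" for A using x that by(simp add: compatible_def)
 have mono: "snd x A <= snd x B" if "A : S" "B : S" "A <= B" for A B using x that by(simp add: compatible_def)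
 show ?thesis
 proof (cases i)
  case None
  then have fU: "fst x ~: U" using n by(simp add: wv_def)
  show ?thesis
  proof (cases j)
   case None
   then show ?thesis using \<open>i = None\<close> line_mod_contains(2) by simp
  next
   case (Some A)
   then have A: "A : S" "A < U" using j by(auto simp: J_def)
   obtain k where k: "k ~= 0" "fst x - cscale k (vrep A (snd x A)) : U"
    using mod[OF fstx[OF A(1)] A refl] fU A by blast
   then show ?thesis using inv[OF k] in_line_mod[OF subU] Some None by(auto simp: wv_def)
  qed
 next
  case (Some B)
  then have B: "B : S" "B < U" using i by(auto simp: J_def)
  have nB: "vrep B (snd x B) ~: U" using n Some by(simp add: wv_def)
  show ?thesis
  proof (cases j)
   case None
   have "fst x : line_mod B (vrep B (snd x B))" using fstx[OF B(1)] compatible_rep(2)[OF x B(1)] by metis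
   then have "fst x : line_mod U (vrep B (snd x B))"
    using B in_line_mod[OF meet(5)[OF B(1)]] in_line_mod[OF subU] by blast
   then show ?thesis using Some None by(simp add: wv_def)
  next
   case (Some A)
   then have A: "A : S" "A < U" using j by(auto simp: J_def)
   let ?C = "A Int B"
   have C: "?C : S" using A B inter meet(6) down[OF A(1)] by blast
   let ?u = "vrep ?C (snd x ?C)"
   have uC: "?u ~: ?C" and "?u : snd x ?C"
    using compatible_rep[OF x C] line_mod_contains(2)[of ?u ?C] by auto
   then have uA: "?u : snd x A" and uB: "?u : snd x B" using mono[OF C A(1)] mono[OF C B(1)] by auto
   show ?thesis
   proof (cases "?u : A")
    case False
    obtain k where k: "k ~= 0" "?u - cscale k (vrep A (snd x A)) : U" using mod[OF uA A refl False] by blast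
    have uB': "?u : line_mod U (vrep B (snd x B))"
     using uB compatible_rep(2)[OF x B(1)] in_line_mod[OF meet(5)[OF B(1)]] in_line_mod[OF subU] B(2) by blast
    have "vrep A (snd x A) = (vrep A (snd x A) - cscale (1 / k) ?u) + cscale (1 / k) ?u" by(simp add: fun_eq_iff)
    also have "... : line_mod U (vrep B (snd x B))"
     using inv[OF k] uB' line_mod_contains(1)[of U "vrep B (snd x B)"] subspace_line_mod
     by(intro cfun.subspace_add cfun.subspace_scale) auto
    finally show ?thesis using \<open>i = Some B\<close> Some by(simp add: wv_def)
   next
    case True
    \<comment> \<open>\<open>?u\<close> now spans the line at \<open>B\<close> but lies in
      \<open>A\<close>, hence in \<open>U\<close>; this would put the vector attached to
      \<open>B\<close> into \<open>U\<close>.\<close>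
    then have "?u ~: B" using uC by blast
    then obtain k where k: "k ~= 0" "?u - cscale k (vrep B (snd x B)) : U" using mod[OF uB B refl] by blast
    have "vrep B (snd x B) = (vrep B (snd x B) - cscale (1 / k) ?u) + cscale (1 / k) ?u" by(simp add: fun_eq_iff)
    also have "... : U" using inv[OF k] True A by(intro cfun.subspace_add[OF subU] cfun.subspace_scale[OF subU]) auto
    finally show ?thesis using nB by simp
   qed
  qed
 qed
qed

lemma ext_pt_U:
 assumes x: "x : compatible W S" and j: "j : J" "wv j x ~: U"
 shows "snd (ext_pt x) U = line_mod U (wv j x)"
proof -
 have "(SOME j. j : J & wv j x ~: U) : J & wv (SOME j. j : J & wv j x ~: U) x ~: U"
  by(rule someI[of "%j. j : J & wv j x ~: U" j]) (use j in auto)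
 then have "line_mod U (wv (SOME j. j : J & wv j x ~: U) x) = line_mod U (wv j x)"
  using line_mod_of_mem[OF subU wv_line[OF x j(1) _ j(2)]] by blast
 then show ?thesis by(simp add: ext_pt_def S'_def)
qed

lemma pr_ext: "x : compatible W S ==> pr (ext_pt x) = x"
proof -
 assume x: "x : compatible W S"
 then have "snd x : extensional S" by(simp add: compatible_def)
 then have "snd (pr (ext_pt x)) = snd x"
  by(intro extensionalityI[where A = S]) (auto simp: pr_def ext_pt_def S'_def US)
 then show ?thesis by(simp add: prod_eq_iff fst_pr) (simp add: ext_pt_def)
qed

lemma ext_pt_compatible:
 assumes x: "x : compatible W S" "x ~: Z"
 shows "ext_pt x : compatible W S' - E"
proof -
 obtain j where j: "j : J" "wv j x ~: U" using Z_iff[OF x(1)] x(2) by blast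
 note eU = ext_pt_U[OF x(1) j]
 have fx: "fst (ext_pt x) = fst x" by(simp add: ext_pt_def)
 have "ext_pt x : compatible W S'"
 proof (rule compatible_insertI)
  show "pr (ext_pt x) : compatible W S" using pr_ext x by simp
  show "snd (ext_pt x) : extensional S'" by(simp add: ext_pt_def)
  show "wv j x : W - U" using wv_W x j by blast
  show "snd (ext_pt x) U = line_mod U (wv j x)" by(rule eU)
  have "None : J" by(simp add: J_def)
  from wv_line[OF x(1) j(1) this j(2)] show "fst (ext_pt x) : snd (ext_pt x) U" unfolding eU fx by(simp add: wv_def)
  fix A assume A: "A : S" "A < U"
  then have "Some A : J" by(simp add: J_def)
  from wv_line[OF x(1) j(1) this j(2)] have "vrep A (snd x A) : line_mod U (wv j x)" by(simp add: wv_def)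
  then have "line_mod A (vrep A (snd x A)) <= line_mod U (wv j x)" using A by(intro line_mod_subset_line_mod) auto
  moreover have "snd (ext_pt x) A = line_mod A (vrep A (snd x A))"
   using compatible_rep(2)[OF x(1) A(1)] A by(simp add: ext_pt_def S'_def US)
  ultimately show "snd (ext_pt x) A <= snd (ext_pt x) U" unfolding eU by simp
 qed
 then show ?thesis using pr_ext[OF x(1)] x(2) by(simp add: E_def)
qed

text \<open>All attached vectors lie in the line at \<open>U\<close>, so one of them outside
  \<open>U\<close> already determines that line.\<close>

lemma ext_pr:
 assumes x: "x : compatible W S' - E"
 shows "ext_pt (pr x) = x"
proof -
 have xc: "x : compatible W S'" and pc: "pr x : compatible W S" "pr x ~: Z"
  using x pr_compatible by(auto simp: E_def)
 obtain j where j: "j : J" "wv j (pr x) ~: U" using Z_iff[OF pc(1)] pc(2) by blast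
 have "wv j (pr x) : snd x U"
 proof (cases j)
  case None
  then show ?thesis using xc by(simp add: wv_def fst_pr compatible_def S'_def)
 next
  case (Some A)
  then have A: "A : S" "A < U" using j by(auto simp: J_def)
  have "vrep A (snd (pr x) A) : snd (pr x) A"
   using compatible_rep(2)[OF pc(1) A(1)] line_mod_contains(2)[of "vrep A (snd (pr x) A)" A] by simp
  then have "vrep A (snd (pr x) A) : snd x A" by(simp add: snd_pr A)
  then show ?thesis using line_in_V(6)[OF xc A] Some by(auto simp: wv_def)
 qed
 moreover obtain u where u: "u : W - U" "snd x U = line_mod U u" using line_in_V(4)[OF xc] by blast
 ultimately have "line_mod U (wv j (pr x)) = snd x U" using line_mod_of_mem[OF subU _ j(2)] by metis
 then have eU: "snd (ext_pt (pr x)) U = snd x U" using ext_pt_U[OF pc(1) j] by simp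
 have eS: "snd (ext_pt (pr x)) B = snd x B" if "B : S" for B using that by(simp add: ext_pt_def S'_def US snd_pr)
 have "snd (ext_pt (pr x)) B = snd x B" if "B : S'" for B
  using that eU eS by(cases "B = U") (simp_all add: S'_def)
 moreover have "snd (ext_pt (pr x)) : extensional S'" by(simp add: ext_pt_def)
 moreover have "snd x : extensional S'" using xc by(simp add: compatible_def)
 ultimately have "snd (ext_pt (pr x)) = snd x" by(intro extensionalityI[where A = S'])
 then show ?thesis by(simp add: prod_eq_iff) (simp add: ext_pt_def fst_pr)
qed

text \<open>The counterpart of \<open>wv\<close> on lifts, continuous where \<open>wv\<close>
  involves a choice.\<close>

definition lv :: "cvec set option => cvec \<times> (cvec set => cvec) => cvec" where
 "lv j y = (case j of None => fst y | Some B => snd y B)"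

lemma lv:
 assumes y: "y : topspace (lift_top V P S)" and P: "P <= compatible W S" and j: "j : J"
 shows "lv j y : V" "wv j (lift_map S y) : U \<longleftrightarrow> lv j y : U" "line_mod U (wv j (lift_map S y)) = line_mod U (lv j y)"
proof -
 have c: "lift_map S y : compatible W S" using y P by(auto simp: topspace_lift_top)
 show "lv j y : V" using y j by(auto simp: lv_def J_def topspace_lift_top)
 have "(wv j (lift_map S y) : U \<longleftrightarrow> lv j y : U) & line_mod U (wv j (lift_map S y)) = line_mod U (lv j y)"
 proof (cases j)
  case None
  then show ?thesis by(simp add: wv_def lv_def lift_map_def)
 next
  case (Some B)
  then have B: "B : S" "B < U" using j by(auto simp: J_def)
  have nB: "snd y B ~: B" using y B by(auto simp: topspace_lift_top)
  have l: "snd (lift_map S y) B = line_mod B (snd y B)" using B by(simp add: lift_map_def)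
  let ?v = "vrep B (snd (lift_map S y) B)"
  have eq: "line_mod B (snd y B) = line_mod B ?v" using compatible_rep(2)[OF c B(1)] l by simp
  have iff: "?v : U \<longleftrightarrow> snd y B : U"
   using line_mod_subset_iff[OF subU, of B ?v] line_mod_subset_iff[OF subU, of B "snd y B"] eq B by auto
  obtain k where k: "k ~= 0" "snd y B - cscale k ?v : B" using line_mod_eq_iff[OF meet(5)[OF B(1)] nB] eq by blast
  then have "line_mod U (snd y B) = line_mod U ?v" using B by(intro line_mod_eq[OF subU _ k(1)]) auto
  then show ?thesis using iff Some by(simp add: wv_def lv_def)
 qed
 then show "wv j (lift_map S y) : U \<longleftrightarrow> lv j y : U" "line_mod U (wv j (lift_map S y)) = line_mod U (lv j y)" by auto
qed

lemma continuous_lv: "j : J ==> cmap (lift_top V P S) euclidean (%y. lv j y i)"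
 using lift_coords by(auto simp: lv_def J_def)

text \<open>An open cover of the complement of \<open>Z\<close>: on \<open>T j\<close> the choice
  hidden in \<open>ext_pt\<close> can be replaced by the fixed index \<open>j\<close>.\<close>

definition T :: "cvec set option => mpoint set" where "T j = {x : compatible W S. wv j x ~: U}"

lemma TC: "T j <= compatible W S" by(auto simp: T_def)

lemma T_cover: "compatible W S - Z = (\<Union>j\<in>J. T j)"
 using Z_iff ZC by(auto simp: T_def)

lemma open_T: assumes j: "j : J" shows "openin X (T j)"
proof (rule open_quotient_openin[OF qX])
 show "T j <= topspace X" by(simp add: tX T_def)
 have "{y : topspace Lt. lift_map S y : T j} = topspace Lt - {y : topspace Lt. lv j y : U}"
  using lv(2)[OF _ order_refl j] by(auto simp: T_def topspace_lift_top)
 moreover have "closedin Lt {y : topspace Lt. lv j y : U}"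
  by(rule closedin_preimage[OF U(1) continuous_lv[OF j]]) (rule lv(1)[OF _ order_refl j])
 ultimately show "openin Lt {y : topspace Lt. lift_map S y : T j}" by(simp add: openin_diff)
qed

lemma continuous_ext_T:
 assumes j: "j : J"
 shows "cmap (subtop X (T j)) (subtop X' (compatible W S' - E)) ext_pt"
proof (rule open_quotient_lift[OF open_quotient_lift_top[OF S WV TC]])
 let ?L = "lift_top V (T j) S"
 have tT: "lift_map S y : compatible W S" "lift_map S y : T j" "lift_map S y ~: Z" if "y : topspace ?L" for y
  using that j Z_iff by(auto simp: topspace_lift_top T_def)
 show "cmap ?L (subtop X' (compatible W S' - E)) (%y. ext_pt (lift_map S y))"
 proof (rule continuous_into_model[OF S'F WV])
  show "cmap ?L euclidean (%y. fst (ext_pt (lift_map S y)) i)" for i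
   using lift_coords(1) by(simp add: ext_pt_def lift_map_def)
  show "cmap ?L (proj_quotient V B) (%y. snd (ext_pt (lift_map S y)) B)" if B: "B : S'" for B
  proof (cases "B = U")
   case True
   have eq: "lv j y : V - U & line_mod U (lv j y) = snd (ext_pt (lift_map S y)) U" if y: "y : topspace ?L" for y
    using lv[OF y TC j] tT[OF y] ext_pt_U[OF tT(1)[OF y] j] by(auto simp: T_def)
   have "cmap ?L (proj_quotient V U) (%y. line_mod U (lv j y))"
    by(rule continuous_line[OF U(1) continuous_lv[OF j]]) (rule eq[THEN conjunct1])
   then show ?thesis unfolding True by(rule continuous_map_eq) (use eq in blast)
  next
   case False
   then have BS: "B : S" using B by(simp add: S'_def)
   have "cmap ?L (proj_quotient V B) (%y. line_mod B (snd y B))"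
    using BS S by(intro continuous_line lift_coords(2)) (auto simp: topspace_lift_top)
   then show ?thesis using False B BS by(simp add: ext_pt_def lift_map_def)
  qed
 qed (use ext_pt_compatible tT in auto)
qed

lemma homeo_off: "homeomorphic_map (subtop X' (topspace X' - E)) (subtop X (topspace X - Z)) pr"
proof (rule homeomorphic_maps_imp_map)
 show "homeomorphic_maps (subtop X' (topspace X' - E)) (subtop X (topspace X - Z)) pr ext_pt"
  unfolding homeomorphic_maps_def
 proof (intro conjI ballI)
  show "cmap (subtop X' (topspace X' - E)) (subtop X (topspace X - Z)) pr"
   using continuous_pr pr_compatible by(auto simp: continuous_map_in_subtopology continuous_map_from_subtopology tX tX' E_def)
  show "cmap (subtop X (topspace X - Z)) (subtop X' (topspace X' - E)) ext_pt"
   unfolding tX tX'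
  proof (rule pasting_lemma[where I = J and T = T and f = "%_. ext_pt"])
   fix j assume j: "j : J"
   then have sub: "T j <= compatible W S - Z" using T_cover by blast
   show "openin (subtop X (compatible W S - Z)) (T j)"
    using open_T[OF j] sub by(simp add: openin_subtopology_alt) blast
   show "cmap (subtop (subtop X (compatible W S - Z)) (T j)) (subtop X' (compatible W S' - E)) ext_pt"
    using continuous_ext_T[OF j] sub by(simp add: subtopology_subtopology Int_absorb1)
  next
   fix x assume "x : topspace (subtop X (compatible W S - Z))"
   then show "EX j. j : J & x : T j & ext_pt x = ext_pt x" using T_cover by(auto simp: tX)
  qed auto
  show "ext_pt (pr x) = x" if "x : topspace (subtop X' (topspace X' - E))" for x
   using that ext_pr by(simp add: tX')
  show "pr (ext_pt x) = x" if "x : topspace (subtop X (topspace X - Z))" for x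
   using that pr_ext by(simp add: tX)
 qed
qed

section \<open>The exceptional part and the centre\<close>

lemma E_line:
 assumes z: "z : Z" and l: "l : line_mod U ` (W - U)"
 shows "(fst z, \<lambda>B\<in>S'. if B = U then l else snd z B) : E" "pr (fst z, \<lambda>B\<in>S'. if B = U then l else snd z B) = z"
proof -
 let ?x = "(fst z, \<lambda>B\<in>S'. if B = U then l else snd z B)"
 have zc: "z : compatible W S" "fst z : U" "!!A. A : S ==> A < U ==> snd z A <= U" using z by(auto simp: Z_def)
 then have "snd z : extensional S" by(simp add: compatible_def)
 then have "snd (pr ?x) = snd z" by(intro extensionalityI[where A = S]) (auto simp: pr_def S'_def US)
 then show 1: "pr ?x = z" by(simp add: prod_eq_iff fst_pr)
 obtain u where u: "u : W - U" "l = line_mod U u" using l by blast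
 have Ul: "U <= l" unfolding u by(rule line_mod_contains)
 have "?x : compatible W S'"
 proof (rule compatible_insertI[OF _ _ u(1)])
  show "snd ?x A <= snd ?x U" if "A : S" "A < U" for A using zc(3)[OF that] Ul that by(auto simp: S'_def)
 qed (use 1 zc Ul u in \<open>auto simp: S'_def\<close>)
 then show "?x : E" using 1 z by(simp add: E_def)
qed

text \<open>Over the centre the vector and all lines at flats below \<open>U\<close> lie in
  \<open>U\<close>, so nesting puts no condition on the line at \<open>U\<close>; the exceptional
  part is therefore a product.\<close>

lemma E_product:
 "homeomorphic_maps (subtop X' E) (prod_top (subtop X Z) (proj_quotient W U))
  (%x. (pr x, snd x U)) (%z. (fst (fst z), \<lambda>B\<in>S'. if B = U then snd z else snd (fst z) B))"
proof -
 obtain e' \<phi>' where "proj_coords W U (d W - d U) e' \<phi>'" using coords[OF U(1) W U(3)] by blast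
 then have PW: "proj_quotient W U = subtop (proj_quotient V U) (line_mod U ` (W - U))"
  using proj_coords.proj_quotient_sub subV WV by blast
 have "cmap (subtop X' E) (proj_quotient W U) (%x. snd x U)"
  unfolding PW continuous_map_in_subtopology
 proof
  show "cmap (subtop X' E) (proj_quotient V U) (%x. snd x U)" by(rule model_coords(2)) (simp add: S'_def)
  show "(%x. snd x U) : topspace (subtop X' E) \<rightarrow> line_mod U ` (W - U)"
   using line_in_V(4) by(fastforce simp: E_def)
 qed
 moreover have "cmap (subtop X' E) (subtop X Z) pr"
  using continuous_pr by(auto simp: continuous_map_in_subtopology continuous_map_from_subtopology E_def)
 ultimately have 1: "cmap (subtop X' E) (prod_top (subtop X Z) (proj_quotient W U)) (%x. (pr x, snd x U))"
  by(simp add: continuous_map_paired)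
 let ?P = "prod_top (subtop X Z) (proj_quotient W U)"
 let ?h = "%z. (fst (fst z), \<lambda>B\<in>S'. if B = U then snd z else snd (fst z) B)"
 have 2: "cmap ?P (subtop X' E) ?h"
 proof (rule continuous_into_model[OF S'F WV])
  show "cmap ?P euclidean (%z. fst (?h z) i)" for i
   using continuous_map_compose[OF continuous_map_fst model_coords(1)[of W S Z i], of "proj_quotient W U"] by(simp add: o_def)
  show "cmap ?P (proj_quotient V B) (%z. snd (?h z) B)" if B: "B : S'" for B
  proof (cases "B = U")
   case True
   have "cmap ?P (proj_quotient W U) snd" by(rule continuous_map_snd)
   then have "cmap ?P (proj_quotient V U) snd" unfolding PW by(simp add: continuous_map_in_subtopology)
   then show ?thesis using True by(simp add: S'_def)
  next
   case False
   then have BS: "B : S" using B by(simp add: S'_def)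
   have "cmap ?P (proj_quotient V B) ((%x. snd x B) \<circ> fst)"
    by(rule continuous_map_compose[OF continuous_map_fst model_coords(2)[OF BS]])
   then show ?thesis using False B by(simp add: o_def)
  qed
  show "?h z : E" if "z : topspace ?P" for z
  proof -
   have "fst z : Z" "snd z : line_mod U ` (W - U)" using that by auto
   then show ?thesis by(rule E_line(1))
  qed
 qed (rule EC)
 show ?thesis
  unfolding homeomorphic_maps_def
 proof (intro conjI 1 2 ballI)
  fix x assume "x : topspace (subtop X' E)"
  then have x: "x : compatible W S'" by(auto simp: E_def)
  then have "snd x : extensional S'" by(simp add: compatible_def)
  then have "(\<lambda>B\<in>S'. if B = U then snd x U else snd (pr x) B) = snd x"
   by(intro extensionalityI[where A = S']) (auto simp: S'_def snd_pr)
  then show "?h (pr x, snd x U) = x" unfolding fst_conv snd_conv by(simp add: prod_eq_iff fst_pr)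
 next
  fix z assume "z : topspace ?P"
  then show "(pr (?h z), snd (?h z) U) = z" using E_line(2)[of "fst z" "snd z"] by(auto simp: prod_eq_iff S'_def)
 qed
qed

definition FU :: "cvec set set" where "FU = {B : F. B < U}"

lemma FU: "FU <= S" "FU <= F" "B : S ==> B Int U : FU"
 using below meet by(auto simp: FU_def)

text \<open>The centre is the model of the flat \<open>U\<close> for the flats below it, since the
  line at any \<open>B\<close> is spanned by a representative of the line at \<open>B Int U\<close>.
  This closes the recursion.\<close>

lemma Z_homeomorphic:
 "homeomorphic_maps (subtop X Z) (model_top V U FU)
  (%x. (fst x, restrict (snd x) FU)) (%x. (fst x, \<lambda>B\<in>S. line_mod B (vr x B)))"
proof -
 let ?f = "%x :: mpoint. (fst x, restrict (snd x) FU)" and ?h = "%x. (fst x, \<lambda>B\<in>S. line_mod B (vr x B))"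
 let ?Y = "model_top V U FU"
 have tY: "topspace ?Y = compatible U FU" using topspace_model[OF FU(2) UV] .
 have subY: "subtop ?Y (compatible U FU) = ?Y" by(metis subtopology_topspace tY)
 have FUU: "B Int U = B" if "B : FU" for B using that by(auto simp: FU_def)
 have f: "?f x : compatible U FU" if z: "x : Z" for x
 proof -
  have x: "x : compatible W S" using z ZC by blast
  have "EX u:U - B. snd x B = line_mod B u" if B: "B : FU" for B
  proof -
   have BS: "B : S" using FU B by blast
   show ?thesis using Z_props[OF z BS] vr(3)[OF x BS] FUU[OF B] by auto
  qed
  note lines = this
  have fU: "fst x : U" using z by(simp add: Z_def)
  have inS: "B : S" if "B : FU" for B using FU(1) that by blast
  show ?thesis
   unfolding compatible_def
  proof (intro CollectI conjI ballI impI)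
   fix B assume B: "B : FU"
   show "EX u:U - B. snd (?f x) B = line_mod B u" using lines[OF B] B by simp
   show "fst (?f x) : snd (?f x) B" using x inS[OF B] B by(simp add: compatible_def)
   show "snd (?f x) B <= snd (?f x) A" if "A : FU" "B <= A" for A
    using x inS[OF B] inS[OF that(1)] B that by(simp add: compatible_def)
  qed (use fU in auto)
 qed
 have vrY: "vr y B : U - B Int U" "snd y (B Int U) = line_mod (B Int U) (vr y B)" if y: "y : compatible U FU" and B: "B : S" for y B
 proof -
  obtain u where u: "u : U - (B Int U)" "snd y (B Int U) = line_mod (B Int U) u" using y FU(3)[OF B] unfolding compatible_def by blast
  have v: "vr y B ~: B Int U & snd y (B Int U) = line_mod (B Int U) (vr y B)" using vrep[of u "B Int U" "snd y (B Int U)"] u by blast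
  then show "snd y (B Int U) = line_mod (B Int U) (vr y B)" by blast
  have "line_mod (B Int U) u <= U" using u by(simp add: line_mod_subset_iff[OF subU])
  then show "vr y B : U - B Int U" using v u line_mod_contains(2)[of "vr y B" "B Int U"] by auto
 qed
 have hF: "snd (?h y) B = snd y B" if y: "y : compatible U FU" and B: "B : FU" for y B
  using vrY(2)[OF y, of B] FUU[OF B] FU(1) B by auto
 have h: "?h y : Z" if y: "y : compatible U FU" for y
 proof -
  have fy: "fst y : U" using y by(simp add: compatible_def)
  have "?h y : compatible W S"
   unfolding compatible_def
  proof (intro CollectI conjI ballI impI)
   show "fst (?h y) : W" using fy U by auto
   fix B assume B: "B : S"
   show "EX u:W - B. snd (?h y) B = line_mod B u" using vrY(1)[OF y B] U(3) B by auto
   have "fst y : snd y (B Int U)" using y FU(3)[OF B] by(simp add: compatible_def)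
   then have "fst y : line_mod (B Int U) (vr y B)" using vrY(2)[OF y B] by simp
   then have "fst y : line_mod B (vr y B)" using in_line_mod[OF meet(4)[OF B]] in_line_mod[OF meet(5)[OF B]] by blast
   then show "fst (?h y) : snd (?h y) B" using B by simp
   fix A assume A: "A : S" "B <= A"
   have "snd y (B Int U) <= snd y (A Int U)"
   proof -
    have "B Int U <= A Int U" using A by blast
    then show ?thesis using y FU(3)[OF B] FU(3)[OF A(1)] by(simp add: compatible_def)
   qed
   then have "vr y B : line_mod (A Int U) (vr y A)"
    using vrY(2)[OF y B] vrY(2)[OF y A(1)] line_mod_contains(2)[of "vr y B" "B Int U"] by auto
   then have "vr y B : line_mod A (vr y A)" using in_line_mod[OF meet(4)[OF A(1)]] in_line_mod[OF meet(5)[OF A(1)]] by blast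
   then show "snd (?h y) B <= snd (?h y) A" using A B line_mod_subset_line_mod[OF A(2)] by simp
  qed simp
  moreover have "snd (?h y) B <= U" if B: "B : S" "B < U" for B
   using vrY(1)[OF y B(1)] B by(auto simp: line_mod_subset_iff[OF subU, THEN iffD2] subsetD)
  ultimately show ?thesis using fy by(simp add: Z_def)
 qed
 have 1: "cmap (subtop X Z) ?Y ?f"
 proof (subst subY[symmetric], rule continuous_into_model[OF FU(2) UV])
  show "cmap (subtop X Z) euclidean (%x. fst (?f x) i)" for i using model_coords(1) by simp
  show "cmap (subtop X Z) (proj_quotient V B) (%x. snd (?f x) B)" if "B : FU" for B
   using that FU(1) model_coords(2)[of B S W Z] by auto
  show "?f x : compatible U FU" if "x : topspace (subtop X Z)" for x using that by(intro f) simp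
 qed auto
 have 2: "cmap ?Y (subtop X Z) ?h"
 proof (subst subY[symmetric], rule open_quotient_lift[OF open_quotient_lift_top[OF FU(2) UV order_refl]])
  let ?L = "lift_top V (compatible U FU) FU"
  show "cmap ?L (subtop X Z) (%y. ?h (lift_map FU y))"
  proof (rule continuous_into_model[OF S WV])
   show "cmap ?L euclidean (%y. fst (?h (lift_map FU y)) i)" for i
    using lift_coords(1) by(simp add: lift_map_def)
   show "cmap ?L (proj_quotient V B) (%y. snd (?h (lift_map FU y)) B)" if B: "B : S" for B
   proof -
    have eq: "snd y (B Int U) : V - B & line_mod B (snd y (B Int U)) = snd (?h (lift_map FU y)) B" if y: "y : topspace ?L" for y
    proof -
     have c: "lift_map FU y : compatible U FU" using y by(simp add: topspace_lift_top)
     have l: "snd (lift_map FU y) (B Int U) = line_mod (B Int U) (snd y (B Int U))" using FU(3)[OF B] by(simp add: lift_map_def)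
     have nB: "snd y (B Int U) ~: B Int U" using y FU(3)[OF B] by(auto simp: topspace_lift_top)
     let ?v = "vr (lift_map FU y) B"
     have eq: "line_mod (B Int U) (snd y (B Int U)) = line_mod (B Int U) ?v" using vrY(2)[OF c B] l by simp
     have "line_mod (B Int U) (snd y (B Int U)) <= U"
      unfolding eq using vrY(1)[OF c B] by(simp add: line_mod_subset_iff[OF subU])
     then have "snd y (B Int U) : U" using line_mod_contains(2)[of "snd y (B Int U)" "B Int U"] by blast
     moreover obtain k where k: "k ~= 0" "snd y (B Int U) - cscale k ?v : B Int U"
      using line_mod_eq_iff[OF meet(4)[OF B] nB] eq by blast
     then have "line_mod B (snd y (B Int U)) = line_mod B ?v" by(intro line_mod_eq[OF meet(5)[OF B] _ k(1)]) auto
     ultimately show ?thesis using nB UV B by auto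
    qed
    have "cmap ?L (proj_quotient V B) (%y. line_mod B (snd y (B Int U)))"
     by(rule continuous_line[OF meet(6)[OF B] lift_coords(2)[OF FU(3)[OF B]]]) (rule eq[THEN conjunct1])
    then show ?thesis by(rule continuous_map_eq) (use eq in blast)
   qed
   show "?h (lift_map FU y) : Z" if "y : topspace ?L" for y using that by(intro h) (simp add: topspace_lift_top)
  qed (rule ZC)
 qed
 show ?thesis
  unfolding homeomorphic_maps_def
 proof (intro conjI 1 2 ballI)
  fix x assume "x : topspace (subtop X Z)"
  then have z: "x : Z" by simp
  then have x: "x : compatible W S" and xN: "x : N" using ZC Z_N by auto
  have "vr (?f x) B = vr x B" if "B : S" for B using FU(3)[OF that] by simp
  then have "snd (?h (?f x)) = snd x"
   using N_props(2)[OF xN, of _ 1] x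
   by(intro extensionalityI[where A = S]) (auto simp: compatible_def)
  then show "?h (?f x) = x" by(simp add: prod_eq_iff)
 next
  fix y assume "y : topspace ?Y"
  then have y: "y : compatible U FU" by(simp add: tY)
  then have "snd (?f (?h y)) = snd y"
   using hF[OF y] by(intro extensionalityI[where A = FU]) (auto simp: compatible_def)
  then show "?f (?h y) = y" by(simp add: prod_eq_iff)
 qed
qed

text \<open>The fibre of the exceptional part is P(W/U), so it is the codimension in
  \<open>W\<close> that counts, although the contraction uses coordinates of
  \<open>V\<close>.\<close>

theorem blowup_step_even:
 assumes b: "even_free X b" and bU: "even_free (model_top V U FU) bU"
 shows "even_free X' (%i. (\<Sum>\<delta>\<in>{1..<d W - d U}. if \<delta> <= i then bU (i - \<delta>) else 0) + b i)"
proof (rule blow_up_even[OF b continuous_pr closedZ openN Z_N _ _ homeo_off])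
 show "E = {x : topspace X'. pr x : Z}" "N' = {x : topspace X'. pr x : N}" by(auto simp: E_def N'_def tX')
 show "cmap (prod_top (top_of_set {0..1}) (subtop X N)) (subtop X N) (%z. flow (fst z) (snd z))"
  by(rule continuous_flow)
 show "cmap (prod_top (top_of_set {0..1}) (subtop X' N')) (subtop X' N') (%z. flow' (fst z) (snd z))"
  by(rule continuous_flow')
 show "flow 0 x : Z" "flow 1 x = x" if "x : N" for x using that flow_0 flow_1 by auto
 show "flow 0 x = x" if "x : Z" for x using that flow_Z by blast
 show "flow' 1 x = x" if "x : N'" for x using that flow'_eqI[of x 1] flow_1[of "pr x"] by(simp add: N'_def)
 show "flow' 0 x = x" if "x : E" for x
  using that flow'_eqI[of x 0] flow_Z[of "pr x"] Z_N by(auto simp: E_def N'_def)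
 show "pr (flow' 0 x) = flow 0 (pr x)" if "x : N'" for x using that pr_flow' by simp
 obtain e' \<phi>' where pW: "proj_coords W U (d W - d U) e' \<phi>'" using coords[OF U(1) W U(3)] by blast
 have "(subtop X Z) homeomorphic_space (model_top V U FU)" using Z_homeomorphic homeomorphic_space_def by blast
 then have "even_free (subtop X Z) bU"
  using even_free_iso[OF bU] homeomorphic_space_imp_isomorphic_homology_groups homeomorphic_space_sym by blast
 then have k: "even_kernel (prod_top (subtop X Z) (proj_quotient W U)) (subtop X Z) fst
   (%i. \<Sum>\<delta>\<in>{1..<d W - d U}. if \<delta> <= i then bU (i - \<delta>) else 0)"
  using dmono[OF U(1) W U(3)] by(intro proj_coords.projective_bundle_even[OF pW]) auto
 have hm: "homeomorphic_map (subtop X' E) (prod_top (subtop X Z) (proj_quotient W U)) (%x. (pr x, snd x U))"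
  using E_product homeomorphic_maps_imp_map by blast
 show "even_kernel (subtop X' E) (subtop X Z) pr (%i. \<Sum>\<delta>\<in>{1..<d W - d U}. if \<delta> <= i then bU (i - \<delta>) else 0)"
  by(rule even_kernel_precompose[OF k homeomorphic_imp_continuous_map[OF hm] homeomorphic_map_homology_iso[OF hm]]) simp
qed

end

section \<open>Betti numbers of all models by recursion\<close>

lemma even_free_point:
 assumes "topspace X = {a}"
 shows "even_free X (%i. if i = 0 then 1 else 0)"
 unfolding even_free_def
proof
 fix p
 show "free_rank (homol p X) (evrank (%i. if i = 0 then 1 else 0) p)"
 proof (cases "p = 0")
  case True
  then show ?thesis
   using free_rank_is_iso[OF free_rank_integer_group group.iso_sym[OF _ homology_coefficients[OF assms]]]
   by(simp add: evrank_def)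
 next
  case False
  then have "evrank (%i. if i = 0 then 1 else 0) p = 0" by(auto simp: evrank_def elim!: evenE)
  then show ?thesis using homology_dimension_axiom[OF assms False] by(simp add: free_rank_0)
 qed
qed

context arrangement begin

text \<open>Before any blow-up the model is \<open>W\<close> itself, contracted to the origin by
  scaling.\<close>

lemma model_empty_even:
 assumes W: "W : insert V F"
 shows "even_free (model_top V W {}) (%i. if i = 0 then 1 else 0)"
proof -
 have WV: "W <= V" and sW: "cfun.subspace W" using W proper subV subF by auto
 let ?X = "model_top V W {}"
 have t: "topspace ?X = compatible W {}" using topspace_model WV by simp
 have subX: "subtop ?X (compatible W {}) = ?X" by(metis subtopology_topspace t)
 define h where "h = (%(s::real) (x::mpoint). (cscale (of_real s) (fst x), snd x))"
 let ?p = "(0, %_. undefined) :: mpoint"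
 have c: "compatible W {} = W \<times> {%_. undefined}" by(auto simp: compatible_def)
 have "cmap (prod_top (top_of_set {0..1}) ?X) (subtop ?X (compatible W {})) (%z. h (fst z) (snd z))"
 proof (rule continuous_into_model[OF _ WV])
  have "cmap ?X euclidean (%x. fst x i)" for i
   using model_coords(1)[of W "{}" "compatible W {}"] by(simp add: subX)
  then show "cmap (prod_top (top_of_set {0..1}) ?X) euclidean (%z. fst (h (fst z) (snd z)) i)" for i
   unfolding h_def fst_conv cscale_apply
   by(intro continuous_map_mult continuous_map_of_real time_coord continuous_map_snd_comp)
  show "h (fst z) (snd z) : compatible W {}" if "z : topspace (prod_top (top_of_set {0..1}) ?X)" for z
   using that cfun.subspace_scale[OF sW] by(auto simp: t c h_def)
 qed auto
 then have cont: "cmap (prod_top (top_of_set {0..1}) ?X) ?X (%z. h (fst z) (snd z))" by(simp add: subX)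
 have 0: "h 0 x = ?p" if "x : topspace ?X" for x
  using that by(auto simp: h_def t c fun_eq_iff)
 have 1: "h 1 x = x" for x by(auto simp: h_def prod_eq_iff fun_eq_iff)
 have p: "?p : topspace ?X" using cfun.subspace_0[OF sW] by(simp add: t c)
 have "hom_induced p (subtop ?X {?p}) {} ?X {} id : iso (homol p (subtop ?X {?p})) (homol p ?X)" for p
  by(rule deformation_retract_iso(3)[OF cont]) (use 0 1 in auto)
 moreover have "topspace (subtop ?X {?p}) = {?p}" using p by auto
 from even_free_point[OF this] have "even_free (subtop ?X {?p}) (%i. if i = 0 then 1 else 0)" .
 ultimately show ?thesis using even_free_iso is_isoI by blast
qed

text \<open>The outer induction on \<open>d W\<close> supplies the Betti numbers of the centres,
  which are models of smaller flats; the inner one adds flats one at a time, by peeling a maximal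
  member off a down-closed set.\<close>

theorem model_even:
 assumes bt: "!!W i. W : insert V F ==> bt W i = (if i = 0 then 1 else 0) +
   (\<Sum>U\<in>{U : F. U < W}. \<Sum>\<delta>\<in>{1..<d W - d U}. if \<delta> <= i then bt U (i - \<delta>) else 0)"
  and W: "W : insert V F"
 shows "even_free (model_top V W {U : F. U < W}) (bt W)"
 using W
proof (induction "d W" arbitrary: W rule: less_induct)
 case less
 have "even_free (model_top V W S) (%i. (if i = 0 then 1 else 0) +
   (\<Sum>U\<in>S. \<Sum>\<delta>\<in>{1..<d W - d U}. if \<delta> <= i then bt U (i - \<delta>) else 0))"
  if "S <= {U : F. U < W}" "!!A B. A : S ==> B : F ==> B <= A ==> B : S" for S
  using that
 proof (induction "card S" arbitrary: S)
  case 0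
  have "finite S" using 0(2) finF by(auto intro: finite_subset)
  then have "S = {}" using 0 by simp
  then show ?case using model_empty_even[OF less.prems] by simp
 next
  case (Suc n)
  have fin: "finite S" using Suc(3) finF by(auto intro: finite_subset)
  have "S ~= {}" using Suc(2) by auto
  then obtain U where US: "U : S" and max: "!!A. A : S ==> U <= A ==> A = U"
   using finite_has_maximal[OF fin] by metis
  define S0 where "S0 = S - {U}"
  have S: "S = insert U S0" "U ~: S0" using US by(auto simp: S0_def)
  have U: "U : F" "U < W" using US Suc(3) by auto
  have down0: "B : S0" if "A : S0" "B : F" "B <= A" for A B
   using that Suc(4)[of A B] max[of A] by(auto simp: S0_def)
  have S0: "S0 <= {U : F. U < W}" using Suc(3) by(auto simp: S0_def)
  have "n = card S0" using Suc(2) US fin by(simp add: S0_def)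
  have IH: "even_free (model_top V W S0) (%i. (if i = 0 then 1 else 0) +
   (\<Sum>U\<in>S0. \<Sum>\<delta>\<in>{1..<d W - d U}. if \<delta> <= i then bt U (i - \<delta>) else 0))"
   by(rule Suc(1)[OF \<open>n = card S0\<close> S0]) (rule down0)
  have "U < V" using proper U by blast
  then obtain e \<phi> where pc: "proj_coords V U (d V - d U) e \<phi>" using coords[OF U(1)] by blast
  interpret b: blowup_step V F d W S0 U "d V - d U" e \<phi>
  proof (intro blowup_step.intro blowup_step_axioms.intro)
   show "B : S0" if "B : F" "B < U" for B
    using Suc(4)[OF US that(1)] that(2) by(auto simp: S0_def)
  qed (fact arrangement_axioms less.prems U S(2) pc down0 | use S0 in blast)+
  have "even_free (model_top V U {B : F. B < U}) (bt U)"
   using less.hyps[of U] dmono[OF U(1) less.prems U(2)] U(1) by simp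
  then have "even_free (model_top V W b.S') (%i. (\<Sum>\<delta>\<in>{1..<d W - d U}. if \<delta> <= i then bt U (i - \<delta>) else 0) +
   ((if i = 0 then 1 else 0) + (\<Sum>U\<in>S0. \<Sum>\<delta>\<in>{1..<d W - d U}. if \<delta> <= i then bt U (i - \<delta>) else 0)))"
   using b.blowup_step_even[OF IH] by(simp add: b.FU_def)
  moreover have "b.S' = S" using S by(simp add: b.S'_def)
  moreover have "finite S0" using fin by(simp add: S0_def)
  ultimately show ?case using S(2) by(simp add: S(1) add.left_commute)
 qed
 from this[of "{U : F. U < W}"] have "even_free (model_top V W {U : F. U < W}) (%i. (if i = 0 then 1 else 0) +
   (\<Sum>U\<in>{U : F. U < W}. \<Sum>\<delta>\<in>{1..<d W - d U}. if \<delta> <= i then bt U (i - \<delta>) else 0))" by auto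
 moreover have "bt W = (%i. (if i = 0 then 1 else 0) +
   (\<Sum>U\<in>{U : F. U < W}. \<Sum>\<delta>\<in>{1..<d W - d U}. if \<delta> <= i then bt U (i - \<delta>) else 0))"
  using bt[OF less.prems] by blast
 ultimately show ?case by simp
qed

end

section \<open>Arrangements in \<open>Cn n\<close>\<close>

definition unit_c :: "nat => nat => complex" where
 "unit_c k = (%i. if i = k then 1 else 0)"

lemma cfun_sum_apply: "(\<Sum>k\<in>A. (f k :: 'a => complex)) i = (\<Sum>k\<in>A. f k i)"
 by(induction A rule: infinite_finite_induct) auto

lemma subspace_Cn: "cfun.subspace (Cn n)"
 unfolding cfun.subspace_def by(auto simp: Cn_def)

lemma Cn_expand:
 assumes "v : Cn n"
 shows "v = (\<Sum>k\<in>{1..n}. cscale (v k) (unit_c k))"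
proof
 fix i
 have "(\<Sum>k\<in>{1..n}. cscale (v k) (unit_c k)) i = (\<Sum>k\<in>{1..n}. if k = i then v k else 0)"
  unfolding cfun_sum_apply by(intro sum.cong) (auto simp: unit_c_def)
 also have "... = v i" using assms by(auto simp: Cn_def)
 finally show "v i = (\<Sum>k\<in>{1..n}. cscale (v k) (unit_c k)) i" by simp
qed

lemma Cn_span: "Cn n <= cfun.span (unit_c ` {1..n})"
proof
 fix v assume "v : Cn n"
 then have "v = (\<Sum>k\<in>{1..n}. cscale (v k) (unit_c k))" by(rule Cn_expand)
 also have "... : cfun.span (unit_c ` {1..n})"
  by(intro cfun.span_sum cfun.span_scale cfun.span_base) auto
 finally show "v : cfun.span (unit_c ` {1..n})" .
qed

lemma independent_finite_Cn:
 assumes "~ cfun.dependent B" "B <= Cn n"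
 shows "finite B"
 using cfun.independent_span_bound[of "unit_c ` {1..n}" B] assms Cn_span by fastforce

text \<open>A basis of \<open>U\<close> is extended to \<open>W\<close> and on to the whole function
  space, so that coefficients are linear everywhere; on \<open>Cn n\<close> they are finite
  combinations of the coordinates and hence continuous.\<close>

lemma proj_coords_exists:
 assumes U: "cfun.subspace U" and W: "cfun.subspace W" and UW: "U <= W" and Wn: "W <= Cn n"
 shows "cfun.dim U <= cfun.dim W" "EX e \<phi>. proj_coords W U (cfun.dim W - cfun.dim U) e \<phi>"
  "cfun.dim U = cfun.dim W ==> U = W"
proof -
 obtain BU where BU: "BU <= U" "~ cfun.dependent BU" "U <= cfun.span BU" "card BU = cfun.dim U"
  using cfun.basis_exists[of U] by blast
 obtain B where B: "BU <= B" "B <= W" "~ cfun.dependent B" "W <= cfun.span B"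
  using cfun.maximal_independent_subset_extend[of BU W] BU UW by blast
 have fB: "finite B" using independent_finite_Cn[OF B(3)] B(2) Wn by blast
 have cB: "card B = cfun.dim W" using cfun.basis_card_eq_dim[OF B(2,4,3)] .
 have fBU: "finite BU" using fB B(1) by(rule rev_finite_subset)
 show le: "cfun.dim U <= cfun.dim W" using card_mono[OF fB B(1)] BU(4) cB by simp
 have spanU: "cfun.span BU = U" using BU U by(metis cfun.span_minimal subset_antisym)
 have spanW: "cfun.span B = W" using B W by(metis cfun.span_minimal subset_antisym)
 show "U = W" if "cfun.dim U = cfun.dim W"
  using card_subset_eq[OF fB B(1)] that BU(4) cB spanU spanW by simp
 let ?c = "cfun.dim W - cfun.dim U"
 have "card (B - BU) = ?c" using fBU B(1) cB BU(4) by(simp add: card_Diff_subset)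
 then obtain e where e: "bij_betw e {..<?c} (B - BU)"
  using ex_bij_betw_nat_finite[of "B - BU"] fB by(metis atLeast0LessThan finite_Diff)
 have eB: "e i : B - BU" if "i < ?c" for i using e that by(auto simp: bij_betw_def)
 define B' where "B' = cfun.extend_basis B"
 have B': "B <= B'" "~ cfun.dependent B'" "cfun.span B' = UNIV"
  using cfun.extend_basis_superset[OF B(3)] cfun.independent_extend_basis[OF B(3)] cfun.span_extend_basis[OF B(3)]
  by(auto simp: B'_def)
 define \<phi> where "\<phi> = (%i v. if i < ?c then cfun.representation B' v (e i) else 0)"
 have add: "\<phi> i (v + w) = \<phi> i v + \<phi> i w" for i v w
  unfolding \<phi>_def using B' by(simp add: cfun.representation_add)
 have scale: "\<phi> i (cscale k v) = k * \<phi> i v" for i k v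
  unfolding \<phi>_def using B' by(simp add: cfun.representation_scale)
 have zero: "\<phi> i 0 = 0" for i using add[of i 0 0] by simp
 have sum: "\<phi> i (\<Sum>k\<in>A. f k) = (\<Sum>k\<in>A. \<phi> i (f k))" for i A and f :: "nat => cvec"
  by(induction A rule: infinite_finite_induct) (simp_all add: add zero del: plus_fun_apply zero_fun_apply)
 have repU: "cfun.representation B' v b = 0" if v: "v : U" "b ~: BU" for v b
 proof -
  have "cfun.representation B' v = cfun.representation BU v"
   by(rule cfun.representation_extend[OF B'(2)]) (use v spanU B(1) B'(1) in auto)
  then show ?thesis using cfun.representation_ne_zero[of BU v b] v(2) by metis
 qed
 have repB: "cfun.representation B' v = cfun.representation B v" if "v : W" for v
  by(rule cfun.representation_extend[OF B'(2)]) (use that spanW B'(1) in auto)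
 have "proj_coords W U ?c e \<phi>"
 proof
  show "continuous_on W (\<phi> i)" for i
  proof -
   have "continuous_on W (%v. \<Sum>k\<in>{1..n}. v k * \<phi> i (unit_c k))"
    by(intro continuous_intros continuous_on_product_then_coordinatewise[OF continuous_on_id])
   moreover have "(\<Sum>k\<in>{1..n}. v k * \<phi> i (unit_c k)) = \<phi> i v" if "v : W" for v
   proof -
    have "\<phi> i v = \<phi> i (\<Sum>k\<in>{1..n}. cscale (v k) (unit_c k))" using Cn_expand[of v n] that Wn by auto
    also have "... = (\<Sum>k\<in>{1..n}. v k * \<phi> i (unit_c k))" unfolding sum scale ..
    finally show ?thesis by simp
   qed
   ultimately show ?thesis using continuous_on_cong[of W W "%v. \<Sum>k\<in>{1..n}. v k * \<phi> i (unit_c k)" "\<phi> i"] by blast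
  qed
  show "\<phi> i u = 0" if "u : U" for i u using repU[OF that] eB[of i] by(auto simp: \<phi>_def)
  show "e i : W" if "i < ?c" for i using eB[OF that] B by blast
  show "\<phi> i (e j) = (if i = j then 1 else 0)" if "i < ?c" "j < ?c" for i j
  proof -
   have "e j : B'" using eB[OF that(2)] B'(1) by blast
   then have "cfun.representation B' (e j) (e i) = (if e j = e i then 1 else 0)"
    using cfun.representation_basis[OF B'(2)] by auto
   moreover have "e j = e i \<longleftrightarrow> i = j" using e that by(auto simp: bij_betw_def inj_on_def)
   ultimately show ?thesis using that by(simp add: \<phi>_def)
  qed
  show "v - (\<Sum>i<?c. cscale (\<phi> i v) (e i)) : U" if v: "v : W" for v
  proof -
   have "v = (\<Sum>b\<in>B. cscale (cfun.representation B v b) b)"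
    using cfun.sum_representation_eq[OF B(3) _ fB order_refl] v spanW by simp
   also have "... = (\<Sum>b\<in>B - BU. cscale (cfun.representation B v b) b) + (\<Sum>b\<in>BU. cscale (cfun.representation B v b) b)"
    using sum.subset_diff[OF B(1) fB] by blast
   also have "(\<Sum>b\<in>B - BU. cscale (cfun.representation B v b) b) = (\<Sum>i<?c. cscale (cfun.representation B v (e i)) (e i))"
    using sum.reindex_bij_betw[OF e, of "%b. cscale (cfun.representation B v b) b"] by simp
   also have "... = (\<Sum>i<?c. cscale (\<phi> i v) (e i))"
    using repB[OF v] by(intro sum.cong) (auto simp: \<phi>_def)
   finally have eq: "v = (\<Sum>i<?c. cscale (\<phi> i v) (e i)) + (\<Sum>b\<in>BU. cscale (cfun.representation B v b) b)" .
   have "v - (\<Sum>i<?c. cscale (\<phi> i v) (e i)) = (\<Sum>b\<in>BU. cscale (cfun.representation B v b) b)"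
    by(rule trans[OF arg_cong[OF eq, of "%x. x - (\<Sum>i<?c. cscale (\<phi> i v) (e i))"] add_diff_cancel_left'])
   also have "... : U" using BU(1) by(intro cfun.subspace_sum[OF U] cfun.subspace_scale[OF U]) auto
   finally show ?thesis .
  qed
 qed (use U W UW add scale in auto)
 then show "EX e \<phi>. proj_coords W U ?c e \<phi>" by blast
qed

lemma arrangement_Cn:
 assumes "finite F" "!!B. B : F ==> cfun.subspace B" "!!B. B : F ==> B < Cn n"
  and "!!A B. A : F ==> B : F ==> A Int B : F"
 shows "arrangement (Cn n) F cfun.dim"
proof
 fix U W assume UW: "U : F" "W : insert (Cn n) F" "U < W"
 have "cfun.subspace W" "W <= Cn n" using UW assms subspace_Cn by auto
 from proj_coords_exists[OF assms(2)[OF UW(1)] this(1) _ this(2)] UW(3)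
 show "EX e \<phi>. proj_coords W U (cfun.dim W - cfun.dim U) e \<phi>" "cfun.dim U < cfun.dim W"
  by(auto simp: le_less)
qed (use assms subspace_Cn in auto)

section \<open>The closure in the De Concini--Procesi model\<close>

text \<open>Proportionality modulo \<open>U\<close> is the vanishing of all 2 by 2 minors of the
  coordinates, which makes it a closed condition.\<close>

lemma (in proj_coords) line_mod_iff:
 assumes v: "v : V" and u: "u : V - U"
 shows "v : line_mod U u \<longleftrightarrow> (ALL i<c. ALL j<c. \<phi> i v * \<phi> j u = \<phi> j v * \<phi> i u)"
proof
 assume "v : line_mod U u"
 then obtain k where k: "v - cscale k u : U" using in_line_mod[OF U] by blast
 have "\<phi> i v = k * \<phi> i u" for i
  using \<phi>_U[OF k, of i] assms by(simp add: \<phi>_diff \<phi>_scale scale_in)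
 then show "ALL i<c. ALL j<c. \<phi> i v * \<phi> j u = \<phi> j v * \<phi> i u" by simp
next
 assume R: "ALL i<c. ALL j<c. \<phi> i v * \<phi> j u = \<phi> j v * \<phi> i u"
 obtain j where j: "j < c" "\<phi> j u ~= 0" using in_U_iff u by blast
 let ?k = "\<phi> j v / \<phi> j u"
 have "\<phi> i (v - cscale ?k u) = 0" if "i < c" for i
  using R that j assms by(auto simp: \<phi>_diff \<phi>_scale scale_in field_simps)
 moreover have "v - cscale ?k u : V" using assms by(intro diff_in scale_in) auto
 ultimately have "v - cscale ?k u : U" using in_U_iff by blast
 then show "v : line_mod U u" using in_line_mod[OF U] by blast
qed

lemma (in proj_coords) closedin_line_mod:
 assumes v: "!!i. cmap T euclidean (%x. v x i)" "!!x. x : topspace T ==> v x : V"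
  and u: "!!i. cmap T euclidean (%x. u x i)" "!!x. x : topspace T ==> u x : V - U"
 shows "closedin T {x : topspace T. v x : line_mod U (u x)}"
proof -
 have eq: "{x : topspace T. v x : line_mod U (u x)} = topspace T Int 
  (\<Inter>p\<in>{..<c} \<times> {..<c}. {x : topspace T. \<phi> (fst p) (v x) * \<phi> (snd p) (u x) - \<phi> (snd p) (v x) * \<phi> (fst p) (u x) : {0}})"
  using line_mod_iff[OF v(2) u(2)] by auto
 have uV: "u x : V" if "x : topspace T" for x using u(2)[OF that] by blast
 have cl: "closedin T {x : topspace T. \<phi> (fst p) (v x) * \<phi> (snd p) (u x) - \<phi> (snd p) (v x) * \<phi> (fst p) (u x) : {0}}" for p
  by(rule closedin_continuous_map_preimage)
    (auto intro!: continuous_map_diff continuous_map_mult continuous_map_\<phi> v u(1) uV)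
 show ?thesis
 proof (cases "c = 0")
  case True
  then show ?thesis unfolding eq by simp
 next
  case False
  then show ?thesis unfolding eq by(intro closedin_Int closedin_INT cl) auto
 qed
qed

context arrangement begin

abbreviation "Y \<equiv> model_top V V F"

lemma tY: "topspace Y = compatible V F" and subY: "subtop Y (compatible V F) = Y"
 using topspace_model[OF order_refl order_refl] subtopology_topspace by metis+

lemma continuous_into_Y:
 assumes "!!i. cmap T euclidean (%x. fst (f x) i)"
  "!!B. B : F ==> cmap T (proj_quotient V B) (%x. snd (f x) B)"
  "!!x. x : topspace T ==> f x : compatible V F"
 shows "cmap T Y f"
 using continuous_into_model[OF order_refl order_refl assms(1,2,3) order_refl] by(simp add: subY)

lemma coords_Y:
 shows "cmap Y euclidean (%x. fst x i)"
  and "B : F ==> cmap Y (proj_quotient V B) (%x. snd x B)"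
 using model_coords(1)[of V F "compatible V F"] model_coords(2)[of _ F V "compatible V F"] by(simp_all only: subY)

lemma closedin_F: "B : F ==> (!!i. cmap T euclidean (%x. w x i)) ==> (!!x. x : topspace T ==> w x : V) ==> closedin T {x : topspace T. w x : B}"
proof -
 assume B: "B : F" and w: "!!i. cmap T euclidean (%x. w x i)" "!!x. x : topspace T ==> w x : V"
 obtain e' \<phi>' where "proj_coords V B (d V - d B) e' \<phi>'" using coords[of B V] proper B by blast
 from proj_coords.closedin_preimage_U[OF this w] show ?thesis .
qed

definition D :: "mpoint set" where "D = {x : compatible V F. ALL B:F. fst x ~: B}"

text \<open>A point over a vector \<open>v\<close> of the arrangement is a limit of points over vectors lying in fewer
 members: move \<open>v\<close> along the line attached to the smallest member containing it.\<close>

lemma D_dense: "x : compatible V F ==> x : Y closure_of D"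
proof (induction "card {B : F. fst x : B}" arbitrary: x rule: less_induct)
 case less
 show ?case
 proof (cases "EX B:F. fst x : B")
  case False
  then have "x : D" using less.prems by(simp add: D_def)
  moreover have "D <= topspace Y" by(auto simp: tY D_def)
  ultimately show ?thesis using closure_of_subset by blast
 next
  case True
  define v where "v = fst x"
  define M where "M = {B : F. v : B}"
  have M: "finite M" "M ~= {}" "M <= F" using finF True by(auto simp: M_def v_def)
  have "\<Inter>M' \<in> F" if "finite M'" "M' ~= {}" "M' <= F" for M'
   using that by(induction M' rule: finite_ne_induct) (auto simp: inter)
  from this[OF M] have BF: "\<Inter>M \<in> F" .
  \<comment> \<open>The smallest flat through \<open>v\<close>. The vector \<open>u\<close> obtained
    below spans the line attached to it, and by nesting \<open>u\<close> lies on the line at every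
    flat through \<open>v\<close>.\<close>
  define B where "B = \<Inter>M"
  have B: "B : F" "v : B" "!!A. A : F ==> v : A ==> B <= A" using BF by(auto simp: B_def M_def)
  have vV: "v : V" and vl: "!!A. A : F ==> v : snd x A" and ext: "snd x : extensional F"
   and ln: "!!A. A : F ==> EX u:V - A. snd x A = line_mod A u"
   and mono: "!!A A'. A : F ==> A' : F ==> A <= A' ==> snd x A <= snd x A'"
   using less.prems by(auto simp: compatible_def v_def)
  obtain u where u: "u : V - B" "snd x B = line_mod B u" using ln[OF B(1)] by blast
  have ul: "u : snd x A" if "A : F" "v : A" for A
   using mono[OF B(1) that(1) B(3)[OF that]] u(2) line_mod_contains(2)[of u B] by auto
  define w where "w = (%\<epsilon>::real. v + cscale (of_real \<epsilon>) u)"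
  have wV: "w \<epsilon> : V" for \<epsilon> unfolding w_def using vV u(1) by(intro cfun.subspace_add[OF subV] cfun.subspace_scale[OF subV]) auto
  \<comment> \<open>Flats through \<open>v\<close> keep their lines, the others receive the line of
    the moved vector; this is compatible for all parameters in \<open>T\<close>.\<close>
  define y where "y = (%\<epsilon>. (w \<epsilon>, \<lambda>A\<in>F. if v : A then snd x A else line_mod A (w \<epsilon>)))"
  define T where "T = {\<epsilon>. ALL A:F. v ~: A --> w \<epsilon> ~: A}"
  have wc: "cmap euclidean euclidean (%\<epsilon>. w \<epsilon> i)" for i
   unfolding w_def by(simp add: continuous_intros)
  have cl: "closed {\<epsilon>. w \<epsilon> : A}" if "A : F" for A
   using closedin_F[OF that wc wV] by simp
  have "T = UNIV - (\<Union>A\<in>{A : F. v ~: A}. {\<epsilon>. w \<epsilon> : A})" by(auto simp: T_def)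
  moreover have "closed (\<Union>A\<in>{A : F. v ~: A}. {\<epsilon>. w \<epsilon> : A})"
   using finF cl by(intro closed_UN) auto
  ultimately have "open T" by(simp add: open_Diff)
  moreover have w0: "w 0 = v" by(simp add: w_def fun_eq_iff)
  then have "0 : T" by(auto simp: T_def)
  ultimately obtain r where r: "r > 0" "ball 0 r <= T" using openE by blast
  have yc: "y \<epsilon> : compatible V F" if "\<epsilon> : T" for \<epsilon>
   unfolding compatible_def
  proof (intro CollectI conjI ballI impI)
   show "fst (y \<epsilon>) : V" "snd (y \<epsilon>) : extensional F" by(simp_all add: y_def wV)
   fix A assume A: "A : F"
   show "EX u:V - A. snd (y \<epsilon>) A = line_mod A u" using ln[OF A] A that wV[of \<epsilon>] by(auto simp: y_def T_def)
   have wl: "w \<epsilon> : snd x A'" if "A' : F" "v : A'" for A'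
   proof -
    have "cfun.subspace (snd x A')" using ln[OF that(1)] subspace_line_mod by auto
    then show ?thesis unfolding w_def using vl[OF that(1)] ul[OF that] by(intro cfun.subspace_add cfun.subspace_scale)
   qed
   show "fst (y \<epsilon>) : snd (y \<epsilon>) A" using A wl[OF A] line_mod_contains(2) by(simp add: y_def)
   fix A' assume A': "A' : F" "A <= A'"
   show "snd (y \<epsilon>) A <= snd (y \<epsilon>) A'"
   proof (cases "v : A'")
    case True
    obtain u' where u': "snd x A' = line_mod A' u'" using ln[OF A'(1)] by blast
    have "line_mod A (w \<epsilon>) <= snd x A'"
     using wl[OF A'(1) True] A'(2) unfolding u' by(intro line_mod_subset_line_mod)
    then show ?thesis using A A' mono[OF A A'] True by(simp add: y_def)
   next
    case False
    then have "line_mod A (w \<epsilon>) <= line_mod A' (w \<epsilon>)" using A'(2) line_mod_contains(2) by(intro line_mod_subset_line_mod)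
    then show ?thesis using A A' False by(auto simp: y_def)
   qed
  qed
  have ycl: "y \<epsilon> : Y closure_of D" if e: "\<epsilon> : T" "\<epsilon> ~= 0" for \<epsilon>
  proof (rule less.hyps[OF _ yc[OF e(1)]])
   \<comment> \<open>A flat containing both \<open>v\<close> and the moved vector contains
     \<open>u\<close>; since \<open>u\<close> is not in \<open>B\<close>, the flat \<open>B\<close>
     is lost and the count drops.\<close>
   have "u : A" if "A : F" "w \<epsilon> : A" "v : A" for A
   proof -
    have "cscale (1 / of_real \<epsilon>) (w \<epsilon> - v) : A"
     using subF[OF that(1)] that by(intro cfun.subspace_scale cfun.subspace_diff)
    also have "cscale (1 / of_real \<epsilon>) (w \<epsilon> - v) = u" using e by(simp add: w_def fun_eq_iff)
    finally show ?thesis .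
   qed
   then have "{A : F. fst (y \<epsilon>) : A} <= {A : F. fst x : A} - {B}"
    using e(1) u(1) B by(auto simp: y_def T_def v_def)
   moreover have "B : {A : F. fst x : A}" using B by(simp add: v_def)
   ultimately have "{A : F. fst (y \<epsilon>) : A} < {A : F. fst x : A}" by blast
   then show "card {A : F. fst (y \<epsilon>) : A} < card {A : F. fst x : A}" using finF by(intro psubset_card_mono) auto
  qed
  have y0: "y 0 = x"
  proof -
   have "(\<lambda>A\<in>F. if v : A then snd x A else line_mod A v) = snd x"
   proof (rule extensionalityI[OF _ ext])
    fix A assume A: "A : F"
    obtain u' where "snd x A = line_mod A u'" using ln[OF A] by blast
    then show "(\<lambda>A\<in>F. if v : A then snd x A else line_mod A v) A = snd x A"
     using A vl[OF A] line_mod_of_mem[OF subF[OF A]] by auto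
   qed simp
   then show ?thesis unfolding y_def w0 prod_eq_iff by(simp only: v_def[symmetric] fst_conv snd_conv simp_thms)
  qed
  have cont: "cmap (top_of_set (ball 0 r)) Y y"
  proof (rule continuous_into_Y)
   have wc': "cmap (top_of_set (ball 0 r)) euclidean (%\<epsilon>. w \<epsilon> i)" for i
    using wc[of i] continuous_map_from_subtopology by blast
   then show "cmap (top_of_set (ball 0 r)) euclidean (%\<epsilon>. fst (y \<epsilon>) i)" for i by(simp add: y_def)
   show "y \<epsilon> : compatible V F" if "\<epsilon> : topspace (top_of_set (ball 0 r))" for \<epsilon> using that r yc by auto
   fix A assume A: "A : F"
   show "cmap (top_of_set (ball 0 r)) (proj_quotient V A) (%\<epsilon>. snd (y \<epsilon>) A)"
   proof (cases "v : A")
    case True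
    then show ?thesis using A ln[OF A] by(auto simp: y_def)
   next
    case False
    have "cmap (top_of_set (ball 0 r)) (proj_quotient V A) (%\<epsilon>. line_mod A (w \<epsilon>))"
     using False A r wV by(intro continuous_line[OF A wc']) (auto simp: T_def)
    then show ?thesis using False A by(simp add: y_def)
   qed
  qed
  have "(0::real) : closure (ball 0 r - {0})"
  proof -
   have "(0::real) islimpt ball 0 r" using r by(simp add: islimpt_ball)
   then show ?thesis using islimpt_in_closure by blast
  qed
  then have "(0::real) : top_of_set (ball 0 r) closure_of (ball 0 r - {0})"
   using r by(simp add: closure_of_subtopology Int_absorb1)
  then have "y 0 : y ` (top_of_set (ball 0 r) closure_of (ball 0 r - {0}))" by(rule imageI)
  also have "... <= Y closure_of (y ` (ball 0 r - {0}))"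
   using continuous_map_image_closure_subset[OF cont] .
  also have "... <= Y closure_of (Y closure_of D)"
   by(intro closure_of_mono image_subsetI ycl) (use r in blast)+
  finally show ?thesis by(simp add: y0)
 qed
qed

text \<open>Lines are indexed by subspaces of the dual in one space and by annihilators in the
  other. The closure is identified with the set \<open>K\<close> cut out by nesting:
  \<open>K\<close> is closed because its conditions are minors, and \<open>D_dense\<close> gives the
  other inclusion.\<close>

theorem DCP_homeomorphic:
 assumes G: "finite G" and FG: "F = annihilator V ` G"
 shows "DCP_model V G homeomorphic_space Y"
proof -
 let ?an = "annihilator V" and ?A = "model_ambient V G"
 \<comment> \<open>Different members of \<open>G\<close> may have the same annihilator, so one of
   them is chosen for each flat.\<close>
 define sel where "sel = (%B. SOME A. A : G & ?an A = B)"
 have sel: "sel B : G" "?an (sel B) = B" if "B : F" for B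
  using someI_ex[of "%A. A : G & ?an A = B"] that unfolding sel_def FG by auto
 have anF: "?an A : F" if "A : G" for A using that FG by blast
 define \<Theta> where "\<Theta> = (%x::mpoint. (fst x, \<lambda>A\<in>G. snd x (?an A)))"
 define \<Psi> where "\<Psi> = (%x::(cvec \<times> ((cvec => complex) set => cvec set)). (fst x, \<lambda>B\<in>F. snd x (sel B)))"
 define K where "K = {x : topspace ?A. (ALL A:G. fst x : snd x A) & (ALL A:G. ALL A':G. ?an A <= ?an A' --> snd x A <= snd x A')}"
 have tA: "x : topspace ?A \<longleftrightarrow> fst x : V & snd x : extensional G & (ALL A:G. snd x A : line_mod (?an A) ` (V - ?an A))" for x
  by(simp add: model_ambient_def mem_Times_iff PiE_iff) blast
 have PsiK: "\<Psi> x : compatible V F" if x: "x : K" for x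
  unfolding compatible_def
 proof (intro CollectI conjI ballI impI)
  show "fst (\<Psi> x) : V" "snd (\<Psi> x) : extensional F" using x by(auto simp: \<Psi>_def K_def tA)
  fix B assume B: "B : F"
  show "EX u:V - B. snd (\<Psi> x) B = line_mod B u"
  proof -
   have "snd x (sel B) : line_mod (?an (sel B)) ` (V - ?an (sel B))" using x sel(1)[OF B] by(simp add: K_def tA)
   then show ?thesis using B by(auto simp: \<Psi>_def sel)
  qed
  show "fst (\<Psi> x) : snd (\<Psi> x) B" using x sel[OF B] B by(simp add: K_def \<Psi>_def)
  show "snd (\<Psi> x) B <= snd (\<Psi> x) B'" if "B' : F" "B <= B'" for B'
   using x sel[OF B] sel[OF that(1)] B that by(simp add: K_def \<Psi>_def)
 qed
 have ThetaK: "\<Theta> y : K" if y: "y : compatible V F" for y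
 proof -
  have l: "snd y B : line_mod B ` (V - B)" if "B : F" for B using y that by(auto simp: compatible_def)
  have "\<Theta> y : topspace ?A" using y l[OF anF] unfolding tA by(auto simp: \<Theta>_def compatible_def)
  then show ?thesis using y anF by(simp add: K_def \<Theta>_def compatible_def)
 qed
 have PT: "\<Psi> (\<Theta> y) = y" if y: "y : compatible V F" for y
 proof -
  have "(\<lambda>B\<in>F. snd (\<Theta> y) (sel B)) = snd y"
   using y sel by(intro extensionalityI[where A = F]) (auto simp: \<Theta>_def compatible_def)
  then show ?thesis by(simp add: \<Psi>_def prod_eq_iff) (simp add: \<Theta>_def)
 qed
 \<comment> \<open>Members of \<open>G\<close> with equal annihilators carry equal lines on
   \<open>K\<close>, because the nesting condition applies in both directions.\<close>
 have TP: "\<Theta> (\<Psi> x) = x" if x: "x : K" for x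
 proof -
  have "snd x (sel (?an A)) = snd x A" if "A : G" for A
   using x sel[OF anF[OF that]] that unfolding K_def by(blast intro: subset_antisym)
  then have "(\<lambda>A\<in>G. snd (\<Psi> x) (?an A)) = snd x"
   using x anF by(intro extensionalityI[where A = G]) (auto simp: \<Psi>_def K_def tA)
  then show ?thesis by(simp add: \<Theta>_def prod_eq_iff) (simp add: \<Psi>_def)
 qed
 have fstV: "cmap ?A euclidean (%x. fst x i)" for i
  using continuous_map_fst[of "top_of_set V"] unfolding model_ambient_def
  by(intro continuous_map_fun_apply[of _ fst]) (auto simp: continuous_map_in_subtopology)
 have sndA: "cmap ?A (proj_quotient V (?an A)) (%x. snd x A)" if "A : G" for A
  unfolding model_ambient_def
  using continuous_map_compose[OF continuous_map_snd continuous_map_product_projection[OF that]] by(simp add: o_def)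
 have PsiC: "cmap (subtop ?A K) Y \<Psi>"
 proof (rule continuous_into_Y)
  show "cmap (subtop ?A K) euclidean (%x. fst (\<Psi> x) i)" for i
   using fstV by(simp add: \<Psi>_def continuous_map_from_subtopology)
  show "cmap (subtop ?A K) (proj_quotient V B) (%x. snd (\<Psi> x) B)" if "B : F" for B
   using sndA[OF sel(1)[OF that]] that by(simp add: \<Psi>_def sel continuous_map_from_subtopology)
 qed (use PsiK in auto)
 have ThetaC: "cmap Y ?A \<Theta>"
  unfolding model_ambient_def continuous_map_pairwise continuous_map_componentwise
 proof (intro conjI ballI)
  have "fst (\<Theta> x) : V" if "x : compatible V F" for x using that by(simp add: \<Theta>_def compatible_def)
  then show "cmap Y (top_of_set V) (fst \<circ> \<Theta>)"
   using coords_Y(1) by(auto simp: continuous_map_in_subtopology continuous_map_fun_iff tY \<Theta>_def o_def)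
  show "cmap Y (proj_quotient V (?an A)) (%x. (snd \<circ> \<Theta>) x A)" if "A : G" for A
   using coords_Y(2)[OF anF[OF that]] that by(simp add: \<Theta>_def)
 qed (auto simp: \<Theta>_def)
 have img: "model_embedding V G ` arrangement_complement V G = \<Theta> ` D"
 proof
  show "model_embedding V G ` arrangement_complement V G <= \<Theta> ` D"
  proof
   fix z assume "z : model_embedding V G ` arrangement_complement V G"
   then obtain v where v: "z = model_embedding V G v" "v : V" "!!B. B : F ==> v ~: B"
    by(auto simp: arrangement_complement_def FG)
   let ?y = "(v, \<lambda>B\<in>F. line_mod B v)"
   have "?y : compatible V F"
    unfolding compatible_def using v(2,3) line_mod_contains(2) line_mod_subset_line_mod[OF _ line_mod_contains(2)] by auto
   then have "?y : D" using v by(simp add: D_def)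
   moreover have "z = \<Theta> ?y"
    unfolding v(1) \<Theta>_def model_embedding_def using anF by(simp cong: restrict_cong)
   ultimately show "z : \<Theta> ` D" by blast
  qed
  show "\<Theta> ` D <= model_embedding V G ` arrangement_complement V G"
  proof
   fix z assume "z : \<Theta> ` D"
   then obtain y where y: "z = \<Theta> y" "y : compatible V F" "!!B. B : F ==> fst y ~: B" by(auto simp: D_def)
   have l: "snd y B = line_mod B (fst y)" if B: "B : F" for B
   proof -
    have "EX u:V - B. snd y B = line_mod B u" "fst y : snd y B" using y(2) B by(simp_all add: compatible_def)
    then obtain u where "snd y B = line_mod B u" "fst y : line_mod B u" by auto
    then show ?thesis using line_mod_of_mem[OF subF[OF B] _ y(3)[OF B]] by simp
   qed
   have "fst y : arrangement_complement V G" using y(2,3) by(auto simp: arrangement_complement_def FG compatible_def)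
   moreover have "z = model_embedding V G (fst y)"
    unfolding y(1) \<Theta>_def model_embedding_def using l anF by(simp cong: restrict_cong)
   ultimately show "z : model_embedding V G ` arrangement_complement V G" by blast
  qed
 qed
 have closedK: "closedin ?A K"
 proof -
  let ?L = "prod_top (top_of_set V) (product_topology (%A. top_of_set (V - ?an A)) G)"
  have q: "open_quotient ?L ?A (%z. (fst z, \<lambda>A\<in>G. line_mod (?an A) (snd z A)))"
   unfolding model_ambient_def
   using subV subF[OF anF] proper[OF anF] by(intro open_quotient_prod open_quotient_product[OF G] open_quotient_line_mod) auto
  have tL: "x : topspace ?L \<longleftrightarrow> fst x : V & snd x : extensional G & (ALL A:G. snd x A : V - ?an A)" for x
   by(simp add: mem_Times_iff PiE_iff) blast
  have c1: "cmap ?L euclidean (%x. fst x i)" for i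
   using continuous_map_fst[of "top_of_set V"]
   by(intro continuous_map_fun_apply[of _ fst]) (auto simp: continuous_map_in_subtopology)
  have c2: "cmap ?L euclidean (%x. snd x A i)" if "A : G" for A i
   using continuous_map_compose[OF continuous_map_snd continuous_map_product_projection[OF that], of "top_of_set V" "%A. top_of_set (V - ?an A)"]
   by(intro continuous_map_fun_apply[of _ "%x. snd x A"]) (auto simp: continuous_map_in_subtopology o_def)
  have cl: "closedin ?L {x : topspace ?L. v x : line_mod (?an A) (snd x A)}"
   if A: "A : G" and v: "!!i. cmap ?L euclidean (%x. v x i)" "!!x. x : topspace ?L ==> v x : V" for A v
  proof -
   obtain e' \<phi>' where "proj_coords V (?an A) (d V - d (?an A)) e' \<phi>'" using coords[OF anF[OF A], of V] proper[OF anF[OF A]] by blast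
   show ?thesis
   proof (rule proj_coords.closedin_line_mod[OF \<open>proj_coords V (?an A) (d V - d (?an A)) e' \<phi>'\<close> v])
    show "cmap ?L euclidean (%x. snd x A i)" for i by(rule c2[OF A])
    show "snd x A : V - ?an A" if "x : topspace ?L" for x using that A unfolding tL by blast
   qed
  qed
  \<comment> \<open>On lifts, nesting of two lines amounts to one representative lying in the larger
    line, which \<open>closedin_line_mod\<close> shows to be closed.\<close>
  define K1 where "K1 = (%A. {x : topspace ?L. fst x : line_mod (?an A) (snd x A)})"
  define K2 where "K2 = (%p. {x : topspace ?L. snd x (fst p) : line_mod (?an (snd p)) (snd x (snd p))})"
  have "{x : topspace ?L. (fst x, \<lambda>A\<in>G. line_mod (?an A) (snd x A)) : K} =
   (topspace ?L Int (\<Inter>A\<in>G. K1 A)) Int (topspace ?L Int (\<Inter>p\<in>{p : G \<times> G. ?an (fst p) <= ?an (snd p)}. K2 p))" (is "?l = ?r")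
  proof -
   have "(fst x, \<lambda>A\<in>G. line_mod (?an A) (snd x A)) : K \<longleftrightarrow> (ALL A:G. x : K1 A) & (ALL p:{p : G \<times> G. ?an (fst p) <= ?an (snd p)}. x : K2 p)"
    if x: "x : topspace ?L" for x
   proof -
    have "(fst x, \<lambda>A\<in>G. line_mod (?an A) (snd x A)) : topspace ?A" using x unfolding tL tA by auto
    moreover have "line_mod (?an A) (snd x A) <= line_mod (?an A') (snd x A') \<longleftrightarrow> snd x A : line_mod (?an A') (snd x A')"
     if "?an A <= ?an A'" for A A'
     using line_mod_subset_line_mod[OF that] line_mod_contains(2) by blast
    ultimately show ?thesis using x unfolding K_def K1_def K2_def by simp blast
   qed
   then show ?thesis by blast
  qed
  moreover have "closedin ?L (topspace ?L Int (\<Inter>A\<in>G. K1 A))"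
  proof (cases "G = {}")
   case True
   then show ?thesis unfolding True by(simp only: image_empty Inter_empty Int_UNIV_right closedin_topspace)
  next
   case False
   then show ?thesis unfolding K1_def by(intro closedin_Int closedin_INT cl c1) (simp_all only: closedin_topspace tL not_False_eq_True)
  qed
  moreover have "closedin ?L (topspace ?L Int (\<Inter>p\<in>{p : G \<times> G. ?an (fst p) <= ?an (snd p)}. K2 p))"
  proof (cases "{p : G \<times> G. ?an (fst p) <= ?an (snd p)} = {}")
   case True
   then show ?thesis unfolding True by(simp only: image_empty Inter_empty Int_UNIV_right closedin_topspace)
  next
   case False
   have "closedin ?L (K2 p)" if "p : {p : G \<times> G. ?an (fst p) <= ?an (snd p)}" for p
    unfolding K2_def using that by(intro cl c2) (auto simp only: tL mem_Times_iff mem_Collect_eq)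
   then show ?thesis using False by(intro closedin_Int closedin_INT closedin_topspace)
  qed
  ultimately show ?thesis by(intro open_quotient_closedin[OF q]) (auto simp only: K_def closedin_Int mem_Collect_eq)
 qed
 have "?A closure_of (model_embedding V G ` arrangement_complement V G) = K"
 proof
  have "\<Theta> ` D <= K" using ThetaK by(auto simp: D_def)
  then show "?A closure_of (model_embedding V G ` arrangement_complement V G) <= K"
   unfolding img using closedK by(rule closure_of_minimal)
  show "K <= ?A closure_of (model_embedding V G ` arrangement_complement V G)"
  proof
   fix x assume x: "x : K"
   then have "\<Theta> (\<Psi> x) : \<Theta> ` (Y closure_of D)" using D_dense PsiK by blast
   also have "... <= ?A closure_of (\<Theta> ` D)" by(rule continuous_map_image_closure_subset[OF ThetaC])
   finally show "x : ?A closure_of (model_embedding V G ` arrangement_complement V G)" using TP[OF x] img by simp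
  qed
 qed
 then have DK: "DCP_model V G = subtop ?A K" by(simp add: DCP_model_def)
 have "homeomorphic_maps (subtop ?A K) Y \<Psi> \<Theta>"
  unfolding homeomorphic_maps_def using PsiC ThetaC ThetaK TP PT
  by(auto simp: continuous_map_in_subtopology tY)
 then show ?thesis unfolding DK homeomorphic_space_def by blast
qed

end

section \<open>The Poincare polynomial as a sum over chains\<close>

text \<open>A geometric sum, so the polynomial division is exact. The result is the Poincare
  polynomial of P^(r-1) without its constant term; in particular it vanishes for
  \<open>r = 1\<close>.\<close>

lemma q_factor_eq:
 assumes "r >= 1"
 shows "q_factor r = (\<Sum>\<delta>\<in>{1..<r}. monom 1 \<delta>)"
proof -
 have eq: "monom 1 r - monom 1 1 = (\<Sum>\<delta>\<in>{1..<r}. monom 1 \<delta>) * [:-1, 1::rat:]"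
  using assms
 proof (induction r rule: nat_induct_at_least)
  case (Suc r)
  have "monom 1 (Suc r) - monom 1 r = monom 1 r * [:-1, 1::rat:]"
   by(simp add: monom_Suc)
  then show ?case using Suc by(simp add: algebra_simps)
 qed simp
 show ?thesis unfolding q_factor_def eq by(rule nonzero_mult_div_cancel_right) simp
qed

lemma coeff_q_factor_mult:
 assumes "r >= 1"
 shows "coeff (q_factor r * p) i = (\<Sum>\<delta>\<in>{1..<r}. if \<delta> <= i then coeff p (i - \<delta>) else 0)"
 unfolding q_factor_eq[OF assms] sum_distrib_right coeff_sum
 by(intro sum.cong) (auto simp: coeff_monom_mult)

context arrangement begin

definition chains :: "cvec set => cvec set list set" where
 "chains W = {c. set c <= F & sorted_wrt (\<supset>) (W # c)}"

definition chain_weight :: "cvec set => cvec set list => rat poly" where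
 "chain_weight W c = (\<Prod>i<length c. q_factor (d ((W # c) ! i) - d (c ! i)))"

definition chain_poly :: "cvec set => rat poly" where
 "chain_poly W = (\<Sum>c\<in>chains W. chain_weight W c)"

lemma chains_rec: "chains W = insert [] (\<Union>U\<in>{U : F. U < W}. (#) U ` chains U)"
proof (rule Set.set_eqI)
 fix c
 show "c : chains W \<longleftrightarrow> c : insert [] (\<Union>U\<in>{U : F. U < W}. (#) U ` chains U)"
  by(cases c) (auto simp: chains_def)
qed

lemma finite_chains: "finite (chains W)"
proof (rule finite_subset)
 show "chains W <= {c. set c <= F & distinct c}"
 proof
  fix c assume "c : chains W"
  then have "set c <= F" "sorted_wrt (\<supset>) c" by(auto simp: chains_def)
  then show "c : {c. set c <= F & distinct c}" by(induction c) auto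
 qed
 show "finite {c. set c <= F & distinct c}" using finF by(rule finite_subset_distinct)
qed

lemma chain_poly_rec:
 "chain_poly W = 1 + (\<Sum>U\<in>{U : F. U < W}. q_factor (d W - d U) * chain_poly U)"
proof -
 let ?S = "{U : F. U < W}"
 have "chain_poly W = chain_weight W [] + sum (chain_weight W) (\<Union>U\<in>?S. (#) U ` chains U)"
  unfolding chain_poly_def chains_rec[of W] using finF finite_chains by(intro sum.insert) auto
 also have "sum (chain_weight W) (\<Union>U\<in>?S. (#) U ` chains U) = (\<Sum>U\<in>?S. sum (chain_weight W) ((#) U ` chains U))"
  using finF finite_chains by(intro sum.UNION_disjoint) auto
 also have "... = (\<Sum>U\<in>?S. q_factor (d W - d U) * chain_poly U)"
 proof (intro sum.cong refl)
  fix U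
  have "chain_weight W (U # c) = q_factor (d W - d U) * chain_weight U c" for c
   unfolding chain_weight_def by(simp add: prod.lessThan_Suc_shift del: prod.lessThan_Suc)
  then show "sum (chain_weight W) ((#) U ` chains U) = q_factor (d W - d U) * chain_poly U"
   by(simp add: sum.reindex chain_poly_def sum_distrib_left)
 qed
 finally show ?thesis by(simp add: chain_weight_def)
qed

lemma coeff_chain_poly:
 assumes "W : insert V F"
 shows "coeff (chain_poly W) i = (if i = 0 then 1 else 0) +
  (\<Sum>U\<in>{U : F. U < W}. \<Sum>\<delta>\<in>{1..<d W - d U}. if \<delta> <= i then coeff (chain_poly U) (i - \<delta>) else 0)"
proof -
 have "coeff (q_factor (d W - d U) * chain_poly U) i =
   (\<Sum>\<delta>\<in>{1..<d W - d U}. if \<delta> <= i then coeff (chain_poly U) (i - \<delta>) else 0)" if "U : {U : F. U < W}" for U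
  using that dmono[of U W] assms by(intro coeff_q_factor_mult) force
 then show ?thesis by(subst chain_poly_rec) (simp add: coeff_sum)
qed

lemma Nats_sum: "(!!x. x : A ==> f x : \<nat>) ==> sum f A : \<nat>"
 by(induction A rule: infinite_finite_induct) auto

text \<open>The coefficients have to be natural numbers before they can serve as Betti numbers in
  \<open>model_even\<close>.\<close>

lemma coeff_chain_poly_Nats: "W : insert V F ==> coeff (chain_poly W) i : \<nat>"
proof (induction "d W" arbitrary: W i rule: less_induct)
 case less
 have "coeff (chain_poly U) j : \<nat>" if "U : {U : F. U < W}" for U j
  using less.hyps[OF dmono] less.prems that by blast
 then show ?case
  unfolding coeff_chain_poly[OF less.prems] by(intro Nats_add Nats_sum) (auto intro: Nats_sum)
qed

theorem poincare_model:
 assumes "X homeomorphic_space model_top V V F"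
 shows "even_poincare_poly X = chain_poly V"
proof -
 define bt where "bt = (%W i. nat \<lfloor>coeff (chain_poly W) i\<rfloor>)"
 have bt: "coeff (chain_poly W) i = of_nat (bt W i)" if "W : insert V F" for W i
  using coeff_chain_poly_Nats[OF that, of i] by(auto simp: bt_def Nats_def)
 have "bt W i = (if i = 0 then 1 else 0) +
   (\<Sum>U\<in>{U : F. U < W}. \<Sum>\<delta>\<in>{1..<d W - d U}. if \<delta> <= i then bt U (i - \<delta>) else 0)"
  (is "_ = ?r") if W: "W : insert V F" for W i
 proof -
  have "rat_of_nat (bt W i) = of_nat ?r"
   unfolding bt[OF W, symmetric] coeff_chain_poly[OF W]
   by(auto simp: bt if_distrib cong: if_cong intro!: sum.cong)
  then show ?thesis by(simp only: of_nat_eq_iff)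
 qed
 from model_even[OF this, of V] have "even_free (model_top V V {U : F. U < V}) (bt V)" by blast
 moreover have "{U : F. U < V} = F" using proper by blast
 ultimately have "even_free X (bt V)"
  using even_free_iso[of "model_top V V F" "bt V" X] assms homeomorphic_space_imp_isomorphic_homology_groups homeomorphic_space_sym by metis
 then have "abelian_rank (cohomology_group p X) = evrank (bt V) (int p)" for p
  by(intro cohomology_rank) (simp add: even_free_def)
 then have r: "abelian_rank (cohomology_group (2 * i) X) = bt V i" for i
  by(simp add: evrank_def)
 have "even_poincare_poly X = (\<Sum>i | coeff (chain_poly V) i ~= 0. monom (coeff (chain_poly V) i) i)"
  unfolding even_poincare_poly_def r using bt[of V] by simp
 also have "... = (\<Sum>i\<le>degree (chain_poly V). monom (coeff (chain_poly V) i) i)"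
  by(rule sum.mono_neutral_left) (auto intro: le_degree)
 also have "... = chain_poly V" by(rule poly_as_sum_of_monoms)
 finally show ?thesis .
qed

end

section \<open>Flats of type B\<close>

text \<open>Coordinate 0 vanishes on \<open>Cn n\<close>, so \<open>b = 0\<close> yields the
  coordinate hyperplanes of the short roots without a separate case.\<close>

definition hyperplanes_B :: "nat => cvec set set" where
 "hyperplanes_B n = {{v : Cn n. v a = s * v b} | a b s. a : {1..n} & b : {0..n} & a ~= b & (s = 1 \<or> s = -1)}"

definition flats_B :: "nat => cvec set set" where
 "flats_B n = {\<Inter>M | M. M <= hyperplanes_B n & M ~= {}}"

lemma Cn_0: "v : Cn n ==> v 0 = 0"
 by(simp add: Cn_def)

lemma annihilator_span: "annihilator V (cfun.span S) = annihilator V S"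
proof -
 have "f v = 0" if "ALL f:S. f v = 0" "f : cfun.span S" for f and v :: cvec
  using that(2)
  by(rule cfun.span_induct) (use that(1) in \<open>auto simp: cfun.subspace_def cscale_def\<close>)
 then show ?thesis by(auto simp: annihilator_def intro: cfun.span_base)
qed

lemma annihilator_root_lines: "annihilator (Cn n) ` root_lines_B n = hyperplanes_B n"
proof -
 let ?h = "%a s b. {v : Cn n. v a = s * v b}"
 have 1: "annihilator (Cn n) (cfun.span {coord i}) = ?h i 1 0" for i
  unfolding annihilator_span by(auto simp: annihilator_def coord_def Cn_0)
 have 2: "annihilator (Cn n) (cfun.span {coord i + coord j}) = ?h i (-1) j" for i j
  unfolding annihilator_span by(auto simp: annihilator_def coord_def add_eq_0_iff2)
 have 3: "annihilator (Cn n) (cfun.span {coord i - coord j}) = ?h i 1 j" for i j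
  unfolding annihilator_span by(auto simp: annihilator_def coord_def)
 have 4: "?h a s 0 = ?h a 1 0" for a s by(auto simp: Cn_0)
 have hB: "?h a s b : hyperplanes_B n" if "a : {1..n}" "b : {0..n}" "a ~= b" "s = 1 \<or> s = -1" for a s b
  using that unfolding hyperplanes_B_def by blast
 show ?thesis
 proof
  show "annihilator (Cn n) ` root_lines_B n <= hyperplanes_B n"
  proof
   fix H assume "H : annihilator (Cn n) ` root_lines_B n"
   then obtain l where l: "l : root_lines_B n" "H = annihilator (Cn n) l" by blast
   from l(1) consider i where "i : {1..n}" "l = cfun.span {coord i}"
    | i j where "i : {1..n}" "j : {1..n}" "i ~= j" "l = cfun.span {coord i + coord j}"
    | i j where "i : {1..n}" "j : {1..n}" "i ~= j" "l = cfun.span {coord i - coord j}"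
    unfolding root_lines_B_def by blast
   then show "H : hyperplanes_B n"
    by cases (simp_all only: l(2) 1 2 3, (rule hB; auto)+)
  qed
  show "hyperplanes_B n <= annihilator (Cn n) ` root_lines_B n"
  proof
   fix H assume "H : hyperplanes_B n"
   then obtain a b s where H: "H = ?h a s b" "a : {1..n}" "b : {0..n}" "a ~= b" "s = 1 \<or> s = -1"
    unfolding hyperplanes_B_def by blast
   show "H : annihilator (Cn n) ` root_lines_B n"
   proof (cases "b = 0")
    case True
    then have "H = annihilator (Cn n) (cfun.span {coord a})" using H(1) 1 4 by simp
    then show ?thesis using H(2) unfolding root_lines_B_def by blast
   next
    case False
    then have b: "b : {1..n}" using H(3) by auto
    have "H = annihilator (Cn n) (cfun.span {coord a - coord b}) \<or> H = annihilator (Cn n) (cfun.span {coord a + coord b})"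
     using H(5) unfolding H(1) 2 3 by auto
    then show ?thesis using H(2,4) b unfolding root_lines_B_def by blast
   qed
  qed
 qed
qed

lemma annihilator_building_B: "annihilator (Cn n) ` building_B n = flats_B n"
proof -
 have ann: "annihilator (Cn n) (cfun.span (\<Union>L)) = \<Inter>(annihilator (Cn n) ` L)" if "L ~= {}" for L
  unfolding annihilator_span using that by(auto simp: annihilator_def)
 have "annihilator (Cn n) ` building_B n = {\<Inter>(annihilator (Cn n) ` L) | L. L <= root_lines_B n & L ~= {}}"
  unfolding building_B_def setcompr_eq_image image_image by(intro image_cong refl ann) blast
 also have "... = flats_B n"
 proof (intro Set.set_eqI iffI)
  fix W assume "W : flats_B n"
  then obtain M where "W = \<Inter>M" "M <= annihilator (Cn n) ` root_lines_B n" "M ~= {}"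
   unfolding flats_B_def annihilator_root_lines by auto
  then show "W : {\<Inter>(annihilator (Cn n) ` L) | L. L <= root_lines_B n & L ~= {}}"
   unfolding subset_image_iff by auto
 next
  fix W assume "W : {\<Inter>(annihilator (Cn n) ` L) | L. L <= root_lines_B n & L ~= {}}"
  then obtain L where "W = \<Inter>(annihilator (Cn n) ` L)" "L <= root_lines_B n" "L ~= {}" by auto
  then show "W : flats_B n"
   unfolding flats_B_def annihilator_root_lines[symmetric] by(intro CollectI exI[of _ "annihilator (Cn n) ` L"]) auto
 qed
 finally show ?thesis .
qed

lemma hyperplanes_BE:
 assumes "H : hyperplanes_B n"
 obtains a b s where "H = {v : Cn n. v a = s * v b}" "a : {1..n}" "b : {0..n}" "a ~= b" "s = 1 \<or> s = -1"
 using assms unfolding hyperplanes_B_def by blast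

lemma finite_building_B: "finite (building_B n)"
proof -
 have "root_lines_B n <= (%i. cfun.span {coord i}) ` {1..n} Un (%(i, j). cfun.span {coord i + coord j}) ` ({1..n} \<times> {1..n}) Un 
  (%(i, j). cfun.span {coord i - coord j}) ` ({1..n} \<times> {1..n})"
  unfolding root_lines_B_def by auto
 then have "finite (root_lines_B n)" by(rule finite_subset) auto
 moreover have "building_B n <= (%L. cfun.span (\<Union>L)) ` Pow (root_lines_B n)" unfolding building_B_def by blast
 ultimately show ?thesis by(meson finite_Pow_iff finite_imageI finite_subset)
qed

lemma flats_B_cases:
 assumes "W : insert (Cn n) (flats_B n)"
 obtains M where "M <= hyperplanes_B n" "W = {v : Cn n. ALL H:M. v : H}"
proof (cases "W = Cn n")
 case True
 then show ?thesis using that[of "{}"] by simp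
next
 case False
 then obtain M where M: "M <= hyperplanes_B n" "M ~= {}" "W = \<Inter>M" using assms by(auto simp: flats_B_def)
 moreover have "H <= Cn n" if "H : M" for H using M(1) that unfolding hyperplanes_B_def by blast
 ultimately show ?thesis using that[of M] by blast
qed

lemma subspace_flats_B:
 assumes "W : insert (Cn n) (flats_B n)" shows "cfun.subspace W"
proof -
 obtain M where M: "M <= hyperplanes_B n" "W = {v : Cn n. ALL H:M. v : H}" using flats_B_cases[OF assms] .
 have "cfun.subspace H" if "H : M" for H
 proof -
  have "H : hyperplanes_B n" using M(1) that by blast
  then obtain a b s where "H = {v : Cn n. v a = s * v b}" by(rule hyperplanes_BE)
  then show ?thesis using subspace_Cn[of n] by(auto simp: cfun.subspace_def cscale_def algebra_simps)
 qed
 moreover have "W = \<Inter>(insert (Cn n) M)" using M(2) by auto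
 ultimately show ?thesis using subspace_Cn[of n] cfun.subspace_Inter[of "insert (Cn n) M"] by auto
qed

lemma hyperplane_proper: "H : hyperplanes_B n ==> H < Cn n"
proof -
 assume "H : hyperplanes_B n"
 then obtain a b s where H: "H = {v : Cn n. v a = s * v b}" "a : {1..n}" "a ~= b"
  unfolding hyperplanes_B_def by blast
 have "unit_c a : Cn n - H" using H by(auto simp: unit_c_def Cn_def)
 then show "H < Cn n" using H(1) by blast
qed

lemma arrangement_B: "arrangement (Cn n) (flats_B n) cfun.dim"
proof (rule arrangement_Cn)
 show "finite (flats_B n)" unfolding annihilator_building_B[symmetric] using finite_building_B by simp
 show "B < Cn n" if "B : flats_B n" for B
  using that hyperplane_proper unfolding flats_B_def by blast
 show "A Int B : flats_B n" if AB: "A : flats_B n" "B : flats_B n" for A B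
 proof -
  obtain M where M: "A = \<Inter>M" "M <= hyperplanes_B n" "M ~= {}" using AB(1) by(auto simp: flats_B_def)
  obtain M' where M': "B = \<Inter>M'" "M' <= hyperplanes_B n" using AB(2) by(auto simp: flats_B_def)
  show ?thesis unfolding flats_B_def
   using M M' by(intro CollectI exI[of _ "M Un M'"]) (simp add: Inter_Un_distrib)
 qed
qed (use subspace_flats_B[of _ n] in blast)

lemma poincare_B_eq: "poincare_B n = arrangement.chain_poly (flats_B n) cfun.dim (Cn n)"
 unfolding poincare_B_def
 using arrangement.poincare_model[OF arrangement_B]
  arrangement.DCP_homeomorphic[OF arrangement_B finite_building_B annihilator_building_B[symmetric]] .

definition signs :: "(nat => complex) => bool" where
 "signs sg \<longleftrightarrow> (ALL i. sg i = 1 \<or> sg i = -1)"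

definition rel_flat :: "nat => (nat \<times> nat) set => (nat => complex) => cvec set" where
 "rel_flat n R sg = {v : Cn n. ALL (a, b):R. sg a * v a = sg b * v b}"

text \<open>Squares express that \<open>v a\<close> and \<open>v b\<close> agree up to a sign, which
  so far may depend on \<open>v\<close>; linearity of the flat later makes it uniform. The index 0
  stands for the value zero.\<close>

definition flat_rel :: "nat => cvec set => (nat \<times> nat) set" where
 "flat_rel n W = {(a, b). a : {0..n} & b : {0..n} & (ALL v:W. (v a)\<^sup>2 = (v b)\<^sup>2)}"

lemma signsD: "signs sg ==> sg i = 1 \<or> sg i = -1"
 by(simp add: signs_def)

lemma signs_mult: "signs sg ==> sg i * sg i = 1" and signs_nz: "signs sg ==> sg i ~= 0"
 and signs_square: "signs sg ==> (sg i * x)\<^sup>2 = x\<^sup>2"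
 by(auto simp: signs_def dest: spec[of _ i])

lemma signs_eq_iff: "signs sg ==> sg a * x = sg b * y \<longleftrightarrow> x = sg a * sg b * y"
 using signs_mult[of sg a] by(metis mult.assoc mult_1)

lemma equiv_flat_rel: "equiv {0..n} (flat_rel n W)"
 by(auto simp: equiv_def refl_on_def sym_on_def trans_on_def flat_rel_def)

lemma equiv_rel:
 fixes n :: nat
 assumes "equiv {0..n} R"
 shows "a <= n ==> (a, a) : R" "(a, b) : R ==> (b, a) : R" "(a, b) : R ==> (b, c) : R ==> (a, c) : R"
  "(a, b) : R ==> a <= n & b <= n"
proof -
 have *: "refl_on {0..n} R" "sym R" "trans R" using assms by(auto simp: equiv_def)
 show "a <= n ==> (a, a) : R" using refl_onD[OF *(1), of a] by simp
 show "(a, b) : R ==> (b, a) : R" by(rule symD[OF *(2)])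
 show "(a, b) : R ==> (b, c) : R ==> (a, c) : R" by(rule transD[OF *(3)])
 show "(a, b) : R ==> a <= n & b <= n" using equiv_type[OF assms] by auto
qed

context
 fixes n :: nat and R :: "(nat \<times> nat) set" and sg :: "nat => complex"
 assumes R: "equiv {0..n} R" and sg: "signs sg"
begin

lemma rel_flat_zero: "v : rel_flat n R sg ==> (a, 0) : R ==> v a = 0"
 using signs_nz[OF sg, of a] by(auto simp: rel_flat_def Cn_0)

text \<open>The signed indicator of a class; for the classes avoiding 0 these vectors form a basis
  of the flat.\<close>

definition class_vec :: "nat => cvec" where
 "class_vec a = (%i. if (a, i) : R then sg i else 0)"

lemma class_vec_in: "(a, 0) ~: R ==> class_vec a : rel_flat n R sg"
proof -
 assume a: "(a, 0) ~: R"
 have "class_vec a i = 0" if "i ~: {1..n}" for i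
  using a that equiv_rel(4)[OF R, of a i] by(cases "i = 0") (auto simp: class_vec_def)
 moreover have "sg b * class_vec a b = sg c * class_vec a c" if "(b, c) : R" for b c
 proof -
  have "(a, b) : R \<longleftrightarrow> (a, c) : R" using that equiv_rel(2,3)[OF R] by blast
  then show ?thesis by(simp add: class_vec_def signs_mult[OF sg])
 qed
 ultimately show ?thesis by(auto simp: rel_flat_def Cn_def)
qed

text \<open>If the class of \<open>a\<close> avoids 0, the vector \<open>class_vec a\<close> lies in
  the flat and separates \<open>a\<close> from every index outside that class.\<close>

lemma flat_rel_rel_flat: "flat_rel n (rel_flat n R sg) = R"
proof (intro Set.set_eqI iffI; clarify)
 fix a b assume ab: "(a, b) : R"
 have "(v a)\<^sup>2 = (v b)\<^sup>2" if "v : rel_flat n R sg" for v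
 proof -
  have "sg a * v a = sg b * v b" using that ab by(auto simp: rel_flat_def)
  then show ?thesis using signs_square[OF sg] by metis
 qed
 then show "(a, b) : flat_rel n (rel_flat n R sg)" using ab equiv_rel(4)[OF R] by(simp add: flat_rel_def)
next
 fix a b assume ab: "(a, b) : flat_rel n (rel_flat n R sg)"
 have *: "(a, b) : R" if "(a, 0) ~: R" "a <= n" "ALL v:rel_flat n R sg. (v a)\<^sup>2 = (v b)\<^sup>2" for a b
 proof -
  have "(class_vec a a)\<^sup>2 = (class_vec a b)\<^sup>2" using that class_vec_in by blast
  then show ?thesis using equiv_rel(1)[OF R that(2)] signs_nz[OF sg, of a] by(auto simp: class_vec_def split: if_splits)
 qed
 show "(a, b) : R"
 proof (cases "(a, 0) : R")
  case True
  show ?thesis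
  proof (cases "(b, 0) : R")
   case False
   then have "(b, a) : R" using ab by(intro *) (auto simp: flat_rel_def)
   then show ?thesis using equiv_rel(2)[OF R] by blast
  qed (use True equiv_rel[OF R] in blast)
 qed (use ab * in \<open>auto simp: flat_rel_def\<close>)
qed

lemma rel_flat_in_flats: "rel_flat n R sg : insert (Cn n) (flats_B n)"
proof (cases "R <= Id")
 case True
 then have "rel_flat n R sg = Cn n" by(auto simp: rel_flat_def)
 then show ?thesis by simp
next
 case False
 let ?h = "%(a, b). {v : Cn n. v a = sg a * sg b * v b}"
 let ?P = "{p : R. fst p ~= 0 & fst p ~= snd p}"
 note h = signs_eq_iff[OF sg]
 have "rel_flat n R sg = \<Inter>(?h ` ?P)"
 proof (intro equalityI subsetI)
  fix v assume v: "v : \<Inter>(?h ` ?P)"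
  obtain a b where ab: "(a, b) : ?P" using False equiv_rel(2)[OF R]
   by(clarsimp simp: subset_iff) (metis fst_conv gr0I snd_conv)
  have C: "v : Cn n" using v ab by blast
  have *: "sg a * v a = sg b * v b" if "(a, b) : R" "a ~= 0" for a b
   using v that unfolding h by(cases "a = b") (auto simp: signs_mult[OF sg])
  have "sg a * v a = sg b * v b" if "(a, b) : R" for a b
   using *[OF that] *[OF equiv_rel(2)[OF R that]] by metis
  then show "v : rel_flat n R sg" using C by(auto simp: rel_flat_def)
 qed (auto simp: rel_flat_def h)
 moreover have "?h ` ?P <= hyperplanes_B n"
 proof
  fix H assume "H : ?h ` ?P"
  then obtain a b where ab: "(a, b) : R" "a ~= 0" "a ~= b" "H = {v : Cn n. v a = sg a * sg b * v b}" by auto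
  moreover have "sg a * sg b = 1 \<or> sg a * sg b = -1" using signsD[OF sg, of a] signsD[OF sg, of b] by auto
  moreover have "a <= n" "b <= n" using equiv_rel(4)[OF R ab(1)] by auto
  ultimately show "H : hyperplanes_B n" unfolding hyperplanes_B_def
   by(intro CollectI exI[of _ a] exI[of _ b] exI[of _ "sg a * sg b"]) auto
 qed
 moreover have "?h ` ?P ~= {}"
  using False equiv_rel(2)[OF R] by(clarsimp simp: subset_iff) (metis fst_conv gr0I snd_conv)
 ultimately show ?thesis unfolding flats_B_def by blast
qed

text \<open>Each class contributes one free coordinate, except the class of 0, which accounts for
  the \<open>Suc\<close>.\<close>

lemma dim_rel_flat: "Suc (cfun.dim (rel_flat n R sg)) = card ({0..n} // R)"
proof -
 define rep where "rep = (%a. LEAST b. (a, b) : R)"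
 have rep: "(a, rep a) : R" if "a <= n" for a
  unfolding rep_def using equiv_rel(1)[OF R that] by(rule LeastI)
 have rep_eq: "rep a = rep b" if "(a, b) : R" for a b
 proof -
  have "(%c. (a, c) : R) = (%c. (b, c) : R)" using that equiv_rel[OF R] by blast
  then show ?thesis by(simp add: rep_def)
 qed
 have rep0: "rep 0 = 0" unfolding rep_def using equiv_rel(1)[OF R, of 0] by(intro Least_equality) auto
 \<comment> \<open>The least elements of all classes other than that of 0, whose least element is 0
   itself.\<close>
 define T where "T = {a : {0..n}. rep a = a} - {0}"
 have T: "a <= n" "(a, 0) ~: R" "(a, i) : R \<longleftrightarrow> i <= n & rep i = a" if "a : T" for a i
  using that rep_eq[of a 0] rep_eq[of a i] rep0 rep[of i] equiv_rel(2,4)[OF R] by(auto simp: T_def)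
 have "bij_betw (%a. R `` {a}) (insert 0 T) ({0..n} // R)"
  unfolding bij_betw_def
 proof
  show "inj_on (%a. R `` {a}) (insert 0 T)"
  proof (rule inj_onI)
   fix a b assume ab: "a : insert 0 T" "b : insert 0 T" "R `` {a} = R `` {b}"
   then have "(a, b) : R" using equiv_rel(1)[OF R, of b] by(auto simp: T_def)
   from rep_eq[OF this] show "a = b" using ab rep0 by(auto simp: T_def)
  qed
  show "(%a. R `` {a}) ` insert 0 T = {0..n} // R"
  proof
   show "(%a. R `` {a}) ` insert 0 T <= {0..n} // R" by(auto simp: quotient_def T_def)
   show "{0..n} // R <= (%a. R `` {a}) ` insert 0 T"
   proof
    fix C assume "C : {0..n} // R"
    then obtain a where a: "a <= n" "C = R `` {a}" by(auto simp: quotient_def)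
    have "C = R `` {rep a}" using a rep[OF a(1)] equiv_class_eq[OF R] by blast
    moreover have "rep a : insert 0 T" using rep_eq[OF rep[OF a(1)]] equiv_rel(4)[OF R rep[OF a(1)]] by(auto simp: T_def)
    ultimately show "C : (%a. R `` {a}) ` insert 0 T" by blast
   qed
  qed
 qed
 then have "card ({0..n} // R) = card (insert 0 T)" by(simp add: bij_betw_same_card)
 moreover have "card (insert 0 T) = Suc (card T)"
  by(rule card_insert_disjoint) (simp_all add: T_def)
 ultimately have "card ({0..n} // R) = Suc (card T)" by simp
 moreover have "cfun.dim (rel_flat n R sg) = card T"
 proof (rule cfun.dim_unique[of "class_vec ` T"])
  have inj: "inj_on class_vec T"
  proof (rule inj_onI)
   fix a b assume ab: "a : T" "b : T" "class_vec a = class_vec b"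
   then have "class_vec a b = sg b" using equiv_rel(1)[OF R, of b] T(1) by(simp add: class_vec_def)
   then have "(a, b) : R" using signs_nz[OF sg, of b] by(auto simp: class_vec_def split: if_splits)
   then show "a = b" using ab T(3)[of a b] by(auto simp: T_def)
  qed
  then show "card (class_vec ` T) = card T" by(rule card_image)
  show "class_vec ` T <= rel_flat n R sg" using class_vec_in T(2) by blast
  have fin: "finite T" by(simp add: T_def)
  have coef: "(\<Sum>a\<in>T. cscale (f a) (class_vec a)) i = (if i <= n & rep i : T then f (rep i) * sg i else 0)" for f i
  proof -
   have "(\<Sum>a\<in>T. cscale (f a) (class_vec a)) i = (\<Sum>a\<in>T. if rep i = a then (if i <= n then f (rep i) * sg i else 0) else 0)"
    unfolding cfun_sum_apply by(intro sum.cong) (auto simp: class_vec_def cscale_def T(3))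
   then show ?thesis using fin by simp
  qed
  show "rel_flat n R sg <= cfun.span (class_vec ` T)"
  proof
   fix v assume v: "v : rel_flat n R sg"
   have "v i = (\<Sum>a\<in>T. cscale (sg a * v a) (class_vec a)) i" for i
   proof (cases "i <= n & rep i : T")
    case True
    have "sg i * v i = sg (rep i) * v (rep i)" using v rep[of i] True by(auto simp: rel_flat_def)
    then have "sg i * sg i * v i = sg (rep i) * v (rep i) * sg i" by(simp add: mult_ac)
    then show ?thesis using True unfolding coef signs_mult[OF sg] by simp
   next
    case False
    have "v i = 0"
    proof (cases "i <= n")
     case True
     then have "rep i = 0" using False rep_eq[OF rep[OF True]] equiv_rel(4)[OF R rep[OF True]] by(auto simp: T_def)
     then show ?thesis using rel_flat_zero[OF v, of i] rep[OF True] by simp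
    qed (use v in \<open>auto simp: rel_flat_def Cn_def\<close>)
    then show ?thesis unfolding coef if_not_P[OF False] .
   qed
   then have "v = (\<Sum>a\<in>T. cscale (sg a * v a) (class_vec a))" by(rule ext)
   then show "v : cfun.span (class_vec ` T)"
    by(metis (no_types, lifting) cfun.span_base cfun.span_scale cfun.span_sum imageI)
  qed
  show "~ cfun.dependent (class_vec ` T)"
  proof (rule cfun.independent_if_scalars_zero)
   fix f x assume f: "(\<Sum>x\<in>class_vec ` T. cscale (f x) x) = 0" and x: "x : class_vec ` T"
   then obtain a where a: "a : T" "x = class_vec a" by blast
   have "(\<Sum>a\<in>T. cscale (f (class_vec a)) (class_vec a)) = 0" using f by(simp add: sum.reindex[OF inj])
   from fun_cong[OF this, of a] show "f x = 0" using a signs_nz[OF sg, of a] unfolding coef by(simp add: T_def split: if_splits)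
  qed (use fin in simp)
 qed
 ultimately show ?thesis by simp
qed

text \<open>In the zero class of \<open>R\<close> all coordinates vanish, so signs there carry no
  information; in every other class only products of two signs matter, the global sign being
  free.\<close>

lemma rel_flat_subset_iff:
 assumes \<tau>: "signs \<tau>" and R': "equiv {0..n} R'"
 shows "rel_flat n R sg <= rel_flat n R' \<tau> \<longleftrightarrow> R' <= R & (ALL (a, b):R'. (a, 0) ~: R --> sg a * sg b = \<tau> a * \<tau> b)"
proof
 assume sub: "rel_flat n R sg <= rel_flat n R' \<tau>"
 have *: "(a, b) : R & sg a * sg b = \<tau> a * \<tau> b" if "(a, b) : R'" "(a, 0) ~: R" for a b
 proof -
  have "(a, a) : R" using equiv_rel(1)[OF R] equiv_rel(4)[OF R' that(1)] by blast
  moreover have "\<tau> a * class_vec a a = \<tau> b * class_vec a b"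
   using class_vec_in[OF that(2)] sub that(1) by(auto simp: rel_flat_def)
  ultimately have eq: "\<tau> a * sg a = \<tau> b * (if (a, b) : R then sg b else 0)" by(simp add: class_vec_def)
  then have "(a, b) : R" using signs_nz[OF sg, of a] signs_nz[OF \<tau>, of a] by(auto split: if_splits)
  with eq show ?thesis
   using signsD[OF sg, of a] signsD[OF sg, of b] signsD[OF \<tau>, of a] signsD[OF \<tau>, of b] by auto
 qed
 have "(a, b) : R" if "(a, b) : R'" for a b
  using *[OF that] *[OF equiv_rel(2)[OF R' that]] equiv_rel(2,3)[OF R] by blast
 then show "R' <= R & (ALL (a, b):R'. (a, 0) ~: R --> sg a * sg b = \<tau> a * \<tau> b)" using * by auto
next
 assume A: "R' <= R & (ALL (a, b):R'. (a, 0) ~: R --> sg a * sg b = \<tau> a * \<tau> b)"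
 show "rel_flat n R sg <= rel_flat n R' \<tau>"
 proof
  fix v assume v: "v : rel_flat n R sg"
  have "\<tau> a * v a = \<tau> b * v b" if ab: "(a, b) : R'" for a b
  proof (cases "(a, 0) : R")
   case True
   then have "(b, 0) : R" using A ab equiv_rel[OF R] by blast
   then show ?thesis using rel_flat_zero[OF v] True by simp
  next
   case False
   then have "sg a * sg b = \<tau> a * \<tau> b" using A ab by blast
   moreover have "sg a * v a = sg b * v b" using v A ab by(auto simp: rel_flat_def)
   ultimately show ?thesis by(simp add: signs_eq_iff[OF sg] signs_eq_iff[OF \<tau>])
  qed
  then show "v : rel_flat n R' \<tau>" using v by(auto simp: rel_flat_def)
 qed
qed

end

lemma flat_eq_rel_flat:
 assumes "W : insert (Cn n) (flats_B n)"
 obtains sg where "signs sg" "W = rel_flat n (flat_rel n W) sg"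
proof -
 obtain M where M: "M <= hyperplanes_B n" "W = {v : Cn n. ALL H:M. v : H}" using flats_B_cases[OF assms] .
 let ?R = "flat_rel n W"
 note R = equiv_flat_rel[of n W]
 \<comment> \<open>Given one vector violating each of the two signs, their sum would violate both,
   against equality of squares.\<close>
 have "EX e. (e = 1 \<or> e = -1) & (ALL v:W. v a = e * v b)" if ab: "(a, b) : ?R" for a b
 proof (rule ccontr)
  assume no: "~ ?thesis"
  then obtain v where v: "v : W" "v a ~= v b" by force
  from no obtain w where w: "w : W" "w a ~= - w b" by force
  have sq: "(u a)\<^sup>2 = (u b)\<^sup>2" if "u : W" for u using ab that by(simp add: flat_rel_def)
  have "v a = - v b" "w a = w b" using sq[OF v(1)] sq[OF w(1)] v w by(auto simp: power2_eq_iff)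
  moreover have "v + w : W" using subspace_flats_B[OF assms] v w by(simp add: cfun.subspace_def)
  ultimately have "(w b - v b)\<^sup>2 = (w b + v b)\<^sup>2" using sq[of "v + w"] by(simp add: add.commute)
  then have "w b * v b = 0" by(simp add: power2_eq_square algebra_simps)
  then show False using v w \<open>v a = - v b\<close> \<open>w a = w b\<close> by auto
 qed
 then have "ALL a b. EX e. (a, b) : ?R --> (e = 1 \<or> e = -1) & (ALL v:W. v a = e * v b)" by blast
 then obtain e where e: "!!a b. (a, b) : ?R ==> e a b = 1 \<or> e a b = -1" "!!a b v. (a, b) : ?R ==> v : W ==> v a = e a b * v b"
  unfolding choice_iff by blast
 define rep where "rep = (%a. LEAST b. (a, b) : ?R)"
 have rep: "(a, rep a) : ?R" if "a <= n" for a
  unfolding rep_def using equiv_rel(1)[OF R that] by(rule LeastI)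
 have rep_eq: "rep a = rep b" if "(a, b) : ?R" for a b
 proof -
  have "(%c. (a, c) : ?R) = (%c. (b, c) : ?R)" using that equiv_rel[OF R] by blast
  then show ?thesis by(simp add: rep_def)
 qed
 \<comment> \<open>Signs are measured against the least element of each class.\<close>
 define sg where "sg = (%a. if a <= n then e a (rep a) else 1)"
 have sg: "signs sg" using e(1)[OF rep] by(auto simp: signs_def sg_def)
 have sW: "sg a * v a = sg b * v b" if "(a, b) : ?R" "v : W" for a b v
 proof -
  have le: "a <= n" "b <= n" using equiv_rel(4)[OF R that(1)] by auto
  have "v a = sg a * v (rep a)" "v b = sg b * v (rep a)"
   using e(2)[OF rep that(2)] le rep_eq[OF that(1)] by(auto simp: sg_def)
  then show ?thesis using signs_mult[OF sg] by(metis mult.assoc mult_1)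
 qed
 have "W = rel_flat n ?R sg"
 proof
  show "W <= rel_flat n ?R sg" using sW M(2) by(auto simp: rel_flat_def)
  show "rel_flat n ?R sg <= W"
  proof
   fix v assume v: "v : rel_flat n ?R sg"
   have "v : H" if H: "H : M" for H
   proof -
    have "H : hyperplanes_B n" using M(1) H by blast
    then obtain a b s where h: "H = {v : Cn n. v a = s * v b}" "a : {1..n}" "b : {0..n}" "s = 1 \<or> s = -1"
     by(rule hyperplanes_BE)
    have us: "u a = s * u b" if "u : W" for u
    proof -
     have "u : H" using that H unfolding M(2) by blast
     then show ?thesis unfolding h(1) by simp
    qed
    have "(u a)\<^sup>2 = (u b)\<^sup>2" if "u : W" for u unfolding us[OF that] using h(4) by auto
    then have ab: "(a, b) : ?R" using h(2,3) by(auto simp: flat_rel_def)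
    have "v a = s * v b"
    proof (cases "(a, 0) : ?R")
     case True
     then have "(b, 0) : ?R" using ab equiv_rel[OF R] by blast
     then show ?thesis using rel_flat_zero[OF R sg v] True by simp
    next
     case False
     then obtain u where u: "u : W" "u a ~= 0" using h(2) M(2) Cn_0 by(force simp: flat_rel_def)
     have "sg a * v a = sg b * v b" using v ab by(auto simp: rel_flat_def)
     moreover have "s = sg a * sg b"
      using sW[OF ab u(1)] us[OF u(1)] u(2) by(auto simp: signs_eq_iff[OF sg])
     ultimately show ?thesis by(simp add: signs_eq_iff[OF sg])
    qed
    then show ?thesis using v h(1) by(auto simp: rel_flat_def)
   qed
   then show "v : W" using v M(2) by(auto simp: rel_flat_def)
  qed
 qed
 with sg show ?thesis by(rule that)
qed

section \<open>Counting flags of flats\<close>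

text \<open>Flags are indexed by all naturals and only weakly increasing, so that every exponent
  vector makes sense: \<open>m\<close> records the dimension of the first flat and the jumps that
  follow.\<close>

definition flags_B :: "nat => exponents => (nat => cvec set) set" where
 "flags_B n m = {w. ALL i. w i : insert (Cn n) (flats_B n) & w i <= w (Suc i) &
   cfun.dim (w i) = (\<Sum>j\<le>i. lookup m j)}"

text \<open>What remains of a flag when the signs are forgotten; \<open>Suc\<close> counts the class
  of 0, which has no dimension.\<close>

definition rel_flags :: "nat => exponents => (nat => (nat \<times> nat) set) set" where
 "rel_flags n m = {R. ALL i. equiv {0..n} (R i) & R (Suc i) <= R i &
   card ({0..n} // R i) = Suc (\<Sum>j\<le>i. lookup m j)}"

definition total :: "exponents => nat" where
 "total m = (\<Sum>i\<in>Poly_Mapping.keys m. lookup m i)"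

definition key_weight :: "exponents => rat poly" where
 "key_weight m = (\<Prod>i\<in>Poly_Mapping.keys m - {0}. q_factor (lookup m i))"

lemma card_quotient_Id: "card (A // Id_on A) = card A"
proof -
 have "A // Id_on A = (%a. {a}) ` A" by(auto simp: quotient_def)
 then show ?thesis by(simp add: card_image)
qed

lemma dim_Cn: "cfun.dim (Cn n) = n"
proof -
 have "equiv {0..n} (Id_on {0..n})" by(auto simp: equiv_def refl_on_def sym_def trans_def)
 from dim_rel_flat[OF this, of "%_. 1"] have "Suc (cfun.dim (rel_flat n (Id_on {0..n}) (%_. 1))) = Suc n"
  by(simp add: signs_def card_quotient_Id)
 moreover have "rel_flat n (Id_on {0..n}) (%_. 1) = Cn n" by(auto simp: rel_flat_def)
 ultimately show ?thesis by simp
qed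

lemma flats_B_dim:
 assumes "W : insert (Cn n) (flats_B n)"
 shows "cfun.dim W <= n" "cfun.dim W = n ==> W = Cn n"
proof -
 have "cfun.dim W < n" if "W : flats_B n"
  using arrangement.dmono[OF arrangement_B that, of "Cn n"] arrangement.proper[OF arrangement_B that] dim_Cn by simp
 then show "cfun.dim W <= n" "cfun.dim W = n ==> W = Cn n" using assms dim_Cn[of n] by auto
qed

lemma flats_B_mono:
 assumes "U : insert (Cn n) (flats_B n)" "W : insert (Cn n) (flats_B n)" "U < W"
 shows "cfun.dim U < cfun.dim W"
proof -
 have "W <= Cn n" using assms(2) arrangement.proper[OF arrangement_B] by blast
 then have "U : flats_B n" using assms by auto
 then show ?thesis using arrangement.dmono[OF arrangement_B _ assms(2,3)] by blast
qed

lemma sum_lookup_le: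
 assumes "Poly_Mapping.keys m <= {..k}"
 shows "(\<Sum>j\<le>k. lookup m j) = total m"
 unfolding total_def using assms by(intro sum.mono_neutral_right) (auto simp: in_keys_iff)

lemma nonbad_keys:
 assumes "~ bad m"
 obtains k where "Poly_Mapping.keys m - {0} = Suc ` {..<k}"
proof -
 let ?K = "Poly_Mapping.keys m - {0}"
 have dn: "i : ?K" if "j : ?K" "1 <= i" "i <= j" for i j
 proof (cases "i = j")
  case False
  then have "i < j" using that by simp
  then show ?thesis using assms that unfolding bad_def by auto
 qed (use that in simp)
 show ?thesis
 proof (cases "?K = {}")
  case True
  then show ?thesis using that[of 0] by simp
 next
  case False
  have fin: "finite ?K" by simp
  have "?K = {1..Max ?K}"
  proof
   show "?K <= {1..Max ?K}"
   proof
    fix j assume j: "j : ?K"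
    then show "j : {1..Max ?K}" using Max_ge[OF fin j] by auto
   qed
   show "{1..Max ?K} <= ?K" using dn[OF Max_in[OF fin False]] by auto
  qed
  also have "... = Suc ` {..<Max ?K}" by(simp add: image_Suc_lessThan)
  finally show ?thesis by(rule that)
 qed
qed

text \<open>An exponent vector without gaps means a flag that grows strictly until it reaches the
  whole space at step \<open>k\<close>.\<close>

lemma flag_total:
 assumes w: "w : flags_B n m" and m: "total m = n" and k: "Poly_Mapping.keys m - {0} = Suc ` {..<k}"
 shows "w i = Cn n \<longleftrightarrow> k <= i" "i < k ==> w i < w (Suc i)"
proof -
 have w1: "w i : insert (Cn n) (flats_B n)" "w i <= w (Suc i)" "cfun.dim (w i) = (\<Sum>j\<le>i. lookup m j)" for i
  using w unfolding flags_B_def by blast+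
 have top: "w i = Cn n" if "k <= i" for i
 proof -
  have "Poly_Mapping.keys m <= {..i}"
  proof
   fix j assume "j : Poly_Mapping.keys m"
   then have "j = 0 \<or> j : Suc ` {..<k}" using k by blast
   then show "j : {..i}" using that by auto
  qed
  then have "cfun.dim (w i) = n" using w1(3)[of i] sum_lookup_le m by simp
  then show ?thesis using flats_B_dim(2)[OF w1(1)] by blast
 qed
 have st: "w i < w (Suc i)" if "i < k" for i
 proof -
  have "Suc i : Poly_Mapping.keys m" using k that by blast
  then have "cfun.dim (w i) < cfun.dim (w (Suc i))" by(simp add: w1(3) in_keys_iff)
  then show ?thesis using w1(2)[of i] by auto
 qed
 then show "i < k ==> w i < w (Suc i)" .
 have "w i ~= Cn n" if "i < k"
 proof
  assume "w i = Cn n"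
  then have "Cn n < w (Suc i)" using st[OF that] by simp
  then show False using w1(1)[of "Suc i"] arrangement.proper[OF arrangement_B] by blast
 qed
 then show "w i = Cn n \<longleftrightarrow> k <= i" using top[of i] by(meson not_le)
qed

definition chain_flag :: "nat => cvec set list => nat => cvec set" where
 "chain_flag n c i = (if i < length c then rev c ! i else Cn n)"

definition nonbad :: "nat => exponents set" where
 "nonbad n = {m. ~ bad m & total m = n}"

text \<open>The exponents are the jumps of dimension along the reversed chain; as the chain is
  strict, the positive jumps fill the indices from 1 to its length, so the monomial is not
  bad.\<close>

lemma chain_flag_in:
 assumes c: "c : arrangement.chains (flats_B n) (Cn n)"
 obtains m where "m : nonbad n" "chain_flag n c : flags_B n m"
  "arrangement.chain_weight cfun.dim (Cn n) c = key_weight m"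
proof -
 note cd = arrangement.chains_def[OF arrangement_B] arrangement.chain_weight_def[OF arrangement_B]
 let ?w = "chain_flag n c" and ?k = "length c"
 have cF: "set c <= flats_B n" and cs: "sorted_wrt (\<supset>) (Cn n # c)" using c by(auto simp: cd)
 have wk: "?w i = (Cn n # c) ! (?k - i)" if "i <= ?k" for i
  using that by(cases "i = ?k") (auto simp: chain_flag_def rev_nth nth_Cons' Suc_diff_Suc)
 have wF: "?w i : insert (Cn n) (flats_B n)" for i
  using cF nth_mem[of i "rev c"] by(auto simp: chain_flag_def)
 have st: "?w i < ?w (Suc i)" if "i < ?k" for i
  using sorted_wrt_nth_less[OF cs, of "?k - Suc i" "?k - i"] that wk[of i] wk[of "Suc i"] by simp
 have top: "?w i = Cn n" if "?k <= i" for i using that by(simp add: chain_flag_def)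
 define f where "f = (%i. if i = 0 then cfun.dim (?w 0) else cfun.dim (?w i) - cfun.dim (?w (i - 1)))"
 define m where "m = Abs_poly_mapping f"
 have "{i. f i ~= 0} <= {..?k}"
 proof
  fix i assume "i : {i. f i ~= 0}"
  then show "i : {..?k}" using top[of i] top[of "i - 1"] by(cases "i <= ?k") (auto simp: f_def)
 qed
 then have fin: "finite {i. f i ~= 0}" by(rule finite_subset) simp
 have m: "lookup m = f" unfolding m_def using fin by(rule lookup_Abs_poly_mapping)
 have le: "cfun.dim (?w i) <= cfun.dim (?w (Suc i))" for i
  using flats_B_mono[OF wF wF st[of i]] top[of i] top[of "Suc i"] by(cases "i < ?k") auto
 have "(\<Sum>j\<le>i. if j = 0 then h 0 else h j - h (j - 1)) = h i" if "!!i. h i <= h (Suc i)" for h :: "nat => nat" and i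
  by(induction i) (use that in simp_all)
 from this[of "%i. cfun.dim (?w i)", OF le] have sum: "(\<Sum>j\<le>i. f j) = cfun.dim (?w i)" for i
  unfolding f_def .
 have fl: "?w : flags_B n m"
  unfolding flags_B_def m sum using wF st top by(auto simp: not_less) (metis le_SucI not_less psubset_imp_subset subsetD)
 have fS: "f (Suc i) ~= 0 \<longleftrightarrow> i < ?k" for i
  using flats_B_mono[OF wF wF st[of i]] top[of i] top[of "Suc i"] by(cases "i < ?k") (auto simp: f_def)
 have keys: "Poly_Mapping.keys m - {0} = Suc ` {..<?k}"
 proof (rule Set.set_eqI)
  fix i show "i : Poly_Mapping.keys m - {0} \<longleftrightarrow> i : Suc ` {..<?k}"
   using fS[of "i - 1"] by(cases i) (auto simp: in_keys_iff m)
 qed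
 have "~ bad m"
 proof
  assume "bad m"
  then obtain i j where ij: "1 <= i" "i < j" "j : Poly_Mapping.keys m - {0}" "i ~: Poly_Mapping.keys m - {0}"
   by(auto simp: bad_def)
  then show False unfolding keys by(cases i) auto
 qed
 moreover have "total m = n"
 proof -
  have "Poly_Mapping.keys m <= {..?k}"
  proof
   fix j assume "j : Poly_Mapping.keys m"
   then have "j = 0 \<or> j : Suc ` {..<?k}" using keys by blast
   then show "j : {..?k}" by auto
  qed
  then show ?thesis using sum_lookup_le[of m ?k] sum[of ?k] top[of ?k] dim_Cn by(simp add: m)
 qed
 moreover have "arrangement.chain_weight cfun.dim (Cn n) c = key_weight m"
 proof -
  have "arrangement.chain_weight cfun.dim (Cn n) c = (\<Prod>i<?k. q_factor (cfun.dim (?w (?k - i)) - cfun.dim (?w (?k - Suc i))))"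
   unfolding cd using wk by(intro prod.cong) auto
  also have "... = (\<Prod>i<?k. q_factor (f (?k - i)))"
   by(intro prod.cong) (auto simp: f_def)
  also have "... = (\<Prod>i<?k. q_factor (f (Suc i)))"
   using prod.nat_diff_reindex[of "%i. q_factor (f (Suc i))" ?k] by(simp add: Suc_diff_Suc)
  also have "... = key_weight m"
   unfolding key_weight_def keys by(simp add: prod.reindex m)
  finally show ?thesis .
 qed
 ultimately show ?thesis using that[of m] fl by(simp add: nonbad_def)
qed

lemma flag_exponents_unique: "w : flags_B n m ==> w : flags_B n m' ==> m = m'"
proof (rule poly_mapping_eqI)
 fix i assume w: "w : flags_B n m" "w : flags_B n m'"
 have s: "(\<Sum>j\<le>i. lookup m j) = (\<Sum>j\<le>i. lookup m' j)" for i
  using w unfolding flags_B_def mem_Collect_eq by metis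
 show "lookup m i = lookup m' i"
  using s[of i] s[of "i - 1"] by(cases i) auto
qed

lemma inj_chain_flag: "inj_on (chain_flag n) (arrangement.chains (flats_B n) (Cn n))"
proof (rule inj_onI)
 note cd = arrangement.chains_def[OF arrangement_B]
 fix c c' assume c: "c : arrangement.chains (flats_B n) (Cn n)" "c' : arrangement.chains (flats_B n) (Cn n)"
  and eq: "chain_flag n c = chain_flag n c'"
 have len: "{i. chain_flag n c i ~= Cn n} = {..<length c}" if "c : arrangement.chains (flats_B n) (Cn n)" for c
 proof -
  have "rev c ! i ~= Cn n" if i: "i < length c" for i
  proof -
   have "rev c ! i : flats_B n" using \<open>c : _\<close> i nth_mem[of i "rev c"] by(auto simp: cd)
   then show ?thesis using arrangement.proper[OF arrangement_B] by blast
  qed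
  then show ?thesis by(auto simp: chain_flag_def)
 qed
 have l: "length c = length c'" using len[OF c(1)] len[OF c(2)] eq by simp
 have "rev c = rev c'"
 proof (rule nth_equalityI)
  fix i assume "i < length (rev c)"
  then show "rev c ! i = rev c' ! i" using fun_cong[OF eq, of i] l by(simp add: chain_flag_def)
 qed (simp add: l)
 then show "c = c'" by simp
qed

lemma chain_flag_image: "chain_flag n ` arrangement.chains (flats_B n) (Cn n) = (\<Union>m\<in>nonbad n. flags_B n m)"
proof
 show "chain_flag n ` arrangement.chains (flats_B n) (Cn n) <= (\<Union>m\<in>nonbad n. flags_B n m)"
  by(auto elim: chain_flag_in)
 show "(\<Union>m\<in>nonbad n. flags_B n m) <= chain_flag n ` arrangement.chains (flats_B n) (Cn n)"
 proof
  fix w assume "w : (\<Union>m\<in>nonbad n. flags_B n m)"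
  then obtain m where m: "~ bad m" "total m = n" and w: "w : flags_B n m" by(auto simp: nonbad_def)
  obtain k where k: "Poly_Mapping.keys m - {0} = Suc ` {..<k}" using nonbad_keys[OF m(1)] .
  note wt = flag_total[OF w m(2) k]
  define c where "c = rev (map w [0..<k])"
  have "Cn n # c = rev (map w [0..<Suc k])" using wt(1)[of k] by(simp add: c_def)
  moreover have "sorted_wrt (<) (map w [0..<Suc k])"
   by(subst sorted_wrt_iff_nth_Suc_transp)
    (auto intro: transpI simp: wt(2) simp del: upt_Suc)
  ultimately have "sorted_wrt (\<supset>) (Cn n # c)" by(simp only: sorted_wrt_rev)
  moreover have "w i : flats_B n" if "i < k" for i
   using w wt(1)[of i] that unfolding flags_B_def by auto
  ultimately have "c : arrangement.chains (flats_B n) (Cn n)"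
   by(auto simp: arrangement.chains_def[OF arrangement_B] c_def)
  moreover have "w = chain_flag n c"
   using wt(1) by(intro ext) (auto simp: chain_flag_def c_def)
  ultimately show "w : chain_flag n ` arrangement.chains (flats_B n) (Cn n)" by blast
 qed
qed

lemma finite_flags: "finite (\<Union>m\<in>nonbad n. flags_B n m)"
 unfolding chain_flag_image[symmetric] using arrangement.finite_chains[OF arrangement_B] by simp

lemma finite_nonbad: "finite (nonbad n)"
proof -
 let ?M = "{m : nonbad n. Poly_Mapping.keys m <= {..n} }"
 have "nonbad n <= ?M"
 proof
  fix m assume m: "m : nonbad n"
  then obtain k where k: "Poly_Mapping.keys m - {0} = Suc ` {..<k}" using nonbad_keys by(auto simp: nonbad_def)
  have "k = card (Poly_Mapping.keys m - {0})" by(simp add: k card_image)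
  also have "... <= (\<Sum>i\<in>Poly_Mapping.keys m - {0}. lookup m i)"
   unfolding card_eq_sum by(intro sum_mono) (auto simp: in_keys_iff Suc_leI)
  also have "... <= total m" unfolding total_def by(intro sum_mono2) auto
  finally have "k <= n" using m by(simp add: nonbad_def)
  moreover have "j = 0 \<or> j : Suc ` {..<k}" if "j : Poly_Mapping.keys m" for j using k that by blast
  ultimately have "Poly_Mapping.keys m <= {..n}" by fastforce
  with m show "m : ?M" by simp
 qed
 moreover have "finite ?M"
 proof (rule inj_on_finite)
  show "(%m. restrict (lookup m) {..n}) ` ?M <= {..n} \<rightarrow>\<^sub>E {..n}"
  proof
   fix f assume "f : (%m. restrict (lookup m) {..n}) ` ?M"
   then obtain m where m: "m : ?M" "f = restrict (lookup m) {..n}" by blast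
   have "lookup m i <= n" for i
   proof (cases "i : Poly_Mapping.keys m")
    case True
    then have "lookup m i <= total m" unfolding total_def by(intro member_le_sum) auto
    then show ?thesis using m by(simp add: nonbad_def)
   qed (simp add: in_keys_iff)
   then show "f : {..n} \<rightarrow>\<^sub>E {..n}" using m by auto
  qed
  show "inj_on (%m. restrict (lookup m) {..n}) ?M"
  proof (rule inj_onI, rule poly_mapping_eqI)
   fix m m' i assume m: "m : ?M" "m' : ?M" and eq: "restrict (lookup m) {..n} = restrict (lookup m') {..n}"
   show "lookup m i = lookup m' i"
   proof (cases "i <= n")
    case True
    then show ?thesis using fun_cong[OF eq, of i] by simp
   next
    case False
    then have "i ~: Poly_Mapping.keys m" "i ~: Poly_Mapping.keys m'" using m by auto
    then show ?thesis by(simp add: in_keys_iff)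
   qed
  qed
 qed (simp add: finite_PiE)
 ultimately show ?thesis by(rule finite_subset)
qed

text \<open>The weight of a chain depends only on its jumps, so chains are grouped by exponent
  vector.\<close>

lemma poincare_B_flags:
 "poincare_B n = (\<Sum>m\<in>nonbad n. smult (of_nat (card (flags_B n m))) (key_weight m))"
proof -
 let ?C = "arrangement.chains (flats_B n) (Cn n)" and ?wt = "arrangement.chain_weight cfun.dim (Cn n)"
 define M where "M = (%w. THE m. m : nonbad n & w : flags_B n m)"
 have M: "M w = m" if "m : nonbad n" "w : flags_B n m" for m w
  unfolding M_def using that flag_exponents_unique by blast
 have "poincare_B n = sum ?wt ?C" by(simp add: poincare_B_eq arrangement.chain_poly_def[OF arrangement_B])
 also have "... = (\<Sum>c\<in>?C. key_weight (M (chain_flag n c)))"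
  by(intro sum.cong refl) (metis M chain_flag_in)
 also have "... = (\<Sum>w\<in>(\<Union>m\<in>nonbad n. flags_B n m). key_weight (M w))"
  unfolding chain_flag_image[symmetric] by(simp add: sum.reindex[OF inj_chain_flag])
 also have "... = (\<Sum>m\<in>nonbad n. \<Sum>w\<in>flags_B n m. key_weight (M w))"
  using finite_nonbad flag_exponents_unique finite_flags
  by(intro sum.UNION_disjoint) (auto intro: finite_subset[OF _ finite_flags])
 also have "... = (\<Sum>m\<in>nonbad n. smult (of_nat (card (flags_B n m))) (key_weight m))"
  by(intro sum.cong refl) (simp add: M of_nat_poly)
 finally show ?thesis .
qed

text \<open>Two indices are related when some level puts them into a common class avoiding 0, that
  is, when the flag fixes the product of their signs.\<close>

definition sign_rel :: "nat => (nat => (nat \<times> nat) set) => (nat \<times> nat) set" where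
 "sign_rel n R = {(a, b). EX i. (a, b) : R i & (a, 0) ~: R i}"

definition sign_set :: "nat => (nat => complex) set" where
 "sign_set n = {sg. signs sg & (ALL i. i ~: {1..n} --> sg i = 1)}"

text \<open>Sign vectors with prescribed products inside the classes differ by one global sign per
  class.\<close>

lemma card_sign_cosets:
 assumes S: "equiv {1..n} S" and sg: "sg : sign_set n"
 shows "card {\<tau> : sign_set n. ALL (a, b):S. \<tau> a * \<tau> b = sg a * sg b} = 2 ^ card ({1..n} // S)"
proof -
 let ?P = "({1..n} // S) \<rightarrow>\<^sub>E {1, -1 :: complex}"
 define h where "h = (%f a. if a : {1..n} then sg a * f (S `` {a}) else 1)"
 have s1: "signs sg" and s2: "!!i. i ~: {1..n} ==> sg i = 1" using sg by(auto simp: sign_set_def)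
 have q: "S `` {a} : {1..n} // S" if "a : {1..n}" for a using that by(rule quotientI)
 have Sin: "a : {1..n} & b : {1..n}" if "(a, b) : S" for a b using equiv_type[OF S] that by auto
 have "bij_betw h ?P {\<tau> : sign_set n. ALL (a, b):S. \<tau> a * \<tau> b = sg a * sg b}"
  unfolding bij_betw_def
 proof
  show "inj_on h ?P"
  proof (rule inj_onI, rule PiE_ext)
   fix f f' C assume f: "f : ?P" "f' : ?P" and eq: "h f = h f'" and C: "C : {1..n} // S"
   then obtain a where a: "a : {1..n}" "C = S `` {a}" by(auto elim: quotientE)
   show "f C = f' C" using fun_cong[OF eq, of a] a signs_nz[OF s1, of a] by(simp add: h_def)
  qed
  show "h ` ?P = {\<tau> : sign_set n. ALL (a, b):S. \<tau> a * \<tau> b = sg a * sg b}"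
  proof (intro equalityI subsetI)
   fix \<tau> assume "\<tau> : h ` ?P"
   then obtain f where f: "f : ?P" "\<tau> = h f" by blast
   have fp: "f (S `` {a}) = 1 \<or> f (S `` {a}) = -1" if "a : {1..n}" for a using f(1) q[OF that] by blast
   have "\<tau> a * \<tau> b = sg a * sg b" if ab: "(a, b) : S" for a b
    using equiv_class_eq[OF S ab] fp[of a] Sin[OF ab] by(auto simp: f(2) h_def)
   moreover have "\<tau> a = 1 \<or> \<tau> a = -1" for a
    using fp[of a] signsD[OF s1, of a] by(auto simp: f(2) h_def)
   ultimately show "\<tau> : {\<tau> : sign_set n. ALL (a, b):S. \<tau> a * \<tau> b = sg a * sg b}"
    by(auto simp: sign_set_def signs_def) (auto simp: f(2) h_def)
  next
   fix \<tau> assume \<tau>: "\<tau> : {\<tau> : sign_set n. ALL (a, b):S. \<tau> a * \<tau> b = sg a * sg b}"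
   then have t1: "signs \<tau>" and t2: "!!i. i ~: {1..n} ==> \<tau> i = 1" by(auto simp: sign_set_def)
   define f where "f = (\<lambda>C\<in>{1..n} // S. \<tau> (SOME a. a : C) * sg (SOME a. a : C))"
   have "f : ?P"
   proof -
    have "\<tau> a * sg a : {1, -1}" for a using signsD[OF t1, of a] signsD[OF s1, of a] by auto
    then show ?thesis unfolding f_def by auto
   qed
   moreover have "\<tau> = h f"
   proof
    fix a
    show "\<tau> a = h f a"
    proof (cases "a : {1..n}")
     case True
     define b where "b = (SOME b. b : S `` {a})"
     have "a : S `` {a}" using True S by(auto simp: equiv_def refl_on_def)
     then have "b : S `` {a}" unfolding b_def by(rule someI)
     then have "\<tau> a * \<tau> b = sg a * sg b" using \<tau> by auto
     moreover have "h f a = sg a * (\<tau> b * sg b)" using True q[OF True] by(simp add: h_def f_def b_def)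
     ultimately show ?thesis
      using signsD[OF t1, of a] signsD[OF s1, of a] signsD[OF t1, of b] signsD[OF s1, of b] by auto
    qed (auto simp: h_def t2)
   qed
   ultimately show "\<tau> : h ` ?P" by blast
  qed
 qed
 then have "card {\<tau> : sign_set n. ALL (a, b):S. \<tau> a * \<tau> b = sg a * sg b} = card ?P"
  by(simp add: bij_betw_same_card)
 also have "... = 2 ^ card ({1..n} // S)"
  using finite_quotient[OF _ equiv_type[OF S]] by(simp add: card_PiE numeral_2_eq_2)
 finally show ?thesis .
qed

lemma card_sign_set: "card (sign_set n) = 2 ^ n"
proof -
 have "equiv {1..n} (Id_on {1..n})" by(auto simp: equiv_def refl_on_def sym_def trans_def)
 from card_sign_cosets[OF this, of "%_. 1"]
 have "card {\<tau> : sign_set n. ALL (a, b):Id_on {1..n}. \<tau> a * \<tau> b = 1} = 2 ^ n"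
  by(simp add: sign_set_def signs_def card_quotient_Id)
 moreover have "{\<tau> : sign_set n. ALL (a, b):Id_on {1..n}. \<tau> a * \<tau> b = 1} = sign_set n"
  by(auto simp: sign_set_def signs_mult)
 ultimately show ?thesis by simp
qed

lemma equiv_eq_Id:
 fixes n :: nat
 assumes R: "equiv {0..n} R" and c: "card ({0..n} // R) = Suc n"
 shows "R = Id_on {0..n}"
proof -
 have "inj_on (%a. R `` {a}) {0..n}"
  using c by(intro eq_card_imp_inj_on) (auto simp: quotient_def UNION_singleton_eq_range)
 then have "a = b" if "(a, b) : R" for a b
  using equiv_class_eq[OF R that] equiv_rel(4)[OF R that] by(auto simp: inj_on_def)
 then show ?thesis using equiv_rel(1,4)[OF R] by(auto simp: Id_on_iff)
qed

context
 fixes n :: nat and m :: exponents and R :: "nat => (nat \<times> nat) set"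
 assumes R: "R : rel_flags n m" and m: "total m = n"
begin

lemma eqR: "equiv {0..n} (R i)" and R_Suc: "R (Suc i) <= R i"
 and card_R: "card ({0..n} // R i) = Suc (\<Sum>j\<le>i. lookup m j)"
 using R by(auto simp: rel_flags_def)

lemma R_anti: "i <= j ==> R j <= R i"
 by(rule lift_Suc_antimono_le[of R, OF R_Suc])

lemma R_final: "EX k. R k = Id_on {0..n}"
proof -
 obtain k where "Poly_Mapping.keys m <= {..k}" using finite_nat_iff_bounded_le[of "Poly_Mapping.keys m"] by auto
 from sum_lookup_le[OF this] have "card ({0..n} // R k) = Suc n" using card_R m by simp
 then show ?thesis using equiv_eq_Id[OF eqR] by blast
qed

text \<open>Transitivity rests on nesting: of the two levels involved, the smaller one relates both
  pairs.\<close>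

lemma equiv_sign_rel: "equiv {1..n} (sign_rel n R)"
proof (rule equivI)
 note r = equiv_rel[OF eqR]
 show "sign_rel n R <= {1..n} \<times> {1..n}"
 proof clarify
  fix a b assume "(a, b) : sign_rel n R"
  then obtain i where i: "(a, b) : R i" "(a, 0) ~: R i" by(auto simp: sign_rel_def)
  have "a ~= 0" using i(2) r(1)[of 0 i] by(intro notI) simp
  moreover have "b ~= 0" using i by metis
  ultimately show "a : {1..n} & b : {1..n}" using r(4)[OF i(1)] by auto
 qed
 show "refl_on {1..n} (sign_rel n R)"
 proof -
  obtain k where "R k = Id_on {0..n}" using R_final by blast
  then have "(a, a) : sign_rel n R" if "a : {1..n}" for a
   using that by(auto simp: sign_rel_def intro!: exI[of _ k])
  then show ?thesis by(simp add: refl_on_def)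
 qed
 show "sym (sign_rel n R)" unfolding sym_def sign_rel_def using r(2,3) by blast
 show "trans (sign_rel n R)"
 proof (rule transI)
  fix a b c assume "(a, b) : sign_rel n R" "(b, c) : sign_rel n R"
  then obtain i j where i: "(a, b) : R i" "(a, 0) ~: R i" and j: "(b, c) : R j" "(b, 0) ~: R j"
   by(auto simp: sign_rel_def)
  show "(a, c) : sign_rel n R"
  proof (cases "i <= j")
   case True
   then have "(b, c) : R i" using R_anti j(1) by blast
   then show ?thesis using i r(3) unfolding sign_rel_def by blast
  next
   case False
   then have "(a, b) : R j" using R_anti[of j i] i(1) by auto
   then show ?thesis using j r(2,3) unfolding sign_rel_def by blast
  qed
 qed
qed

definition sign_flag :: "(nat => complex) => nat => cvec set" where
 "sign_flag sg i = rel_flat n (R i) sg"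

lemma sign_flag_eq_iff:
 assumes "signs sg" "signs \<tau>"
 shows "sign_flag \<tau> = sign_flag sg \<longleftrightarrow> (ALL (a, b):sign_rel n R. \<tau> a * \<tau> b = sg a * sg b)"
proof -
 have "sign_flag \<tau> i = sign_flag sg i \<longleftrightarrow> (ALL (a, b):R i. (a, 0) ~: R i --> \<tau> a * \<tau> b = sg a * sg b)" for i
  unfolding sign_flag_def set_eq_subset
   rel_flat_subset_iff[OF eqR assms(1) assms(2) eqR] rel_flat_subset_iff[OF eqR assms(2) assms(1) eqR] by auto
 then show ?thesis unfolding fun_eq_iff[of "sign_flag \<tau>"] sign_rel_def by simp blast
qed

text \<open>Signs chosen separately at each level are assembled into one vector: an index takes its
  sign from the first level at which it leaves the class of 0, and inclusion of the flats carries
  the products of signs to later levels.\<close>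

lemma sign_flag_image: "sign_flag ` sign_set n = {w : flags_B n m. ALL i. flat_rel n (w i) = R i}"
proof (intro equalityI subsetI)
 fix w assume "w : sign_flag ` sign_set n"
 then obtain sg where sg: "signs sg" "w = sign_flag sg" by(auto simp: sign_set_def)
 have "w i <= w (Suc i)" for i
  unfolding sg(2) sign_flag_def rel_flat_subset_iff[OF eqR sg(1) sg(1) eqR] using R_Suc by auto
 moreover have "cfun.dim (w i) = (\<Sum>j\<le>i. lookup m j)" for i
  using dim_rel_flat[OF eqR[of i] sg(1)] card_R[of i] by(simp add: sg(2) sign_flag_def)
 moreover have "w i : insert (Cn n) (flats_B n)" for i
  unfolding sg(2) sign_flag_def by(rule rel_flat_in_flats[OF eqR sg(1)])
 moreover have "flat_rel n (w i) = R i" for i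
  unfolding sg(2) sign_flag_def by(rule flat_rel_rel_flat[OF eqR sg(1)])
 ultimately show "w : {w : flags_B n m. ALL i. flat_rel n (w i) = R i}" by(simp add: flags_B_def)
next
 fix w assume "w : {w : flags_B n m. ALL i. flat_rel n (w i) = R i}"
 then have w: "w i : insert (Cn n) (flats_B n)" "w i <= w (Suc i)" "flat_rel n (w i) = R i" for i
  unfolding flags_B_def by blast+
 have "EX sg. signs sg & w i = rel_flat n (R i) sg" for i using flat_eq_rel_flat[OF w(1)[of i]] w(3) by metis
 then obtain sg where sg: "!!i. signs (sg i)" "!!i. w i = rel_flat n (R i) (sg i)" by metis
 have mono: "w i <= w j" if "i <= j" for i j by(rule lift_Suc_mono_le[of w, OF w(2) that])
 define lv where "lv = (%a. LEAST i. (a, 0) ~: R i)"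
 define \<tau> where "\<tau> = (%a. if a : {1..n} then sg (lv a) a else 1)"
 have \<tau>: "\<tau> : sign_set n" using sg(1) by(auto simp: sign_set_def signs_def \<tau>_def)
 then have st: "signs \<tau>" by(simp add: sign_set_def)
 have eq: "\<tau> a * \<tau> b = sg i a * sg i b" if ab: "(a, b) : R i" "(a, 0) ~: R i" for i a b
 proof -
  note r = equiv_rel[OF eqR]
  have lvI: "lv a <= i" "(a, 0) ~: R (lv a)" if "(a, 0) ~: R i" for a
   unfolding lv_def using that Least_le[of "%i. (a, 0) ~: R i" i] LeastI[of "%i. (a, 0) ~: R i" i] by auto
  note le = lvI[OF ab(2)]
  have abj: "(a, b) : R j" if "j <= i" for j using R_anti[OF that] ab by blast
  have b0: "(b, 0) ~: R i" using ab r(2,3) by blast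
  have "lv b <= i" "(b, 0) ~: R (lv b)" using lvI[OF b0] .
  then have "(a, 0) ~: R (lv b)" using abj[of "lv b"] r(2,3) by blast
  moreover have "(b, 0) ~: R (lv a)" using abj[of "lv a"] le r(2,3) by blast
  ultimately have lv: "lv b = lv a" unfolding lv_def by(meson Least_le order_antisym)
  have "(a, b) : sign_rel n R" using ab by(auto simp: sign_rel_def)
  then have in1: "a : {1..n}" "b : {1..n}" using equiv_type[OF equiv_sign_rel] by auto
  have "rel_flat n (R (lv a)) (sg (lv a)) <= rel_flat n (R i) (sg i)" using mono[OF le(1)] by(simp add: sg(2))
  then have "sg (lv a) a * sg (lv a) b = sg i a * sg i b"
   unfolding rel_flat_subset_iff[OF eqR sg(1) sg(1) eqR] using ab le(2) by blast
  then show ?thesis using in1 lv by(simp add: \<tau>_def)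
 qed
 have "w i = sign_flag \<tau> i" for i
  unfolding sign_flag_def sg(2) set_eq_subset
   rel_flat_subset_iff[OF eqR sg(1) st eqR] rel_flat_subset_iff[OF eqR st sg(1) eqR] using eq by auto
 then show "w : sign_flag ` sign_set n" using \<tau> by blast
qed

text \<open>The 2^n sign vectors are spread evenly over the flags with the given relations: each
  flag arises once for every choice of a global sign on the classes of
  \<open>sign_rel n R\<close>.\<close>

lemma card_flags_over:
 "card {w : flags_B n m. ALL i. flat_rel n (w i) = R i} * 2 ^ card ({1..n} // sign_rel n R) = 2 ^ n"
proof -
 have fin: "finite (sign_set n)" using card_sign_set[of n] by(metis card.infinite power_not_zero zero_neq_numeral)
 have "card {\<tau> : sign_set n. sign_flag \<tau> = w} = 2 ^ card ({1..n} // sign_rel n R)"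
  if w: "w : sign_flag ` sign_set n" for w
 proof -
  obtain sg where sg: "sg : sign_set n" "w = sign_flag sg" using w by blast
  have "{\<tau> : sign_set n. sign_flag \<tau> = w} = {\<tau> : sign_set n. ALL (a, b):sign_rel n R. \<tau> a * \<tau> b = sg a * sg b}"
   using sign_flag_eq_iff sg by(auto simp: sign_set_def)
  then show ?thesis using card_sign_cosets[OF equiv_sign_rel sg(1)] by simp
 qed
 then have "card (sign_set n) = card (sign_flag ` sign_set n) * 2 ^ card ({1..n} // sign_rel n R)"
  using sum.image_gen[OF fin, of "%_. 1::nat" sign_flag] by simp
 then show ?thesis by(simp add: card_sign_set sign_flag_image)
qed

end

lemma flags_B_rel_flags:
 assumes w: "w : flags_B n m"
 shows "(%i. flat_rel n (w i)) : rel_flags n m"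
proof -
 have w: "w i : insert (Cn n) (flats_B n)" "w i <= w (Suc i)" "cfun.dim (w i) = (\<Sum>j\<le>i. lookup m j)" for i
  using w unfolding flags_B_def by blast+
 have "card ({0..n} // flat_rel n (w i)) = Suc (cfun.dim (w i))" for i
  using flat_eq_rel_flat[OF w(1)[of i]] dim_rel_flat[OF equiv_flat_rel] by metis
 moreover have "flat_rel n (w (Suc i)) <= flat_rel n (w i)" for i using w(2)[of i] by(auto simp: flat_rel_def)
 ultimately show ?thesis unfolding rel_flags_def using equiv_flat_rel w(3) by simp
qed

text \<open>Dividing out the global signs leaves one factor 1/2 for each class of
  \<open>sign_rel n R\<close>; these factors become the powers of 1/2 attached to forests.\<close>

theorem card_flags_B:
 assumes m: "m : nonbad n"
 shows "finite (rel_flags n m)"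
  and "of_nat (card (flags_B n m)) = 2 ^ n * (\<Sum>R\<in>rel_flags n m. (1/2) ^ card ({1..n} // sign_rel n R) :: rat)"
proof -
 let ?f = "%w i. flat_rel n (w i)"
 have t: "total m = n" using m by(simp add: nonbad_def)
 have fin: "finite (flags_B n m)" using finite_flags m by(auto intro: finite_subset[rotated])
 have fib: "{w : flags_B n m. ?f w = R} = {w : flags_B n m. ALL i. flat_rel n (w i) = R i}" for R
  by(auto simp: fun_eq_iff)
 have "{w : flags_B n m. ?f w = R} ~= {}" if "R : rel_flags n m" for R
  unfolding fib using card_flags_over[OF that t] by(metis card.empty mult_0 power_not_zero zero_neq_numeral)
 then have img: "?f ` flags_B n m = rel_flags n m" using flags_B_rel_flags by blast
 then show "finite (rel_flags n m)" using fin by(metis finite_imageI)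
 have "of_nat (card (flags_B n m)) = (\<Sum>R\<in>rel_flags n m. of_nat (card {w : flags_B n m. ?f w = R}) :: rat)"
  using sum.image_gen[OF fin, of "%_. 1::rat" ?f] img by simp
 also have "... = (\<Sum>R\<in>rel_flags n m. 2 ^ n * (1/2) ^ card ({1..n} // sign_rel n R))"
 proof (intro sum.cong refl)
  fix R assume "R : rel_flags n m"
  from arg_cong[OF card_flags_over[OF this t], of rat_of_nat]
  have "rat_of_nat (card {w : flags_B n m. ?f w = R}) * 2 ^ card ({1..n} // sign_rel n R) = 2 ^ n"
   unfolding fib by simp
  then show "rat_of_nat (card {w : flags_B n m. ?f w = R}) = 2 ^ n * (1/2) ^ card ({1..n} // sign_rel n R)"
   by(simp add: field_simps power_divide)
 qed
 finally show "of_nat (card (flags_B n m)) = 2 ^ n * (\<Sum>R\<in>rel_flags n m. (1/2) ^ card ({1..n} // sign_rel n R) :: rat)"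
  by(simp add: sum_distrib_left)
qed

section \<open>Labelled forests as flags of equivalence relations\<close>

locale forest_graph =
 fixes Ga :: forest
 assumes fin: "finite (verts Ga)" and EN: "edges Ga <= verts Ga \<times> verts Ga"
  and ac: "acyclic (edges Ga)" and sv: "single_valued ((edges Ga)\<inverse>)"
begin

abbreviation "N \<equiv> verts Ga"
abbreviation "E \<equiv> edges Ga"
abbreviation "lev \<equiv> level Ga"

lemma finE: "finite E"
 using finite_subset[OF EN] fin by simp

lemma wfE: "wf E" and wfE': "wf (E\<inverse>)"
 using finE ac by(simp_all add: finite_acyclic_wf finite_acyclic_wf_converse)

lemma parent_unique: "(u, v) : E ==> (u', v) : E ==> u = u'"
 using sv by(auto simp: single_valued_def)

lemma root_path: "v : N ==> EX r:roots Ga. (r, v) : E\<^sup>*"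
proof (induction v rule: wf_induct_rule[OF wfE])
 case (1 v)
 show ?case
 proof (cases "v : roots Ga")
  case False
  then obtain u where u: "(u, v) : E" using 1 by(auto simp: roots_def)
  then show ?thesis using 1(1)[OF u] EN by(meson SigmaD1 rtrancl.rtrancl_into_rtrancl subsetD)
 qed auto
qed

lemma root_dist_unique:
 assumes "r : roots Ga" "(r, v) : E ^^ d" "r' : roots Ga" "(r', v) : E ^^ d'"
 shows "d = d'"
 using assms
proof (induction d arbitrary: v d')
 case 0
 then show ?case by(cases d') (auto simp: roots_def)
next
 case (Suc d)
 then obtain u where u: "(r, u) : E ^^ d" "(u, v) : E" by auto
 obtain e where e: "d' = Suc e" using Suc.prems u by(cases d') (auto simp: roots_def)
 then obtain u' where "(r', u') : E ^^ e" "(u', v) : E" using Suc.prems by auto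
 then show ?case using Suc.IH[OF Suc.prems(1) u(1) Suc.prems(3)] parent_unique[OF u(2)] e by auto
qed

lemma level_eq: "r : roots Ga ==> (r, v) : E ^^ d ==> lev v = Suc d"
 unfolding level_def using root_dist_unique by(subst the_equality[of _ d]) auto

lemma level_root: "r : roots Ga ==> lev r = 1"
 using level_eq[of r r 0] by simp

lemma level_edge: assumes "(u, v) : E" shows "lev v = Suc (lev u)"
proof -
 obtain r d where "r : roots Ga" "(r, u) : E ^^ d" using root_path[of u] assms EN by(auto simp: rtrancl_power)
 then show ?thesis using level_eq[of r u d] level_eq[of r v "Suc d"] assms by auto
qed

lemma level_le: "(u, v) : E\<^sup>* ==> lev u <= lev v & (lev u = lev v --> u = v)"
 by(induction rule: rtrancl_induct) (auto simp: level_edge)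

lemma level_1: assumes "v : N" shows "lev v >= 1" "lev v = 1 ==> v : roots Ga"
proof -
 obtain r where "r : roots Ga" "(r, v) : E\<^sup>*" using root_path[OF assms] by blast
 then show "lev v >= 1" "lev v = 1 ==> v : roots Ga" using level_le[of r v] level_root[of r] by auto
qed

lemma level_unique:
 assumes "!!v. v : roots Ga ==> h v = 1" "!!u v. (u, v) : E ==> h v = Suc (h u)" "v : N"
 shows "lev v = h v"
proof -
 obtain r where r: "r : roots Ga" "(r, v) : E\<^sup>*" using root_path[OF assms(3)] by blast
 from r(2) show ?thesis
  by(induction rule: rtrancl_induct) (simp_all add: assms level_root r(1) level_edge)
qed

lemma ancestors: "(u, x) : E\<^sup>* ==> (v, x) : E\<^sup>* ==> (u, v) : E\<^sup>* \<or> (v, u) : E\<^sup>*"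
 using single_valued_confluent[OF sv, of x u v] by(auto simp: rtrancl_converse)

lemma ancestor_unique: "(u, x) : E\<^sup>* ==> (v, x) : E\<^sup>* ==> lev u = lev v ==> u = v"
 using ancestors level_le by metis

lemma ancestor_at: "x : N ==> 1 <= l ==> l <= lev x ==> EX u:N. lev u = l & (u, x) : E\<^sup>*"
proof (induction x rule: wf_induct_rule[OF wfE])
 case (1 x)
 show ?case
 proof (cases "l = lev x")
  case False
  then have "x ~: roots Ga" using 1 level_root by fastforce
  then obtain p where p: "(p, x) : E" using 1 by(auto simp: roots_def)
  then show ?thesis using 1(1)[OF p] 1 False EN level_edge[OF p] by(fastforce intro: rtrancl_into_rtrancl)
 qed (use 1 in auto)
qed

lemma leaf_below: "v : N ==> EX x:leaves Ga. (v, x) : E\<^sup>*"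
proof (induction v rule: wf_induct_rule[OF wfE'])
 case (1 v)
 show ?case
 proof (cases "v : leaves Ga")
  case False
  then obtain u where u: "(v, u) : E" using 1 by(auto simp: leaves_def)
  then show ?thesis using 1(1)[of u] EN by(meson SigmaD2 converseI converse_rtrancl_into_rtrancl subsetD)
 qed auto
qed

lemma leafN: "x : leaves Ga ==> x : N"
 by(simp add: leaves_def)

lemma leaf_desc: "x : leaves Ga ==> (x, y) : E\<^sup>* ==> y = x"
 by(auto simp: leaves_def elim: converse_rtranclE)

lemma nonleaf_out: "v : N - leaves Ga ==> out Ga v ~= {}"
 by(auto simp: leaves_def out_def)

lemma finite_out: "finite (out Ga v)" and finite_wout: "finite (wout Ga v)"
 using finE by(simp_all add: out_def wout_def)

end

text \<open>The exponent vector of the monomial attached to a forest, for both series at once: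
  leaving a strong root out of the exponent of \<open>g 0\<close> gives \<open>tr Ga - 1\<close> for
  strong forests and \<open>tr Ga\<close> for weak ones.\<close>

definition expo :: "forest => exponents" where
 "expo Ga = Poly_Mapping.single 0 (card (roots Ga - strong Ga)) +
   (\<Sum>v\<in>strong Ga. Poly_Mapping.single (level Ga v) (card (wout Ga v))) +
   (\<Sum>v\<in>weak_inner Ga. Poly_Mapping.single (level Ga v) (card (out Ga v) - 1))"

text \<open>The number of maximal weak subtrees; it is the total power of 1/2 in the term of the
  forest, once \<open>g 0\<close> has been halved in the weak series.\<close>

definition weak_trees :: "forest => nat" where
 "weak_trees Ga = card (roots Ga - strong Ga) + (\<Sum>v\<in>strong Ga. card (wout Ga v))"

locale lforest = forest_graph +
 assumes SN: "strong Ga <= verts Ga - leaves Ga"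
  and S1: "u : strong Ga ==> v : strong Ga ==> level Ga u = level Ga v ==> u = v"
  and S2: "(u, v) : edges Ga ==> v : strong Ga ==> u : strong Ga"

lemma levelled_forest_iff: "levelled_forest Ga \<longleftrightarrow> lforest Ga"
 unfolding levelled_forest_def lforest_def forest_graph_def lforest_axioms_def by blast

context lforest begin

abbreviation "S \<equiv> strong Ga"

lemma strong_up: "(u, v) : E\<^sup>* ==> v : S ==> u : S"
 by(induction rule: converse_rtrancl_induct) (auto intro: S2)

lemma finS: "finite S"
 using SN fin by(meson finite_Diff finite_subset)

text \<open>The vertices that stand for the classes without 0 at step \<open>i\<close>: weak
  vertices of level \<open>i + 1\<close>, and leaves that ended earlier and persist as
  singletons.\<close>

definition live :: "nat => nat set" where
 "live i = {v : N - S. lev v = Suc i} Un {x : leaves Ga. lev x <= i}"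

lemma wout_weak: "v ~: S ==> wout Ga v = out Ga v"
 using S2 by(auto simp: wout_def out_def)

lemma lookup_expo_Suc: "lookup (expo Ga) (Suc i) =
  (\<Sum>v\<in>{v : S. lev v = Suc i}. card (wout Ga v)) + (\<Sum>v\<in>{v : weak_inner Ga. lev v = Suc i}. card (out Ga v) - 1)"
proof -
 have "finite (weak_inner Ga)" using fin by(simp add: weak_inner_def)
 then show ?thesis using finS unfolding expo_def
  by(simp add: lookup_add lookup_sum lookup_single when_def sum.inter_filter)
qed

lemma lookup_expo_0: "lookup (expo Ga) 0 = card (roots Ga - S)"
 using level_1(1) SN unfolding expo_def
 by(auto simp: lookup_add lookup_sum lookup_single when_def weak_inner_def intro!: sum.neutral) force+

text \<open>From one level to the next a weak inner vertex is replaced by its children, a gain of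
  \<open>card (out Ga v) - 1\<close>, and a strong vertex releases its weak children; these gains
  are the exponents.\<close>

lemma card_live: "card (live i) = (\<Sum>j\<le>i. lookup (expo Ga) j)"
proof (induction i)
 case 0
 have "live 0 = roots Ga - S"
 proof
  show "live 0 <= roots Ga - S" using level_1 leafN by(fastforce simp: live_def)
  show "roots Ga - S <= live 0" using level_root by(auto simp: live_def roots_def)
 qed
 then show ?case by(simp add: lookup_expo_0)
next
 case (Suc i)
 let ?W = "%l. {v : N - S. lev v = l}" and ?I = "{v : N - leaves Ga. lev v = Suc i}"
 let ?L = "{x : leaves Ga. lev x <= i}" and ?L' = "{x : leaves Ga. lev x = Suc i}"
 let ?WI = "{v : weak_inner Ga. lev v = Suc i}" and ?SI = "{v : S. lev v = Suc i}"
 have f: "finite (?W l)" "finite ?L" "finite ?L'" "finite ?WI" "finite ?SI" "finite ?I" for l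
  using fin finS leafN by(auto intro: finite_subset[of _ N] simp: weak_inner_def)
 have LS: "x ~: S" if "x : leaves Ga" for x using SN that by blast
 have l1: "card (live i) = card ?WI + card ?L' + card ?L"
 proof -
  have "live i = (?WI Un ?L') Un ?L" using LS leafN by(auto simp: live_def weak_inner_def)
  moreover have "?WI Int ?L' = {}" "(?WI Un ?L') Int ?L = {}" by(auto simp: weak_inner_def)
  ultimately show ?thesis using f by(simp add: card_Un_disjoint)
 qed
 have l2: "card (live (Suc i)) = card (?W (Suc (Suc i))) + card ?L' + card ?L"
 proof -
  have "live (Suc i) = (?W (Suc (Suc i)) Un ?L') Un ?L" by(auto simp: live_def le_Suc_eq)
  moreover have "?W (Suc (Suc i)) Int ?L' = {}" "(?W (Suc (Suc i)) Un ?L') Int ?L = {}" by auto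
  ultimately show ?thesis using f by(simp add: card_Un_disjoint)
 qed
 \<comment> \<open>Every weak vertex one level further down is the head of exactly one edge counted
   by \<open>wout\<close>.\<close>
 have "bij_betw snd (\<Union>v\<in>?I. wout Ga v) (?W (Suc (Suc i)))"
  unfolding bij_betw_def
 proof
  show "inj_on snd (\<Union>v\<in>?I. wout Ga v)"
   using parent_unique by(auto simp: inj_on_def wout_def out_def)
  show "snd ` (\<Union>v\<in>?I. wout Ga v) = ?W (Suc (Suc i))"
  proof
   show "snd ` (\<Union>v\<in>?I. wout Ga v) <= ?W (Suc (Suc i))"
    using EN level_edge by(auto simp: wout_def out_def)
   show "?W (Suc (Suc i)) <= snd ` (\<Union>v\<in>?I. wout Ga v)"
   proof
    fix v assume v: "v : ?W (Suc (Suc i))"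
    then obtain u where u: "(u, v) : E" using level_root by(fastforce simp: roots_def)
    then have "(u, v) : wout Ga u" "u : ?I"
     using v EN level_edge[OF u] by(auto simp: wout_def out_def leaves_def)
    then show "v : snd ` (\<Union>v\<in>?I. wout Ga v)" by force
   qed
  qed
 qed
 then have "card (?W (Suc (Suc i))) = card (\<Union>v\<in>?I. wout Ga v)" by(simp add: bij_betw_same_card)
 also have "... = (\<Sum>v\<in>?I. card (wout Ga v))"
  using f finite_wout by(intro card_UN_disjoint ballI impI) (auto simp: out_def wout_def[unfolded out_def])
 also have "?I = ?SI Un ?WI" using SN by(auto simp: weak_inner_def)
 also have "(\<Sum>v\<in>?SI Un ?WI. card (wout Ga v)) = (\<Sum>v\<in>?SI. card (wout Ga v)) + (\<Sum>v\<in>?WI. card (wout Ga v))"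
  using f by(intro sum.union_disjoint) (auto simp: weak_inner_def)
 also have "(\<Sum>v\<in>?WI. card (wout Ga v)) = (\<Sum>v\<in>?WI. (card (out Ga v) - 1) + 1)"
 proof (intro sum.cong refl)
  fix v assume v: "v : ?WI"
  then have "out Ga v ~= {}" using nonleaf_out by(auto simp: weak_inner_def)
  then have "card (out Ga v) >= 1" using finite_out by(simp add: Suc_leI card_gt_0_iff)
  then show "card (wout Ga v) = card (out Ga v) - 1 + 1" using v wout_weak by(simp add: weak_inner_def)
 qed
 also have "... = (\<Sum>v\<in>?WI. card (out Ga v) - 1) + card ?WI" unfolding sum.distrib by simp
 finally show ?case using l1 l2 Suc by(simp add: lookup_expo_Suc)
qed

text \<open>Beyond the height of the forest only leaves are live, so the degree of the monomial is
  the number of leaves.\<close>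

lemma total_expo: "total (expo Ga) = card (leaves Ga)"
proof -
 obtain k where k: "Poly_Mapping.keys (expo Ga) <= {..k}" using finite_nat_iff_bounded_le[of "Poly_Mapping.keys (expo Ga)"] by auto
 obtain l where l: "lev ` N <= {..l}" using finite_nat_iff_bounded_le[of "lev ` N"] fin by auto
 have "live (max k l) = leaves Ga" using l leafN by(fastforce simp: live_def)
 then show ?thesis using card_live[of "max k l"] sum_lookup_le[of "expo Ga" "max k l"] k by fastforce
qed

definition top_weak :: "nat set" where
 "top_weak = {v : N - S. ALL u. (u, v) : E --> u : S}"

lemma card_top_weak: "card top_weak = weak_trees Ga"
proof -
 have eq: "top_weak = (roots Ga - S) Un snd ` (\<Union>v\<in>S. wout Ga v)" (is "_ = ?A Un ?B")
 proof
  show "top_weak <= ?A Un ?B"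
  proof
   fix v assume v: "v : top_weak"
   show "v : ?A Un ?B"
   proof (cases "v : roots Ga")
    case False
    then obtain u where "(u, v) : E" using v by(auto simp: top_weak_def roots_def)
    then show ?thesis using v by(force simp: top_weak_def wout_def out_def)
   qed (use v in \<open>simp add: top_weak_def\<close>)
  qed
  show "?A Un ?B <= top_weak" using EN by(auto simp: top_weak_def roots_def wout_def out_def dest: parent_unique)
 qed
 have "inj_on snd (\<Union>v\<in>S. wout Ga v)" using parent_unique by(auto simp: inj_on_def wout_def out_def)
 then have "card ?B = card (\<Union>v\<in>S. wout Ga v)" by(rule card_image)
 also have "... = (\<Sum>v\<in>S. card (wout Ga v))"
  using finS finite_wout by(intro card_UN_disjoint ballI impI) (auto simp: wout_def out_def)
 finally have "card ?B = (\<Sum>v\<in>S. card (wout Ga v))" .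
 moreover have "card (?A Un ?B) = card ?A + card ?B"
 proof (rule card_Un_disjoint)
  show "finite ?B" using finS finite_wout by blast
 qed (use fin in \<open>auto simp: roots_def wout_def out_def\<close>)
 ultimately show ?thesis unfolding eq weak_trees_def by simp
qed

lemma top_weak_above: "v : N - S ==> EX u:top_weak. (u, v) : E\<^sup>*"
proof (induction v rule: wf_induct_rule[OF wfE])
 case (1 v)
 show ?case
 proof (cases "v : top_weak")
  case False
  then obtain u where u: "(u, v) : E" "u : N - S" using 1 EN by(auto simp: top_weak_def)
  then show ?thesis using 1(1)[OF u] by(meson rtrancl.rtrancl_into_rtrancl)
 qed auto
qed

lemma top_weak_unique:
 assumes "u : top_weak" "v : top_weak" "(u, v) : E\<^sup>*"
 shows "u = v"
 using assms(3)
proof (cases rule: rtranclE)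
 case (step p)
 then show ?thesis using assms strong_up[of u p] by(auto simp: top_weak_def)
qed simp

end

text \<open>The label \<open>0\<close> marks the strong vertices.\<close>

definition labs :: "forest => (nat => nat) => nat => nat set" where
 "labs Ga be v = be ` {x : leaves Ga. (v, x) : (edges Ga)\<^sup>*} Un (if v : strong Ga then {0} else {})"

text \<open>The flag of relations encoded by a labelled forest: step \<open>i\<close> is read off at
  level \<open>i + 1\<close>, and labels found at no vertex of that level are alone in their
  class.\<close>

definition code :: "forest => (nat => nat) => nat => (nat \<times> nat) set" where
 "code Ga be i = {(a, b). a <= card (leaves Ga) & b <= card (leaves Ga) &
   (a = b \<or> (EX v:verts Ga. level Ga v = Suc i & a : labs Ga be v & b : labs Ga be v))}"

text \<open>The vertices of a minimal forest as they appear in its flag. A singleton counts only at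
  the first step where it is a class, which is where the leaf sits; \<open>{0}\<close> never counts,
  since a strong vertex has a leaf below it.\<close>

definition keyset :: "nat => (nat => (nat \<times> nat) set) => (nat \<times> nat set) set" where
 "keyset n R = {(Suc i, A) | i A. A : {0..n} // R i & A ~= {0} &
   (card A >= 2 \<or> i = 0 \<or> A ~: {0..n} // R (i - 1))}"

locale labelled_forest = lforest +
 fixes be :: "nat => nat" and n :: nat
 assumes be: "bij_betw be (leaves Ga) {1..n}"
begin

abbreviation "L \<equiv> labs Ga be"
abbreviation "R \<equiv> code Ga be"

lemma card_leaves: "card (leaves Ga) = n"
 using bij_betw_same_card[OF be] by simp

lemma be_in: "x : leaves Ga ==> 1 <= be x & be x <= n"
 using be by(auto simp: bij_betw_def)

lemma L_mono: "(u, v) : E\<^sup>* ==> L v <= L u"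
 using strong_up[of u v] by(auto simp: labs_def)

lemma L_leaf: "x : leaves Ga ==> L x = {be x}"
 using leaf_desc[of x] SN by(auto simp: labs_def)

lemma zero_L: "0 : L v \<longleftrightarrow> v : S"
proof -
 have "be x ~= 0" if "x : leaves Ga" for x using be_in[OF that] by simp
 then show ?thesis by(auto simp: labs_def image_iff)
qed

lemma be_L: "x : leaves Ga ==> be x : L v \<longleftrightarrow> (v, x) : E\<^sup>*"
 using be_in[of x] be by(auto simp: labs_def bij_betw_def inj_on_def split: if_splits)

lemma L_le: "a : L v ==> a <= n"
 using be_in by(auto simp: labs_def split: if_splits)

lemma leaf_of: "1 <= a ==> a <= n ==> EX x:leaves Ga. be x = a"
proof -
 assume "1 <= a" "a <= n"
 then have "a : be ` leaves Ga" unfolding bij_betw_imp_surj_on[OF be] by simp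
 then show ?thesis by blast
qed

lemma L_disjoint:
 assumes "u : N" "v : N" "lev u = lev v" "a : L u" "a : L v"
 shows "u = v"
proof (cases "a = 0")
 case True
 then show ?thesis using assms S1 zero_L by blast
next
 case False
 then obtain x where x: "x : leaves Ga" "be x = a" using leaf_of[of a] L_le[OF assms(4)] by auto
 then show ?thesis using assms be_L[OF x(1)] ancestor_unique by metis
qed

lemma L_nonempty: assumes "v : N" obtains x where "x : leaves Ga" "(v, x) : E\<^sup>*" "be x : L v"
 using leaf_below[OF assms] be_L by metis

text \<open>Levels and label sets determine the edges, so a labelled forest can be recovered from
  these keys.\<close>

lemma edge_iff: "u : N ==> v : N ==> (u, v) : E \<longleftrightarrow> lev v = Suc (lev u) & L v <= L u"
proof
 assume uv: "u : N" "v : N" "lev v = Suc (lev u) & L v <= L u"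
 obtain x where x: "x : leaves Ga" "(v, x) : E\<^sup>*" "be x : L v" using L_nonempty[OF uv(2)] .
 have "lev u >= 1" using level_1 uv by blast
 then have "v ~: roots Ga" using level_root[of v] uv(3) by auto
 then obtain p where p: "(p, v) : E" using uv(2) by(auto simp: roots_def)
 have "(p, x) : E\<^sup>*" using p x(2) by(rule converse_rtrancl_into_rtrancl)
 moreover have "(u, x) : E\<^sup>*" using be_L[OF x(1)] x(3) uv(3) by blast
 ultimately show "(u, v) : E" using ancestor_unique[of p x u] level_edge[OF p] uv(3) p by auto
qed (use level_edge L_mono[OF r_into_rtrancl] in blast)

lemma code_iff: "(a, b) : R i \<longleftrightarrow> a <= n & b <= n & (a = b \<or> (EX v:N. lev v = Suc i & a : L v & b : L v))"
 by(simp add: code_def card_leaves)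

lemma codeE: assumes "(a, b) : R i" "a ~= b"
 obtains v where "v : N" "lev v = Suc i" "a : L v" "b : L v"
 using assms unfolding code_iff by blast

lemma codeI: "v : N ==> lev v = Suc i ==> a : L v ==> b : L v ==> (a, b) : R i"
 using L_le[of a v] L_le[of b v] unfolding code_iff by blast

lemma equiv_code: "equiv {0..n} (R i)"
proof (rule equivI)
 show "trans (R i)"
 proof (rule transI)
  fix a b c assume abc: "(a, b) : R i" "(b, c) : R i"
  show "(a, c) : R i"
  proof (cases "a = b \<or> b = c")
   case False
   obtain u where u: "u : N" "lev u = Suc i" "a : L u" "b : L u" using codeE[OF abc(1)] False by blast
   obtain v where v: "v : N" "lev v = Suc i" "b : L v" "c : L v" using codeE[OF abc(2)] False by blast
   have "u = v" using L_disjoint[of u v b] u v by simp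
   then show ?thesis using codeI u v by blast
  qed (use abc in blast)
 qed
 show "sym (R i)" unfolding sym_def code_iff by blast
qed (auto simp: code_iff refl_on_def)

lemma code_class: "v : N ==> lev v = Suc i ==> a : L v ==> R i `` {a} = L v"
proof -
 assume v: "v : N" "lev v = Suc i" "a : L v"
 have "b : L v" if ab: "(a, b) : R i" "a ~= b" for b
 proof -
  obtain u where u: "u : N" "lev u = Suc i" "a : L u" "b : L u" using codeE[OF ab] .
  then have "u = v" using L_disjoint[of u v a] v by simp
  then show ?thesis using u by simp
 qed
 then show ?thesis using codeI[OF v] v by blast
qed

lemma low_class: "x : leaves Ga ==> lev x <= i ==> R i `` {be x} = {be x}"
proof -
 assume x: "x : leaves Ga" "lev x <= i"
 have "b = be x" if b: "(be x, b) : R i" for b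
 proof (rule ccontr)
  assume "b ~= be x"
  then obtain v where "v : N" "lev v = Suc i" "be x : L v" using codeE[OF b] by metis
  then show False using level_le[of v x] be_L[OF x(1)] x by simp
 qed
 moreover have "(be x, be x) : R i" using be_in[OF x(1)] by(simp add: code_iff)
 ultimately show ?thesis by blast
qed

lemma code_cases:
 assumes "C : {0..n} // R i"
 shows "(EX v:N. lev v = Suc i & C = L v) \<or> (EX a<=n. C = {a})"
proof -
 obtain a where a: "a <= n" "C = R i `` {a}" using assms by(auto elim: quotientE)
 show ?thesis
 proof (cases "EX v:N. lev v = Suc i & a : L v")
  case True
  then obtain v where "v : N" "lev v = Suc i" "a : L v" by blast
  then show ?thesis using code_class[of v i a] a by auto
 next
  case False
  then have "(a, b) : R i \<longleftrightarrow> b = a" for b using a(1) codeE[of a b i] by(auto simp: code_iff)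
  then have "C = {a}" using a(2) by blast
  then show ?thesis using a by blast
 qed
qed

lemma L_class: assumes "v : N" "lev v = Suc i" shows "L v : {0..n} // R i"
 using L_nonempty[OF assms(1)] code_class[OF assms] L_le by(metis atLeastAtMost_iff le0 quotientI)

text \<open>Combined with \<open>card_live\<close>, this turns exponents into numbers of
  classes.\<close>

lemma bij_live: "bij_betw L (live i) ({0..n} // R i - {R i `` {0}})"
 unfolding bij_betw_def
proof
 have "(0, 0) : R i" by(simp add: code_iff)
 then have ne: "R i `` {0} ~= C" if "0 ~: C" for C using that by blast
 have leaf: "L x : {0..n} // R i" "0 ~: L x" if x: "x : leaves Ga" "lev x <= i" for x
  using be_in[OF x(1)] quotientI[of "be x" "{0..n}" "R i"] L_leaf[OF x(1)] low_class[OF x] by auto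
 show "inj_on L (live i)"
 proof (rule inj_onI)
  have mix: False if "x : leaves Ga" "lev x <= i" "lev v = Suc i" "L x = L v" for x v
   using that be_L[of x v] L_leaf[of x] level_le[of v x] by auto
  fix u v assume uv: "u : live i" "v : live i" "L u = L v"
  show "u = v"
  proof (cases "lev u = Suc i & lev v = Suc i")
   case True
   have "u : N" "v : N" using uv leafN by(auto simp: live_def)
   moreover obtain x where "be x : L u" using L_nonempty[OF \<open>u : N\<close>] .
   ultimately show ?thesis using True uv(3) L_disjoint[of u v "be x"] by simp
  next
   case False
   then consider "u : leaves Ga" "v : leaves Ga" using uv mix[of u v] mix[of v u] by(auto simp: live_def)
   then show ?thesis using uv(3) be L_leaf by cases (auto simp: bij_betw_def inj_on_def)
  qed
 qed
 show "L ` live i = {0..n} // R i - {R i `` {0}}"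
 proof (intro equalityI subsetI)
  fix C assume "C : L ` live i"
  then obtain v where v: "v : live i" "C = L v" by blast
  then consider "v : N - S" "lev v = Suc i" | "v : leaves Ga" "lev v <= i" by(auto simp: live_def)
  then have "C : {0..n} // R i & 0 ~: C" using v(2) L_class zero_L leaf by cases auto
  then show "C : {0..n} // R i - {R i `` {0}}" using ne by blast
 next
  fix C assume C: "C : {0..n} // R i - {R i `` {0}}"
  then have "C : {0..n} // R i" by blast
  then obtain a where a: "a <= n" "C = R i `` {a}" by(auto elim: quotientE)
  moreover from this have "a ~= 0" using C by auto
  ultimately obtain x where x: "x : leaves Ga" "be x = a" using leaf_of[of a] by auto
  show "C : L ` live i"
  proof (cases "lev x <= i")
   case True
   then have "C = L x" "x : live i" using x a low_class[OF x(1)] L_leaf by(auto simp: live_def)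
   then show ?thesis by blast
  next
   case False
   then obtain v where v: "v : N" "lev v = Suc i" "(v, x) : E\<^sup>*" using ancestor_at[of x "Suc i"] leafN[OF x(1)] by auto
   then have "C = L v" using code_class[OF v(1,2)] be_L[OF x(1)] x a by simp
   moreover have "v ~: S"
   proof
    assume "v : S"
    then have "C = R i `` {0}" using code_class[OF v(1,2), of 0] zero_L \<open>C = L v\<close> by simp
    then show False using C by blast
   qed
   ultimately show ?thesis using v by(auto simp: live_def)
  qed
 qed
qed

lemma code_rel_flags: "R : rel_flags n (expo Ga)"
proof -
 have "R (Suc i) <= R i" for i
 proof clarify
  fix a b assume ab: "(a, b) : R (Suc i)"
  show "(a, b) : R i"
  proof (cases "a = b")
   case False
   obtain v where v: "v : N" "lev v = Suc (Suc i)" "a : L v" "b : L v" using codeE[OF ab False] .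
   then obtain u where "(u, v) : E" using level_root by(fastforce simp: roots_def)
   then have "u : N" "lev u = Suc i" "a : L u" "b : L u" using v edge_iff[of u v] EN by auto
   then show ?thesis by(rule codeI)
  qed (use ab in \<open>simp add: code_iff\<close>)
 qed
 moreover have "card ({0..n} // R i) = Suc (\<Sum>j\<le>i. lookup (expo Ga) j)" for i
 proof -
  have "R i `` {0} : {0..n} // R i" by(auto intro: quotientI)
  moreover have "finite ({0..n} // R i)" using finite_quotient[OF _ equiv_type[OF equiv_code]] by simp
  ultimately have "Suc (card ({0..n} // R i - {R i `` {0}})) = card ({0..n} // R i)" by(intro card_Suc_Diff1)
  then show ?thesis using bij_betw_same_card[OF bij_live] card_live by simp
 qed
 ultimately show ?thesis by(simp add: rel_flags_def equiv_code)
qed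

text \<open>A class avoiding 0 is the label set of a weak vertex, possibly a leaf, and so lies under
  the root of a maximal weak subtree.\<close>

lemma sign_rel_iff: "(a, b) : sign_rel n R \<longleftrightarrow> (EX v:top_weak. a : L v & b : L v)"
proof
 assume "EX v:top_weak. a : L v & b : L v"
 then obtain v where v: "v : N" "v ~: S" "a : L v" "b : L v" by(auto simp: top_weak_def)
 have "1 <= lev v" using level_1 v by blast
 then obtain i where i: "lev v = Suc i" by(cases "lev v") auto
 have "R i `` {a} = L v" using code_class[OF v(1) i v(3)] .
 then have "(a, b) : R i" "(a, 0) ~: R i" using v(2,4) zero_L by auto
 then show "(a, b) : sign_rel n R" by(auto simp: sign_rel_def)
next
 have ex: "EX u:top_weak. a : L u & b : L u" if "v : N - S" "a : L v" "b : L v" for v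
  using top_weak_above[OF that(1)] L_mono that by blast
 assume "(a, b) : sign_rel n R"
 then obtain i where i: "(a, b) : R i" "(a, 0) ~: R i" by(auto simp: sign_rel_def)
 show "EX v:top_weak. a : L v & b : L v"
 proof (cases "a = b")
  case True
  have "a ~= 0" "a <= n" using i by(auto simp: code_iff)
  then obtain x where x: "x : leaves Ga" "be x = a" using leaf_of[of a] by auto
  then show ?thesis using ex[of x] leafN[OF x(1)] SN L_leaf[OF x(1)] True by auto
 next
  case False
  obtain v where v: "v : N" "lev v = Suc i" "a : L v" "b : L v" using codeE[OF i(1) False] .
  have "v ~: S" using code_class[OF v(1,2,3)] i(2) zero_L by blast
  then show ?thesis using ex v by blast
 qed
qed

lemma card_sign_rel: "card ({1..n} // sign_rel n R) = weak_trees Ga"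
proof -
 have cl: "sign_rel n R `` {a} = L v" if v: "v : top_weak" "a : L v" for v a
 proof -
  have "u = v" if "u : top_weak" "a : L u" for u
  proof -
   have "a ~= 0" using v zero_L by(auto simp: top_weak_def intro: gr0I)
   then obtain x where x: "x : leaves Ga" "be x = a" using leaf_of[of a] L_le[OF v(2)] by auto
   then have "(u, x) : E\<^sup>*" "(v, x) : E\<^sup>*" using be_L that v by auto
   then show ?thesis using ancestors top_weak_unique v(1) that(1) by metis
  qed
  then have "(a, b) : sign_rel n R \<longleftrightarrow> b : L v" for b unfolding sign_rel_iff using v by blast
  then show ?thesis by blast
 qed
 have N: "v : N" "0 ~: L v" if "v : top_weak" for v using that zero_L by(auto simp: top_weak_def)
 have "bij_betw L top_weak ({1..n} // sign_rel n R)"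
  unfolding bij_betw_def
 proof
  show "inj_on L top_weak"
  proof (rule inj_onI)
   fix u v assume uv: "u : top_weak" "v : top_weak" "L u = L v"
   obtain x where x: "x : leaves Ga" "(u, x) : E\<^sup>*" "be x : L u" using L_nonempty[OF N(1)[OF uv(1)]] .
   then have "(v, x) : E\<^sup>*" using be_L uv(3) by simp
   then show "u = v" using ancestors[OF x(2)] top_weak_unique uv by metis
  qed
  show "L ` top_weak = {1..n} // sign_rel n R"
  proof (intro equalityI subsetI)
   fix C assume "C : L ` top_weak"
   then obtain v where v: "v : top_weak" "C = L v" by blast
   obtain x where x: "x : leaves Ga" "be x : L v" using L_nonempty[OF N(1)[OF v(1)]] by metis
   then show "C : {1..n} // sign_rel n R" using cl[OF v(1) x(2)] v(2) be_in[OF x(1)] by(metis atLeastAtMost_iff quotientI)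
  next
   fix C assume "C : {1..n} // sign_rel n R"
   then obtain a where a: "a : {1..n}" "C = sign_rel n R `` {a}" by(auto elim: quotientE)
   then obtain x where x: "x : leaves Ga" "be x = a" using leaf_of[of a] by auto
   obtain v where v: "v : top_weak" "(v, x) : E\<^sup>*" using top_weak_above[of x] leafN[OF x(1)] SN x(1) by blast
   then show "C : L ` top_weak" using cl[OF v(1), of a] be_L[OF x(1)] x(2) a(2) by auto
  qed
 qed
 then show ?thesis using card_top_weak by(metis bij_betw_same_card)
qed

end

section \<open>Recovering a minimal forest from its flag of relations\<close>

context labelled_forest begin

text \<open>A strong vertex carries 0 and the label of a leaf below it. One label therefore means a
  weak vertex above a single leaf, and such a vertex would root a trivial tail unless it is that
  leaf.\<close>

lemma single_label:
 assumes "minimal Ga" "v : N" "card (L v) < 2"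
 shows "v : leaves Ga"
proof (rule ccontr)
 assume nl: "v ~: leaves Ga"
 let ?D = "{x : leaves Ga. (v, x) : E\<^sup>*}"
 have finD: "finite ?D" using fin leafN by(auto intro: finite_subset[of _ N])
 have cD: "card (be ` ?D) = card ?D" using be by(intro card_image) (auto simp: bij_betw_def inj_on_def)
 obtain x where x: "x : ?D" using L_nonempty[OF assms(2)] by blast
 have vS: "v ~: S"
 proof
  assume "v : S"
  then have "{0, be x} <= L v" using x by(auto simp: labs_def)
  moreover have "finite (L v)" using finD by(simp add: labs_def)
  ultimately have "card {0, be x} <= card (L v)" by(intro card_mono)
  then show False using be_in[of x] x assms(3) by simp
 qed
 then have "card ?D < 2" using assms(3) cD by(simp add: labs_def)
 moreover have "card ?D > 0" using x finD by(auto simp: card_gt_0_iff)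
 ultimately have c1: "card ?D = 1" by simp
 have "is_singleton (out Ga v)"
 proof -
  obtain e where e: "e : out Ga v" using nonleaf_out assms(2) nl by blast
  have "e' = e" if "e' : out Ga v" for e'
  proof -
   have c: "(v, snd e) : E" "(v, snd e') : E"
    using e that unfolding out_def by(metis (mono_tags) mem_Collect_eq prod.collapse)+
   then obtain y y' where "y : leaves Ga" "(snd e, y) : E\<^sup>*" "y' : leaves Ga" "(snd e', y') : E\<^sup>*"
    using leaf_below EN by(meson SigmaD2 subsetD)
   moreover have "y = z" if "y : ?D" "z : ?D" for y z using that card_1_singletonE[OF c1] by(metis singletonD)
   ultimately have "snd e = snd e'" using c level_edge by(metis (mono_tags, lifting) ancestor_unique converse_rtrancl_into_rtrancl mem_Collect_eq)
   then show ?thesis using e that by(auto simp: out_def prod_eq_iff)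
  qed
  then show ?thesis using e by(intro is_singletonI') auto
 qed
 then have "card (out Ga v) = 1" by(simp add: is_singleton_altdef)
 moreover have "descendants Ga v Int S = {}" using strong_up vS by(auto simp: descendants_def)
 moreover have "descendants Ga v Int leaves Ga = ?D" by(auto simp: descendants_def)
 ultimately have "trivial_tail_root Ga v" using assms(2) nl c1 by(simp add: trivial_tail_root_def)
 then show False using assms(1) by(simp add: minimal_def)
qed

text \<open>Without trivial tails a label becomes a singleton exactly at the level of its leaf; this
  is how minimality makes the vertices visible in the flag.\<close>

lemma keyset_code:
 assumes min: "minimal Ga"
 shows "(%v. (lev v, L v)) ` N = keyset n R"
proof (intro equalityI subsetI)
 fix p assume "p : (%v. (lev v, L v)) ` N"
 then obtain v where v: "v : N" "p = (lev v, L v)" by blast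
 have "1 <= lev v" using level_1 v by blast
 then obtain i where i: "lev v = Suc i" by(cases "lev v") auto
 obtain x where x: "x : leaves Ga" "be x : L v" using L_nonempty[OF v(1)] .
 have "be x ~= 0" using be_in[OF x(1)] by simp
 then have "L v ~= {0}" using x(2) by(metis singletonD)
 moreover have "L v ~: {0..n} // R (i - 1)" if c: "card (L v) < 2" "i ~= 0"
 proof
  assume Lc: "L v : {0..n} // R (i - 1)"
  have vl: "v : leaves Ga" using single_label[OF min v(1) c(1)] .
  have "v ~: roots Ga" using level_root[of v] i c by auto
  then obtain u where u: "(u, v) : E" using v by(auto simp: roots_def)
  then have uN: "u : N" "lev u = Suc (i - 1)" using EN level_edge[OF u] i c by auto
  have "be v : L u" using be_L[OF vl] u by auto
  from code_class[OF uN this] have "L u = R (i - 1) `` {be v}" by simp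
  moreover have "R (i - 1) `` {be v} = L v"
   using Lc equiv_class_eq_iff[OF equiv_code] quotient_eq_iff[OF equiv_code] L_leaf[OF vl]
   by(metis equiv_code Image_singleton_iff insertI1 quotientE equiv_class_eq)
  ultimately have "card (L u) < 2" using c by simp
  then have "u : leaves Ga" using single_label[OF min uN(1)] by blast
  then show False using u by(auto simp: leaves_def)
 qed
 ultimately show "p : keyset n R"
  using L_class[OF v(1) i] v(2) i unfolding keyset_def by(auto simp: not_less[symmetric])
next
 fix p assume "p : keyset n R"
 then obtain i A where p: "p = (Suc i, A)" and A: "A : {0..n} // R i" "A ~= {0}"
  and K: "card A >= 2 \<or> i = 0 \<or> A ~: {0..n} // R (i - 1)" by(auto simp: keyset_def)
 have "EX v:N. lev v = Suc i & A = L v"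
 proof (rule ccontr)
  assume no: "~ ?thesis"
  then obtain a where a: "a <= n" "A = {a}" using code_cases[OF A(1)] by blast
  then obtain x where x: "x : leaves Ga" "be x = a" using leaf_of[of a] A(2) by auto
  have Ra: "R i `` {a} = {a}"
   using A(1) a equiv_class_eq[OF equiv_code] by(metis Image_singleton_iff insertI1 quotientE)
  have "~ Suc i <= lev x"
  proof
   assume "Suc i <= lev x"
   then obtain u where u: "u : N" "lev u = Suc i" "(u, x) : E\<^sup>*" using ancestor_at[OF leafN[OF x(1)], of "Suc i"] by auto
   then show False using no code_class[OF u(1,2), of a] be_L[OF x(1)] x(2) Ra a by auto
  qed
  then have "lev x <= i" "i ~= 0" using level_1[OF leafN[OF x(1)]] by auto
  moreover have "R (i - 1) `` {a} ~= {a}" using K a \<open>i ~= 0\<close> quotientI[of a "{0..n}" "R (i - 1)"] by auto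
  ultimately have lx: "lev x = i" using low_class[OF x(1), of "i - 1"] x(2) by fastforce
  then have "R (i - 1) `` {a} = L x" using code_class[OF leafN[OF x(1)], of "i - 1" a] L_leaf[OF x(1)] x(2) \<open>i ~= 0\<close> by simp
  then show False using \<open>R (i - 1) `` {a} ~= {a}\<close> L_leaf[OF x(1)] x(2) by simp
 qed
 then obtain v where "v : N" "p = (lev v, L v)" using p by auto
 then show "p : (%v. (lev v, L v)) ` N" by blast
qed

lemma minimal_iff: "minimal Ga \<longleftrightarrow> (ALL v:N. card (L v) < 2 --> v : leaves Ga)"
proof
 assume R: "ALL v:N. card (L v) < 2 --> v : leaves Ga"
 have False if t: "trivial_tail_root Ga v" for v
 proof -
  have D: "descendants Ga v Int leaves Ga = {x : leaves Ga. (v, x) : E\<^sup>*}" "v : descendants Ga v"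
   by(auto simp: descendants_def)
  then have "v ~: S" "card {x : leaves Ga. (v, x) : E\<^sup>*} = 1" using t unfolding trivial_tail_root_def by auto
  then have "card (L v) < 2" by(auto simp: labs_def card_1_singleton_iff)
  then show False using R t by(auto simp: trivial_tail_root_def)
 qed
 then show "minimal Ga" by(auto simp: minimal_def)
qed (use single_label in blast)

lemma key_inj: "inj_on (%v. (lev v, L v)) N"
proof (rule inj_onI)
 fix u v assume uv: "u : N" "v : N" "(lev u, L u) = (lev v, L v)"
 obtain x where "be x : L u" using L_nonempty[OF uv(1)] .
 then show "u = v" using L_disjoint[of u v "be x"] uv by simp
qed

end

lemma rel_flags_unique: "R : rel_flags n m ==> R : rel_flags n m' ==> m = m'"
proof (rule poly_mapping_eqI)
 fix i assume R: "R : rel_flags n m" "R : rel_flags n m'"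
 have "Suc (\<Sum>j\<le>i. lookup m j) = Suc (\<Sum>j\<le>i. lookup m' j)" for i
  using R unfolding rel_flags_def mem_Collect_eq by metis
 from this[of i] this[of "i - 1"] show "lookup m i = lookup m' i" by(cases i) auto
qed

text \<open>Vertices of the two forests are matched by their keys, which \<open>keyset_code\<close>
  recovers from the common code.\<close>

lemma code_eq_imp_iso:
 assumes G: "labelled_forest Ga be n" "minimal Ga" and D: "labelled_forest Dl \<gamma> n" "minimal Dl"
  and eq: "code Ga be = code Dl \<gamma>"
 obtains f where "bij_betw f (verts Ga) (verts Dl)" "map_prod f f ` edges Ga = edges Dl" "f ` strong Ga = strong Dl"
  "!!x. x : leaves Ga ==> f x : leaves Dl & \<gamma> (f x) = be x"
proof -
 interpret G: labelled_forest Ga be n by fact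
 interpret D: labelled_forest Dl \<gamma> n by fact
 let ?kG = "%v. (level Ga v, labs Ga be v)" and ?kD = "%v. (level Dl v, labs Dl \<gamma> v)"
 define f where "f = (%v. the_inv_into (verts Dl) ?kD (?kG v))"
 have im: "?kG ` verts Ga = ?kD ` verts Dl" using G.keyset_code[OF G(2)] D.keyset_code[OF D(2)] eq by simp
 have bD: "bij_betw (the_inv_into (verts Dl) ?kD) (?kD ` verts Dl) (verts Dl)"
  using D.key_inj by(intro bij_betw_the_inv_into) (simp add: bij_betw_def)
 have "bij_betw ?kG (verts Ga) (?kD ` verts Dl)" using G.key_inj im by(simp add: bij_betw_def)
 then have bij: "bij_betw f (verts Ga) (verts Dl)" using bij_betw_trans[OF _ bD] by(simp add: f_def o_def)
 have key: "level Dl (f v) = level Ga v" "labs Dl \<gamma> (f v) = labs Ga be v" if "v : verts Ga" for v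
 proof -
  have "?kG v : ?kD ` verts Dl" using im that by blast
  from f_the_inv_into_f[OF D.key_inj this] show "level Dl (f v) = level Ga v" "labs Dl \<gamma> (f v) = labs Ga be v"
   by(simp_all add: f_def)
 qed
 have fN: "f v : verts Dl" if "v : verts Ga" for v using bij that by(auto simp: bij_betw_def)
 have onto: "EX v:verts Ga. w = f v" if "w : verts Dl" for w using bij that by(auto simp: bij_betw_def)
 have edge: "(f u, f v) : edges Dl \<longleftrightarrow> (u, v) : edges Ga" if "u : verts Ga" "v : verts Ga" for u v
  using G.edge_iff[OF that] D.edge_iff[OF fN fN, OF that] key that by simp
 have strong: "f v : strong Dl \<longleftrightarrow> v : strong Ga" if "v : verts Ga" for v
  using G.zero_L[of v] D.zero_L[of "f v"] key(2)[OF that] by simp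
 show ?thesis
 proof (rule that[OF bij])
  show "map_prod f f ` edges Ga = edges Dl"
  proof (intro equalityI subsetI)
   fix e assume "e : map_prod f f ` edges Ga"
   then show "e : edges Dl" using edge G.EN by auto
  next
   fix e assume e: "e : edges Dl"
   then have "fst e : verts Dl" "snd e : verts Dl" using D.EN by auto
   then obtain u v where "u : verts Ga" "v : verts Ga" "fst e = f u" "snd e = f v" using onto by metis
   then have "u : verts Ga" "v : verts Ga" "e = (f u, f v)" by(simp_all add: prod_eq_iff)
   then show "e : map_prod f f ` edges Ga" using edge e by(auto intro!: image_eqI[of _ _ "(u, v)"])
  qed
  show "f ` strong Ga = strong Dl" using strong onto G.SN D.SN by blast
  fix x assume x: "x : leaves Ga"
  then have xN: "x : verts Ga" by(rule G.leafN)
  have "f x : leaves Dl"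
  proof (rule ccontr)
   assume "f x ~: leaves Dl"
   then obtain w where "(f x, w) : edges Dl" using fN[OF xN] by(auto simp: leaves_def)
   moreover from this obtain y where "y : verts Ga" "w = f y" using onto D.EN by blast
   ultimately have "(x, y) : edges Ga" using edge xN by simp
   then show False using x by(auto simp: leaves_def)
  qed
  then show "f x : leaves Dl & \<gamma> (f x) = be x"
   using key(2)[OF xN] G.L_leaf[OF x] D.L_leaf by auto
 qed
qed

lemma iso_transport:
 assumes G: "labelled_forest Ga be n" and bij: "bij_betw f (verts Ga) (verts Dl)"
  and E: "map_prod f f ` edges Ga = edges Dl" and S: "f ` strong Ga = strong Dl"
  and \<gamma>: "!!x. x : leaves Ga ==> \<gamma> (f x) = be x"
 shows "labelled_forest Dl \<gamma> n" "code Dl \<gamma> = code Ga be" "minimal Ga ==> minimal Dl"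
proof -
 interpret G: labelled_forest Ga be n by fact
 let ?N = "verts Ga" and ?N' = "verts Dl" and ?E = "edges Ga" and ?E' = "edges Dl"
 have inj: "f u = f v \<longleftrightarrow> u = v" if "u : ?N" "v : ?N" for u v using bij that by(auto simp: bij_betw_def inj_on_def)
 have N': "?N' = f ` ?N" using bij by(simp add: bij_betw_def)
 have ED: "EX u v. (u, v) : ?E & a = f u & b = f v" if "(a, b) : ?E'" for a b using that E by force
 have EI: "(f u, f v) : ?E'" if "(u, v) : ?E" for u v using that E by force
 have EN: "u : ?N & v : ?N" if "(u, v) : ?E" for u v using that G.EN by blast
 have edge: "(f u, f v) : ?E' \<longleftrightarrow> (u, v) : ?E" if "u : ?N" "v : ?N" for u v
  using ED[of "f u" "f v"] EI EN inj that by metis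
 have star: "(f u, f v) : ?E'\<^sup>* \<longleftrightarrow> (u, v) : ?E\<^sup>*" if "u : ?N" "v : ?N" for u v
 proof
  show "(u, v) : ?E\<^sup>* ==> (f u, f v) : ?E'\<^sup>*"
   by(induction rule: rtrancl_induct) (auto intro: rtrancl_into_rtrancl EI)
  have "(a, b) : ?E'\<^sup>* ==> a = f u ==> EX v:?N. b = f v & (u, v) : ?E\<^sup>*" for a b
  proof (induction rule: rtrancl_induct)
   case (step b c)
   then obtain v where v: "v : ?N" "b = f v" "(u, v) : ?E\<^sup>*" by blast
   obtain v' w where w: "(v', w) : ?E" "b = f v'" "c = f w" using ED[OF step(2)] by blast
   then have "v' = v" using inj v EN by blast
   then have "(u, w) : ?E\<^sup>*" using v(3) w(1) by(simp add: rtrancl_into_rtrancl)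
   then show ?case using w EN by blast
  qed (use that in auto)
  then show "(f u, f v) : ?E'\<^sup>* ==> (u, v) : ?E\<^sup>*" using inj that by metis
 qed
 have strong: "f v : strong Dl \<longleftrightarrow> v : strong Ga" if "v : ?N" for v
  using S G.SN inj that by blast
 have leaf: "f v : leaves Dl \<longleftrightarrow> v : leaves Ga" if "v : ?N" for v
  using that N' edge ED EI EN inj unfolding leaves_def Domain_iff mem_Collect_eq by(metis imageI)
 have leaves: "leaves Dl = f ` leaves Ga"
 proof
  show "leaves Dl <= f ` leaves Ga" using leaf N' by(auto simp: leaves_def[of Dl] image_iff)
  show "f ` leaves Ga <= leaves Dl" using leaf G.leafN by blast
 qed
 have fg: "forest_graph Dl"
 proof
  show "finite ?N'" using N' G.fin by simp
  show "?E' <= ?N' \<times> ?N'" using EN unfolding N' E[symmetric] by auto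
  show "acyclic ?E'"
   unfolding acyclic_def
  proof (intro allI notI)
   fix a assume "(a, a) : ?E'\<^sup>+"
   then obtain b where b: "(a, b) : ?E'\<^sup>*" "(b, a) : ?E'" by(meson tranclD2)
   obtain u v where uv: "(u, v) : ?E" "b = f u" "a = f v" using ED[OF b(2)] by blast
   then have "(v, u) : ?E\<^sup>*" using star b(1) EN by blast
   then show False using uv(1) G.ac by(meson acyclic_def rtrancl_into_trancl1)
  qed
  show "single_valued (?E'\<inverse>)"
   unfolding single_valued_def converse_iff using ED inj EN G.parent_unique by metis
 qed
 interpret D: forest_graph Dl by fact
 have lev: "level Dl (f v) = level Ga v" if v: "v : ?N" for v
 proof (rule G.level_unique[symmetric, OF _ _ v])
  show "level Dl (f u) = 1" if "u : roots Ga" for u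
  proof (rule D.level_root)
   have "u : ?N" "u ~: Range ?E" using that by(auto simp: roots_def)
   then have "f u ~: Range ?E'" using ED EN inj by(metis Range.cases RangeI)
   then show "f u : roots Dl" using \<open>u : ?N\<close> N' by(simp add: roots_def)
  qed
  show "level Dl (f w) = Suc (level Dl (f u))" if "(u, w) : ?E" for u w using D.level_edge EI that by blast
 qed
 show LF: "labelled_forest Dl \<gamma> n"
 proof
  show "strong Dl <= ?N' - leaves Dl"
  proof
   fix w assume "w : strong Dl"
   then obtain v where "v : strong Ga" "w = f v" unfolding S[symmetric] by blast
   then have "v : ?N" "v ~: leaves Ga" "w = f v" using G.SN by auto
   then show "w : ?N' - leaves Dl" using leaf N' by simp
  qed
  show "u = v" if "u : strong Dl" "v : strong Dl" "level Dl u = level Dl v" for u v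
  proof -
   obtain a b where ab: "a : strong Ga" "u = f a" "b : strong Ga" "v = f b" using \<open>u : _\<close> \<open>v : _\<close> unfolding S[symmetric] by blast
   then have "a : ?N" "b : ?N" using G.SN by auto
   then show ?thesis using G.S1[OF ab(1,3)] that(3) ab lev by simp
  qed
  show "u : strong Dl" if "(u, v) : ?E'" "v : strong Dl" for u v
  proof -
   obtain a b where ab: "(a, b) : ?E" "u = f a" "v = f b" using ED[OF \<open>(u, v) : ?E'\<close>] by blast
   then show ?thesis using EN[OF ab(1)] that(2) strong G.S2[OF ab(1)] by simp
  qed
  have "bij_betw f (leaves Ga) (leaves Dl)" using leaves inj G.leafN by(auto simp: bij_betw_def inj_on_def)
  moreover have "bij_betw (\<gamma> \<circ> f) (leaves Ga) {1..n}" using G.be \<gamma> bij_betw_cong[of "leaves Ga" "\<gamma> \<circ> f" be] by simp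
  ultimately show "bij_betw \<gamma> (leaves Dl) {1..n}" using bij_betw_comp_iff by blast
 qed
 interpret D: labelled_forest Dl \<gamma> n by fact
 have labs: "labs Dl \<gamma> (f v) = labs Ga be v" if "v : ?N" for v
 proof -
  have "{x : leaves Dl. (f v, x) : ?E'\<^sup>*} = f ` {x : leaves Ga. (v, x) : ?E\<^sup>*}"
   unfolding leaves using star[OF that] G.leafN by blast
  moreover have "\<gamma> ` f ` {x : leaves Ga. (v, x) : ?E\<^sup>*} = be ` {x : leaves Ga. (v, x) : ?E\<^sup>*}"
   using \<gamma> by(auto simp: image_image)
  ultimately show ?thesis using strong[OF that] by(simp add: labs_def)
 qed
 show "code Dl \<gamma> = code Ga be"
 proof (intro ext Set.set_eqI, clarify)
  fix i a b
  show "(a, b) : code Dl \<gamma> i \<longleftrightarrow> (a, b) : code Ga be i"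
   unfolding G.code_iff D.code_iff N' by(simp add: lev labs)
 qed
 show "minimal Ga ==> minimal Dl"
  unfolding G.minimal_iff D.minimal_iff N' using labs leaf by auto
qed

text \<open>The vertices are the classes with a positive label, followed down to the first step at
  which they are singletons; inclusion between consecutive steps gives the edges.\<close>

lemma forest_of_code:
 assumes RF: "R : rel_flags n m" and m: "total m = n"
 obtains Ga be where "labelled_forest Ga be n" "minimal Ga" "code Ga be = R"
proof -
 note eqR = eqR[OF RF m] and anti = R_anti[OF RF m]
 note r = equiv_rel[OF eqR]
 let ?c = "%i a. R i `` {a}"
 obtain k where k: "R k = Id_on {0..n}" using R_final[OF RF m] by blast
 have self: "a : ?c i a" if "a <= n" for a i using r(1)[OF that] by blast
 have cls: "?c i b = ?c i a" if "b : ?c i a" for a b i using that equiv_class_eq[OF eqR] by blast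
 have cle: "b <= n" if "b : ?c i a" for a b i using that r(4) by blast
 have single: "?c j a = {a}" if "?c i a = {a}" "i <= j" "a <= n" for i j a
  using anti[OF that(2)] that(1) self[OF that(3), of j] by blast
 \<comment> \<open>A positive label \<open>a\<close> excludes the class \<open>{0}\<close>. That
   \<open>a\<close> is not alone one step earlier ends each branch at its leaf and so rules out
   trivial tails.\<close>
 define K where "K = {(Suc i, ?c i a) | i a. 1 <= a & a <= n & (i = 0 \<or> ?c (i - 1) a ~= {a})}"
 have KI: "(Suc i, ?c i a) : K" if "1 <= a" "a <= n" "i = 0 \<or> ?c (i - 1) a ~= {a}" for i a
  using that unfolding K_def by blast
 have KE: "EX i a. p = (Suc i, ?c i a) & 1 <= a & a <= n & (i = 0 \<or> ?c (i - 1) a ~= {a})" if "p : K" for p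
  using that unfolding K_def by blast
 have KD: "A = ?c i a" "i = 0 \<or> ?c (i - 1) a ~= {a}" if iA: "(Suc i, A) : K" "a : A" "1 <= a" for i A a
 proof -
  obtain b where b: "A = ?c i b" "1 <= b" "b <= n" "i = 0 \<or> ?c (i - 1) b ~= {b}" using KE[OF iA(1)] by auto
  show "A = ?c i a" using b(1) cls iA(2) by blast
  show "i = 0 \<or> ?c (i - 1) a ~= {a}"
  proof (rule ccontr)
   assume *: "~ ?thesis"
   have "b : ?c i a" using b(1,3) self \<open>A = ?c i a\<close> by blast
   then have "b : ?c (i - 1) a" using anti[of "i - 1" i] by auto
   then have "b = a" using * by auto
   then show False using * b(4) by auto
  qed
 qed
 have Kpos: "EX a:A. 1 <= a & a <= n" if "(Suc i, A) : K" for i A using KE[OF that] self by auto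
 have Ksuc: "EX i A. p = (Suc i, A)" if "p : K" for p using KE[OF that] by blast
 have Kle: "A <= {0..n}" if "(l, A) : K" for l A using KE[OF that] cle by auto
 have "finite K"
 proof (rule finite_subset)
  show "K <= {..Suc (Suc k)} \<times> Pow {0..n}"
  proof
   fix p assume p: "p : K"
   then obtain i a where i: "p = (Suc i, ?c i a)" "1 <= a" "a <= n" "i = 0 \<or> ?c (i - 1) a ~= {a}" using KE by blast
   have "?c k a = {a}" using k i by auto
   then have "~ k <= i - 1" if "i ~= 0" using single[of k a "i - 1"] i that by auto
   then have "i <= Suc k" by(cases "i = 0") auto
   moreover have "?c i a <= {0..n}" using cle by auto
   ultimately show "p : {..Suc (Suc k)} \<times> Pow {0..n}" using i(1) by auto
  qed
 qed simp
 \<comment> \<open>Vertices have to be natural numbers, so the keys are encoded injectively.\<close>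
 then obtain enc :: "nat \<times> nat set => nat" where enc: "inj_on enc K" using finite_imp_inj_to_nat_seg by blast
 define dec where "dec = the_inv_into K enc"
 have dec: "dec (enc p) = p" if "p : K" for p unfolding dec_def using the_inv_into_f_f[OF enc that] .
 define Ga where "Ga = \<lparr>verts = enc ` K, edges = {(enc p, enc q) | p q. p : K & q : K & fst q = Suc (fst p) & snd q <= snd p},
  strong = {enc p | p. p : K & 0 : snd p}\<rparr>"
 have V: "verts Ga = enc ` K" and ED: "edges Ga = {(enc p, enc q) | p q. p : K & q : K & fst q = Suc (fst p) & snd q <= snd p}"
  and ST: "strong Ga = {enc p | p. p : K & 0 : snd p}" by(simp_all add: Ga_def)
 have edge: "(enc p, enc q) : edges Ga \<longleftrightarrow> fst q = Suc (fst p) & snd q <= snd p" if "p : K" "q : K" for p q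
  using that inj_onD[OF enc] unfolding ED by blast
 have edgeE: "EX p:K. EX q:K. u = enc p & v = enc q & fst q = Suc (fst p) & snd q <= snd p" if "(u, v) : edges Ga" for u v
  using that unfolding ED by blast
 have strong: "enc p : strong Ga \<longleftrightarrow> 0 : snd p" if "p : K" for p
  using that inj_onD[OF enc] unfolding ST by blast
 have child: "(Suc (Suc i), ?c (Suc i) a) : K" "(enc (Suc i, ?c i a), enc (Suc (Suc i), ?c (Suc i) a)) : edges Ga"
  if "(Suc i, ?c i a) : K" "1 <= a" "a <= n" "?c i a ~= {a}" for i a
 proof -
  show K': "(Suc (Suc i), ?c (Suc i) a) : K" using KI[of a "Suc i"] that by simp
  show "(enc (Suc i, ?c i a), enc (Suc (Suc i), ?c (Suc i) a)) : edges Ga"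
   using edge[OF that(1) K'] anti[of i "Suc i"] by auto
 qed
 have same: "p = p'" if pp: "p : K" "p' : K" "fst p = fst p'" "b : snd p" "b : snd p'" for p p' b
 proof -
  obtain i a where p: "p = (Suc i, ?c i a)" using KE[OF pp(1)] by blast
  obtain i' a' where p': "p' = (Suc i', ?c i' a')" using KE[OF pp(2)] by blast
  show ?thesis using pp(3-5) cls[of b i a] cls[of b i' a'] by(auto simp: p p')
 qed
 have ne: "EX a:snd p. 1 <= a & a <= n" if "p : K" for p using Ksuc[OF that] Kpos that by auto
 have fg: "forest_graph Ga"
 proof
  show "finite (verts Ga)" using \<open>finite K\<close> by(simp add: V)
  show "edges Ga <= verts Ga \<times> verts Ga" by(auto simp: V ED)
  have "edges Ga <= measure (%x. fst (dec x))" using edgeE dec by fastforce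
  then show "acyclic (edges Ga)" using wf_acyclic wf_subset wf_measure by blast
  show "single_valued ((edges Ga)\<inverse>)"
   unfolding single_valued_def
  proof (intro allI impI)
   fix w u u' assume "(w, u) : (edges Ga)\<inverse>" "(w, u') : (edges Ga)\<inverse>"
   then obtain p q p' q' where p: "p : K" "q : K" "u = enc p" "w = enc q" "fst q = Suc (fst p)" "snd q <= snd p"
    and p': "p' : K" "q' : K" "u' = enc p'" "w = enc q'" "fst q' = Suc (fst p')" "snd q' <= snd p'"
    using edgeE by(meson converseD)
   have "q' = q" using p p' inj_onD[OF enc] by metis
   then show "u = u'" using same[of p p'] p p' ne[OF p(2)] by auto
  qed
 qed
 interpret forest_graph Ga by fact
 have lev: "level Ga (enc p) = fst p" if "p : K" for p
 proof -
  have "level Ga (enc p) = fst (dec (enc p))"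
  proof (rule level_unique)
   show "fst (dec v) = Suc (fst (dec u))" if uv: "(u, v) : edges Ga" for u v using edgeE[OF uv] dec by auto
   show "enc p : verts Ga" using that by(simp add: V)
   show "fst (dec v) = 1" if v: "v : roots Ga" for v
   proof -
    obtain q where q: "q : K" "v = enc q" using v by(auto simp: roots_def V)
    obtain i a where i: "q = (Suc i, ?c i a)" "1 <= a" "a <= n" "i = 0 \<or> ?c (i - 1) a ~= {a}" using KE[OF q(1)] by blast
    \<comment> \<open>A key at a later step has a parent with the same label, so roots occur only at
      step 0.\<close>
    have "i = 0"
    proof (rule ccontr)
     assume "i ~= 0"
     then obtain j where j: "i = Suc j" by(cases i) auto
     then have nj: "?c j a ~= {a}" using i(4) by simp
     moreover have "j = 0 \<or> ?c (j - 1) a ~= {a}" using single[of "j - 1" a j] nj i(3) by auto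
     ultimately have "(enc (Suc j, ?c j a), enc q) : edges Ga" using child(2)[OF KI] i j by blast
     then show False using v q by(auto simp: roots_def)
    qed
    then show ?thesis using q i dec by simp
   qed
  qed
  then show ?thesis using dec[OF that] by simp
 qed
 have leaf: "enc p : leaves Ga \<longleftrightarrow> (EX a. snd p = {a})" if p: "p : K" for p
 proof
  assume l: "enc p : leaves Ga"
  obtain i a where i: "p = (Suc i, ?c i a)" "1 <= a" "a <= n" using KE[OF p] by blast
  have "?c i a = {a}"
  proof (rule ccontr)
   assume "?c i a ~= {a}"
   then have "enc p : Domain (edges Ga)" using child(2)[of i a] i p by blast
   then show False using l by(simp add: leaves_def)
  qed
  then show "EX a. snd p = {a}" using i by auto
 next
  assume "EX a. snd p = {a}"
  then obtain a where a: "snd p = {a}" by blast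
  have "enc p ~: Domain (edges Ga)"
  proof
   assume "enc p : Domain (edges Ga)"
   then obtain w where w: "(enc p, w) : edges Ga" by blast
   then obtain p' q where q: "p' : K" "q : K" "enc p = enc p'" "fst q = Suc (fst p')" "snd q <= snd p'" using edgeE by blast
   then have pp: "p' = p" using inj_onD[OF enc] p by metis
   obtain i where i: "p = (Suc i, {a})" using Ksuc[OF p] a by auto
   have "1 <= a" "a <= n" using ne[OF p] a by auto
   have "snd q = {a}" using ne[OF q(2)] q(5) pp a by auto
   then have "(Suc (Suc i), {a}) : K" using q(2,4) pp i by(metis fst_conv prod.collapse)
   then have "?c i a ~= {a}" using KD(2)[of "Suc i" "{a}" a] \<open>1 <= a\<close> by auto
   moreover have "?c i a = {a}" using KD(1)[of i "{a}" a] p i \<open>1 <= a\<close> by auto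
   ultimately show False by simp
  qed
  then show "enc p : leaves Ga" using p by(simp add: leaves_def V)
 qed
 have ex_leaf: "EX j. (Suc j, {a}) : K & ?c j a = {a} & (ALL i<j. ?c i a ~= {a})" if a: "1 <= a" "a <= n" for a
 proof -
  define j where "j = (LEAST j. ?c j a = {a})"
  have "?c k a = {a}" using k a by auto
  then have j: "?c j a = {a}" unfolding j_def by(rule LeastI)
  have lt: "?c i a ~= {a}" if "i < j" for i using not_less_Least[of i "%j. ?c j a = {a}"] that by(simp add: j_def)
  then have "(Suc j, ?c j a) : K" using a by(intro KI) auto
  then show ?thesis using j lt by auto
 qed
 define be where "be = (%x. the_elem (snd (dec x)))"
 have be: "be (enc p) = a" if "p : K" "snd p = {a}" for p a using that dec by(simp add: be_def)
 have leafE: "EX p:K. EX a. x = enc p & snd p = {a} & 1 <= a & a <= n" if x: "x : leaves Ga" for x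
 proof -
  obtain p where p: "p : K" "x = enc p" using leafN[OF x] by(auto simp: V)
  then obtain a where a: "snd p = {a}" using leaf[OF p(1)] x by blast
  then show ?thesis using p ne[OF p(1)] by(intro bexI[of _ p] exI[of _ a]) auto
 qed
 have lvl_unique: "i = j" if "(Suc i, {a}) : K" "(Suc j, {a}) : K" "1 <= a" "a <= n" for i j a
 proof -
  have "~ i < j" if iK: "(Suc i, {a}) : K" "(Suc j, {a}) : K" for i j
  proof
   assume "i < j"
   have "?c i a = {a}" using KD(1)[OF iK(1) _ \<open>1 <= a\<close>] by simp
   then have "?c (j - 1) a = {a}" using single[of i a "j - 1"] \<open>i < j\<close> \<open>a <= n\<close> by simp
   then show False using KD(2)[OF iK(2) _ \<open>1 <= a\<close>] \<open>i < j\<close> by simp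
  qed
  then show ?thesis using that by(metis linorder_neqE_nat)
 qed
 have LF: "labelled_forest Ga be n"
 proof
  show "strong Ga <= verts Ga - leaves Ga"
  proof
   fix v assume "v : strong Ga"
   then obtain p where p: "p : K" "v = enc p" "0 : snd p" unfolding ST by blast
   obtain a where "a : snd p" "1 <= a" using ne[OF p(1)] by blast
   then have "\<nexists>a. snd p = {a}" using p(3) by(metis singletonD not_one_le_zero)
   then show "v : verts Ga - leaves Ga" using leaf[OF p(1)] p by(simp add: V)
  qed
  show "u = v" if "u : strong Ga" "v : strong Ga" "level Ga u = level Ga v" for u v
  proof -
   obtain p q where "p : K" "u = enc p" "0 : snd p" "q : K" "v = enc q" "0 : snd q"
    using \<open>u : strong Ga\<close> \<open>v : strong Ga\<close> unfolding ST by blast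
   then show ?thesis using same[of p q 0] lev that(3) by auto
  qed
  show "u : strong Ga" if "(u, v) : edges Ga" "v : strong Ga" for u v
   using edgeE[OF that(1)] that(2) strong by blast
  show "bij_betw be (leaves Ga) {1..n}"
   unfolding bij_betw_def
  proof
   show "inj_on be (leaves Ga)"
   proof (rule inj_onI)
    fix x y assume x: "x : leaves Ga" "y : leaves Ga" "be x = be y"
    obtain p a where p: "p : K" "x = enc p" "snd p = {a}" "1 <= a" "a <= n" using leafE[OF x(1)] by blast
    obtain q b where q: "q : K" "y = enc q" "snd q = {b}" using leafE[OF x(2)] by blast
    have ab: "b = a" using x(3) be[OF p(1,3)] be[OF q(1,3)] p q by simp
    obtain i j where "p = (Suc i, {a})" "q = (Suc j, {a})" using Ksuc[OF p(1)] Ksuc[OF q(1)] p q ab by auto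
    then show "x = y" using lvl_unique[of i a j] p q by simp
   qed
   show "be ` leaves Ga = {1..n}"
   proof (intro equalityI subsetI)
    fix a assume "a : be ` leaves Ga"
    then show "a : {1..n}" using leafE be by force
   next
    fix a assume "a : {1..n}"
    then obtain j where "(Suc j, {a}) : K" using ex_leaf[of a] by auto
    then show "a : be ` leaves Ga" using leaf[of "(Suc j, {a})"] be[of "(Suc j, {a})" a] by(auto intro: rev_image_eqI)
   qed
  qed
 qed
 interpret F: labelled_forest Ga be n by fact
 have labs: "labs Ga be (enc p) = snd p" if p: "p : K" for p
 proof -
  have desc: "EX q:K. x = enc q & snd q <= snd p" if "(enc p, x) : (edges Ga)\<^sup>*" for x
   using that
  proof (induction rule: rtrancl_induct)
   case (step y z)
   then obtain q where q: "q : K" "y = enc q" "snd q <= snd p" by blast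
   obtain q' q'' where "q' : K" "q'' : K" "y = enc q'" "z = enc q''" "snd q'' <= snd q'" using edgeE[OF step(2)] by blast
   moreover from this have "q' = q" using q inj_onD[OF enc] by metis
   ultimately show ?case using q by blast
  qed (use p in auto)
  have "a : snd p" if al: "a : labs Ga be (enc p)" for a
  proof (cases "a = 0")
   case True
   then show ?thesis using al F.zero_L strong[OF p] by simp
  next
   case False
   then obtain x where x: "x : leaves Ga" "(enc p, x) : (edges Ga)\<^sup>*" "a = be x" using al by(auto simp: labs_def split: if_splits)
   obtain q where q: "q : K" "x = enc q" "snd q <= snd p" using desc[OF x(2)] by blast
   obtain b where "snd q = {b}" using leaf[OF q(1)] x(1) q(2) by blast
   then show ?thesis using be[OF q(1)] x(3) q by auto
  qed
  moreover have "a : labs Ga be (enc p)" if a: "a : snd p" for a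
  proof (cases "a = 0")
   case True
   then show ?thesis using a F.zero_L strong[OF p] by simp
  next
   case False
   obtain i A where i: "p = (Suc i, A)" using Ksuc[OF p] by blast
   have a1: "1 <= a" "a <= n" using False a i Kle[of "Suc i" A] p by auto
   have pA: "p = (Suc i, ?c i a)" "i = 0 \<or> ?c (i - 1) a ~= {a}" using KD[of i A a] i p a a1 by auto
   obtain j where j: "(Suc j, {a}) : K" "?c j a = {a}" "ALL i<j. ?c i a ~= {a}" using ex_leaf[OF a1] by blast
   \<comment> \<open>\<open>a\<close> cannot become a singleton before step \<open>i\<close>, so its
     leaf is reached by descending from \<open>p\<close>.\<close>
   have "i <= j"
   proof (rule ccontr)
    assume ij: "~ i <= j"
    then have "j <= i - 1" by linarith
    then show False using pA(2) single[OF j(2) _ a1(2)] ij by auto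
   qed
   then have "(Suc j, ?c j a) : K & (enc p, enc (Suc j, ?c j a)) : (edges Ga)\<^sup>*" using j(3)
   proof (induction j rule: dec_induct)
    case (step l)
    then have "(Suc l, ?c l a) : K" "(enc p, enc (Suc l, ?c l a)) : (edges Ga)\<^sup>*" "?c l a ~= {a}" by auto
    then show ?case using child[of l a] a1 by(meson rtrancl_into_rtrancl)
   qed (use p pA in auto)
   then show ?thesis
    using leaf[OF j(1)] be[OF j(1), of a] j F.be_L[of "enc (Suc j, {a})" "enc p"] by auto
  qed
  ultimately show ?thesis by blast
 qed
 have "minimal Ga"
  unfolding F.minimal_iff
 proof (intro ballI impI)
  fix v assume v: "v : verts Ga" "card (labs Ga be v) < 2"
  then obtain p where p: "p : K" "v = enc p" by(auto simp: V)
  have "finite (snd p)" using Kle[of "fst p" "snd p"] p finite_subset by fastforce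
  then have "card (snd p) ~= 0" using ne[OF p(1)] by auto
  then have "card (snd p) = 1" using v(2) labs p by simp
  then show "v : leaves Ga" using leaf p by(auto simp: card_1_singleton_iff)
 qed
 moreover have "code Ga be = R"
 proof (intro ext Set.set_eqI, clarify)
  fix i a b
  have "(EX v:verts Ga. level Ga v = Suc i & a : labs Ga be v & b : labs Ga be v) \<longleftrightarrow> (EX p:K. fst p = Suc i & a : snd p & b : snd p)"
   unfolding V using lev labs by simp
  also have "a <= n & b <= n & (a = b \<or> ...) \<longleftrightarrow> (a, b) : R i"
  proof
   assume "a <= n & b <= n & (a = b \<or> (EX p:K. fst p = Suc i & a : snd p & b : snd p))"
   then consider "a = b" "a <= n" | A where "(Suc i, A) : K" "a : A" "b : A" by auto
   then show "(a, b) : R i"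
   proof cases
    case 2
    obtain c where "A = ?c i c" using KE[OF 2(1)] by auto
    then show ?thesis using 2 cls by blast
   qed (use r(1) in auto)
  next
   assume ab: "(a, b) : R i"
   have "EX p:K. fst p = Suc i & a : snd p & b : snd p" if "a ~= b"
   proof -
    \<comment> \<open>Keys are named by positive labels, so if \<open>a\<close> is 0 its partner
      \<open>b\<close> takes the lead.\<close>
    obtain c d where c: "c ~= d" "1 <= c" "c <= n" "(c, d) : R i" "a : ?c i c" "b : ?c i c"
    proof (cases "a = 0")
     case True
     then show ?thesis using that[of b a] \<open>a ~= b\<close> ab r(2)[OF ab] r(4)[OF ab] self by auto
    next
     case False
     then show ?thesis using that[of a b] \<open>a ~= b\<close> ab r(4)[OF ab] self by auto
    qed
    have "?c i c ~= {c}" using c(1,4) by auto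
    then have "(Suc i, ?c i c) : K" using single[of "i - 1" c i] c by(intro KI) auto
    then show ?thesis using c by force
   qed
   then show "a <= n & b <= n & (a = b \<or> (EX p:K. fst p = Suc i & a : snd p & b : snd p))" using r(4)[OF ab] by blast
  qed
  finally show "(a, b) : code Ga be i \<longleftrightarrow> (a, b) : R i" unfolding F.code_iff .
 qed
 ultimately show ?thesis using that LF by blast
qed

section \<open>Counting labellings\<close>

text \<open>Extensional, so that labellings agreeing on the leaves are counted once.\<close>

definition labelings :: "'a set => ('a => nat) set" where
 "labelings A = {be : extensional A. bij_betw be A {1..card A}}"

lemma card_labelings:
 assumes A: "finite A"
 shows "card (labelings A) = fact (card A)"
proof -
 let ?n = "card A"
 obtain h where h: "bij_betw h A {1..?n}" using ex_bij_betw_finite_nat[OF A] ex_bij_betw_nat_finite_1[OF A] bij_betw_inv by blast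
 have "bij_betw (%\<pi>. restrict (\<pi> \<circ> h) A) {\<pi>. \<pi> permutes {1..?n}} (labelings A)"
 proof (rule bij_betw_byWitness[where f' = "%be x. if x : {1..?n} then be (the_inv_into A h x) else x"])
  have hi: "h (the_inv_into A h x) = x" "the_inv_into A h x : A" if "x : {1..?n}" for x
   using h that by(auto simp: bij_betw_def f_the_inv_into_f intro: the_inv_into_into)
  have ih: "the_inv_into A h (h a) = a" "h a : {1..?n}" if "a : A" for a
   using h that by(auto simp: bij_betw_def the_inv_into_f_f)
  show "ALL \<pi>:{\<pi>. \<pi> permutes {1..?n}}. (%x. if x : {1..?n} then restrict (\<pi> \<circ> h) A (the_inv_into A h x) else x) = \<pi>"
  proof
   fix \<pi> assume "\<pi> : {\<pi>. \<pi> permutes {1..?n}}"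
   then have nin: "\<pi> x = x" if "x ~: {1..?n}" for x using that permutes_not_in by fastforce
   show "(%x. if x : {1..?n} then restrict (\<pi> \<circ> h) A (the_inv_into A h x) else x) = \<pi>"
   proof
    fix x show "(if x : {1..?n} then restrict (\<pi> \<circ> h) A (the_inv_into A h x) else x) = \<pi> x"
     using hi[of x] nin[of x] by(cases "x : {1..?n}") (simp_all only: restrict_apply comp_apply if_True if_False not_False_eq_True simp_thms)
   qed
  qed
  show "ALL be:labelings A. restrict ((%x. if x : {1..?n} then be (the_inv_into A h x) else x) \<circ> h) A = be"
  proof
   fix be assume "be : labelings A"
   then have ext: "be : extensional A" by(simp add: labelings_def)
   show "restrict ((%x. if x : {1..?n} then be (the_inv_into A h x) else x) \<circ> h) A = be"
   proof (rule extensionalityI[OF _ ext])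
    fix a assume a: "a : A"
    show "restrict ((%x. if x : {1..?n} then be (the_inv_into A h x) else x) \<circ> h) A a = be a"
     using a ih[OF a] by(simp only: restrict_apply comp_apply if_True)
   qed simp
  qed
  show "(%\<pi>. restrict (\<pi> \<circ> h) A) ` {\<pi>. \<pi> permutes {1..?n}} <= labelings A"
  proof clarify
   fix \<pi> assume "\<pi> permutes {1..?n}"
   then have "bij_betw (\<pi> \<circ> h) A {1..?n}" using bij_betw_trans[OF h permutes_imp_bij] by blast
   then show "restrict (\<pi> \<circ> h) A : labelings A" using bij_betw_cong[of A "restrict (\<pi> \<circ> h) A" "\<pi> \<circ> h"] by(simp add: labelings_def)
  qed
  show "(%be x. if x : {1..?n} then be (the_inv_into A h x) else x) ` labelings A <= {\<pi>. \<pi> permutes {1..?n}}"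
  proof clarify
   fix be assume "be : labelings A"
   then have "bij_betw be A {1..?n}" by(simp add: labelings_def)
   from bij_betw_trans[OF bij_betw_the_inv_into[OF h] this]
   have "bij_betw (%x. if x : {1..?n} then be (the_inv_into A h x) else x) {1..?n} {1..?n}"
    using bij_betw_cong[of "{1..?n}" "%x. if x : {1..?n} then be (the_inv_into A h x) else x" "be \<circ> the_inv_into A h"] by simp
   then show "(%x. if x : {1..?n} then be (the_inv_into A h x) else x) permutes {1..?n}"
    by(rule bij_imp_permutes) (simp only: if_False)
  qed
 qed
 then show ?thesis using card_permutations[of "{1..?n}" ?n] by(simp add: bij_betw_same_card)
qed

context labelled_forest begin

lemma aut:
 assumes "f : Aut Ga"
 shows "f permutes N" "(u, v) : E ==> (f u, f v) : E" "x : leaves Ga ==> f x : leaves Ga"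
  "v : N ==> lev (f v) = lev v" "(u, v) : E\<^sup>* ==> (f u, f v) : E\<^sup>*"
proof -
 have f: "f permutes N" and fE: "map_prod f f ` E = E" using assms by(auto simp: Aut_def)
 note inj = permutes_inj[OF f] and fN = permutes_in_image[OF f]
 have EI: "(f u, f v) : E" if "(u, v) : E" for u v using that fE by force
 have ED: "EX u v. (u, v) : E & a = f u & b = f v" if "(a, b) : E" for a b
 proof -
  have "(a, b) : map_prod f f ` E" using that fE by simp
  then show ?thesis by auto
 qed
 show "f permutes N" "(u, v) : E ==> (f u, f v) : E" by fact+
 show "x : leaves Ga ==> f x : leaves Ga"
  using fN ED inj by(fastforce simp: leaves_def Domain_iff dest: injD)
 show "(u, v) : E\<^sup>* ==> (f u, f v) : E\<^sup>*"
  by(induction rule: rtrancl_induct) (auto intro: EI rtrancl_into_rtrancl)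
 have "f r : roots Ga" if "r : roots Ga" for r
  using that fN ED inj by(fastforce simp: roots_def Range_iff dest: injD)
 then show "v : N ==> lev (f v) = lev v"
  using level_unique[of "%v. lev (f v)" v] level_root level_edge EI by simp
qed

text \<open>Labellings with the same code are related by a unique automorphism:
  \<open>code_eq_imp_iso\<close> provides it, and its action on the leaves determines it.\<close>

lemma card_fibre:
 assumes min: "minimal Ga"
 shows "card {\<gamma> : labelings (leaves Ga). code Ga \<gamma> = code Ga be} = card (Aut Ga)"
proof -
 let ?\<psi> = "%f. restrict (be \<circ> inv_into UNIV f) (leaves Ga)"
 have LF: "labelled_forest Ga be n" ..
 have lab: "labelled_forest Ga \<gamma> n \<longleftrightarrow> bij_betw \<gamma> (leaves Ga) {1..n}" for \<gamma>
  using lforest_axioms by(simp add: labelled_forest_def labelled_forest_axioms_def)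
 have \<psi>f: "?\<psi> f (f x) = be x" if "f : Aut Ga" "x : leaves Ga" for f x
  using aut(1,3)[OF that(1)] that(2) by(simp add: permutes_inverses)
 have onto: "EX x:leaves Ga. y = f x" if "f : Aut Ga" "y : leaves Ga" for f y
 proof -
  have "f ` leaves Ga = leaves Ga"
   using fin leafN aut(3)[OF that(1)] permutes_inj_on[OF aut(1)[OF that(1)]]
   by(intro endo_inj_surj) (auto intro: finite_subset[of _ N])
  then show ?thesis using that(2) by blast
 qed
 have "bij_betw ?\<psi> (Aut Ga) {\<gamma> : labelings (leaves Ga). code Ga \<gamma> = code Ga be}"
  unfolding bij_betw_def
 proof
  show "inj_on ?\<psi> (Aut Ga)"
  proof (rule inj_onI)
   fix f f' assume f: "f : Aut Ga" "f' : Aut Ga" and eq: "?\<psi> f = ?\<psi> f'"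
   have L: "f x = f' x" if x: "x : leaves Ga" for x
   proof -
    obtain y where y: "y : leaves Ga" "f x = f' y" using onto[OF f(2) aut(3)[OF f(1) x]] by blast
    have "be x = be y" using \<psi>f[OF f(1) x] \<psi>f[OF f(2) y(1)] y(2) eq by simp
    then show ?thesis using be x y by(auto simp: bij_betw_def inj_on_def)
   qed
   show "f = f'"
   proof
    fix v
    show "f v = f' v"
    proof (cases "v : N")
     case True
     \<comment> \<open>A vertex is the only ancestor of \<open>x\<close> at its level, so its image
       is fixed by the image of \<open>x\<close>.\<close>
     obtain x where x: "x : leaves Ga" "(v, x) : E\<^sup>*" using leaf_below[OF True] by blast
     then show ?thesis
      using ancestor_unique[OF aut(5)[OF f(1) x(2)], of "f' v"] aut(5)[OF f(2) x(2)] L[OF x(1)] aut(4) f True by simp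
    next
     case False
     then show ?thesis using permutes_not_in[OF aut(1)] f by metis
    qed
   qed
  qed
  show "?\<psi> ` Aut Ga = {\<gamma> : labelings (leaves Ga). code Ga \<gamma> = code Ga be}"
  proof (intro equalityI subsetI)
   fix \<gamma> assume "\<gamma> : ?\<psi> ` Aut Ga"
   then obtain f where f: "f : Aut Ga" "\<gamma> = ?\<psi> f" by blast
   have "map_prod f f ` E = E" "f ` S = S" using f(1) by(simp_all add: Aut_def)
   from iso_transport(1,2)[OF LF permutes_imp_bij[OF aut(1)[OF f(1)]] this, of \<gamma>] \<psi>f[OF f(1)]
   have "labelled_forest Ga \<gamma> n" "code Ga \<gamma> = code Ga be" unfolding f(2) by blast+
   then show "\<gamma> : {\<gamma> : labelings (leaves Ga). code Ga \<gamma> = code Ga be}"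
    using lab by(simp add: labelings_def card_leaves f(2))
  next
   fix \<gamma> assume \<gamma>: "\<gamma> : {\<gamma> : labelings (leaves Ga). code Ga \<gamma> = code Ga be}"
   then have bg: "bij_betw \<gamma> (leaves Ga) {1..n}" and ext: "\<gamma> : extensional (leaves Ga)" by(simp_all add: labelings_def card_leaves)
   then have LG: "labelled_forest Ga \<gamma> n" using lab by simp
   obtain f where f: "bij_betw f N N" "map_prod f f ` E = E" "f ` S = S"
    "!!x. x : leaves Ga ==> f x : leaves Ga & \<gamma> (f x) = be x"
    using code_eq_imp_iso[OF LF min LG min] \<gamma> by auto
   define f' where "f' = (%v. if v : N then f v else v)"
   have eqf: "f' v = f v" if "v : N" for v using that by(simp add: f'_def)
   have "bij_betw f' N N" using f(1) bij_betw_cong[of N f' f] eqf by simp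
   then have "f' permutes N" by(rule bij_imp_permutes) (simp add: f'_def)
   moreover have "map_prod f' f' ` E = map_prod f f ` E" using EN eqf by(intro image_cong) auto
   moreover have "f' ` S = f ` S" using SN eqf by(intro image_cong) auto
   ultimately have A: "f' : Aut Ga" using f by(simp add: Aut_def)
   have "?\<psi> f' = \<gamma>"
   proof (rule extensionalityI[OF _ ext])
    fix y assume "y : leaves Ga"
    then obtain x where x: "x : leaves Ga" "y = f' x" using onto[OF A] by blast
    then show "?\<psi> f' y = \<gamma> y" using \<psi>f[OF A x(1)] f(4)[OF x(1)] eqf[OF leafN[OF x(1)]] by simp
   qed simp
   then show "\<gamma> : ?\<psi> ` Aut Ga" using A by blast
  qed
 qed
 then show ?thesis by(simp add: bij_betw_same_card)
qed

end

section \<open>Orbit counting and isomorphism classes of forests\<close>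

definition codes :: "forest => (nat => (nat \<times> nat) set) set" where
 "codes Ga = code Ga ` labelings (leaves Ga)"

lemma labelled_forestI: "lforest Ga ==> be : labelings (leaves Ga) ==> labelled_forest Ga be (card (leaves Ga))"
 by(simp add: labelled_forest_def labelled_forest_axioms_def labelings_def)

text \<open>Labellings fall into groups of size \<open>card (Aut Ga)\<close>, one for each code;
  this is the origin of the weight 1/|Aut|.\<close>

lemma card_codes:
 assumes G: "lforest Ga" and min: "minimal Ga"
 shows "card (codes Ga) * card (Aut Ga) = fact (card (leaves Ga))" "finite (leaves Ga)"
proof -
 interpret lforest Ga by fact
 show fl: "finite (leaves Ga)" using fin leafN by(auto intro: finite_subset[of _ "verts Ga"])
 then have "card (labelings (leaves Ga)) ~= 0" by(simp add: card_labelings)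
 then have finl: "finite (labelings (leaves Ga))" by(metis card.infinite)
 have "card {\<gamma> : labelings (leaves Ga). code Ga \<gamma> = R} = card (Aut Ga)" if "R : codes Ga" for R
  using that labelled_forest.card_fibre[OF labelled_forestI[OF G] min] by(auto simp: codes_def)
 then have "card (labelings (leaves Ga)) = card (codes Ga) * card (Aut Ga)"
  using sum.image_gen[OF finl, of "%_. 1::nat" "code Ga"] by(simp add: codes_def)
 then show "card (codes Ga) * card (Aut Ga) = fact (card (leaves Ga))" using card_labelings[OF fl] by simp
qed

lemma codes_restrict:
 assumes "labelled_forest Ga be n"
 shows "code Ga be : codes Ga"
proof -
 interpret labelled_forest Ga be n by fact
 have "labs Ga (restrict be (leaves Ga)) = labs Ga be"
  by(intro ext) (auto simp: labs_def intro!: image_cong)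
 then have "code Ga (restrict be (leaves Ga)) = code Ga be" unfolding code_def by simp
 moreover have "restrict be (leaves Ga) : labelings (leaves Ga)"
  using be bij_betw_cong[of "leaves Ga" "restrict be (leaves Ga)" be] by(simp add: labelings_def card_leaves)
 ultimately show ?thesis unfolding codes_def by(metis imageI)
qed

lemma forest_iso_refl: "(Ga, Ga) : forest_iso"
 unfolding forest_iso_def by(auto intro!: exI[of _ "%x. x"] simp: bij_betw_def map_prod_def)

lemma forest_iso_trans: "(Ga, Dl) : forest_iso ==> (Dl, \<Theta>) : forest_iso ==> (Ga, \<Theta>) : forest_iso"
proof -
 assume iso: "(Ga, Dl) : forest_iso" "(Dl, \<Theta>) : forest_iso"
 obtain f where f: "bij_betw f (verts Ga) (verts Dl)" "map_prod f f ` edges Ga = edges Dl" "f ` strong Ga = strong Dl"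
  using iso(1) unfolding forest_iso_def by blast
 obtain h where h: "bij_betw h (verts Dl) (verts \<Theta>)" "map_prod h h ` edges Dl = edges \<Theta>" "h ` strong Dl = strong \<Theta>"
  using iso(2) unfolding forest_iso_def by blast
 have "map_prod (h \<circ> f) (h \<circ> f) ` edges Ga = edges \<Theta>" "(h \<circ> f) ` strong Ga = strong \<Theta>"
  unfolding map_prod.comp[symmetric] image_comp[symmetric] f h by simp_all
 then show ?thesis using bij_betw_trans[OF f(1) h(1)] unfolding forest_iso_def by blast
qed

lemma forest_iso_sym:
 assumes "edges Ga <= verts Ga \<times> verts Ga" "strong Ga <= verts Ga" "(Ga, Dl) : forest_iso"
 shows "(Dl, Ga) : forest_iso"
proof -
 obtain f where f: "bij_betw f (verts Ga) (verts Dl)" "map_prod f f ` edges Ga = edges Dl" "f ` strong Ga = strong Dl"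
  using assms(3) unfolding forest_iso_def by blast
 let ?h = "the_inv_into (verts Ga) f"
 have hf: "?h (f x) = x" if "x : verts Ga" for x using f(1) that by(auto simp: bij_betw_def the_inv_into_f_f)
 have "map_prod ?h ?h ` edges Dl = (%x. x) ` edges Ga"
  unfolding f(2)[symmetric] image_image using assms(1) hf by(intro image_cong refl) auto
 moreover have "?h ` strong Dl = (%x. x) ` strong Ga"
  unfolding f(3)[symmetric] image_image using assms(2) hf by(intro image_cong refl) auto
 ultimately show ?thesis using bij_betw_the_inv_into[OF f(1)] unfolding forest_iso_def by auto
qed

definition good_forests :: "forest set" where
 "good_forests = {Ga. lforest Ga & minimal Ga & card (leaves Ga) >= 1}"

lemma good_iso:
 assumes G: "Ga : good_forests" and iso: "(Ga, Dl) : forest_iso"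
 shows "Dl : good_forests" "card (leaves Dl) = card (leaves Ga)" "codes Dl = codes Ga" "strong Dl = {} \<longleftrightarrow> strong Ga = {}"
  "forest_iso `` {Ga} = forest_iso `` {Dl}"
proof -
 have tr: "labelled_forest Dl (be \<circ> the_inv_into (verts Ga) f) n & code Dl (be \<circ> the_inv_into (verts Ga) f) = code Ga be & (minimal Ga --> minimal Dl)"
  if L: "labelled_forest Ga be n" and f: "bij_betw f (verts Ga) (verts Dl)" "map_prod f f ` edges Ga = edges Dl" "f ` strong Ga = strong Dl"
  for Ga Dl be f n
 proof -
  have "(be \<circ> the_inv_into (verts Ga) f) (f x) = be x" if "x : leaves Ga" for x
   using f(1) that by(simp add: leaves_def bij_betw_def the_inv_into_f_f)
  from iso_transport[OF L f this] show ?thesis by blast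
 qed
 have sub: "codes Ga <= codes Dl & Dl : good_forests & card (leaves Dl) = card (leaves Ga)"
  if G: "Ga : good_forests" and iso: "(Ga, Dl) : forest_iso" for Ga Dl
 proof -
  have g: "lforest Ga" "minimal Ga" "card (leaves Ga) >= 1" using G by(auto simp: good_forests_def)
  obtain f where f: "bij_betw f (verts Ga) (verts Dl)" "map_prod f f ` edges Ga = edges Dl" "f ` strong Ga = strong Dl"
   using iso unfolding forest_iso_def by blast
  note t = tr[OF labelled_forestI[OF g(1)] f]
  have "codes Ga <= codes Dl"
   using t codes_restrict unfolding codes_def[of Ga] by(metis (no_types, lifting) image_subsetI)
  moreover have "labelings (leaves Ga) ~= {}"
   using card_labelings[OF card_codes(2)[OF g(1,2)]] by(metis card.empty fact_nonzero)
  then obtain be where "be : labelings (leaves Ga)" by blast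
  note t' = t[OF this]
  have "card (leaves Dl) = card (leaves Ga)" using t' labelled_forest.card_leaves by blast
  moreover have "lforest Dl" using t' by(simp add: labelled_forest_def)
  ultimately show ?thesis using t' g by(simp add: good_forests_def)
 qed
 have wf: "edges Ga <= verts Ga \<times> verts Ga" "strong Ga <= verts Ga"
  using G forest_graph.EN lforest.SN unfolding good_forests_def lforest_def by(auto simp: lforest_axioms_def)
 note iso' = forest_iso_sym[OF wf iso]
 show "Dl : good_forests" "card (leaves Dl) = card (leaves Ga)" using sub[OF G iso] by blast+
 then show "codes Dl = codes Ga" using sub[OF G iso] sub[OF _ iso'] by blast
 show "strong Dl = {} \<longleftrightarrow> strong Ga = {}" using iso unfolding forest_iso_def by auto
 show "forest_iso `` {Ga} = forest_iso `` {Dl}" using forest_iso_trans iso iso' by blast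
qed

definition rep :: "forest set => forest" where
 "rep c = (SOME Ga. Ga : c)"

lemma rep_class:
 assumes c: "c : F // forest_iso" and F: "F <= good_forests" "!!Ga Dl. Ga : F ==> (Ga, Dl) : forest_iso ==> Dl : F"
 shows "rep c : F" "c = forest_iso `` {rep c}"
proof -
 obtain Ga where G: "Ga : F" "c = forest_iso `` {Ga}" using c by(auto elim: quotientE)
 have "Ga : c" using G forest_iso_refl by blast
 then have "rep c : c" unfolding rep_def by(rule someI)
 then have "(Ga, rep c) : forest_iso" using G by blast
 then show "rep c : F" "c = forest_iso `` {rep c}" using F good_iso(5)[of Ga "rep c"] G by auto
qed

lemma code_in_rel_flags:
 assumes "Ga : good_forests" "R : codes Ga"
 shows "R : rel_flags (card (leaves Ga)) (expo Ga)" "card ({1..card (leaves Ga)} // sign_rel (card (leaves Ga)) R) = weak_trees Ga"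
 using assms labelled_forest.code_rel_flags[OF labelled_forestI] labelled_forest.card_sign_rel[OF labelled_forestI]
 by(auto simp: codes_def good_forests_def)

text \<open>Each flag of relations is the code of exactly one isomorphism class of minimal forests,
  and a class accounts for n!/|Aut| flags, all with the same number of sign classes.\<close>

theorem sum_over_classes:
 assumes n: "total m = n" and fin: "finite (rel_flags n m)" and n1: "n >= 1"
 shows "finite {c : good_forests // forest_iso. expo (rep c) = m}"
  and "(\<Sum>c | c \<in> good_forests // forest_iso & expo (rep c) = m. 1 / of_nat (card (Aut (rep c))) * (1/2) ^ weak_trees (rep c)) =
  1 / fact n * (\<Sum>R\<in>rel_flags n m. (1/2) ^ card ({1..n} // sign_rel n R) :: rat)"
proof -
 let ?C = "{c : good_forests // forest_iso. expo (rep c) = m}"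
 have r: "rep c : good_forests" "c = forest_iso `` {rep c}" "expo (rep c) = m" if "c : ?C" for c
  using that rep_class[of c good_forests] good_iso(1) by auto
 have leaves: "card (leaves (rep c)) = n" if "c : ?C" for c
  using r[OF that] lforest.total_expo[of "rep c"] n by(simp add: good_forests_def)
 have cod: "R : rel_flags n m" "card ({1..n} // sign_rel n R) = weak_trees (rep c)" if "c : ?C" "R : codes (rep c)" for c R
  using code_in_rel_flags[OF r(1)[OF that(1)] that(2)] leaves[OF that(1)] r(3)[OF that(1)] by auto
 have disj: "c = c'" if cc: "c : ?C" "c' : ?C" "R : codes (rep c)" "R : codes (rep c')" for c c' R
 proof -
  obtain be \<gamma> where bg: "be : labelings (leaves (rep c))" "\<gamma> : labelings (leaves (rep c'))" "code (rep c) be = code (rep c') \<gamma>"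
   using cc(3,4) unfolding codes_def by auto
  have L: "labelled_forest (rep c) be n" "labelled_forest (rep c') \<gamma> n" "minimal (rep c)" "minimal (rep c')"
   using r(1)[OF cc(1)] r(1)[OF cc(2)] labelled_forestI[OF _ bg(1)] labelled_forestI[OF _ bg(2)]
   unfolding leaves[OF cc(1)] leaves[OF cc(2)] by(simp_all add: good_forests_def)
  have iso: "(rep c, rep c') : forest_iso"
   by(rule code_eq_imp_iso[OF L(1,3,2,4) bg(3)]) (auto simp: forest_iso_def)
  show ?thesis by(rule trans[OF r(2)[OF cc(1)] trans[OF good_iso(5)[OF r(1)[OF cc(1)] iso] r(2)[OF cc(2), symmetric]]])
 qed
 have un: "rel_flags n m = (\<Union>c\<in>?C. codes (rep c))"
 proof (intro equalityI subsetI)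
  fix R assume R: "R : rel_flags n m"
  obtain Ga be where G: "labelled_forest Ga be n" "minimal Ga" "code Ga be = R" using forest_of_code[OF R n] .
  have cl: "card (leaves Ga) = n" using labelled_forest.card_leaves[OF G(1)] .
  have gf: "Ga : good_forests" using G n1 cl by(simp add: good_forests_def labelled_forest_def)
  let ?c = "forest_iso `` {Ga}"
  have c: "?c : good_forests // forest_iso" using gf by(rule quotientI)
  have rc: "rep ?c : good_forests" "?c = forest_iso `` {rep ?c}"
   by(rule rep_class[OF c order_refl]; erule (1) good_iso(1))+
  have "rep ?c : forest_iso `` {rep ?c}" using forest_iso_refl by blast
  then have "rep ?c : ?c" unfolding rc(2)[symmetric] .
  then have "codes (rep ?c) = codes Ga" using good_iso(3)[OF gf] by blast
  then have Rc: "R : codes (rep ?c)" using codes_restrict[OF G(1)] G(3) by simp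
  have "card (leaves (rep ?c)) = n" using good_iso(2)[OF gf] \<open>rep ?c : ?c\<close> cl by blast
  then have "R : rel_flags n (expo (rep ?c))" using code_in_rel_flags(1)[OF rc(1) Rc] by simp
  then have "expo (rep ?c) = m" using R rel_flags_unique by blast
  then show "R : (\<Union>c\<in>?C. codes (rep c))" using Rc c by blast
 qed (use cod in blast)
 have card: "card (codes (rep c)) * card (Aut (rep c)) = fact n" if "c : ?C" for c
  using card_codes(1)[of "rep c"] r(1)[OF that] leaves[OF that] by(simp add: good_forests_def)
 \<comment> \<open>Finiteness of the set of classes is inherited from \<open>rel_flags n m\<close>,
   since a class is recovered from any one of its codes.\<close>
 have "inj_on (%c. SOME R. R : codes (rep c)) ?C"
 proof (rule inj_onI)
  fix c c' assume c: "c : ?C" "c' : ?C" "(SOME R. R : codes (rep c)) = (SOME R. R : codes (rep c'))"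
  have ne: "(SOME R. R : codes (rep c)) : codes (rep c)" if "c : ?C" for c
  proof -
   have "codes (rep c) ~= {}" using card[OF that] by(metis card.empty fact_nonzero mult_0)
   then show ?thesis by(simp add: some_in_eq)
  qed
  then show "c = c'" using disj[OF c(1,2) ne[OF c(1)]] ne[OF c(2)] c(3) by simp
 qed
 moreover have "(%c. SOME R. R : codes (rep c)) ` ?C <= rel_flags n m"
 proof
  fix R assume "R : (%c. SOME R. R : codes (rep c)) ` ?C"
  then obtain c where c: "c : ?C" "R = (SOME R. R : codes (rep c))" by blast
  have "codes (rep c) ~= {}" using card[OF c(1)] by(metis card.empty fact_nonzero mult_0)
  then show "R : rel_flags n m" using cod(1)[OF c(1)] c(2) by(simp add: some_in_eq)
 qed
 ultimately show finC: "finite ?C" using fin by(rule inj_on_finite)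
 have "(\<Sum>R\<in>rel_flags n m. (1/2) ^ card ({1..n} // sign_rel n R) :: rat) = (\<Sum>c\<in>?C. \<Sum>R\<in>codes (rep c). (1/2) ^ card ({1..n} // sign_rel n R))"
  unfolding un
 proof (rule sum.UNION_disjoint[OF finC])
  show "ALL c:?C. finite (codes (rep c))"
  proof
   fix c assume "c : ?C"
   from card[OF this] show "finite (codes (rep c))" by(metis card.infinite fact_nonzero mult_0)
  qed
  show "ALL c:?C. ALL c':?C. c ~= c' --> codes (rep c) Int codes (rep c') = {}" using disj by blast
 qed
 also have "... = (\<Sum>c\<in>?C. fact n * (1 / of_nat (card (Aut (rep c))) * (1/2) ^ weak_trees (rep c)))"
 proof (intro sum.cong refl)
  fix c assume c: "c : ?C"
  have "(\<Sum>R\<in>codes (rep c). (1/2) ^ card ({1..n} // sign_rel n R) :: rat) = of_nat (card (codes (rep c))) * (1/2) ^ weak_trees (rep c)"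
   using cod(2)[OF c] by simp
  moreover have "rat_of_nat (card (codes (rep c))) * of_nat (card (Aut (rep c))) = fact n"
   using arg_cong[OF card[OF c], of rat_of_nat] by simp
  moreover have "card (Aut (rep c)) ~= 0" using card[OF c] by(metis fact_nonzero mult_0_right)
  ultimately show "(\<Sum>R\<in>codes (rep c). (1/2) ^ card ({1..n} // sign_rel n R) :: rat) = fact n * (1 / of_nat (card (Aut (rep c))) * (1/2) ^ weak_trees (rep c))"
   by(simp add: field_simps)
 qed
 finally show "(\<Sum>c\<in>?C. 1 / of_nat (card (Aut (rep c))) * (1/2) ^ weak_trees (rep c)) =
  1 / fact n * (\<Sum>R\<in>rel_flags n m. (1/2) ^ card ({1..n} // sign_rel n R) :: rat)"
  unfolding sum_distrib_left[symmetric] by simp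
qed

section \<open>The generating function\<close>

lemma gpow: "(cst c * g i) ^ k = Poly_Mapping.single (Poly_Mapping.single i k) (c ^ k)"
 by(induction k) (simp_all add: cst_def g_def mult_single single_add[symmetric] single_one)

lemma prod_single:
 "(\<Prod>v\<in>A. Poly_Mapping.single (f v) (c v)) = (Poly_Mapping.single (\<Sum>v\<in>A. f v) (\<Prod>v\<in>A. c v) :: polynomial)"
 by(induction A rule: infinite_finite_induct) (simp_all add: mult_single)

lemma prod_gpow:
 "(\<Prod>v\<in>A. (cst c * g (f v)) ^ k v) = Poly_Mapping.single (\<Sum>v\<in>A. Poly_Mapping.single (f v) (k v)) (c ^ (\<Sum>v\<in>A. k v))"
 unfolding gpow prod_single by(simp add: power_sum)

lemma gprod: "(\<Prod>v\<in>A. g (f v) ^ k v) = Poly_Mapping.single (\<Sum>v\<in>A. Poly_Mapping.single (f v) (k v)) 1"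
 using prod_gpow[of 1 f k A] by(simp add: cst_def)

lemma forests_good: "forests_A <= good_forests" "strong_forests_B <= good_forests"
 by(auto simp: forests_A_def strong_forests_B_def good_forests_def levelled_forest_iff)

text \<open>By the second part, halving \<open>g 0\<close> in the weak series inserts one factor 1/2
  per tree, the same rule as for strong forests.\<close>

lemma term_A_eq:
 assumes "Ga : forests_A"
 shows "term_A Ga = Poly_Mapping.single (expo Ga) (1 / of_nat (card (Aut Ga)))"
  "weak_trees Ga = lookup (expo Ga) 0"
proof -
 have s: "strong Ga = {}" and G: "lforest Ga" using assms by(auto simp: forests_A_def levelled_forest_iff)
 have "weak_inner Ga = verts Ga - leaves Ga" by(simp add: weak_inner_def s)
 moreover have "g 0 ^ tr Ga = Poly_Mapping.single (Poly_Mapping.single 0 (tr Ga)) 1"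
  using gpow[of 1 0 "tr Ga"] by(simp add: cst_def)
 ultimately show "term_A Ga = Poly_Mapping.single (expo Ga) (1 / of_nat (card (Aut Ga)))"
  unfolding term_A_def gprod by(simp add: cst_def mult_single expo_def s tr_def)
 show "weak_trees Ga = lookup (expo Ga) 0" using lforest.lookup_expo_0[OF G] by(simp add: weak_trees_def s)
qed

lemma term_B_eq:
 assumes "Ga : strong_forests_B"
 shows "term_B Ga = Poly_Mapping.single (expo Ga) (1 / of_nat (card (Aut Ga)) * (1/2) ^ weak_trees Ga)"
proof -
 have s: "strong Ga ~= {}" and G: "lforest Ga" using assms by(auto simp: strong_forests_B_def levelled_forest_iff)
 interpret lforest Ga by fact
 obtain v where v: "v : S" using s by blast
 then obtain r where r: "r : roots Ga" "(r, v) : E\<^sup>*" using root_path[of v] SN by blast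
 \<comment> \<open>A strong forest has exactly one strong root, so \<open>tr Ga - 1\<close> is the
   number of its weak components.\<close>
 have "roots Ga Int S = {r}" using strong_up[OF r(2) v] r(1) S1 level_root by fastforce
 then have "card (roots Ga Int S) = 1" by simp
 moreover have "finite (roots Ga)" using fin by(simp add: roots_def)
 ultimately have "tr Ga - 1 = card (roots Ga - S)" by(simp add: tr_def card_Diff_subset_Int)
 then show ?thesis
  unfolding term_B_def prod_gpow gprod unfolding gpow unfolding cst_def mult_single
  by(simp add: expo_def weak_trees_def power_add)
qed

text \<open>Each term is one monomial with nonzero coefficient, so the summands passing the filter
  in \<open>sum_iso_classes\<close> are those with exponent \<open>m\<close>.\<close>

lemma class_sum:
 assumes F: "F <= good_forests" "!!Ga Dl. Ga : F ==> (Ga, Dl) : forest_iso ==> Dl : F"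
  and T: "!!Ga. Ga : F ==> T Ga = Poly_Mapping.single (expo Ga) (h Ga)" "!!Ga. Ga : F ==> h Ga ~= 0"
 shows "sum_iso_classes F T m = (\<Sum>c | c \<in> F // forest_iso & expo (rep c) = m. h (rep c))"
proof -
 have r: "rep c : F" if "c : F // forest_iso" for c using rep_class(1)[OF that F] .
 have "{c. c : F // forest_iso & lookup (T (rep c)) m ~= 0} = {c. c : F // forest_iso & expo (rep c) = m}"
  using r T by(auto simp: lookup_single when_def split: if_splits)
 then show ?thesis
  unfolding sum_iso_classes_def rep_def[symmetric]
  using r T by(intro sum.cong) (auto simp: lookup_single)
qed

lemma Aut_nonzero: "Ga : good_forests ==> card (Aut Ga) ~= 0"
 using card_codes(1)[of Ga] by(metis (mono_tags, lifting) fact_nonzero good_forests_def mem_Collect_eq mult_0_right)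

text \<open>The lone leaf, too small for \<open>forests_A\<close>, stands for the extra summand
  \<open>g 0\<close> of \<open>p_A\<close>.\<close>

definition leaf_forests :: "forest set" where
 "leaf_forests = {Ga : good_forests. strong Ga = {} & card (leaves Ga) = 1}"

lemma leaf_forests_iff: "Ga : leaf_forests \<longleftrightarrow> (EX x. Ga = \<lparr>verts = {x}, edges = {}, strong = {}\<rparr>)"
proof
 assume G: "Ga : leaf_forests"
 then have g: "lforest Ga" "minimal Ga" "strong Ga = {}" "card (leaves Ga) = 1" by(auto simp: leaf_forests_def good_forests_def)
 obtain x where x: "leaves Ga = {x}" using card_1_singletonE[OF g(4)] .
 have "labelled_forest Ga (%_. 1) 1"
  using g(1) x by(simp add: labelled_forest_def labelled_forest_axioms_def bij_betw_def)
 then interpret labelled_forest Ga "%_. 1" 1 .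
 have "card (L v) < 2" for v
 proof -
  have "L v <= {1}" using g(3) by(auto simp: labs_def)
  then have "card (L v) <= card {1::nat}" by(intro card_mono) auto
  then show ?thesis by simp
 qed
 then have "N = {x}" using single_label[OF g(2)] leafN x by blast
 moreover have "E = {}"
 proof (rule ccontr)
  assume "E ~= {}"
  then obtain u v where "(u, v) : E" by auto
  then have "u : N" "u ~: leaves Ga" using EN by(auto simp: leaves_def)
  then show False using x \<open>N = {x}\<close> by auto
 qed
 ultimately show "EX x. Ga = \<lparr>verts = {x}, edges = {}, strong = {}\<rparr>" using g(3) by(intro exI[of _ x]) simp
next
 assume "EX x. Ga = \<lparr>verts = {x}, edges = {}, strong = {}\<rparr>"
 then obtain x where x: "Ga = \<lparr>verts = {x}, edges = {}, strong = {}\<rparr>" by blast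
 have "leaves Ga = {x}" by(auto simp: leaves_def x)
 moreover have "lforest Ga" by unfold_locales (auto simp: x acyclic_def single_valued_def)
 moreover have "minimal Ga" by(auto simp: minimal_def trivial_tail_root_def leaves_def x)
 ultimately show "Ga : leaf_forests" by(simp add: leaf_forests_def good_forests_def x)
qed

lemma leaf_values:
 assumes "Ga : leaf_forests"
 shows "expo Ga = Poly_Mapping.single 0 1" "card (Aut Ga) = 1" "weak_trees Ga = 1"
proof -
 obtain x where x: "Ga = \<lparr>verts = {x}, edges = {}, strong = {}\<rparr>" using assms leaf_forests_iff by blast
 have "roots Ga = {x}" "weak_inner Ga = {}" by(auto simp: roots_def weak_inner_def leaves_def x)
 then show "expo Ga = Poly_Mapping.single 0 1" "weak_trees Ga = 1" by(simp_all add: expo_def weak_trees_def x)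
 have "Aut Ga = {id}" by(auto simp: Aut_def x)
 then show "card (Aut Ga) = 1" by simp
qed

lemma leaf_class: "leaf_forests // forest_iso = {forest_iso `` {\<lparr>verts = {0}, edges = {}, strong = {}\<rparr>}}"
proof -
 have G: "\<lparr>verts = {x}, edges = {}, strong = {}\<rparr> : good_forests" for x
  using leaf_forests_iff by(auto simp: leaf_forests_def)
 have "(\<lparr>verts = {0}, edges = {}, strong = {}\<rparr>, \<lparr>verts = {x}, edges = {}, strong = {}\<rparr>) : forest_iso" for x
  unfolding forest_iso_def by(auto intro!: exI[of _ "%_. x"] simp: bij_betw_def)
 from good_iso(5)[OF G this]
 have "forest_iso `` {\<lparr>verts = {x}, edges = {}, strong = {}\<rparr>} = forest_iso `` {\<lparr>verts = {0}, edges = {}, strong = {}\<rparr>}" for x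
  by(rule sym)
 note cl = this
 have "c : leaf_forests // forest_iso \<longleftrightarrow> c = forest_iso `` {\<lparr>verts = {0}, edges = {}, strong = {}\<rparr>}" for c
 proof
  assume "c : leaf_forests // forest_iso"
  then obtain Ga where "Ga : leaf_forests" "c = forest_iso `` {Ga}" by(rule quotientE)
  then show "c = forest_iso `` {\<lparr>verts = {0}, edges = {}, strong = {}\<rparr>}" using leaf_forests_iff cl by metis
 next
  have "\<lparr>verts = {0}, edges = {}, strong = {}\<rparr> : leaf_forests" using leaf_forests_iff by blast
  then show "c = forest_iso `` {\<lparr>verts = {0}, edges = {}, strong = {}\<rparr>} ==> c : leaf_forests // forest_iso"
   by(simp only: quotientI)
 qed
 then show ?thesis by blast
qed

text \<open>The lone leaf, the other weak forests and the strong forests together make up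
  \<open>good_forests\<close>, and after halving \<open>g 0\<close> all three families follow the
  same weight.\<close>

lemma Q_B_eq:
 assumes fin: "finite {c : good_forests // forest_iso. expo (rep c) = m}"
 shows "Q_B m = (\<Sum>c | c \<in> good_forests // forest_iso & expo (rep c) = m. 1 / of_nat (card (Aut (rep c))) * (1/2) ^ weak_trees (rep c))"
proof -
 let ?h = "%Ga. 1 / of_nat (card (Aut Ga)) :: rat" and ?C = "%F. {c. c : F // forest_iso & expo (rep c) = m}"
 let ?v = "%Ga. ?h Ga * (1/2) ^ weak_trees Ga"
 have A: "Dl : forests_A" if "Ga : forests_A" "(Ga, Dl) : forest_iso" for Ga Dl
  using that good_iso(1,2,4)[of Ga Dl] forests_good by(auto simp: forests_A_def good_forests_def levelled_forest_iff)
 have B: "Dl : strong_forests_B" if "Ga : strong_forests_B" "(Ga, Dl) : forest_iso" for Ga Dl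
  using that good_iso(1,2,4)[of Ga Dl] forests_good by(auto simp: strong_forests_B_def good_forests_def levelled_forest_iff)
 have I: "Dl : leaf_forests" if "Ga : leaf_forests" "(Ga, Dl) : forest_iso" for Ga Dl
  using that good_iso(1,2,4)[of Ga Dl] by(auto simp: leaf_forests_def)
 have Ig: "leaf_forests <= good_forests" by(auto simp: leaf_forests_def)
 have rA: "rep c : forests_A" if "c : forests_A // forest_iso" for c by(rule rep_class(1)[OF that forests_good(1)]) (rule A)
 have rB: "rep c : strong_forests_B" if "c : strong_forests_B // forest_iso" for c by(rule rep_class(1)[OF that forests_good(2)]) (rule B)
 have rI: "rep c : leaf_forests" if "c : leaf_forests // forest_iso" for c by(rule rep_class(1)[OF that Ig]) (rule I)
 have sA: "sum_iso_classes forests_A term_A m * (1/2) ^ lookup m 0 = (\<Sum>c\<in>?C forests_A. ?v (rep c))"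
 proof -
  have "sum_iso_classes forests_A term_A m = (\<Sum>c\<in>?C forests_A. ?h (rep c))"
  proof (rule class_sum[OF forests_good(1)])
   show "?h Ga ~= 0" if "Ga : forests_A" for Ga using Aut_nonzero[of Ga] forests_good that by auto
  qed (use A term_A_eq in blast)+
  then show ?thesis using term_A_eq(2)[OF rA] by(auto simp: sum_distrib_right intro!: sum.cong)
 qed
 have sB: "sum_iso_classes strong_forests_B term_B m = (\<Sum>c\<in>?C strong_forests_B. ?v (rep c))"
 proof (rule class_sum[OF forests_good(2)])
  show "?v Ga ~= 0" if "Ga : strong_forests_B" for Ga using Aut_nonzero[of Ga] forests_good that by auto
 qed (use B term_B_eq in blast)+
 have sI: "lookup (g 0) m * (1/2) ^ lookup m 0 = (\<Sum>c\<in>?C leaf_forests. ?v (rep c))"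
 proof (cases "m = Poly_Mapping.single 0 1")
  case True
  let ?c = "forest_iso `` {\<lparr>verts = {0}, edges = {}, strong = {}\<rparr>}"
  have "rep ?c : leaf_forests" using rI leaf_class by blast
  note lv = leaf_values[OF this]
  have "?C leaf_forests = {?c}" unfolding leaf_class using lv(1) True by auto
  then show ?thesis using lv(2,3) True by(simp add: g_def)
 next
  case False
  then have e: "?C leaf_forests = {}" using leaf_values(1)[OF rI] by blast
  have "lookup (g 0) m = 0" using False by(auto simp: g_def lookup_single when_def)
  then show ?thesis unfolding e by simp
 qed
 have split: "good_forests = leaf_forests Un forests_A Un strong_forests_B"
  by(auto simp: leaf_forests_def forests_A_def strong_forests_B_def good_forests_def levelled_forest_iff)
 then have q: "good_forests // forest_iso = leaf_forests // forest_iso Un forests_A // forest_iso Un strong_forests_B // forest_iso"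
  unfolding quotient_def by blast
 have "?C good_forests = ?C leaf_forests Un ?C forests_A Un ?C strong_forests_B" unfolding q by blast
 moreover have "False" if "c : leaf_forests // forest_iso" "c : forests_A // forest_iso" for c
  using rI[OF that(1)] rA[OF that(2)] by(simp add: leaf_forests_def forests_A_def)
 then have "?C leaf_forests Int ?C forests_A = {}" by blast
 moreover have "False" if "c : strong_forests_B // forest_iso" "c : leaf_forests // forest_iso \<or> c : forests_A // forest_iso" for c
  using rB[OF that(1)] rI[of c] rA[of c] that(2) by(auto simp: leaf_forests_def forests_A_def strong_forests_B_def)
 then have "(?C leaf_forests Un ?C forests_A) Int ?C strong_forests_B = {}" by blast
 moreover have "finite (?C leaf_forests)" "finite (?C forests_A)" "finite (?C strong_forests_B)"
  using fin unfolding q by(auto elim!: rev_finite_subset)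
 ultimately have "(\<Sum>c\<in>?C good_forests. ?v (rep c)) = (\<Sum>c\<in>?C leaf_forests. ?v (rep c)) + (\<Sum>c\<in>?C forests_A. ?v (rep c)) + (\<Sum>c\<in>?C strong_forests_B. ?v (rep c))"
  by(simp add: sum.union_disjoint)
 also have "... = Q_B m"
  unfolding sI[symmetric] sA[symmetric] sB[symmetric]
  by(simp add: Q_B_def halve_g0_def p_A_def Q_tilde_B_def algebra_simps)
 finally show ?thesis by simp
qed

text \<open>The weighted forests with exponent \<open>m\<close> count flags of relations up to n!,
  and restoring the signs brings in 2^n.\<close>

lemma Q_B_flags:
 assumes m: "m : nonbad n" and n: "n >= 1"
 shows "Q_B m = of_nat (card (flags_B n m)) / (2 ^ n * fact n)"
proof -
 have t: "total m = n" using m by(simp add: nonbad_def)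
 note s = sum_over_classes[OF t card_flags_B(1)[OF m] n]
 show ?thesis unfolding Q_B_eq[OF s(1)] s(2) card_flags_B(2)[OF m] by simp
qed

text \<open>The degree of the monomial is the number of leaves, which is positive for the forests
  that are summed.\<close>

lemma Q_B_0:
 assumes "total m = 0"
 shows "Q_B m = 0"
proof -
 have e: "{c. c : good_forests // forest_iso & expo (rep c) = m} = {}"
 proof -
  have "expo (rep c) ~= m" if c: "c : good_forests // forest_iso" for c
  proof -
   have "rep c : good_forests" by(rule rep_class(1)[OF c order_refl]) (rule good_iso(1))
   then have "total (expo (rep c)) >= 1" using lforest.total_expo by(simp add: good_forests_def)
   then show ?thesis using assms by auto
  qed
  then show ?thesis by blast
 qed
 show ?thesis using Q_B_eq[of m] unfolding e by simp
qed

lemma subst_monomial_nth: "fps_nth (subst_monomial m) n = (if n = total m then key_weight m else 0)"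
proof -
 let ?K = "Poly_Mapping.keys m - {0}"
 have "subst_monomial m = fps_const (key_weight m) * fps_X ^ (lookup m 0 + (\<Sum>i\<in>?K. lookup m i))"
 proof -
  have "(\<Prod>i\<in>?K. fps_const (q_factor (lookup m i)) * fps_X ^ lookup m i) =
    fps_const (key_weight m) * fps_X ^ (\<Sum>i\<in>?K. lookup m i)"
  proof -
   have "(\<Prod>i\<in>K. fps_const (f i)) = fps_const (\<Prod>i\<in>K. f i)" for K and f :: "nat => rat poly"
    by(induction K rule: infinite_finite_induct) (simp_all flip: fps_const_mult)
   then show ?thesis unfolding prod.distrib power_sum key_weight_def by simp
  qed
  then show ?thesis by(simp add: subst_monomial_def power_add algebra_simps)
 qed
 also have "lookup m 0 + (\<Sum>i\<in>?K. lookup m i) = total m"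
  unfolding total_def by(cases "0 : Poly_Mapping.keys m") (auto simp: sum.remove in_keys_iff)
 finally show ?thesis by(simp add: fps_X_power_nth)
qed

lemma remove_bad_nth: "fps_nth (remove_bad_and_subst F) n = (\<Sum>m\<in>nonbad n. smult (F m) (key_weight m))"
proof -
 have "fps_nth (remove_bad_and_subst F) n = (\<Sum>m | ~ bad m & fps_nth (subst_monomial m) n ~= 0. smult (F m) (fps_nth (subst_monomial m) n))"
  by(simp add: remove_bad_and_subst_def)
 also have "... = (\<Sum>m\<in>nonbad n. smult (F m) (key_weight m))"
  by(rule sum.mono_neutral_cong_left[OF finite_nonbad]) (auto simp: nonbad_def subst_monomial_nth split: if_splits)
 finally show ?thesis .
qed

text \<open>In dimension 1 the only possible jump is 1, where \<open>q_factor\<close> vanishes. This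
  agrees with the coefficient 1/2 of the linear term, which \<open>phi_B\<close> lists
  separately.\<close>

lemma poincare_B_1: "poincare_B 1 = 1"
proof -
 have "q_factor (cfun.dim (Cn 1) - cfun.dim U) = 0" if "U : {U : flats_B 1. U < Cn 1}" for U
 proof -
  have "cfun.dim U < 1" using that flats_B_mono[of U 1 "Cn 1"] by(simp add: dim_Cn)
  then show ?thesis by(simp add: dim_Cn q_factor_eq)
 qed
 then show ?thesis
  unfolding poincare_B_eq by(subst arrangement.chain_poly_rec[OF arrangement_B]) simp
qed

theorem theorem3p3:
 shows "remove_bad_and_subst Q_B = phi_B"
proof (rule fps_ext)
 fix n
 show "fps_nth (remove_bad_and_subst Q_B) n = fps_nth phi_B n"
 proof (cases "n = 0")
  case True
  then have "fps_nth (remove_bad_and_subst Q_B) n = 0"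
   unfolding remove_bad_nth by(intro sum.neutral) (auto simp: nonbad_def Q_B_0)
  then show ?thesis using True by(simp add: phi_B_def)
 next
  case False
  have "fps_nth (remove_bad_and_subst Q_B) n = (\<Sum>m\<in>nonbad n. smult (1 / (2 ^ n * fact n)) (smult (of_nat (card (flags_B n m))) (key_weight m)))"
   unfolding remove_bad_nth using False by(intro sum.cong) (simp_all add: Q_B_flags)
  also have "... = smult (1 / (2 ^ n * fact n)) (poincare_B n)"
  proof -
   have "(\<Sum>m\<in>A. smult a (f m)) = smult a (\<Sum>m\<in>A. f m)" for a :: rat and f and A :: "exponents set"
    by(induction A rule: infinite_finite_induct) (simp_all add: smult_add_right)
   then show ?thesis by(simp only: poincare_B_flags)
  qed
  also have "... = fps_nth phi_B n"
  proof (cases "n = 1")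
   case True
   then show ?thesis by(simp add: phi_B_def poincare_B_1[simplified] one_pCons)
  next
   case n1: False
   then show ?thesis using False by(simp add: phi_B_def)
  qed
  finally show ?thesis .
 qed
qed

end
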